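(* Let $A$ and $B$ be rings and $M$ an $A$-$B$-bimodule such that the upper triangular matrix ring $\Lambda=\begin{pmatrix}A&M\\ 0&B\end{pmatrix}$ is an Artin algebra, and suppose that ${}_AM$ and $M_B$ are projective modules. Let $\begin{pmatrix}X\\ Y\end{pmatrix}_\phi$ be a finitely generated $\Lambda$-module. Then $\begin{pmatrix}X\\ Y\end{pmatrix}_\phi$ is a Gorenstein-projective $\Lambda$-module if and only if $\phi: M\otimes_BY\to X$ is injective, $\operatorname{Coker}\phi$ is a Gorenstein-projective $A$-module, and $Y$ is a Gorenstein-projective $B$-module. In this case, $X$ is a Gorenstein-projective $A$-module if and only if $M\otimes_BY$ is a Gorenstein-projective $A$-module.
   Context: All modules are finitely generated left modules unless indicated. A left $\Lambda$-module is identified with a triple $\begin{pmatrix}X\\ Y\end{pmatrix}_\phi$, where $X$ is a left $A$-module, $Y$ is a left $B$-module and $\phi: M\otimes_BY\to X$ is an $A$-map. A $\Lambda$-map $\begin{pmatrix}X\\ Y\end{pmatrix}_\phi\to\begin{pmatrix}X'\\ Y'\end{pmatrix}_{\phi'}$ is a pair $(f,g)$ with $f\in\operatorname{Hom}_A(X,X')$, $g\in\operatorname{Hom}_B(Y,Y')$ and $f\phi=\phi'(\mathrm{id}\otimes g)$. For an Artin algebra $R$, a complete $R$-projective resolution is an exact complex $P^\bullet=\cdots\to P^{-1}\to P^0\xrightarrow{d^0}P^1\to\cdots$ of finitely generated projective $R$-modules such that $\operatorname{Hom}_R(P^\bullet,R)$ is also exact. A finitely generated $R$-module $N$ is Gorenstein-projective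 if $N\cong\operatorname{Ker}d^0$ for some complete $R$-projective resolution. *)

theory Defs
  imports "HOL-Algebra.Module" "HOL-Algebra.QuotRing" "HOL-Algebra.Free_Abelian_Groups"
begin

section \<open>Modules over arbitrary rings\<close>

text \<open>
  The locale \<^locale>\<open>module\<close> of HOL-Algebra requires a commutative ring of scalars.  We keep its record
  type, whose ring multiplication and unit are irrelevant for modules, and drop commutativity.
\<close>

locale left_module = R?: ring R + M?: abelian_group M
  for R :: "('r, 'q) ring_scheme" (structure) and M :: "('r, 'm, 'c) module_scheme" (structure) +
  assumes smult_closed [simp, intro]:
      "\<lbrakk>a \<in> carrier R; x \<in> carrier M\<rbrakk> \<Longrightarrow> a \<odot>\<^bsub>M\<^esub> x \<in> carrier M"
    and smult_l_distr:
      "\<lbrakk>a \<in> carrier R; b \<in> carrier R; x \<in> carrier M\<rbrakk> \<Longrightarrow>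
        (a \<oplus> b) \<odot>\<^bsub>M\<^esub> x = a \<odot>\<^bsub>M\<^esub> x \<oplus>\<^bsub>M\<^esub> b \<odot>\<^bsub>M\<^esub> x"
    and smult_r_distr:
      "\<lbrakk>a \<in> carrier R; x \<in> carrier M; y \<in> carrier M\<rbrakk> \<Longrightarrow>
        a \<odot>\<^bsub>M\<^esub> (x \<oplus>\<^bsub>M\<^esub> y) = a \<odot>\<^bsub>M\<^esub> x \<oplus>\<^bsub>M\<^esub> a \<odot>\<^bsub>M\<^esub> y"
    and smult_assoc1:
      "\<lbrakk>a \<in> carrier R; b \<in> carrier R; x \<in> carrier M\<rbrakk> \<Longrightarrow>
        (a \<otimes> b) \<odot>\<^bsub>M\<^esub> x = a \<odot>\<^bsub>M\<^esub> (b \<odot>\<^bsub>M\<^esub> x)"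
    and smult_one [simp]: "x \<in> carrier M \<Longrightarrow> \<one> \<odot>\<^bsub>M\<^esub> x = x"

definition module_hom ::
  "('r, 'q) ring_scheme \<Rightarrow> ('r, 'm, 'c) module_scheme \<Rightarrow> ('r, 'n, 'd) module_scheme \<Rightarrow> ('m \<Rightarrow> 'n) set"
  where "module_hom R M N =
    {f \<in> hom (add_monoid M) (add_monoid N).
      \<forall>r \<in> carrier R. \<forall>x \<in> carrier M. f (r \<odot>\<^bsub>M\<^esub> x) = r \<odot>\<^bsub>N\<^esub> f x}"

definition module_isomorphic ::
  "('r, 'q) ring_scheme \<Rightarrow> ('r, 'm, 'c) module_scheme \<Rightarrow> ('r, 'n, 'd) module_scheme \<Rightarrow> bool"
  where "module_isomorphic R M N \<longleftrightarrow>
    (\<exists>f \<in> module_hom R M N. bij_betw f (carrier M) (carrier N))"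

definition finitely_generated ::
  "('r, 'q) ring_scheme \<Rightarrow> ('r, 'm, 'c) module_scheme \<Rightarrow> bool"
  where "finitely_generated R M \<longleftrightarrow>
    (\<exists>S. finite S \<and> S \<subseteq> carrier M \<and> (\<forall>H. submodule H R M \<and> S \<subseteq> H \<longrightarrow> H = carrier M))"

definition quotient_module :: "('r, 'm, 'c) module_scheme \<Rightarrow> 'm set \<Rightarrow> ('r, 'm set) module"
  where "quotient_module M H =
    \<lparr>carrier = a_rcosets\<^bsub>M\<^esub> H, mult = undefined, one = undefined,
     ring.zero = H, ring.add = set_add M,
     smult = (\<lambda>r C. \<Union>x \<in> C. H +>\<^bsub>M\<^esub> (r \<odot>\<^bsub>M\<^esub> x))\<rparr>"

definition cokernel_module ::
  "('r, 'm, 'c) module_scheme \<Rightarrow> ('r, 'n, 'd) module_scheme \<Rightarrow> ('m \<Rightarrow> 'n) \<Rightarrow> ('r, 'n set) module"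
  where "cokernel_module M N f = quotient_module N (f ` carrier M)"

definition kernel_module ::
  "('r, 'm) module \<Rightarrow> ('r, 'n) module \<Rightarrow> ('m \<Rightarrow> 'n) \<Rightarrow> ('r, 'm) module"
  where "kernel_module M N f = M\<lparr>carrier := a_kernel M N f\<rparr>"

definition regular_module :: "('r, 'q) ring_scheme \<Rightarrow> ('r, 'r) module"
  where "regular_module R =
    \<lparr>carrier = carrier R, mult = mult R, one = one R, ring.zero = ring.zero R,
     ring.add = ring.add R, smult = mult R\<rparr>"

text \<open>
  The lifting property against surjections \<open>g : N \<rightarrow> N'\<close>.  A definition cannot quantify over all types, so
  \<open>N'\<close> ranges over modules on the type of \<open>P\<close> and \<open>N\<close> over modules on functions from it to the
  scalars; this covers the canonical map from the free module on \<open>P\<close> onto \<open>P\<close>.  Theorem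
  \<open>projective_module_lift\<close> below derives the lifting property for \<open>N\<close> and \<open>N'\<close> on arbitrary types.
\<close>

definition projective_module ::
  "('r, 'q) ring_scheme \<Rightarrow> ('r, 'm, 'c) module_scheme \<Rightarrow> bool"
  where "projective_module R P \<longleftrightarrow> left_module R P \<and>
    (\<forall>(N :: ('r, 'm \<Rightarrow> 'r) module) (N' :: ('r, 'm) module) g f.
      left_module R N \<and> left_module R N' \<and>
      g \<in> module_hom R N N' \<and> g ` carrier N = carrier N' \<and> f \<in> module_hom R P N' \<longrightarrow>
      (\<exists>h \<in> module_hom R P N. \<forall>x \<in> carrier P. g (h x) = f x))"


section \<open>Gorenstein-projective modules\<close>

text \<open>
  As a group, \<open>Hom\<^sub>R(M, N)\<close>; its elements are extensional functions, so that they are determined by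
  their values on the carrier.
\<close>

definition Hom_group ::
  "('r, 'q) ring_scheme \<Rightarrow> ('r, 'm, 'c) module_scheme \<Rightarrow> ('r, 'n, 'd) module_scheme \<Rightarrow> ('m \<Rightarrow> 'n) ring"
  where "Hom_group R M N =
    \<lparr>carrier = module_hom R M N \<inter> extensional (carrier M), mult = undefined, one = undefined,
     ring.zero = (\<lambda>x \<in> carrier M. \<zero>\<^bsub>N\<^esub>),
     ring.add = (\<lambda>f g. \<lambda>x \<in> carrier M. f x \<oplus>\<^bsub>N\<^esub> g x)\<rparr>"

definition exact_complex :: "(int \<Rightarrow> ('m, 'c) ring_scheme) \<Rightarrow> (int \<Rightarrow> 'm \<Rightarrow> 'm) \<Rightarrow> bool"
  where "exact_complex C d \<longleftrightarrow>
    (\<forall>i. abelian_group (C i) \<and> d i \<in> hom (add_monoid (C i)) (add_monoid (C (i + 1))) \<and>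
      d i ` carrier (C i) = a_kernel (C (i + 1)) (C (i + 2)) (d (i + 1)))"

text \<open>
  In degree \<open>i\<close> the complex \<open>Hom\<^sub>R(P, R)\<close> is \<open>Hom\<^sub>R(P\<^sup>-\<^sup>i, R)\<close>, with differential given by composition
  with \<open>d\<^sup>-\<^sup>i\<^sup>-\<^sup>1\<close>; signs do not affect exactness and are omitted.
\<close>

definition complete_projective_resolution ::
  "('r, 'q) ring_scheme \<Rightarrow> (int \<Rightarrow> ('r, 'p) module) \<Rightarrow> (int \<Rightarrow> 'p \<Rightarrow> 'p) \<Rightarrow> bool"
  where "complete_projective_resolution R P d \<longleftrightarrow>
    (\<forall>i. projective_module R (P i) \<and> finitely_generated R (P i) \<and>
         d i \<in> module_hom R (P i) (P (i + 1))) \<and>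
    exact_complex P d \<and>
    exact_complex (\<lambda>i. Hom_group R (P (- i)) (regular_module R))
      (\<lambda>i f. compose (carrier (P (- (i + 1)))) f (d (- (i + 1))))"

text \<open>
  Every finitely generated \<open>R\<close>-module is isomorphic to one whose elements are functions from the naturals
  to \<open>R\<close> (lemma \<open>finitely_generated_nat_fun\<close>), so restricting the terms of the resolution to this
  type loses no generality; see theorem \<open>Gorenstein_projectiveI\<close> for resolutions on an arbitrary type.
\<close>

definition Gorenstein_projective ::
  "('r, 'q) ring_scheme \<Rightarrow> ('r, 'm, 'c) module_scheme \<Rightarrow> bool"
  where "Gorenstein_projective R N \<longleftrightarrow> left_module R N \<and> finitely_generated R N \<and>
    (\<exists>(P :: int \<Rightarrow> ('r, nat \<Rightarrow> 'r) module) d.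
      complete_projective_resolution R P d \<and>
      module_isomorphic R N (kernel_module (P 0) (P 1) (d 0)))"


section \<open>Artin algebras\<close>

definition artinian_cring :: "('k, 'q) ring_scheme \<Rightarrow> bool"
  where "artinian_cring K \<longleftrightarrow> cring K \<and>
    (\<forall>I :: nat \<Rightarrow> 'k set. (\<forall>n. ideal (I n) K \<and> I (Suc n) \<subseteq> I n) \<longrightarrow> (\<exists>n. \<forall>m \<ge> n. I m = I n))"

definition artin_algebra_over ::
  "('k, 'p) ring_scheme \<Rightarrow> ('k \<Rightarrow> 'r) \<Rightarrow> ('r, 'q) ring_scheme \<Rightarrow> bool"
  where "artin_algebra_over K \<eta> R \<longleftrightarrow>
    artinian_cring K \<and> ring R \<and> \<eta> \<in> ring_hom K R \<and>
    (\<forall>k \<in> carrier K. \<forall>r \<in> carrier R. \<eta> k \<otimes>\<^bsub>R\<^esub> r = r \<otimes>\<^bsub>R\<^esub> \<eta> k) \<and>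
    finitely_generated K
      \<lparr>carrier = carrier R, mult = mult R, one = one R, ring.zero = ring.zero R, ring.add = ring.add R,
       smult = (\<lambda>k r. \<eta> k \<otimes>\<^bsub>R\<^esub> r)\<rparr>"

text \<open>
  The base ring may be taken on the type of \<open>R\<close>, since it can be replaced by its image in \<open>R\<close>
  (theorem \<open>artin_algebra_overD\<close> below).
\<close>

definition artin_algebra :: "('r, 'q) ring_scheme \<Rightarrow> bool"
  where "artin_algebra R \<longleftrightarrow> (\<exists>(K :: 'r ring) \<eta>. artin_algebra_over K \<eta> R)"


section \<open>Bimodules and tensor products\<close>

definition op_ring :: "('r, 'q) ring_scheme \<Rightarrow> ('r, 'q) ring_scheme"
  where "op_ring R = R\<lparr>mult := (\<lambda>x y. y \<otimes>\<^bsub>R\<^esub> x)\<rparr>"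

record ('a, 'b, 'm) bimodule = "('a, 'm) module" +
  rsmult :: "'m \<Rightarrow> 'b \<Rightarrow> 'm"

text \<open>Right \<open>B\<close>-modules are left modules over \<open>op_ring B\<close>.\<close>

definition right_part :: "('a, 'b, 'm, 'c) bimodule_scheme \<Rightarrow> ('b, 'm) module"
  where "right_part M =
    \<lparr>carrier = carrier M, mult = mult M, one = one M, ring.zero = ring.zero M, ring.add = ring.add M,
     smult = (\<lambda>b x. rsmult M x b)\<rparr>"

locale bimodule =
  left: left_module A M + right: left_module "op_ring B" "right_part M"
  for A :: "('a, 'p) ring_scheme" and B :: "('b, 'q) ring_scheme"
    and M :: "('a, 'b, 'm, 'c) bimodule_scheme" +
  assumes smult_rsmult:
    "\<lbrakk>a \<in> carrier A; x \<in> carrier M; b \<in> carrier B\<rbrakk> \<Longrightarrow>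
      rsmult M (a \<odot>\<^bsub>M\<^esub> x) b = a \<odot>\<^bsub>M\<^esub> rsmult M x b"

text \<open>
  The tensor product \<open>M \<otimes>\<^sub>B Y\<close> as the quotient of the free abelian group on \<open>M \<times> Y\<close> by the
  balancing relations, with the left \<open>A\<close>-action \<open>a (x \<otimes> y) = (a x) \<otimes> y\<close>.  On the free abelian group
  itself this action is additive, but distributes over sums of scalars only modulo the relations.
\<close>

definition pretensor ::
  "('a, 'b, 'm, 'c) bimodule_scheme \<Rightarrow> ('b, 'y, 'd) module_scheme \<Rightarrow> ('a, ('m \<times> 'y) \<Rightarrow>\<^sub>0 int) module"
  where "pretensor M Y =
    \<lparr>carrier = carrier (free_Abelian_group (carrier M \<times> carrier Y)),
     mult = undefined, one = undefined, ring.zero = 0, ring.add = (+),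
     smult = (\<lambda>a. frag_extend (\<lambda>(x, y). frag_of (a \<odot>\<^bsub>M\<^esub> x, y)))\<rparr>"

definition tensor_relations ::
  "('b, 'q) ring_scheme \<Rightarrow> ('a, 'b, 'm, 'c) bimodule_scheme \<Rightarrow> ('b, 'y, 'd) module_scheme \<Rightarrow>
    (('m \<times> 'y) \<Rightarrow>\<^sub>0 int) set"
  where "tensor_relations B M Y =
    {frag_of (x \<oplus>\<^bsub>M\<^esub> x', y) - frag_of (x, y) - frag_of (x', y) | x x' y.
       x \<in> carrier M \<and> x' \<in> carrier M \<and> y \<in> carrier Y} \<union>
    {frag_of (x, y \<oplus>\<^bsub>Y\<^esub> y') - frag_of (x, y) - frag_of (x, y') | x y y'.
       x \<in> carrier M \<and> y \<in> carrier Y \<and> y' \<in> carrier Y} \<union>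
    {frag_of (rsmult M x b, y) - frag_of (x, b \<odot>\<^bsub>Y\<^esub> y) | x b y.
       x \<in> carrier M \<and> b \<in> carrier B \<and> y \<in> carrier Y}"

definition tensor_null ::
  "('b, 'q) ring_scheme \<Rightarrow> ('a, 'b, 'm, 'c) bimodule_scheme \<Rightarrow> ('b, 'y, 'd) module_scheme \<Rightarrow>
    (('m \<times> 'y) \<Rightarrow>\<^sub>0 int) set"
  where "tensor_null B M Y =
    generate (free_Abelian_group (carrier M \<times> carrier Y)) (tensor_relations B M Y)"

definition tensor_module ::
  "('b, 'q) ring_scheme \<Rightarrow> ('a, 'b, 'm, 'c) bimodule_scheme \<Rightarrow> ('b, 'y, 'd) module_scheme \<Rightarrow>
    ('a, (('m \<times> 'y) \<Rightarrow>\<^sub>0 int) set) module"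
  where "tensor_module B M Y = quotient_module (pretensor M Y) (tensor_null B M Y)"

definition tensor_elem ::
  "('b, 'q) ring_scheme \<Rightarrow> ('a, 'b, 'm, 'c) bimodule_scheme \<Rightarrow> ('b, 'y, 'd) module_scheme \<Rightarrow>
    'm \<Rightarrow> 'y \<Rightarrow> (('m \<times> 'y) \<Rightarrow>\<^sub>0 int) set"
  where "tensor_elem B M Y x y = tensor_null B M Y +>\<^bsub>pretensor M Y\<^esub> frag_of (x, y)"


section \<open>Triangular matrix rings and their modules\<close>

text \<open>The triple \<open>(a, x, b)\<close> stands for the matrix with rows \<open>(a, x)\<close> and \<open>(0, b)\<close>.\<close>

definition triangular_ring ::
  "('a, 'p) ring_scheme \<Rightarrow> ('b, 'q) ring_scheme \<Rightarrow> ('a, 'b, 'm, 'c) bimodule_scheme \<Rightarrow>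
    ('a \<times> 'm \<times> 'b) ring"
  where "triangular_ring A B M =
    \<lparr>carrier = carrier A \<times> carrier M \<times> carrier B,
     mult = (\<lambda>(a, x, b) (a', x', b').
       (a \<otimes>\<^bsub>A\<^esub> a', a \<odot>\<^bsub>M\<^esub> x' \<oplus>\<^bsub>M\<^esub> rsmult M x b', b \<otimes>\<^bsub>B\<^esub> b')),
     one = (\<one>\<^bsub>A\<^esub>, \<zero>\<^bsub>M\<^esub>, \<one>\<^bsub>B\<^esub>),
     ring.zero = (\<zero>\<^bsub>A\<^esub>, \<zero>\<^bsub>M\<^esub>, \<zero>\<^bsub>B\<^esub>),
     ring.add = (\<lambda>(a, x, b) (a', x', b'). (a \<oplus>\<^bsub>A\<^esub> a', x \<oplus>\<^bsub>M\<^esub> x', b \<oplus>\<^bsub>B\<^esub> b'))\<rparr>"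

text \<open>The module of column vectors given by a triple \<open>(X, Y, \<phi>)\<close> with \<open>\<phi> : M \<otimes>\<^sub>B Y \<rightarrow> X\<close>.\<close>

definition triangular_module ::
  "('b, 'q) ring_scheme \<Rightarrow> ('a, 'b, 'm, 'c) bimodule_scheme \<Rightarrow>
    ('a, 'x, 'd) module_scheme \<Rightarrow> ('b, 'y, 'e) module_scheme \<Rightarrow>
    ((('m \<times> 'y) \<Rightarrow>\<^sub>0 int) set \<Rightarrow> 'x) \<Rightarrow> ('a \<times> 'm \<times> 'b, 'x \<times> 'y) module"
  where "triangular_module B M X Y \<phi> =
    \<lparr>carrier = carrier X \<times> carrier Y, mult = undefined, one = undefined,
     ring.zero = (\<zero>\<^bsub>X\<^esub>, \<zero>\<^bsub>Y\<^esub>),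
     ring.add = (\<lambda>(x, y) (x', y'). (x \<oplus>\<^bsub>X\<^esub> x', y \<oplus>\<^bsub>Y\<^esub> y')),
     smult = (\<lambda>(a, m, b) (x, y). (a \<odot>\<^bsub>X\<^esub> x \<oplus>\<^bsub>X\<^esub> \<phi> (tensor_elem B M Y m y), b \<odot>\<^bsub>Y\<^esub> y))\<rparr>"


section \<open>Basic facts\<close>

lemma left_moduleI:
  fixes R (structure) and M (structure)
  assumes "ring R" and "abelian_group M"
    and "\<And>a x. \<lbrakk>a \<in> carrier R; x \<in> carrier M\<rbrakk> \<Longrightarrow> a \<odot>\<^bsub>M\<^esub> x \<in> carrier M"
    and "\<And>a b x. \<lbrakk>a \<in> carrier R; b \<in> carrier R; x \<in> carrier M\<rbrakk> \<Longrightarrow>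
      (a \<oplus> b) \<odot>\<^bsub>M\<^esub> x = a \<odot>\<^bsub>M\<^esub> x \<oplus>\<^bsub>M\<^esub> b \<odot>\<^bsub>M\<^esub> x"
    and "\<And>a x y. \<lbrakk>a \<in> carrier R; x \<in> carrier M; y \<in> carrier M\<rbrakk> \<Longrightarrow>
      a \<odot>\<^bsub>M\<^esub> (x \<oplus>\<^bsub>M\<^esub> y) = a \<odot>\<^bsub>M\<^esub> x \<oplus>\<^bsub>M\<^esub> a \<odot>\<^bsub>M\<^esub> y"
    and "\<And>a b x. \<lbrakk>a \<in> carrier R; b \<in> carrier R; x \<in> carrier M\<rbrakk> \<Longrightarrow>
      (a \<otimes> b) \<odot>\<^bsub>M\<^esub> x = a \<odot>\<^bsub>M\<^esub> (b \<odot>\<^bsub>M\<^esub> x)"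
    and "\<And>x. x \<in> carrier M \<Longrightarrow> \<one> \<odot>\<^bsub>M\<^esub> x = x"
  shows "left_module R M"
  using assms by (intro left_module.intro left_module_axioms.intro) auto

context left_module
begin

lemma smult_r_zero [simp]:
  assumes "a \<in> carrier R" shows "a \<odot>\<^bsub>M\<^esub> \<zero>\<^bsub>M\<^esub> = \<zero>\<^bsub>M\<^esub>"
proof -
  have "a \<odot>\<^bsub>M\<^esub> \<zero>\<^bsub>M\<^esub> \<oplus>\<^bsub>M\<^esub> a \<odot>\<^bsub>M\<^esub> \<zero>\<^bsub>M\<^esub> = a \<odot>\<^bsub>M\<^esub> \<zero>\<^bsub>M\<^esub>"
    using assms by (simp flip: smult_r_distr)
  then show ?thesis
    using assms by (metis M.add.r_cancel_one' M.zero_closed smult_closed)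
qed

lemma smult_l_zero [simp]:
  assumes "x \<in> carrier M" shows "\<zero> \<odot>\<^bsub>M\<^esub> x = \<zero>\<^bsub>M\<^esub>"
proof -
  have "\<zero> \<odot>\<^bsub>M\<^esub> x \<oplus>\<^bsub>M\<^esub> \<zero> \<odot>\<^bsub>M\<^esub> x = \<zero> \<odot>\<^bsub>M\<^esub> x"
    using assms by (simp flip: smult_l_distr)
  then show ?thesis
    using assms by (metis M.add.r_cancel_one' R.zero_closed smult_closed)
qed

lemma smult_minus_one:
  assumes "x \<in> carrier M" shows "(\<ominus> \<one>) \<odot>\<^bsub>M\<^esub> x = \<ominus>\<^bsub>M\<^esub> x"
proof (rule M.minus_equality [symmetric])
  have "(\<ominus> \<one>) \<odot>\<^bsub>M\<^esub> x \<oplus>\<^bsub>M\<^esub> \<one> \<odot>\<^bsub>M\<^esub> x = (\<ominus> \<one> \<oplus> \<one>) \<odot>\<^bsub>M\<^esub> x"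
    using assms by (simp add: smult_l_distr)
  then show "(\<ominus> \<one>) \<odot>\<^bsub>M\<^esub> x \<oplus>\<^bsub>M\<^esub> x = \<zero>\<^bsub>M\<^esub>"
    using assms by (simp add: R.l_neg)
qed (use assms in auto)

lemma left_submoduleI:
  assumes "H \<subseteq> carrier M" and "\<zero>\<^bsub>M\<^esub> \<in> H"
    and "\<And>x y. \<lbrakk>x \<in> H; y \<in> H\<rbrakk> \<Longrightarrow> x \<oplus>\<^bsub>M\<^esub> y \<in> H"
    and "\<And>a x. \<lbrakk>a \<in> carrier R; x \<in> H\<rbrakk> \<Longrightarrow> a \<odot>\<^bsub>M\<^esub> x \<in> H"
  shows "submodule H R M"
proof (intro submodule.intro subgroup.intro submodule_axioms.intro)
  fix x assume "x \<in> H"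
  then show "inv\<^bsub>add_monoid M\<^esub> x \<in> H"
    using assms smult_minus_one [of x] by (metis R.a_inv_closed R.one_closed a_inv_def subset_iff)
qed (use assms in auto)

lemma smult_finsum:
  assumes "a \<in> carrier R" and "f \<in> I \<rightarrow> carrier M"
  shows "a \<odot>\<^bsub>M\<^esub> finsum M f I = finsum M (\<lambda>i. a \<odot>\<^bsub>M\<^esub> f i) I"
  using assms(2)
proof (induction I rule: infinite_finite_induct)
  case (insert i I)
  then have "f i \<in> carrier M" "f \<in> I \<rightarrow> carrier M" by auto
  moreover from this have "(\<lambda>i. a \<odot>\<^bsub>M\<^esub> f i) \<in> I \<rightarrow> carrier M" using assms(1) by auto
  ultimately show ?case using insert assms(1) by (simp add: smult_r_distr)
qed (use assms(1) in simp_all)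

end

lemma module_homI:
  assumes "\<And>x. x \<in> carrier M \<Longrightarrow> f x \<in> carrier N"
    and "\<And>x y. \<lbrakk>x \<in> carrier M; y \<in> carrier M\<rbrakk> \<Longrightarrow> f (x \<oplus>\<^bsub>M\<^esub> y) = f x \<oplus>\<^bsub>N\<^esub> f y"
    and "\<And>r x. \<lbrakk>r \<in> carrier R; x \<in> carrier M\<rbrakk> \<Longrightarrow> f (r \<odot>\<^bsub>M\<^esub> x) = r \<odot>\<^bsub>N\<^esub> f x"
  shows "f \<in> module_hom R M N"
  using assms by (auto simp: module_hom_def hom_def)

lemma module_homD:
  assumes "f \<in> module_hom R M N"
  shows "\<And>x. x \<in> carrier M \<Longrightarrow> f x \<in> carrier N"
    and "\<And>x y. \<lbrakk>x \<in> carrier M; y \<in> carrier M\<rbrakk> \<Longrightarrow> f (x \<oplus>\<^bsub>M\<^esub> y) = f x \<oplus>\<^bsub>N\<^esub> f y"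
    and "\<And>r x. \<lbrakk>r \<in> carrier R; x \<in> carrier M\<rbrakk> \<Longrightarrow> f (r \<odot>\<^bsub>M\<^esub> x) = r \<odot>\<^bsub>N\<^esub> f x"
  using assms by (auto simp: module_hom_def hom_def)

lemma additive_zero:
  assumes "abelian_group G" "abelian_group H" "f \<in> hom (add_monoid G) (add_monoid H)"
  shows "f \<zero>\<^bsub>G\<^esub> = \<zero>\<^bsub>H\<^esub>"
  using hom_one [OF assms(3)] assms abelian_group.a_group by (metis monoid.simps(2))

lemma module_hom_zero:
  assumes "left_module R M" "left_module R N" "f \<in> module_hom R M N"
  shows "f \<zero>\<^bsub>M\<^esub> = \<zero>\<^bsub>N\<^esub>"
  using assms additive_zero [of M N f] by (auto simp: left_module_def module_hom_def)

lemma module_hom_finsum: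
  assumes "left_module R M" "left_module R N" "f \<in> module_hom R M N" "g \<in> I \<rightarrow> carrier M"
  shows "f (finsum M g I) = finsum N (\<lambda>i. f (g i)) I"
proof -
  interpret M: left_module R M by fact
  interpret N: left_module R N by fact
  show ?thesis using assms(4)
  proof (induction I rule: infinite_finite_induct)
    case (insert i I)
    then have "g i \<in> carrier M" "g \<in> I \<rightarrow> carrier M" by auto
    moreover from this have "(\<lambda>i. f (g i)) \<in> I \<rightarrow> carrier N" "f (g i) \<in> carrier N"
      using module_homD(1)[OF assms(3)] by auto
    ultimately show ?case using insert by (simp add: module_homD(2)[OF assms(3)])
  qed (simp_all add: module_hom_zero[OF assms(1-3)])
qed

lemma module_hom_comp:
  assumes "f \<in> module_hom R L M" "g \<in> module_hom R M N"
  shows "(\<lambda>x. g (f x)) \<in> module_hom R L N"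
  by (rule module_homI) (simp_all add: module_homD[OF assms(1)] module_homD[OF assms(2)])

lemma module_hom_inv:
  assumes "left_module R M" "f \<in> module_hom R M N" "bij_betw f (carrier M) (carrier N)"
  shows "inv_into (carrier M) f \<in> module_hom R N M"
proof -
  interpret M: left_module R M by fact
  note bij = bij_betw_inv_into_right[OF assms(3)] bij_betw_inv_into_left[OF assms(3)]
  have cl: "\<And>y. y \<in> carrier N \<Longrightarrow> inv_into (carrier M) f y \<in> carrier M"
    using bij_betw_inv_into[OF assms(3)] bij_betwE by blast
  show ?thesis
  proof (rule module_homI)
    fix x y assume *: "x \<in> carrier N" "y \<in> carrier N"
    have "x \<oplus>\<^bsub>N\<^esub> y = f (inv_into (carrier M) f x \<oplus>\<^bsub>M\<^esub> inv_into (carrier M) f y)"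
      using * cl bij by (simp add: module_homD(2)[OF assms(2)])
    then show "inv_into (carrier M) f (x \<oplus>\<^bsub>N\<^esub> y) = inv_into (carrier M) f x \<oplus>\<^bsub>M\<^esub> inv_into (carrier M) f y"
      using * cl bij by simp
  next
    fix r x assume *: "r \<in> carrier R" "x \<in> carrier N"
    have "r \<odot>\<^bsub>N\<^esub> x = f (r \<odot>\<^bsub>M\<^esub> inv_into (carrier M) f x)"
      using * cl bij by (simp add: module_homD(3)[OF assms(2)])
    then show "inv_into (carrier M) f (r \<odot>\<^bsub>N\<^esub> x) = r \<odot>\<^bsub>M\<^esub> inv_into (carrier M) f x"
      using * cl bij by simp
  qed (rule cl)
qed

section \<open>Projective modules\<close>

definition free_module :: "('r, 'q) ring_scheme \<Rightarrow> 'i set \<Rightarrow> ('r, 'i \<Rightarrow> 'r) module"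
  where "free_module R I =
    \<lparr>carrier = {c. finite {i. c i \<noteq> \<zero>\<^bsub>R\<^esub>} \<and> (\<forall>i. c i \<in> carrier R) \<and> (\<forall>i. i \<notin> I \<longrightarrow> c i = \<zero>\<^bsub>R\<^esub>)},
     mult = undefined, one = undefined, ring.zero = (\<lambda>i. \<zero>\<^bsub>R\<^esub>),
     ring.add = (\<lambda>c d i. c i \<oplus>\<^bsub>R\<^esub> d i), smult = (\<lambda>r c i. r \<otimes>\<^bsub>R\<^esub> c i)\<rparr>"

lemma left_module_free_module:
  fixes R :: "('r, 'q) ring_scheme" and I :: "'i set"
  assumes "ring R" shows "left_module R (free_module R I)"
proof -
  interpret R: ring R by fact
  have fin: "finite {i. c i \<oplus>\<^bsub>R\<^esub> d i \<noteq> \<zero>\<^bsub>R\<^esub>}"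
    if "finite {i. c i \<noteq> \<zero>\<^bsub>R\<^esub>}" "finite {i. d i \<noteq> \<zero>\<^bsub>R\<^esub>}" for c d :: "'i \<Rightarrow> 'r"
    by (rule finite_subset[OF _ finite_UnI[OF that]]) auto
  have fin': "finite {i. r \<otimes>\<^bsub>R\<^esub> c i \<noteq> \<zero>\<^bsub>R\<^esub>}" if "r \<in> carrier R" "finite {i. c i \<noteq> \<zero>\<^bsub>R\<^esub>}" for r c
    by (rule finite_subset[OF _ that(2)]) (use that(1) in auto)
  show ?thesis
  proof (rule left_moduleI[OF assms])
    show "abelian_group (free_module R I)"
    proof (rule abelian_groupI; clarsimp simp: free_module_def)
      fix c assume *: "finite {i. c i \<noteq> \<zero>\<^bsub>R\<^esub>}" "\<forall>i. c i \<in> carrier R" "\<forall>i. i \<notin> I \<longrightarrow> c i = \<zero>\<^bsub>R\<^esub>"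
      show "\<exists>d. finite {i. d i \<noteq> \<zero>\<^bsub>R\<^esub>} \<and> (\<forall>i. d i \<in> carrier R) \<and> (\<forall>i. i \<notin> I \<longrightarrow> d i = \<zero>\<^bsub>R\<^esub>) \<and>
          (\<lambda>i. d i \<oplus>\<^bsub>R\<^esub> c i) = (\<lambda>i. \<zero>\<^bsub>R\<^esub>)"
        by (rule exI[of _ "\<lambda>i. \<ominus>\<^bsub>R\<^esub> c i"])
          (use * in \<open>auto simp: R.l_neg intro: finite_subset[OF _ *(1)]\<close>)
    qed (auto simp: fin R.a_ac)
  qed (auto simp: free_module_def fin fin' R.l_distr R.r_distr R.m_assoc)
qed

definition free_lift ::
  "('r, 'q) ring_scheme \<Rightarrow> ('r, 'n, 'd) module_scheme \<Rightarrow> ('i \<Rightarrow> 'n) \<Rightarrow> ('i \<Rightarrow> 'r) \<Rightarrow> 'n"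
  where "free_lift R N n c = (\<Oplus>\<^bsub>N\<^esub>i \<in> {i. c i \<noteq> \<zero>\<^bsub>R\<^esub>}. c i \<odot>\<^bsub>N\<^esub> n i)"

lemma free_lift_superset:
  assumes "left_module R N" "n \<in> I \<rightarrow> carrier N" "c \<in> carrier (free_module R I)"
    "finite J" "{i. c i \<noteq> \<zero>\<^bsub>R\<^esub>} \<subseteq> J" "J \<subseteq> I"
  shows "free_lift R N n c = (\<Oplus>\<^bsub>N\<^esub>i \<in> J. c i \<odot>\<^bsub>N\<^esub> n i)"
proof -
  interpret N: left_module R N by fact
  have n: "\<And>i. i \<in> J \<Longrightarrow> n i \<in> carrier N" using assms by auto
  show ?thesis unfolding free_lift_def
    by (rule N.M.add.finprod_mono_neutral_cong_left)
      (use assms n in \<open>auto simp: free_module_def\<close>)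
qed

lemma free_lift_hom:
  assumes "left_module R N" "n \<in> I \<rightarrow> carrier N"
  shows "free_lift R N n \<in> module_hom R (free_module R I) N"
proof -
  interpret N: left_module R N by fact
  let ?S = "\<lambda>c. {i. c i \<noteq> \<zero>\<^bsub>R\<^esub>}"
  interpret F: left_module R "free_module R I" by (rule left_module_free_module[OF N.R.ring_axioms])
  have S: "finite (?S c)" "?S c \<subseteq> I" "\<And>i. c i \<in> carrier R" if "c \<in> carrier (free_module R I)" for c
    using that by (auto simp: free_module_def)
  have n: "n i \<in> carrier N" if "i \<in> I" for i using assms that by auto
  show ?thesis
  proof (rule module_homI)
    fix c assume c: "c \<in> carrier (free_module R I)"
    show "free_lift R N n c \<in> carrier N" unfolding free_lift_def
      by (rule N.M.finsum_closed) (use S[OF c] n in auto)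
  next
    fix c d assume c: "c \<in> carrier (free_module R I)" and d: "d \<in> carrier (free_module R I)"
    let ?J = "?S c \<union> ?S d"
    have cd: "c \<oplus>\<^bsub>free_module R I\<^esub> d = (\<lambda>i. c i \<oplus>\<^bsub>R\<^esub> d i)" by (simp add: free_module_def)
    have J: "finite ?J" "?J \<subseteq> I" using S(1,2)[OF c] S(1,2)[OF d] by auto
    have fc: "(\<lambda>i. c i \<odot>\<^bsub>N\<^esub> n i) \<in> ?J \<rightarrow> carrier N" and fd: "(\<lambda>i. d i \<odot>\<^bsub>N\<^esub> n i) \<in> ?J \<rightarrow> carrier N"
      using J(2) n S(3)[OF c] S(3)[OF d] by blast+
    have cdc: "(\<lambda>i. c i \<oplus>\<^bsub>R\<^esub> d i) \<in> carrier (free_module R I)" using F.M.a_closed[OF c d] by (simp add: cd)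
    have "free_lift R N n (\<lambda>i. c i \<oplus>\<^bsub>R\<^esub> d i) = (\<Oplus>\<^bsub>N\<^esub>i \<in> ?J. (c i \<oplus>\<^bsub>R\<^esub> d i) \<odot>\<^bsub>N\<^esub> n i)"
      by (rule free_lift_superset[OF assms cdc J(1) _ J(2)]) auto
    also have "\<dots> = (\<Oplus>\<^bsub>N\<^esub>i \<in> ?J. c i \<odot>\<^bsub>N\<^esub> n i \<oplus>\<^bsub>N\<^esub> d i \<odot>\<^bsub>N\<^esub> n i)"
      by (rule N.M.add.finprod_cong')
        (use J(2) n S(3)[OF c] S(3)[OF d] in \<open>auto intro!: N.smult_l_distr\<close>)
    also have "\<dots> = (\<Oplus>\<^bsub>N\<^esub>i \<in> ?J. c i \<odot>\<^bsub>N\<^esub> n i) \<oplus>\<^bsub>N\<^esub> (\<Oplus>\<^bsub>N\<^esub>i \<in> ?J. d i \<odot>\<^bsub>N\<^esub> n i)"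
      by (rule N.M.add.finprod_multf[OF fc fd])
    also have "\<dots> = free_lift R N n c \<oplus>\<^bsub>N\<^esub> free_lift R N n d"
      using free_lift_superset[OF assms c J(1) _ J(2)] free_lift_superset[OF assms d J(1) _ J(2)] by auto
    finally show "free_lift R N n (c \<oplus>\<^bsub>free_module R I\<^esub> d) = free_lift R N n c \<oplus>\<^bsub>N\<^esub> free_lift R N n d"
      by (simp add: cd)
  next
    fix r c assume r: "r \<in> carrier R" and c: "c \<in> carrier (free_module R I)"
    have rc: "r \<odot>\<^bsub>free_module R I\<^esub> c = (\<lambda>i. r \<otimes>\<^bsub>R\<^esub> c i)" by (simp add: free_module_def)
    have rcc: "(\<lambda>i. r \<otimes>\<^bsub>R\<^esub> c i) \<in> carrier (free_module R I)" using F.smult_closed[OF r c] by (simp add: rc)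
    have "free_lift R N n (\<lambda>i. r \<otimes>\<^bsub>R\<^esub> c i) = (\<Oplus>\<^bsub>N\<^esub>i \<in> ?S c. (r \<otimes>\<^bsub>R\<^esub> c i) \<odot>\<^bsub>N\<^esub> n i)"
      by (rule free_lift_superset[OF assms rcc S(1)[OF c] _ S(2)[OF c]]) (use r in auto)
    also have "\<dots> = (\<Oplus>\<^bsub>N\<^esub>i \<in> ?S c. r \<odot>\<^bsub>N\<^esub> (c i \<odot>\<^bsub>N\<^esub> n i))"
      by (rule N.M.add.finprod_cong') (use S[OF c] n r in \<open>auto intro!: N.smult_assoc1\<close>)
    also have "\<dots> = r \<odot>\<^bsub>N\<^esub> free_lift R N n c" unfolding free_lift_def
      by (rule N.smult_finsum[symmetric]) (use S[OF c] n r in auto)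
    finally show "free_lift R N n (r \<odot>\<^bsub>free_module R I\<^esub> c) = r \<odot>\<^bsub>N\<^esub> free_lift R N n c"
      by (simp add: rc)
  qed
qed

lemma hom_free_lift:
  assumes "left_module R N" "left_module R N'" "g \<in> module_hom R N N'" "n \<in> I \<rightarrow> carrier N"
    and c: "c \<in> carrier (free_module R I)"
  shows "g (free_lift R N n c) = free_lift R N' (\<lambda>i. g (n i)) c"
proof -
  interpret N: left_module R N by fact
  interpret N': left_module R N' by fact
  have S: "\<And>i. c i \<noteq> \<zero>\<^bsub>R\<^esub> \<Longrightarrow> i \<in> I" "\<And>i. c i \<in> carrier R" using c by (auto simp: free_module_def)
  have n: "n i \<in> carrier N" if "i \<in> I" for i using assms that by auto
  have "g (free_lift R N n c) = (\<Oplus>\<^bsub>N'\<^esub>i \<in> {i. c i \<noteq> \<zero>\<^bsub>R\<^esub>}. g (c i \<odot>\<^bsub>N\<^esub> n i))"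
    unfolding free_lift_def by (rule module_hom_finsum[OF assms(1-3)]) (use S n in auto)
  also have "\<dots> = free_lift R N' (\<lambda>i. g (n i)) c" unfolding free_lift_def
    by (rule N'.M.add.finprod_cong')
      (use S n module_homD[OF assms(3)] in auto)
  finally show ?thesis .
qed

text \<open>A projective module has the lifting property with respect to modules on arbitrary types.\<close>

theorem projective_module_lift:
  fixes N :: "('r, 'n, 'd) module_scheme" and N' :: "('r, 'k, 'e) module_scheme"
    and P :: "('r, 'm, 'c) module_scheme"
  assumes P: "projective_module R P" and N: "left_module R N" and N': "left_module R N'"
    and g: "g \<in> module_hom R N N'" "g ` carrier N = carrier N'" and f: "f \<in> module_hom R P N'"
  shows "\<exists>h \<in> module_hom R P N. \<forall>x \<in> carrier P. g (h x) = f x"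
proof -
  have LP: "left_module R P" using P by (simp add: projective_module_def)
  interpret P: left_module R P by fact
  let ?F = "free_module R (carrier P)"
  let ?P' = "\<lparr>carrier = carrier P, mult = mult P, one = one P, ring.zero = ring.zero P,
    ring.add = ring.add P, smult = smult P\<rparr> :: ('r, 'm) module"
  have LP': "left_module R ?P'"
    by (rule left_moduleI[OF P.R.ring_axioms])
      (auto intro!: abelian_groupI P.M.a_assoc P.M.a_comm P.smult_l_distr P.smult_r_distr
        P.smult_assoc1 bexI[of _ "\<ominus>\<^bsub>P\<^esub> x" for x] P.M.l_neg)
  have LF: "left_module R ?F" by (rule left_module_free_module[OF P.R.ring_axioms])
  have pi: "free_lift R P (\<lambda>x. x) \<in> module_hom R ?F ?P'"
    using free_lift_hom[OF LP, of "\<lambda>x. x" "carrier P"] by (simp add: module_hom_def hom_def)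
  have idh: "(\<lambda>x. x) \<in> module_hom R P ?P'" by (auto simp: module_hom_def hom_def)
  have "free_lift R P (\<lambda>x. x) ` carrier ?F = carrier ?P'"
  proof (intro equalityI subsetI)
    fix x assume "x \<in> carrier ?P'"
    then have x: "x \<in> carrier P" by simp
    let ?d = "\<lambda>i. if i = x then \<one>\<^bsub>R\<^esub> else \<zero>\<^bsub>R\<^esub>"
    have d: "?d \<in> carrier ?F" using x by (auto simp: free_module_def)
    have "free_lift R P (\<lambda>x. x) ?d = (\<Oplus>\<^bsub>P\<^esub>i \<in> {x}. ?d i \<odot>\<^bsub>P\<^esub> i)"
      by (rule free_lift_superset[OF LP _ d]) (use x in auto)
    also have "\<dots> = x" using x by simp
    finally show "x \<in> free_lift R P (\<lambda>x. x) ` carrier ?F" using d by (metis image_eqI)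
  qed (use module_homD(1)[OF pi] in auto)
  then obtain h where h: "h \<in> module_hom R P ?F" "\<And>x. x \<in> carrier P \<Longrightarrow> free_lift R P (\<lambda>x. x) (h x) = x"
    using P LF LP' pi idh unfolding projective_module_def by meson
  have "\<forall>x \<in> carrier P. \<exists>y \<in> carrier N. g y = f x"
    using g(2) module_homD(1)[OF f] by (metis imageE)
  then obtain n where n: "n \<in> carrier P \<rightarrow> carrier N" "\<And>x. x \<in> carrier P \<Longrightarrow> g (n x) = f x"
    by (metis Pi_I)
  have nh: "(\<lambda>x. free_lift R N n (h x)) \<in> module_hom R P N"
    by (rule module_hom_comp[OF h(1) free_lift_hom[OF N n(1)]])
  have "g (free_lift R N n (h x)) = f x" if x: "x \<in> carrier P" for x
  proof -
    have hx: "h x \<in> carrier ?F" by (rule module_homD(1)[OF h(1) x])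
    interpret N': left_module R N' by fact
    have S: "\<And>i. h x i \<noteq> \<zero>\<^bsub>R\<^esub> \<Longrightarrow> i \<in> carrier P" "\<And>i. h x i \<in> carrier R"
      using hx by (auto simp: free_module_def)
    have "g (free_lift R N n (h x)) = free_lift R N' (\<lambda>i. g (n i)) (h x)"
      by (rule hom_free_lift[OF N N' g(1) n(1) hx])
    also have "\<dots> = free_lift R N' f (h x)" unfolding free_lift_def
      by (rule N'.M.add.finprod_cong')
        (use n(2) S module_homD(1)[OF f] in auto)
    also have "\<dots> = f (free_lift R P (\<lambda>x. x) (h x))"
      by (rule hom_free_lift[OF LP N' f _ hx, symmetric]) auto
    also have "\<dots> = f x" using h(2) x by simp
    finally show ?thesis .
  qed
  with nh show ?thesis by (intro bexI[of _ "\<lambda>x. free_lift R N n (h x)"] ballI)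
qed


section \<open>Transport of structure\<close>

lemma projective_module_iso:
  fixes Q :: "('r, 'n, 'd) module_scheme"
  assumes P: "projective_module R P" and Q: "left_module R Q"
    and e: "e \<in> module_hom R P Q" "bij_betw e (carrier P) (carrier Q)"
  shows "projective_module R Q"
  unfolding projective_module_def
proof (intro conjI allI impI Q; elim conjE)
  fix N :: "('r, 'n \<Rightarrow> 'r) module" and N' :: "('r, 'n) module" and g f
  assume *: "left_module R N" "left_module R N'" "g \<in> module_hom R N N'"
    "g ` carrier N = carrier N'" "f \<in> module_hom R Q N'"
  have LP: "left_module R P" using P by (simp add: projective_module_def)
  obtain h where h: "h \<in> module_hom R P N" "\<And>x. x \<in> carrier P \<Longrightarrow> g (h x) = f (e x)"
    using projective_module_lift[OF P *(1-4) module_hom_comp[OF e(1) *(5)]] by blast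
  let ?i = "inv_into (carrier P) e"
  have "(\<lambda>y. h (?i y)) \<in> module_hom R Q N"
    by (rule module_hom_comp[OF module_hom_inv[OF LP e] h(1)])
  moreover have "g (h (?i y)) = f y" if "y \<in> carrier Q" for y
    using h(2)[of "?i y"] that bij_betw_inv_into_right[OF e(2) that]
      bij_betw_inv_into[OF e(2)] bij_betwE by fastforce
  ultimately show "\<exists>h \<in> module_hom R Q N. \<forall>x \<in> carrier Q. g (h x) = f x"
    by (intro bexI[of _ "\<lambda>y. h (?i y)"] ballI)
qed

lemma (in left_module) submodule_vimage:
  assumes "left_module R N" "e \<in> module_hom R M N" "submodule H R N"
  shows "submodule {x \<in> carrier M. e x \<in> H} R M"
proof -
  interpret N: left_module R N by fact
  interpret H: submodule H R N by fact
  show ?thesis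
    by (rule left_submoduleI)
      (use H.one_closed H.m_closed in
        \<open>auto simp: module_homD[OF assms(2)] module_hom_zero[OF left_module_axioms assms(1,2)]\<close>)
qed

lemma finitely_generated_image:
  assumes P: "left_module R P" "finitely_generated R P" and Q: "left_module R Q"
    and e: "e \<in> module_hom R P Q" "e ` carrier P = carrier Q"
  shows "finitely_generated R Q"
proof -
  interpret P: left_module R P by fact
  obtain S where S: "finite S" "S \<subseteq> carrier P"
    "\<And>H. submodule H R P \<Longrightarrow> S \<subseteq> H \<Longrightarrow> H = carrier P"
    using P(2) by (auto simp: finitely_generated_def)
  have "H = carrier Q" if H: "submodule H R Q" "e ` S \<subseteq> H" for H
  proof -
    interpret H: submodule H R Q by fact
    have "{x \<in> carrier P. e x \<in> H} = carrier P"
      by (rule S(3)[OF P.submodule_vimage[OF Q e(1) H(1)]]) (use S(2) H(2) in auto)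
    then have "carrier Q \<subseteq> H" unfolding e(2)[symmetric] by blast
    with H.subset show ?thesis by auto
  qed
  moreover have "finite (e ` S)" "e ` S \<subseteq> carrier Q" using S e by auto
  ultimately show ?thesis unfolding finitely_generated_def by blast
qed

definition transported_module ::
  "('r, 'm, 'c) module_scheme \<Rightarrow> ('m \<Rightarrow> 'n) \<Rightarrow> ('r, 'n) module"
  where "transported_module M e =
    (let i = inv_into (carrier M) e in
     \<lparr>carrier = e ` carrier M, mult = undefined, one = undefined, ring.zero = e \<zero>\<^bsub>M\<^esub>,
      ring.add = (\<lambda>x y. e (i x \<oplus>\<^bsub>M\<^esub> i y)), smult = (\<lambda>r x. e (r \<odot>\<^bsub>M\<^esub> i x))\<rparr>)"

lemma transported_module:
  assumes "left_module R M" "inj_on e (carrier M)"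
  shows "left_module R (transported_module M e)"
    and "e \<in> module_hom R M (transported_module M e)"
    and "bij_betw e (carrier M) (carrier (transported_module M e))"
proof -
  interpret M: left_module R M by fact
  have i: "x \<in> carrier M \<Longrightarrow> inv_into (carrier M) e (e x) = x" for x
    using assms(2) by simp
  show "left_module R (transported_module M e)"
  proof (rule left_moduleI[OF M.R.ring_axioms])
    show "abelian_group (transported_module M e)"
    proof (rule abelian_groupI; clarsimp simp: transported_module_def Let_def i)
      fix x assume x: "x \<in> carrier M"
      then show "\<exists>y \<in> carrier M. e (y \<oplus>\<^bsub>M\<^esub> x) = e \<zero>\<^bsub>M\<^esub>"
        by (intro bexI[of _ "\<ominus>\<^bsub>M\<^esub> x"]) (auto simp: M.M.l_neg)
    qed (auto simp: M.M.a_ac)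
  qed (auto simp: transported_module_def Let_def i M.smult_l_distr M.smult_r_distr M.smult_assoc1)
  show "e \<in> module_hom R M (transported_module M e)"
    by (rule module_homI) (auto simp: transported_module_def Let_def i)
  show "bij_betw e (carrier M) (carrier (transported_module M e))"
    using assms(2) by (auto simp: bij_betw_def transported_module_def Let_def)
qed

lemma finitely_generated_nat_fun:
  fixes M :: "('r, 'm, 'c) module_scheme"
  assumes "left_module R M" "finitely_generated R M"
  shows "\<exists>e :: 'm \<Rightarrow> nat \<Rightarrow> 'r. inj_on e (carrier M)"
proof -
  interpret M: left_module R M by fact
  obtain S where S: "finite S" "S \<subseteq> carrier M"
    "\<And>H. submodule H R M \<Longrightarrow> S \<subseteq> H \<Longrightarrow> H = carrier M"
    using assms(2) by (auto simp: finitely_generated_def)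
  obtain n and s :: "nat \<Rightarrow> 'm" where s: "S = s ` {i. i < n}"
    using S(1) by (metis finite_imp_nat_seg_image_inj_on)
  let ?sum = "\<lambda>c. \<Oplus>\<^bsub>M\<^esub>i \<in> {i. i < n}. c i \<odot>\<^bsub>M\<^esub> s i"
  let ?C = "{c :: nat \<Rightarrow> 'r. \<forall>i. c i \<in> carrier R}"
  have sM: "s i \<in> carrier M" if "i < n" for i using S(2) s that by auto
  have "?sum ` ?C = carrier M"
  proof (rule S(3))
    show "submodule (?sum ` ?C) R M"
    proof (rule M.left_submoduleI)
      show "?sum ` ?C \<subseteq> carrier M" using sM by (auto intro!: M.M.finsum_closed)
      have "?sum (\<lambda>i. \<zero>\<^bsub>R\<^esub>) = \<zero>\<^bsub>M\<^esub>" by (rule M.M.add.finprod_one_eqI) (use sM in auto)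
      then show "\<zero>\<^bsub>M\<^esub> \<in> ?sum ` ?C" by (intro image_eqI[of _ _ "\<lambda>i. \<zero>\<^bsub>R\<^esub>"]) auto
    next
      fix x y assume "x \<in> ?sum ` ?C" "y \<in> ?sum ` ?C"
      then obtain c d where c: "x = ?sum c" "\<forall>i. c i \<in> carrier R" and d: "y = ?sum d" "\<forall>i. d i \<in> carrier R"
        by blast
      have "?sum (\<lambda>i. c i \<oplus>\<^bsub>R\<^esub> d i) = (\<Oplus>\<^bsub>M\<^esub>i \<in> {i. i < n}. c i \<odot>\<^bsub>M\<^esub> s i \<oplus>\<^bsub>M\<^esub> d i \<odot>\<^bsub>M\<^esub> s i)"
        by (rule M.M.add.finprod_cong') (use sM c d in \<open>auto intro!: M.smult_l_distr\<close>)
      also have "\<dots> = x \<oplus>\<^bsub>M\<^esub> y" unfolding c(1) d(1)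
        by (rule M.M.add.finprod_multf) (use sM c d in auto)
      finally show "x \<oplus>\<^bsub>M\<^esub> y \<in> ?sum ` ?C"
        using c d by (intro image_eqI[of _ _ "\<lambda>i. c i \<oplus>\<^bsub>R\<^esub> d i"]) auto
    next
      fix r x assume r: "r \<in> carrier R" and "x \<in> ?sum ` ?C"
      then obtain c where c: "x = ?sum c" "\<forall>i. c i \<in> carrier R" by blast
      have "?sum (\<lambda>i. r \<otimes>\<^bsub>R\<^esub> c i) = (\<Oplus>\<^bsub>M\<^esub>i \<in> {i. i < n}. r \<odot>\<^bsub>M\<^esub> (c i \<odot>\<^bsub>M\<^esub> s i))"
        by (rule M.M.add.finprod_cong') (use sM c r in \<open>auto intro!: M.smult_assoc1\<close>)
      also have "\<dots> = r \<odot>\<^bsub>M\<^esub> x" unfolding c(1)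
        by (rule M.smult_finsum[symmetric]) (use sM c r in auto)
      finally show "r \<odot>\<^bsub>M\<^esub> x \<in> ?sum ` ?C"
        using c r by (intro image_eqI[of _ _ "\<lambda>i. r \<otimes>\<^bsub>R\<^esub> c i"]) auto
    qed
    show "S \<subseteq> ?sum ` ?C"
    proof
      fix x assume "x \<in> S"
      then obtain j where j: "j < n" "x = s j" using s by auto
      have "?sum (\<lambda>i. if i = j then \<one>\<^bsub>R\<^esub> else \<zero>\<^bsub>R\<^esub>) =
          (\<Oplus>\<^bsub>M\<^esub>i \<in> {i. i < n}. if i = j then s i else \<zero>\<^bsub>M\<^esub>)"
        by (rule M.M.add.finprod_cong') (use sM in auto)
      also have "\<dots> = s j"
        by (rule M.M.add.finprod_singleton_swap) (use sM j in auto)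
      finally show "x \<in> ?sum ` ?C"
        using j by (intro image_eqI[of _ _ "\<lambda>i. if i = j then \<one>\<^bsub>R\<^esub> else \<zero>\<^bsub>R\<^esub>"]) auto
    qed
  qed
  then have "\<exists>c. ?sum c = x" if "x \<in> carrier M" for x using that by (metis (no_types, lifting) imageE)
  then have "?sum (SOME c. ?sum c = x) = x" if "x \<in> carrier M" for x
    by (rule someI_ex) (rule that)
  then have "inj_on (\<lambda>x. SOME c. ?sum c = x) (carrier M)"
    by (rule inj_on_inverseI[where g = ?sum])
  then show ?thesis by (rule exI[of "\<lambda>e. inj_on e (carrier M)"])
qed

lemma exact_complex_iso:
  assumes ex: "exact_complex C d"
    and C': "\<And>i. abelian_group (C' i)"
    and d': "\<And>i. d' i \<in> hom (add_monoid (C' i)) (add_monoid (C' (i + 1)))"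
    and t: "\<And>i. t i \<in> hom (add_monoid (C i)) (add_monoid (C' i))"
    and bij: "\<And>i. bij_betw (t i) (carrier (C i)) (carrier (C' i))"
    and comm: "\<And>i x. x \<in> carrier (C i) \<Longrightarrow> d' i (t i x) = t (i + 1) (d i x)"
  shows "exact_complex C' d'"
  unfolding exact_complex_def
proof (intro allI conjI C' d')
  fix i :: int
  have C: "abelian_group (C i)" for i using ex by (auto simp: exact_complex_def)
  have d: "d i x \<in> carrier (C (i + 1))" if "x \<in> carrier (C i)" for i x
    using ex that by (fastforce simp: exact_complex_def hom_def)
  have e: "d i ` carrier (C i) = a_kernel (C (i + 1)) (C (i + 2)) (d (i + 1))"
    using ex by (auto simp: exact_complex_def)
  have im: "t i ` carrier (C i) = carrier (C' i)" for i using bij by (auto simp: bij_betw_def)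
  have t0: "t i \<zero>\<^bsub>C i\<^esub> = \<zero>\<^bsub>C' i\<^esub>" for i by (rule additive_zero[OF C C' t])
  have z: "t i x = \<zero>\<^bsub>C' i\<^esub> \<longleftrightarrow> x = \<zero>\<^bsub>C i\<^esub>" if "x \<in> carrier (C i)" for i x
    using inj_on_eq_iff[OF bij_betw_imp_inj_on[OF bij] that, of "\<zero>\<^bsub>C i\<^esub>"]
      abelian_groupE(2)[OF C, of i] t0[of i] by simp
  have "d' i ` carrier (C' i) = t (i + 1) ` d i ` carrier (C i)"
    unfolding im[of i, symmetric] image_image by (rule image_cong) (simp_all add: comm)
  also have "\<dots> = t (i + 1) ` {x \<in> carrier (C (i + 1)). d (i + 1) x = \<zero>\<^bsub>C (i + 2)\<^esub>}"
    by (simp add: e a_kernel_def')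
  also have "\<dots> = t (i + 1) ` {x \<in> carrier (C (i + 1)). d' (i + 1) (t (i + 1) x) = \<zero>\<^bsub>C' (i + 2)\<^esub>}"
    using z[of _ "i + 2"] d[of _ "i + 1"] by (intro arg_cong[of _ _ "image _"]) (auto simp: comm add.assoc t0)
  also have "\<dots> = {y \<in> t (i + 1) ` carrier (C (i + 1)). d' (i + 1) y = \<zero>\<^bsub>C' (i + 2)\<^esub>}" by auto
  finally show "d' i ` carrier (C' i) = a_kernel (C' (i + 1)) (C' (i + 2)) (d' (i + 1))"
    by (simp add: im a_kernel_def')
qed

lemma left_module_regular:
  assumes "ring R" shows "left_module R (regular_module R)"
proof -
  interpret ring R by fact
  show ?thesis
    by (rule left_moduleI[OF assms])
      (auto intro!: abelian_groupI a_assoc a_comm l_distr r_distr m_assoc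
         bexI[of _ "\<ominus>\<^bsub>R\<^esub> x" for x] l_neg simp: regular_module_def)
qed

lemma abelian_group_Hom_group:
  assumes "left_module R M" "left_module R N"
  shows "abelian_group (Hom_group R M N)"
proof -
  interpret M: left_module R M by fact
  interpret N: left_module R N by fact
  show ?thesis
  proof (rule abelian_groupI)
    fix f g assume "f \<in> carrier (Hom_group R M N)" "g \<in> carrier (Hom_group R M N)"
    then have f: "f \<in> module_hom R M N" and g: "g \<in> module_hom R M N" by (auto simp: Hom_group_def)
    have "(\<lambda>x \<in> carrier M. f x \<oplus>\<^bsub>N\<^esub> g x) \<in> module_hom R M N"
      by (rule module_homI)
        (simp_all add: module_homD[OF f] module_homD[OF g] N.M.a_ac N.smult_r_distr)
    then show "f \<oplus>\<^bsub>Hom_group R M N\<^esub> g \<in> carrier (Hom_group R M N)" by (simp add: Hom_group_def)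
    show "f \<oplus>\<^bsub>Hom_group R M N\<^esub> g = g \<oplus>\<^bsub>Hom_group R M N\<^esub> f"
      by (auto simp: Hom_group_def module_homD[OF f] module_homD[OF g] N.M.a_comm)
  next
    show "\<zero>\<^bsub>Hom_group R M N\<^esub> \<in> carrier (Hom_group R M N)"
      by (auto simp: Hom_group_def intro!: module_homI)
  next
    fix f g h assume "f \<in> carrier (Hom_group R M N)" "g \<in> carrier (Hom_group R M N)"
      "h \<in> carrier (Hom_group R M N)"
    then have f: "f \<in> module_hom R M N" and g: "g \<in> module_hom R M N" and h: "h \<in> module_hom R M N"
      by (auto simp: Hom_group_def)
    show "f \<oplus>\<^bsub>Hom_group R M N\<^esub> g \<oplus>\<^bsub>Hom_group R M N\<^esub> h =
        f \<oplus>\<^bsub>Hom_group R M N\<^esub> (g \<oplus>\<^bsub>Hom_group R M N\<^esub> h)"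
      by (auto simp: Hom_group_def module_homD[OF f] module_homD[OF g] module_homD[OF h] N.M.a_assoc
          intro!: restrict_ext)
  next
    fix f assume *: "f \<in> carrier (Hom_group R M N)"
    then have f: "f \<in> module_hom R M N" "f \<in> extensional (carrier M)" by (auto simp: Hom_group_def)
    show "\<zero>\<^bsub>Hom_group R M N\<^esub> \<oplus>\<^bsub>Hom_group R M N\<^esub> f = f"
      using f(2) by (auto simp: Hom_group_def module_homD[OF f(1)] fun_eq_iff extensional_def)
    have "(\<lambda>x \<in> carrier M. \<ominus>\<^bsub>N\<^esub> f x) \<in> module_hom R M N"
    proof (rule module_homI; simp add: module_homD[OF f(1)] N.M.minus_add)
      fix r x assume "r \<in> carrier R" "x \<in> carrier M"
      then have "r \<odot>\<^bsub>N\<^esub> (\<ominus>\<^bsub>N\<^esub> f x) \<oplus>\<^bsub>N\<^esub> r \<odot>\<^bsub>N\<^esub> f x = \<zero>\<^bsub>N\<^esub>"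
        by (simp add: module_homD[OF f(1)] N.M.l_neg flip: N.smult_r_distr)
      then show "\<ominus>\<^bsub>N\<^esub> (r \<odot>\<^bsub>N\<^esub> f x) = r \<odot>\<^bsub>N\<^esub> (\<ominus>\<^bsub>N\<^esub> f x)"
        using \<open>r \<in> carrier R\<close> \<open>x \<in> carrier M\<close> by (simp add: N.M.minus_equality module_homD[OF f(1)])
    qed
    then show "\<exists>g \<in> carrier (Hom_group R M N). g \<oplus>\<^bsub>Hom_group R M N\<^esub> f = \<zero>\<^bsub>Hom_group R M N\<^esub>"
      by (intro bexI[of _ "\<lambda>x \<in> carrier M. \<ominus>\<^bsub>N\<^esub> f x"])
        (auto simp: Hom_group_def module_homD[OF f(1)] N.M.l_neg intro!: restrict_ext)
  qed
qed


lemma Hom_group_precompose: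
  assumes "left_module R L" "f \<in> module_hom R L M"
  shows "(\<lambda>g. compose (carrier L) g f) \<in> hom (add_monoid (Hom_group R M N)) (add_monoid (Hom_group R L N))"
proof -
  interpret L: left_module R L by fact
  have 1: "compose (carrier L) g f \<in> module_hom R L N" if "g \<in> module_hom R M N" for g
  proof (rule module_homI)
    fix r x assume "r \<in> carrier R" "x \<in> carrier L"
    then show "compose (carrier L) g f (r \<odot>\<^bsub>L\<^esub> x) = r \<odot>\<^bsub>N\<^esub> compose (carrier L) g f x"
      by (simp add: compose_eq L.smult_closed module_homD[OF assms(2)] module_homD[OF that])
  qed (simp_all add: compose_eq L.M.a_closed module_homD[OF assms(2)] module_homD[OF that])
  have 2: "compose (carrier L) (\<lambda>x \<in> carrier M. g x \<oplus>\<^bsub>N\<^esub> h x) f =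
      (\<lambda>x \<in> carrier L. compose (carrier L) g f x \<oplus>\<^bsub>N\<^esub> compose (carrier L) h f x)" for g h
    using module_homD(1)[OF assms(2)] by (auto simp: compose_def fun_eq_iff)
  show ?thesis
    unfolding hom_def by (simp add: Hom_group_def 1 2)
qed


lemma complete_projective_resolution_transport:
  fixes R :: "('r, 'q) ring_scheme" and P :: "int \<Rightarrow> ('r, 'p) module" and e :: "int \<Rightarrow> 'p \<Rightarrow> 'n"
  assumes P: "complete_projective_resolution R P d" and e: "\<And>i. inj_on (e i) (carrier (P i))"
  defines "P' \<equiv> \<lambda>i. transported_module (P i) (e i)"
  defines "d' \<equiv> \<lambda>i y. e (i + 1) (d i (inv_into (carrier (P i)) (e i) y))"
  shows "complete_projective_resolution R P' d'"
proof -
  have pj: "projective_module R (P i)" and fg: "finitely_generated R (P i)"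
    and d: "d i \<in> module_hom R (P i) (P (i + 1))" for i
    using P by (auto simp: complete_projective_resolution_def)
  have L: "left_module R (P i)" for i using pj by (simp add: projective_module_def)
  have L': "left_module R (P' i)" and eh: "e i \<in> module_hom R (P i) (P' i)"
    and eb: "bij_betw (e i) (carrier (P i)) (carrier (P' i))" for i
    unfolding P'_def by (rule transported_module[OF L e])+
  have RR: "left_module R (regular_module R)"
    by (rule left_module_regular) (use L in \<open>auto simp: left_module_def\<close>)
  define iv where "iv = (\<lambda>i. inv_into (carrier (P i)) (e i))"
  have iv: "iv i \<in> module_hom R (P' i) (P i)" for i
    unfolding iv_def by (rule module_hom_inv[OF L eh eb])
  have ive: "iv i (e i x) = x" if "x \<in> carrier (P i)" for i x
    unfolding iv_def by (rule bij_betw_inv_into_left[OF eb that])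
  have eiv: "e i (iv i y) = y" if "y \<in> carrier (P' i)" for i y
    unfolding iv_def by (rule bij_betw_inv_into_right[OF eb that])
  have d'_eq: "d' i = (\<lambda>y. e (i + 1) (d i (iv i y)))" for i by (simp add: d'_def iv_def)
  have d': "d' i \<in> module_hom R (P' i) (P' (i + 1))" for i
    unfolding d'_eq by (rule module_hom_comp[OF module_hom_comp[OF iv d] eh])
  have "exact_complex P' d'"
  proof (rule exact_complex_iso[where t = e])
    show "exact_complex P d" using P by (simp add: complete_projective_resolution_def)
  qed (use L' d' eh eb in \<open>auto simp: module_hom_def left_module_def d'_eq ive\<close>)
  moreover have "exact_complex (\<lambda>i. Hom_group R (P' (- i)) (regular_module R))
      (\<lambda>i f. compose (carrier (P' (- (i + 1)))) f (d' (- (i + 1))))"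
  proof (rule exact_complex_iso[where t = "\<lambda>i f. compose (carrier (P' (- i))) f (iv (- i))"])
    show "exact_complex (\<lambda>i. Hom_group R (P (- i)) (regular_module R))
        (\<lambda>i f. compose (carrier (P (- (i + 1)))) f (d (- (i + 1))))"
      using P by (simp add: complete_projective_resolution_def)
  next
    fix i show "abelian_group (Hom_group R (P' (- i)) (regular_module R))"
      by (rule abelian_group_Hom_group[OF L' RR])
  next
    fix i
    have "d' (- (i + 1)) \<in> module_hom R (P' (- (i + 1))) (P' (- i))"
      using d'[of "- (i + 1)"] by simp
    then show "(\<lambda>f. compose (carrier (P' (- (i + 1)))) f (d' (- (i + 1)))) \<in>
        hom (add_monoid (Hom_group R (P' (- i)) (regular_module R)))
          (add_monoid (Hom_group R (P' (- (i + 1))) (regular_module R)))"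
      by (rule Hom_group_precompose[OF L'])
  next
    fix i
    show h: "(\<lambda>f. compose (carrier (P' (- i))) f (iv (- i))) \<in>
        hom (add_monoid (Hom_group R (P (- i)) (regular_module R)))
          (add_monoid (Hom_group R (P' (- i)) (regular_module R)))" for i
      by (rule Hom_group_precompose[OF L' iv])
    have h': "(\<lambda>f. compose (carrier (P (- i))) f (e (- i))) \<in>
        hom (add_monoid (Hom_group R (P' (- i)) (regular_module R)))
          (add_monoid (Hom_group R (P (- i)) (regular_module R)))"
      by (rule Hom_group_precompose[OF L eh])
    show "bij_betw (\<lambda>f. compose (carrier (P' (- i))) f (iv (- i)))
        (carrier (Hom_group R (P (- i)) (regular_module R)))
        (carrier (Hom_group R (P' (- i)) (regular_module R)))"
    proof (rule bij_betw_byWitness[where f' = "\<lambda>f. compose (carrier (P (- i))) f (e (- i))"])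
      show "\<forall>f \<in> carrier (Hom_group R (P (- i)) (regular_module R)).
          compose (carrier (P (- i))) (compose (carrier (P' (- i))) f (iv (- i))) (e (- i)) = f"
        using module_homD(1)[OF eh]
        by (auto simp: Hom_group_def compose_def fun_eq_iff extensional_def ive)
      show "\<forall>f \<in> carrier (Hom_group R (P' (- i)) (regular_module R)).
          compose (carrier (P' (- i))) (compose (carrier (P (- i))) f (e (- i))) (iv (- i)) = f"
        using module_homD(1)[OF iv]
        by (auto simp: Hom_group_def compose_def fun_eq_iff extensional_def eiv)
    qed (use h[of i] h' in \<open>auto simp: hom_def\<close>)
  next
    fix i :: int and f
    let ?j = "- (i + 1)"
    have j: "?j + 1 = - i" by simp
    have dj: "d ?j x \<in> carrier (P (- i))" if "x \<in> carrier (P ?j)" for x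
      using module_homD(1)[OF d that] unfolding j .
    have ej: "e (- i) x \<in> carrier (P' (- i))" if "x \<in> carrier (P (- i))" for x
      by (rule module_homD(1)[OF eh that])
    show "compose (carrier (P' ?j)) (compose (carrier (P' (- i))) f (iv (- i))) (d' ?j) =
        compose (carrier (P' ?j)) (compose (carrier (P ?j)) f (d ?j)) (iv ?j)"
    proof
      fix y
      show "compose (carrier (P' ?j)) (compose (carrier (P' (- i))) f (iv (- i))) (d' ?j) y =
          compose (carrier (P' ?j)) (compose (carrier (P ?j)) f (d ?j)) (iv ?j) y"
      proof (cases "y \<in> carrier (P' ?j)")
        case True
        then have "iv ?j y \<in> carrier (P ?j)" by (rule module_homD(1)[OF iv])
        with True show ?thesis
          unfolding d'_eq j by (simp only: compose_eq dj ej ive)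
      qed (simp only: compose_def restrict_apply if_False)
    qed
  qed
  moreover have "projective_module R (P' i)" for i by (rule projective_module_iso[OF pj L' eh eb])
  moreover have "finitely_generated R (P' i)" for i
    by (rule finitely_generated_image[OF L fg L' eh]) (use eb in \<open>auto simp: bij_betw_def\<close>)
  ultimately show ?thesis using d' by (simp add: complete_projective_resolution_def)
qed

text \<open>Resolutions on an arbitrary type may be used to show that a module is Gorenstein-projective.\<close>

theorem Gorenstein_projectiveI:
  fixes R :: "('r, 'q) ring_scheme" and N :: "('r, 'm, 'c) module_scheme"
    and P :: "int \<Rightarrow> ('r, 'p) module"
  assumes N: "left_module R N" "finitely_generated R N"
    and P: "complete_projective_resolution R P d"
    and iso: "module_isomorphic R N (kernel_module (P 0) (P 1) (d 0))"
  shows "Gorenstein_projective R N"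
proof -
  have pj: "projective_module R (P i)" and fg: "finitely_generated R (P i)"
    and d: "d i \<in> module_hom R (P i) (P (i + 1))" for i
    using P by (auto simp: complete_projective_resolution_def)
  have L: "left_module R (P i)" for i using pj by (simp add: projective_module_def)
  have "\<forall>i. \<exists>f :: 'p \<Rightarrow> nat \<Rightarrow> 'r. inj_on f (carrier (P i))"
    using finitely_generated_nat_fun[OF L fg] by blast
  then obtain e :: "int \<Rightarrow> 'p \<Rightarrow> nat \<Rightarrow> 'r" where e: "\<And>i. inj_on (e i) (carrier (P i))" by metis
  define P' where "P' = (\<lambda>i. transported_module (P i) (e i))"
  define d' where "d' = (\<lambda>i y. e (i + 1) (d i (inv_into (carrier (P i)) (e i) y)))"
  have L': "left_module R (P' i)" and eh: "e i \<in> module_hom R (P i) (P' i)"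
    and eb: "bij_betw (e i) (carrier (P i)) (carrier (P' i))" for i
    unfolding P'_def by (rule transported_module[OF L e])+
  obtain f where f: "f \<in> module_hom R N (kernel_module (P 0) (P 1) (d 0))"
    "bij_betw f (carrier N) (a_kernel (P 0) (P 1) (d 0))"
    using iso by (auto simp: module_isomorphic_def kernel_module_def)
  have e1: "e 1 x = \<zero>\<^bsub>P' 1\<^esub> \<longleftrightarrow> x = \<zero>\<^bsub>P 1\<^esub>" if "x \<in> carrier (P 1)" for x
    using inj_on_eq_iff[OF e that, of "\<zero>\<^bsub>P 1\<^esub>"] module_hom_zero[OF L L' eh, of 1]
      abelian_groupE(2)[of "P 1"] L[of 1] by (simp add: left_module_def)
  have ker: "e 0 ` a_kernel (P 0) (P 1) (d 0) = a_kernel (P' 0) (P' 1) (d' 0)"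
  proof -
    have "d' 0 (e 0 x) = e 1 (d 0 x)" if "x \<in> carrier (P 0)" for x
      using that by (simp add: d'_def e)
    moreover have "carrier (P' 0) = e 0 ` carrier (P 0)" using eb[of 0] by (simp add: bij_betw_def)
    moreover have "d 0 x \<in> carrier (P 1)" if "x \<in> carrier (P 0)" for x
      using module_homD(1)[OF d that] by simp
    ultimately show ?thesis by (auto simp: a_kernel_def' e1 module_hom_zero[OF L L' eh])
  qed
  have fk: "f x \<in> a_kernel (P 0) (P 1) (d 0)" if "x \<in> carrier N" for x
    using f(2) that bij_betwE by blast
  have sub: "a_kernel (P 0) (P 1) (d 0) \<subseteq> carrier (P 0)" by (auto simp: a_kernel_def')
  have "(\<lambda>x. e 0 (f x)) \<in> module_hom R N (kernel_module (P' 0) (P' 1) (d' 0))"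
  proof (rule module_homI)
    fix x assume "x \<in> carrier N"
    then show "e 0 (f x) \<in> carrier (kernel_module (P' 0) (P' 1) (d' 0))"
      using fk[of x] ker by (auto simp: kernel_module_def)
  next
    fix x y assume *: "x \<in> carrier N" "y \<in> carrier N"
    then have "f x \<in> carrier (P 0)" "f y \<in> carrier (P 0)" using fk sub by auto
    with * show "e 0 (f (x \<oplus>\<^bsub>N\<^esub> y)) = e 0 (f x) \<oplus>\<^bsub>kernel_module (P' 0) (P' 1) (d' 0)\<^esub> e 0 (f y)"
      by (simp add: kernel_module_def module_homD(2)[OF f(1)] module_homD(2)[OF eh])
  next
    fix r x assume *: "r \<in> carrier R" "x \<in> carrier N"
    then have "f x \<in> carrier (P 0)" using fk sub by auto
    with * show "e 0 (f (r \<odot>\<^bsub>N\<^esub> x)) = r \<odot>\<^bsub>kernel_module (P' 0) (P' 1) (d' 0)\<^esub> e 0 (f x)"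
      by (simp add: kernel_module_def module_homD(3)[OF f(1)] module_homD(3)[OF eh])
  qed
  moreover have "bij_betw (\<lambda>x. e 0 (f x)) (carrier N) (carrier (kernel_module (P' 0) (P' 1) (d' 0)))"
  proof -
    have "bij_betw (e 0) (a_kernel (P 0) (P 1) (d 0)) (a_kernel (P' 0) (P' 1) (d' 0))"
      using inj_on_subset[OF e sub] ker by (simp add: bij_betw_def)
    from bij_betw_trans[OF f(2) this] show ?thesis by (simp add: kernel_module_def comp_def)
  qed
  ultimately have "module_isomorphic R N (kernel_module (P' 0) (P' 1) (d' 0))"
    unfolding module_isomorphic_def by (intro bexI[of _ "\<lambda>x. e 0 (f x)"])
  moreover have "complete_projective_resolution R P' d'"
    unfolding P'_def d'_def by (rule complete_projective_resolution_transport[OF P e])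
  ultimately show ?thesis
    unfolding Gorenstein_projective_def using N by (intro conjI exI[of _ P'] exI[of _ d'])
qed

text \<open>The base ring of an Artin algebra may live on an arbitrary type.\<close>

theorem artin_algebra_overD:
  fixes K :: "('k, 'p) ring_scheme" and R :: "('r, 'q) ring_scheme"
  assumes "artin_algebra_over K \<eta> R"
  shows "artin_algebra R"
proof -
  have K: "cring K" and dcc: "\<And>I :: nat \<Rightarrow> 'k set.
      (\<And>n. ideal (I n) K) \<Longrightarrow> (\<And>n. I (Suc n) \<subseteq> I n) \<Longrightarrow> \<exists>n. \<forall>m \<ge> n. I m = I n"
    and R: "ring R" and eta: "\<eta> \<in> ring_hom K R"
    and central: "\<And>k r. k \<in> carrier K \<Longrightarrow> r \<in> carrier R \<Longrightarrow> \<eta> k \<otimes>\<^bsub>R\<^esub> r = r \<otimes>\<^bsub>R\<^esub> \<eta> k"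
    using assms by (auto simp: artin_algebra_over_def artinian_cring_def)
  let ?alg = "\<lambda>h. \<lparr>carrier = carrier R, mult = mult R, one = one R, ring.zero = ring.zero R,
    ring.add = ring.add R, smult = (\<lambda>k r. h k \<otimes>\<^bsub>R\<^esub> r)\<rparr>"
  have fg: "finitely_generated K (?alg \<eta>)" using assms by (simp add: artin_algebra_over_def)
  interpret K: cring K by fact
  interpret R: ring R by fact
  interpret h: ring_hom_ring K R \<eta>
    by (rule ring_hom_ringI2[OF K.ring_axioms R eta])
  define L where "L = (\<lparr>carrier = \<eta> ` carrier K, mult = mult R, one = one R, ring.zero = ring.zero R,
    ring.add = ring.add R\<rparr> :: 'r ring)"
  have "cring L"
  proof (rule cringI)
    show "abelian_group L"
    proof (rule abelian_groupI)
      fix x assume "x \<in> carrier L"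
      then obtain k where k: "k \<in> carrier K" "x = \<eta> k" by (auto simp: L_def)
      then have "\<eta> (\<ominus>\<^bsub>K\<^esub> k) \<oplus>\<^bsub>R\<^esub> x = \<zero>\<^bsub>R\<^esub>" by (simp add: R.l_neg)
      then show "\<exists>y \<in> carrier L. y \<oplus>\<^bsub>L\<^esub> x = \<zero>\<^bsub>L\<^esub>"
        using k by (intro bexI[of _ "\<eta> (\<ominus>\<^bsub>K\<^esub> k)"]) (simp_all add: L_def R.l_neg del: h.hom_a_inv)
    qed (auto simp: L_def K.a_ac simp flip: h.hom_add h.hom_zero)
    show "comm_monoid L"
      by (rule comm_monoidI)
        (auto simp: L_def K.m_ac simp flip: h.hom_mult h.hom_one)
  qed (auto simp: L_def R.l_distr)
  moreover have "artinian_cring L"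
    unfolding artinian_cring_def
  proof (intro conjI allI impI \<open>cring L\<close>)
    fix I :: "nat \<Rightarrow> 'r set" assume I: "\<forall>n. ideal (I n) L \<and> I (Suc n) \<subseteq> I n"
    interpret hL: ring_hom_ring K L \<eta>
      by (rule ring_hom_ringI2[OF K.ring_axioms cring.axioms(1)[OF \<open>cring L\<close>]])
        (use eta in \<open>auto simp: ring_hom_def L_def\<close>)
    obtain n where n: "\<forall>m \<ge> n. {k \<in> carrier K. \<eta> k \<in> I m} = {k \<in> carrier K. \<eta> k \<in> I n}"
      using dcc[of "\<lambda>m. {k \<in> carrier K. \<eta> k \<in> I m}"] hL.ideal_vimage I by blast
    have "I m \<subseteq> \<eta> ` carrier K" for m
      using I ideal.axioms(1) additive_subgroup.a_subset by (fastforce simp: L_def)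
    then have "I m = \<eta> ` {k \<in> carrier K. \<eta> k \<in> I m}" for m by blast
    with n show "\<exists>n. \<forall>m \<ge> n. I m = I n" by metis
  qed
  moreover have "finitely_generated L (?alg (\<lambda>x. x))"
  proof -
    obtain S where S: "finite S" "S \<subseteq> carrier R"
      "\<And>H. submodule H K (?alg \<eta>) \<Longrightarrow> S \<subseteq> H \<Longrightarrow> H = carrier R"
      using fg by (auto simp: finitely_generated_def)
    have "submodule H K (?alg \<eta>)" if "submodule H L (?alg (\<lambda>x. x))" for H
      using that by (auto simp: submodule_def submodule_axioms_def subgroup_def m_inv_def L_def)
    then show ?thesis unfolding finitely_generated_def using S by (intro exI[of _ S]) auto
  qed
  ultimately have "artin_algebra_over L (\<lambda>x. x) R"
    unfolding artin_algebra_over_def using R central h.hom_closed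
    by (auto simp: L_def ring_hom_def)
  then show ?thesis unfolding artin_algebra_def by blast
qed


section \<open>Well-definedness of the constructions\<close>

text \<open>
  The first lemma does not assume that \<open>M\<close> is a module, as it is also applied to \<^const>\<open>pretensor\<close>.
\<close>

lemma quotient_module_ops:
  assumes M: "abelian_group M" and H: "subgroup H (add_monoid M)"
  shows "carrier (quotient_module M H) = (\<lambda>x. H +>\<^bsub>M\<^esub> x) ` carrier M"
    and "\<And>x y. \<lbrakk>x \<in> carrier M; y \<in> carrier M\<rbrakk> \<Longrightarrow>
      (H +>\<^bsub>M\<^esub> x) \<oplus>\<^bsub>quotient_module M H\<^esub> (H +>\<^bsub>M\<^esub> y) = H +>\<^bsub>M\<^esub> (x \<oplus>\<^bsub>M\<^esub> y)"
    and "\<And>x y. \<lbrakk>x \<in> carrier M; y \<in> carrier M\<rbrakk> \<Longrightarrow>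
      H +>\<^bsub>M\<^esub> x = H +>\<^bsub>M\<^esub> y \<longleftrightarrow> x \<ominus>\<^bsub>M\<^esub> y \<in> H"
    and "abelian_group (quotient_module M H)"
    and "\<And>r x. \<lbrakk>x \<in> carrier M; \<And>y. y \<in> carrier M \<Longrightarrow> r \<odot>\<^bsub>M\<^esub> y \<in> carrier M;
        \<And>y z. \<lbrakk>y \<in> carrier M; z \<in> carrier M\<rbrakk> \<Longrightarrow> r \<odot>\<^bsub>M\<^esub> (y \<oplus>\<^bsub>M\<^esub> z) = r \<odot>\<^bsub>M\<^esub> y \<oplus>\<^bsub>M\<^esub> r \<odot>\<^bsub>M\<^esub> z;
        \<And>y. y \<in> H \<Longrightarrow> r \<odot>\<^bsub>M\<^esub> y \<in> H\<rbrakk> \<Longrightarrow>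
      r \<odot>\<^bsub>quotient_module M H\<^esub> (H +>\<^bsub>M\<^esub> x) = H +>\<^bsub>M\<^esub> (r \<odot>\<^bsub>M\<^esub> x)"
proof -
  interpret M: abelian_group M by fact
  interpret H: abelian_subgroup H M
    by (rule abelian_subgroupI3) (auto intro: additive_subgroupI H M.abelian_group_axioms)
  show car: "carrier (quotient_module M H) = (\<lambda>x. H +>\<^bsub>M\<^esub> x) ` carrier M"
    by (auto simp: quotient_module_def A_RCOSETS_def' a_r_coset_def')
  show add: "(H +>\<^bsub>M\<^esub> x) \<oplus>\<^bsub>quotient_module M H\<^esub> (H +>\<^bsub>M\<^esub> y) = H +>\<^bsub>M\<^esub> (x \<oplus>\<^bsub>M\<^esub> y)"
    if "x \<in> carrier M" "y \<in> carrier M" for x y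
    using H.a_rcos_sum[OF that] by (simp add: quotient_module_def)
  show "H +>\<^bsub>M\<^esub> x = H +>\<^bsub>M\<^esub> y \<longleftrightarrow> x \<ominus>\<^bsub>M\<^esub> y \<in> H" if "x \<in> carrier M" "y \<in> carrier M" for x y
    using that H.a_rcos_module_minus[OF _ that(2,1)] H.a_repr_independence' H.a_repr_independenceD
      H.a_rcos_self M.abelian_group_axioms
    by (metis H.a_rcos_module a_minus_def)
  have zero: "\<zero>\<^bsub>quotient_module M H\<^esub> = H +>\<^bsub>M\<^esub> \<zero>\<^bsub>M\<^esub>"
    using M.a_coset_add_zero H.a_subset by (simp add: quotient_module_def)
  show "abelian_group (quotient_module M H)"
  proof (rule abelian_groupI; (unfold car zero)?; clarsimp simp: add)
    fix x assume x: "x \<in> carrier M"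
    then show "\<exists>y \<in> carrier M. H +>\<^bsub>M\<^esub> (y \<oplus>\<^bsub>M\<^esub> x) = H +>\<^bsub>M\<^esub> \<zero>\<^bsub>M\<^esub>"
      by (intro bexI[of _ "\<ominus>\<^bsub>M\<^esub> x"]) (auto simp: M.l_neg)
  qed (auto simp: M.a_ac)
  fix r x assume x: "x \<in> carrier M"
    and cl: "\<And>y. y \<in> carrier M \<Longrightarrow> r \<odot>\<^bsub>M\<^esub> y \<in> carrier M"
    and ad: "\<And>y z. \<lbrakk>y \<in> carrier M; z \<in> carrier M\<rbrakk> \<Longrightarrow>
      r \<odot>\<^bsub>M\<^esub> (y \<oplus>\<^bsub>M\<^esub> z) = r \<odot>\<^bsub>M\<^esub> y \<oplus>\<^bsub>M\<^esub> r \<odot>\<^bsub>M\<^esub> z"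
    and st: "\<And>y. y \<in> H \<Longrightarrow> r \<odot>\<^bsub>M\<^esub> y \<in> H"
  have "H +>\<^bsub>M\<^esub> (r \<odot>\<^bsub>M\<^esub> y) = H +>\<^bsub>M\<^esub> (r \<odot>\<^bsub>M\<^esub> x)" if y: "y \<in> H +>\<^bsub>M\<^esub> x" for y
  proof -
    obtain h where h: "h \<in> H" "y = h \<oplus>\<^bsub>M\<^esub> x" using y by (auto simp: a_r_coset_def')
    have "h \<in> carrier M" using h(1) H.a_subset by auto
    then have "r \<odot>\<^bsub>M\<^esub> y = r \<odot>\<^bsub>M\<^esub> h \<oplus>\<^bsub>M\<^esub> r \<odot>\<^bsub>M\<^esub> x" using h x by (simp add: ad)
    with st[OF h(1)] have "r \<odot>\<^bsub>M\<^esub> y \<in> H +>\<^bsub>M\<^esub> (r \<odot>\<^bsub>M\<^esub> x)" by (auto simp: a_r_coset_def')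
    then show ?thesis using H.a_repr_independence' cl[OF x] by metis
  qed
  moreover have "x \<in> H +>\<^bsub>M\<^esub> x" using H.a_rcos_self x by auto
  ultimately show "r \<odot>\<^bsub>quotient_module M H\<^esub> (H +>\<^bsub>M\<^esub> x) = H +>\<^bsub>M\<^esub> (r \<odot>\<^bsub>M\<^esub> x)"
    unfolding quotient_module_def module.simps by (intro UN_constant_eq ballI)
qed

lemma left_module_quotient:
  assumes "left_module R M" "submodule H R M"
  shows "left_module R (quotient_module M H)"
proof -
  interpret M: left_module R M by fact
  interpret H: submodule H R M by fact
  note ops = quotient_module_ops[OF M.M.abelian_group_axioms H.subgroup_axioms]
  have smult: "r \<odot>\<^bsub>quotient_module M H\<^esub> (H +>\<^bsub>M\<^esub> x) = H +>\<^bsub>M\<^esub> (r \<odot>\<^bsub>M\<^esub> x)"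
    if "r \<in> carrier R" "x \<in> carrier M" for r x
    by (rule ops(5)) (use that in \<open>auto simp: M.smult_r_distr\<close>)
  show ?thesis
    by (rule left_moduleI[OF M.R.ring_axioms ops(4)])
      (auto simp: ops(1,2) smult M.smult_l_distr M.smult_r_distr M.smult_assoc1)
qed

lemma left_module_cokernel:
  assumes "left_module R M" "left_module R N" "f \<in> module_hom R M N"
  shows "left_module R (cokernel_module M N f)"
proof -
  interpret M: left_module R M by fact
  interpret N: left_module R N by fact
  have "submodule (f ` carrier M) R N"
    by (rule N.left_submoduleI)
      (auto simp: module_homD[OF assms(3)] simp flip: module_homD(2,3)[OF assms(3)]
        module_hom_zero[OF assms])
  then show ?thesis unfolding cokernel_module_def by (rule left_module_quotient[OF assms(2)])
qed

context bimodule
begin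

lemma rsmult_closed [simp, intro]:
  "\<lbrakk>x \<in> carrier M; b \<in> carrier B\<rbrakk> \<Longrightarrow> rsmult M x b \<in> carrier M"
  and rsmult_distr_ring:
  "\<lbrakk>x \<in> carrier M; b \<in> carrier B; b' \<in> carrier B\<rbrakk> \<Longrightarrow>
    rsmult M x (b \<oplus>\<^bsub>B\<^esub> b') = rsmult M x b \<oplus>\<^bsub>M\<^esub> rsmult M x b'"
  and rsmult_distr:
  "\<lbrakk>x \<in> carrier M; x' \<in> carrier M; b \<in> carrier B\<rbrakk> \<Longrightarrow>
    rsmult M (x \<oplus>\<^bsub>M\<^esub> x') b = rsmult M x b \<oplus>\<^bsub>M\<^esub> rsmult M x' b"
  and rsmult_assoc:
  "\<lbrakk>x \<in> carrier M; b \<in> carrier B; b' \<in> carrier B\<rbrakk> \<Longrightarrow>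
    rsmult M x (b \<otimes>\<^bsub>B\<^esub> b') = rsmult M (rsmult M x b) b'"
  and rsmult_one [simp]: "x \<in> carrier M \<Longrightarrow> rsmult M x \<one>\<^bsub>B\<^esub> = x"
  and rsmult_zero [simp]: "x \<in> carrier M \<Longrightarrow> rsmult M x \<zero>\<^bsub>B\<^esub> = \<zero>\<^bsub>M\<^esub>"
  and zero_rsmult [simp]: "b \<in> carrier B \<Longrightarrow> rsmult M \<zero>\<^bsub>M\<^esub> b = \<zero>\<^bsub>M\<^esub>"
  using right.smult_closed[of b x] right.smult_l_distr[of b b' x] right.smult_r_distr[of b x x']
    right.smult_assoc1[of b' b x] right.smult_one[of x] right.smult_l_zero[of x] right.smult_r_zero[of b]
  by (simp_all add: right_part_def op_ring_def)

end

lemma abelian_group_pretensor: "abelian_group (pretensor M Y)"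
proof (rule abelian_groupI)
  fix u v assume "u \<in> carrier (pretensor M Y)" "v \<in> carrier (pretensor M Y)"
  then show "u \<oplus>\<^bsub>pretensor M Y\<^esub> v \<in> carrier (pretensor M Y)"
    by (simp add: pretensor_def) (meson keys_add le_supI order_trans)
next
  fix u assume "u \<in> carrier (pretensor M Y)"
  then show "\<exists>v \<in> carrier (pretensor M Y). v \<oplus>\<^bsub>pretensor M Y\<^esub> u = \<zero>\<^bsub>pretensor M Y\<^esub>"
    by (intro bexI[of _ "- u"]) (simp_all add: pretensor_def)
qed (simp_all add: pretensor_def add_ac)

locale tensor = bimodule A B M + Y: left_module B Y
  for A :: "('a, 'p) ring_scheme" and B :: "('b, 'q) ring_scheme"
    and M :: "('a, 'b, 'm, 'c) bimodule_scheme" and Y :: "('b, 'y, 'd) module_scheme"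
begin

abbreviation "F \<equiv> free_Abelian_group (carrier M \<times> carrier Y)"

lemma tensor_relations_subset: "tensor_relations B M Y \<subseteq> carrier F"
proof -
  have "Poly_Mapping.keys (frag_of p - frag_of q - frag_of r) \<subseteq> carrier M \<times> carrier Y"
    "Poly_Mapping.keys (frag_of p - frag_of q) \<subseteq> carrier M \<times> carrier Y"
    if "p \<in> carrier M \<times> carrier Y" "q \<in> carrier M \<times> carrier Y" "r \<in> carrier M \<times> carrier Y" for p q r
    using that keys_diff[of "frag_of p - frag_of q" "frag_of r"] keys_diff[of "frag_of p" "frag_of q"]
    by (auto simp: keys_frag_of)
  then show ?thesis by (auto simp: tensor_relations_def)
qed

lemma subgroup_tensor_null: "subgroup (tensor_null B M Y) F"
  unfolding tensor_null_def by (rule group.generate_is_subgroup) (auto simp: tensor_relations_subset)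

lemma subgroup_tensor_null': "subgroup (tensor_null B M Y) (add_monoid (pretensor M Y))"
  using subgroup_tensor_null
  by (auto simp: subgroup_def pretensor_def free_Abelian_group_def m_inv_def)

lemma tensor_null_diff:
  "\<lbrakk>u \<in> tensor_null B M Y; v \<in> tensor_null B M Y\<rbrakk> \<Longrightarrow> u - v \<in> tensor_null B M Y"
  using subgroup.m_closed[OF subgroup_tensor_null, of u "- v"]
    subgroup.m_inv_closed[OF subgroup_tensor_null, of v] subgroup.subset[OF subgroup_tensor_null]
  by auto

lemma tensor_null_add:
  "\<lbrakk>u \<in> tensor_null B M Y; v \<in> tensor_null B M Y\<rbrakk> \<Longrightarrow> u + v \<in> tensor_null B M Y"
  using subgroup.m_closed[OF subgroup_tensor_null, of u v] by auto

lemma tensor_null_zero: "0 \<in> tensor_null B M Y"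
  using subgroup.one_closed[OF subgroup_tensor_null] by auto

lemma tensor_null_rel: "u \<in> tensor_relations B M Y \<Longrightarrow> u \<in> tensor_null B M Y"
  unfolding tensor_null_def by (rule generate.incl)

lemma pretensor_simps:
  "carrier (pretensor M Y) = {c. Poly_Mapping.keys c \<subseteq> carrier M \<times> carrier Y}"
  "(\<oplus>\<^bsub>pretensor M Y\<^esub>) = (+)" "\<zero>\<^bsub>pretensor M Y\<^esub> = 0"
  "a \<odot>\<^bsub>pretensor M Y\<^esub> c = frag_extend (\<lambda>(x, y). frag_of (a \<odot>\<^bsub>M\<^esub> x, y)) c"
  by (auto simp: pretensor_def)

lemma pretensor_minus:
  assumes "u \<in> carrier (pretensor M Y)" "v \<in> carrier (pretensor M Y)"
  shows "u \<ominus>\<^bsub>pretensor M Y\<^esub> v = u - v"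
proof -
  interpret P: abelian_group "pretensor M Y" by (rule abelian_group_pretensor)
  have "\<ominus>\<^bsub>pretensor M Y\<^esub> v = - v"
    by (rule P.minus_equality) (use assms in \<open>auto simp: pretensor_simps keys_minus\<close>)
  then show ?thesis by (simp add: a_minus_def pretensor_simps)
qed

lemma pretensor_smult_closed:
  assumes "a \<in> carrier A" "c \<in> carrier (pretensor M Y)"
  shows "a \<odot>\<^bsub>pretensor M Y\<^esub> c \<in> carrier (pretensor M Y)"
proof -
  have "Poly_Mapping.keys (frag_extend (\<lambda>(x, y). frag_of (a \<odot>\<^bsub>M\<^esub> x, y)) c)
      \<subseteq> (\<Union>p \<in> Poly_Mapping.keys c. Poly_Mapping.keys ((\<lambda>(x, y). frag_of (a \<odot>\<^bsub>M\<^esub> x, y)) p))"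
    by (rule keys_frag_extend)
  also have "\<dots> \<subseteq> carrier M \<times> carrier Y"
    using assms by (auto simp: pretensor_simps keys_frag_of split: prod.splits)
  finally show ?thesis by (simp add: pretensor_simps)
qed

lemma pretensor_smult_add:
  "a \<odot>\<^bsub>pretensor M Y\<^esub> (c + d) = a \<odot>\<^bsub>pretensor M Y\<^esub> c + a \<odot>\<^bsub>pretensor M Y\<^esub> d"
  by (simp add: pretensor_simps frag_extend_add)

lemma pretensor_smult_diff:
  "a \<odot>\<^bsub>pretensor M Y\<^esub> (c - d) = a \<odot>\<^bsub>pretensor M Y\<^esub> c - a \<odot>\<^bsub>pretensor M Y\<^esub> d"
  by (simp add: pretensor_simps frag_extend_diff)

lemma pretensor_smult_of: "a \<odot>\<^bsub>pretensor M Y\<^esub> frag_of (x, y) = frag_of (a \<odot>\<^bsub>M\<^esub> x, y)"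
  by (simp add: pretensor_simps)

lemma tensor_relations_add_left:
  "\<lbrakk>x \<in> carrier M; x' \<in> carrier M; y \<in> carrier Y\<rbrakk> \<Longrightarrow>
    frag_of (x \<oplus>\<^bsub>M\<^esub> x', y) - frag_of (x, y) - frag_of (x', y) \<in> tensor_relations B M Y"
  and tensor_relations_add_right:
  "\<lbrakk>x \<in> carrier M; y \<in> carrier Y; y' \<in> carrier Y\<rbrakk> \<Longrightarrow>
    frag_of (x, y \<oplus>\<^bsub>Y\<^esub> y') - frag_of (x, y) - frag_of (x, y') \<in> tensor_relations B M Y"
  and tensor_relations_balanced:
  "\<lbrakk>x \<in> carrier M; b \<in> carrier B; y \<in> carrier Y\<rbrakk> \<Longrightarrow>
    frag_of (rsmult M x b, y) - frag_of (x, b \<odot>\<^bsub>Y\<^esub> y) \<in> tensor_relations B M Y"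
  unfolding tensor_relations_def by blast+

lemma smult_tensor_null:
  assumes a: "a \<in> carrier A" and c: "c \<in> tensor_null B M Y"
  shows "a \<odot>\<^bsub>pretensor M Y\<^esub> c \<in> tensor_null B M Y"
proof -
  have rel: "a \<odot>\<^bsub>pretensor M Y\<^esub> c \<in> tensor_relations B M Y" if c: "c \<in> tensor_relations B M Y" for c
  proof -
    consider x x' y where "c = frag_of (x \<oplus>\<^bsub>M\<^esub> x', y) - frag_of (x, y) - frag_of (x', y)"
        "x \<in> carrier M" "x' \<in> carrier M" "y \<in> carrier Y"
      | x y y' where "c = frag_of (x, y \<oplus>\<^bsub>Y\<^esub> y') - frag_of (x, y) - frag_of (x, y')"
        "x \<in> carrier M" "y \<in> carrier Y" "y' \<in> carrier Y"
      | x b y where "c = frag_of (rsmult M x b, y) - frag_of (x, b \<odot>\<^bsub>Y\<^esub> y)"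
        "x \<in> carrier M" "b \<in> carrier B" "y \<in> carrier Y"
      using c unfolding tensor_relations_def by blast
    then show ?thesis
    proof cases
      case (1 x x' y)
      then show ?thesis
        using tensor_relations_add_left[of "a \<odot>\<^bsub>M\<^esub> x" "a \<odot>\<^bsub>M\<^esub> x'" y] a
        by (simp add: pretensor_smult_diff pretensor_smult_of left.smult_r_distr)
    next
      case (2 x y y')
      then show ?thesis
        using tensor_relations_add_right[of "a \<odot>\<^bsub>M\<^esub> x" y y'] a
        by (simp add: pretensor_smult_diff pretensor_smult_of)
    next
      case (3 x b y)
      then show ?thesis
        using tensor_relations_balanced[of "a \<odot>\<^bsub>M\<^esub> x" b y] a
        by (simp add: pretensor_smult_diff pretensor_smult_of smult_rsmult)
    qed
  qed
  show ?thesis using c unfolding tensor_null_def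
  proof (induction rule: generate.induct)
    case one
    then show ?case by (metis generate.one one_free_Abelian_group pretensor_simps(4) frag_extend_0)
  next
    case (incl h)
    then show ?case by (intro generate.incl rel)
  next
    case (inv h)
    have "Poly_Mapping.keys u \<subseteq> carrier M \<times> carrier Y" if "u \<in> tensor_relations B M Y" for u
      using subsetD[OF tensor_relations_subset that] by simp
    from this[OF inv] this[OF rel[OF inv]]
    have "Poly_Mapping.keys h \<subseteq> carrier M \<times> carrier Y"
      "Poly_Mapping.keys (a \<odot>\<^bsub>pretensor M Y\<^esub> h) \<subseteq> carrier M \<times> carrier Y" .
    then show ?case using generate.inv[OF rel[OF inv], of F]
      by (simp add: pretensor_simps frag_extend_minus)
  next
    case (eng h1 h2)
    then show ?case using generate.eng[OF eng(3,4)] by (simp add: pretensor_smult_add)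
  qed
qed

lemmas tensor_ops = quotient_module_ops[OF abelian_group_pretensor subgroup_tensor_null',
  folded tensor_module_def]

abbreviation "cl c \<equiv> tensor_null B M Y +>\<^bsub>pretensor M Y\<^esub> c"

lemma cl_eq:
  "\<lbrakk>u \<in> carrier (pretensor M Y); v \<in> carrier (pretensor M Y); u - v \<in> tensor_null B M Y\<rbrakk> \<Longrightarrow> cl u = cl v"
  using tensor_ops(3) by (simp add: pretensor_minus)

lemma tensor_smult:
  assumes "a \<in> carrier A" "c \<in> carrier (pretensor M Y)"
  shows "a \<odot>\<^bsub>tensor_module B M Y\<^esub> cl c = cl (a \<odot>\<^bsub>pretensor M Y\<^esub> c)"
  by (rule tensor_ops(5))
    (use assms in \<open>auto simp: pretensor_smult_closed pretensor_smult_add smult_tensor_null pretensor_simps(2)\<close>)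

lemma frag_of_pretensor:
  "\<lbrakk>x \<in> carrier M; y \<in> carrier Y\<rbrakk> \<Longrightarrow> frag_of (x, y) \<in> carrier (pretensor M Y)"
  by (simp add: pretensor_simps)

theorem left_module_tensor: "left_module A (tensor_module B M Y)"
proof (rule left_moduleI[OF left.R.ring_axioms tensor_ops(4)])
  interpret Q: abelian_group "tensor_module B M Y" by (rule tensor_ops(4))
  interpret P: abelian_group "pretensor M Y" by (rule abelian_group_pretensor)
  fix a assume a: "a \<in> carrier A"
  show "a \<odot>\<^bsub>tensor_module B M Y\<^esub> u \<in> carrier (tensor_module B M Y)" if "u \<in> carrier (tensor_module B M Y)" for u
    using that a by (auto simp: tensor_ops(1) tensor_smult pretensor_smult_closed)
  show "a \<odot>\<^bsub>tensor_module B M Y\<^esub> (u \<oplus>\<^bsub>tensor_module B M Y\<^esub> v) =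
      a \<odot>\<^bsub>tensor_module B M Y\<^esub> u \<oplus>\<^bsub>tensor_module B M Y\<^esub> a \<odot>\<^bsub>tensor_module B M Y\<^esub> v"
    if uv: "u \<in> carrier (tensor_module B M Y)" "v \<in> carrier (tensor_module B M Y)" for u v
  proof -
    obtain c d where cd: "u = cl c" "v = cl d" "c \<in> carrier (pretensor M Y)" "d \<in> carrier (pretensor M Y)"
      using uv by (auto simp: tensor_ops(1))
    have "c + d \<in> carrier (pretensor M Y)" using P.a_closed[OF cd(3,4)] by (simp add: pretensor_simps)
    then show ?thesis
      using cd a by (simp add: tensor_ops(2) tensor_smult pretensor_smult_closed pretensor_simps(2) pretensor_smult_add)
  qed
  fix b assume b: "b \<in> carrier A"
  show "(a \<oplus>\<^bsub>A\<^esub> b) \<odot>\<^bsub>tensor_module B M Y\<^esub> u =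
      a \<odot>\<^bsub>tensor_module B M Y\<^esub> u \<oplus>\<^bsub>tensor_module B M Y\<^esub> b \<odot>\<^bsub>tensor_module B M Y\<^esub> u"
    if u: "u \<in> carrier (tensor_module B M Y)" for u
  proof -
    obtain c where c: "u = cl c" "c \<in> carrier (pretensor M Y)" using u by (auto simp: tensor_ops(1))
    have "(a \<oplus>\<^bsub>A\<^esub> b) \<odot>\<^bsub>pretensor M Y\<^esub> c - (a \<odot>\<^bsub>pretensor M Y\<^esub> c + b \<odot>\<^bsub>pretensor M Y\<^esub> c) \<in> tensor_null B M Y"
      (is "?D c \<in> _")
    proof (rule frag_induction[of c "carrier M \<times> carrier Y" "\<lambda>c. ?D c \<in> tensor_null B M Y"])
      show "?D 0 \<in> tensor_null B M Y" by (simp add: pretensor_simps(4) tensor_null_zero)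
      show "?D (frag_of p) \<in> tensor_null B M Y" if "p \<in> carrier M \<times> carrier Y" for p
        using that a b tensor_null_rel[OF tensor_relations_add_left]
        by (cases p) (auto simp: pretensor_smult_of left.smult_l_distr diff_diff_eq)
      show "?D (c - d) \<in> tensor_null B M Y" if "?D c \<in> tensor_null B M Y" "?D d \<in> tensor_null B M Y" for c d
        using tensor_null_diff[OF that] by (simp add: pretensor_smult_diff algebra_simps)
    qed (use c in \<open>simp add: pretensor_simps\<close>)
    then have "cl ((a \<oplus>\<^bsub>A\<^esub> b) \<odot>\<^bsub>pretensor M Y\<^esub> c) = cl (a \<odot>\<^bsub>pretensor M Y\<^esub> c + b \<odot>\<^bsub>pretensor M Y\<^esub> c)"
      using P.a_closed[OF pretensor_smult_closed[OF a c(2)] pretensor_smult_closed[OF b c(2)]] a b c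
      by (intro cl_eq pretensor_smult_closed) (auto simp: pretensor_simps(2))
    then show ?thesis
      using c a b by (simp add: tensor_ops(2) tensor_smult pretensor_smult_closed pretensor_simps(2))
  qed
  show "(a \<otimes>\<^bsub>A\<^esub> b) \<odot>\<^bsub>tensor_module B M Y\<^esub> u = a \<odot>\<^bsub>tensor_module B M Y\<^esub> (b \<odot>\<^bsub>tensor_module B M Y\<^esub> u)"
    if u: "u \<in> carrier (tensor_module B M Y)" for u
  proof -
    obtain c where c: "u = cl c" "c \<in> carrier (pretensor M Y)" using u by (auto simp: tensor_ops(1))
    have "(a \<otimes>\<^bsub>A\<^esub> b) \<odot>\<^bsub>pretensor M Y\<^esub> c = a \<odot>\<^bsub>pretensor M Y\<^esub> (b \<odot>\<^bsub>pretensor M Y\<^esub> c)" (is "?E c")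
    proof (rule frag_induction[of c "carrier M \<times> carrier Y" ?E])
      show "?E 0" by (simp add: pretensor_simps(4))
      show "?E (frag_of p)" if "p \<in> carrier M \<times> carrier Y" for p
        using that a b by (cases p) (auto simp: pretensor_smult_of left.smult_assoc1)
      show "?E (c - d)" if "?E c" "?E d" for c d using that by (simp add: pretensor_smult_diff)
    qed (use c in \<open>simp add: pretensor_simps\<close>)
    then show ?thesis using c a b by (simp add: tensor_smult pretensor_smult_closed)
  qed
next
  fix u assume "u \<in> carrier (tensor_module B M Y)"
  then obtain c where c: "u = cl c" "c \<in> carrier (pretensor M Y)" by (auto simp: tensor_ops(1))
  have "\<one>\<^bsub>A\<^esub> \<odot>\<^bsub>pretensor M Y\<^esub> c = c" (is "?E c")
  proof (rule frag_induction[of c "carrier M \<times> carrier Y" ?E])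
    show "?E 0" by (simp add: pretensor_simps(4))
    show "?E (frag_of p)" if "p \<in> carrier M \<times> carrier Y" for p
      using that by (cases p) (auto simp: pretensor_smult_of)
    show "?E (c - d)" if "?E c" "?E d" for c d using that by (simp add: pretensor_smult_diff)
  qed (use c in \<open>simp add: pretensor_simps\<close>)
  then show "\<one>\<^bsub>A\<^esub> \<odot>\<^bsub>tensor_module B M Y\<^esub> u = u" using c by (simp add: tensor_smult)
qed

lemma tensor_elem_closed:
  "\<lbrakk>x \<in> carrier M; y \<in> carrier Y\<rbrakk> \<Longrightarrow> tensor_elem B M Y x y \<in> carrier (tensor_module B M Y)"
  by (auto simp: tensor_elem_def tensor_ops(1) frag_of_pretensor)

lemma smult_tensor_elem:
  "\<lbrakk>a \<in> carrier A; x \<in> carrier M; y \<in> carrier Y\<rbrakk> \<Longrightarrow>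
    a \<odot>\<^bsub>tensor_module B M Y\<^esub> tensor_elem B M Y x y = tensor_elem B M Y (a \<odot>\<^bsub>M\<^esub> x) y"
  by (simp add: tensor_elem_def tensor_smult frag_of_pretensor pretensor_smult_of)

lemma frag_of_add_pretensor:
  "\<lbrakk>x \<in> carrier M; y \<in> carrier Y; x' \<in> carrier M; y' \<in> carrier Y\<rbrakk> \<Longrightarrow>
    frag_of (x, y) + frag_of (x', y') \<in> carrier (pretensor M Y)"
  using abelian_groupE(1)[OF abelian_group_pretensor frag_of_pretensor frag_of_pretensor]
  by (simp add: pretensor_simps)

lemma tensor_elem_add_left:
  assumes "x \<in> carrier M" "x' \<in> carrier M" "y \<in> carrier Y"
  shows "tensor_elem B M Y (x \<oplus>\<^bsub>M\<^esub> x') y =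
    tensor_elem B M Y x y \<oplus>\<^bsub>tensor_module B M Y\<^esub> tensor_elem B M Y x' y"
  using cl_eq[OF frag_of_pretensor frag_of_add_pretensor] assms
    tensor_null_rel[OF tensor_relations_add_left[OF assms]]
  by (simp add: tensor_elem_def tensor_ops(2) frag_of_pretensor pretensor_simps(2) diff_diff_eq)

lemma tensor_elem_add_right:
  assumes "x \<in> carrier M" "y \<in> carrier Y" "y' \<in> carrier Y"
  shows "tensor_elem B M Y x (y \<oplus>\<^bsub>Y\<^esub> y') =
    tensor_elem B M Y x y \<oplus>\<^bsub>tensor_module B M Y\<^esub> tensor_elem B M Y x y'"
  using cl_eq[OF frag_of_pretensor frag_of_add_pretensor] assms
    tensor_null_rel[OF tensor_relations_add_right[OF assms]]
  by (simp add: tensor_elem_def tensor_ops(2) frag_of_pretensor pretensor_simps(2) diff_diff_eq)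

lemma tensor_elem_balanced:
  assumes "x \<in> carrier M" "b \<in> carrier B" "y \<in> carrier Y"
  shows "tensor_elem B M Y (rsmult M x b) y = tensor_elem B M Y x (b \<odot>\<^bsub>Y\<^esub> y)"
  unfolding tensor_elem_def
  by (rule cl_eq) (use assms tensor_null_rel[OF tensor_relations_balanced[OF assms]] in
      \<open>auto intro!: frag_of_pretensor\<close>)

end

theorem ring_triangular_ring:
  fixes A :: "('a, 'p) ring_scheme" and B :: "('b, 'q) ring_scheme"
  assumes "ring B" "bimodule A B M"
  shows "ring (triangular_ring A B M)"
proof -
  interpret bimodule A B M by fact
  interpret B: ring B by fact
  show ?thesis
  proof (rule ringI)
    show "abelian_group (triangular_ring A B M)"
    proof (rule abelian_groupI)
      fix u assume "u \<in> carrier (triangular_ring A B M)"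
      then obtain a x b where u: "u = (a, x, b)" "a \<in> carrier A" "x \<in> carrier M" "b \<in> carrier B"
        by (auto simp: triangular_ring_def)
      then show "\<exists>v \<in> carrier (triangular_ring A B M). v \<oplus>\<^bsub>triangular_ring A B M\<^esub> u = \<zero>\<^bsub>triangular_ring A B M\<^esub>"
        by (intro bexI[of _ "(\<ominus>\<^bsub>A\<^esub> a, \<ominus>\<^bsub>M\<^esub> x, \<ominus>\<^bsub>B\<^esub> b)"])
          (auto simp: triangular_ring_def left.R.l_neg left.M.l_neg B.l_neg)
    qed (auto simp: triangular_ring_def left.R.a_ac left.M.a_ac B.a_ac)
    show "monoid (triangular_ring A B M)"
      by (rule monoidI)
        (auto simp: triangular_ring_def left.R.m_assoc B.m_assoc left.smult_r_distr left.smult_assoc1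
          rsmult_distr rsmult_assoc smult_rsmult left.M.a_assoc)
  qed (auto simp: triangular_ring_def left.R.l_distr left.R.r_distr B.l_distr B.r_distr
      left.smult_l_distr left.smult_r_distr rsmult_distr rsmult_distr_ring left.M.a_ac)
qed

theorem left_module_triangular_module:
  assumes "ring B" "bimodule A B M" "left_module A X" "left_module B Y"
    and f: "f \<in> module_hom A (tensor_module B M Y) X"
  shows "left_module (triangular_ring A B M) (triangular_module B M X Y f)"
proof -
  interpret bimodule A B M by fact
  interpret X: left_module A X by fact
  interpret Y: left_module B Y by fact
  interpret tensor A B M Y ..
  interpret T: left_module A "tensor_module B M Y" by (rule left_module_tensor)
  have fc: "f (tensor_elem B M Y m y) \<in> carrier X" if "m \<in> carrier M" "y \<in> carrier Y" for m y
    by (rule module_homD(1)[OF f]) (rule tensor_elem_closed[OF that])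
  have fs: "f (tensor_elem B M Y (a \<odot>\<^bsub>M\<^esub> m) y) = a \<odot>\<^bsub>X\<^esub> f (tensor_elem B M Y m y)"
    if "a \<in> carrier A" "m \<in> carrier M" "y \<in> carrier Y" for a m y
    using that by (simp add: module_homD(3)[OF f] tensor_elem_closed flip: smult_tensor_elem)
  have fl: "f (tensor_elem B M Y (m \<oplus>\<^bsub>M\<^esub> m') y) = f (tensor_elem B M Y m y) \<oplus>\<^bsub>X\<^esub> f (tensor_elem B M Y m' y)"
    if "m \<in> carrier M" "m' \<in> carrier M" "y \<in> carrier Y" for m m' y
    using that by (simp add: module_homD(2)[OF f] tensor_elem_closed tensor_elem_add_left)
  have fr: "f (tensor_elem B M Y m (y \<oplus>\<^bsub>Y\<^esub> y')) = f (tensor_elem B M Y m y) \<oplus>\<^bsub>X\<^esub> f (tensor_elem B M Y m y')"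
    if "m \<in> carrier M" "y \<in> carrier Y" "y' \<in> carrier Y" for m y y'
    using that by (simp add: module_homD(2)[OF f] tensor_elem_closed tensor_elem_add_right)
  have f0: "f (tensor_elem B M Y \<zero>\<^bsub>M\<^esub> y) = \<zero>\<^bsub>X\<^esub>" if y: "y \<in> carrier Y" for y
    using fs[of "\<zero>\<^bsub>A\<^esub>" "\<zero>\<^bsub>M\<^esub>" y] y fc[of "\<zero>\<^bsub>M\<^esub>" y] by simp
  show ?thesis
  proof (rule left_moduleI)
    show "ring (triangular_ring A B M)" by (rule ring_triangular_ring) fact+
    show "abelian_group (triangular_module B M X Y f)"
    proof (rule abelian_groupI)
      fix u assume "u \<in> carrier (triangular_module B M X Y f)"
      then obtain x y where u: "u = (x, y)" "x \<in> carrier X" "y \<in> carrier Y"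
        by (auto simp: triangular_module_def)
      then show "\<exists>v \<in> carrier (triangular_module B M X Y f).
          v \<oplus>\<^bsub>triangular_module B M X Y f\<^esub> u = \<zero>\<^bsub>triangular_module B M X Y f\<^esub>"
        by (intro bexI[of _ "(\<ominus>\<^bsub>X\<^esub> x, \<ominus>\<^bsub>Y\<^esub> y)"]) (auto simp: triangular_module_def X.M.l_neg Y.M.l_neg)
    qed (auto simp: triangular_module_def X.M.a_ac Y.M.a_ac)
  qed (auto simp: triangular_module_def triangular_ring_def fc fs fl fr f0 X.smult_l_distr X.smult_r_distr
      X.smult_assoc1 Y.smult_l_distr Y.smult_r_distr Y.smult_assoc1 tensor_elem_balanced X.M.a_ac)
qed

end

theory Submission
  imports Defs
begin

text \<open>
  Resolutions are handled one step at a time.  Call \<open>0 \<rightarrow> N \<rightarrow> P \<rightarrow> N' \<rightarrow> 0\<close> a proper step if \<open>P\<close> is finitely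
  generated projective and every map \<open>N \<rightarrow> R\<close> extends to \<open>P\<close>.  Splicing shows that the Gorenstein-projective
  modules form the largest class in which every module is the left end and the right end of a proper step
  whose other end is in the class, so a module is shown to be Gorenstein-projective by exhibiting such a class.

  Let \<open>Y\<close> and \<open>C = Coker \<phi>\<close> be Gorenstein-projective and \<open>\<phi>\<close> injective.  Proper steps \<open>Y \<rightarrow> Q\<close> and \<open>C \<rightarrow> P\<close>
  combine, by the horseshoe construction applied to \<open>0 \<rightarrow> M \<otimes> Y \<rightarrow> X \<rightarrow> C \<rightarrow> 0\<close>, to a proper step from
  \<open>(X, Y)\<close> to \<open>(M \<otimes> Q \<oplus> P, Q)\<close>: the functor \<open>M \<otimes> -\<close> is exact because \<open>M\<^sub>B\<close> is projective, and
  \<open>M \<otimes> Y \<rightarrow> M \<otimes> Q\<close> extends to \<open>X\<close> because \<open>M\<close> is a projective \<open>A\<close>-module and \<open>Ext\<^sup>1(C, A) = 0\<close>.  Conversely, a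
  projective \<open>\<Lambda>\<close>-module has an injective structure map with projective cokernel, so that proper steps of
  \<open>\<Lambda>\<close>-modules restrict to the cokernels by the three-by-three lemma; maps into the two columns of \<open>\<Lambda>\<close> yield
  the extension properties.  The last claim holds because Gorenstein-projective modules are closed under
  extensions and under kernels of epimorphisms.
\<close>

section \<open>Short exact sequences of modules\<close>

text \<open>Types shape the bookkeeping: a class of modules lives on one fixed type, while
  cokernels, kernels, sums and tensor products each create a new one. Every coinductive class below
  is therefore formed on fixed types, finite generation lets each newly built module be copied back
  to them, and \<open>Gorenstein_projective_stepI\<close> returns to arbitrary types at the end.
  Since P is projective, the extension condition of a proper step says Ext^1(N', R) = 0; this is
  what allows properness to be checked one step at a time. In the converse direction the order is
  forced. A functional on Y becomes a \<Lambda>-valued map on (X, Y) only after an induced map from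
  the tensor product to M has been extended to X, which is a question about Ext^1(C, M). Hence the
  cokernel C is settled before Y. The Artin hypothesis enters as finite generation of M over A and
  over B. With projectivity this gives finite dual bases of M: the right one makes tensoring with M
  exact, the left one passes from A-valued to M-valued extension problems.\<close>

lemma module_hom_minus:
  assumes "left_module R M" "left_module R N" "f \<in> module_hom R M N" "x \<in> carrier M" "y \<in> carrier M"
  shows "f (x \<ominus>\<^bsub>M\<^esub> y) = f x \<ominus>\<^bsub>N\<^esub> f y"
proof -
  interpret M: left_module R M by fact
  interpret N: left_module R N by fact
  show ?thesis
    using assms(4,5) module_homD[OF assms(3)] M.smult_minus_one[of y] N.smult_minus_one[of "f y"]
    by (metis M.M.a_inv_closed M.R.a_inv_closed M.R.one_closed a_minus_def)
qed

lemma (in abelian_group) minus_eq_zero_iff: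
  "\<lbrakk>x \<in> carrier G; y \<in> carrier G\<rbrakk> \<Longrightarrow> x \<ominus> y = \<zero> \<longleftrightarrow> x = y"
  by (metis a_minus_def add.inv_closed add.inv_equality add.inv_inv add.r_inv)

lemma (in abelian_group) minus_zero_right: "x \<in> carrier G \<Longrightarrow> x \<ominus> \<zero> = x"
  by (metis a_minus_def minus_eq_zero_iff r_zero zero_closed minus_equality)

lemma module_hom_eq_iff:
  assumes "left_module R M" "left_module R N" "f \<in> module_hom R M N" "x \<in> carrier M" "y \<in> carrier M"
  shows "f x = f y \<longleftrightarrow> f (x \<ominus>\<^bsub>M\<^esub> y) = \<zero>\<^bsub>N\<^esub>"
proof -
  interpret N: left_module R N by fact
  show ?thesis
    using module_hom_minus[OF assms] module_homD(1)[OF assms(3)] assms(4,5)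
    by (simp add: N.M.minus_eq_zero_iff)
qed

lemma module_hom_inj_iff:
  assumes "left_module R M" "left_module R N" "f \<in> module_hom R M N"
  shows "inj_on f (carrier M) \<longleftrightarrow> (\<forall>x \<in> carrier M. f x = \<zero>\<^bsub>N\<^esub> \<longrightarrow> x = \<zero>\<^bsub>M\<^esub>)"
proof -
  interpret M: left_module R M by fact
  show ?thesis
  proof
    assume "inj_on f (carrier M)"
    then show "\<forall>x \<in> carrier M. f x = \<zero>\<^bsub>N\<^esub> \<longrightarrow> x = \<zero>\<^bsub>M\<^esub>"
      using module_hom_zero[OF assms] by (metis M.M.zero_closed inj_onD)
  next
    assume *: "\<forall>x \<in> carrier M. f x = \<zero>\<^bsub>N\<^esub> \<longrightarrow> x = \<zero>\<^bsub>M\<^esub>"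
    show "inj_on f (carrier M)"
    proof (rule inj_onI)
      fix x y assume xy: "x \<in> carrier M" "y \<in> carrier M" "f x = f y"
      then have "x \<ominus>\<^bsub>M\<^esub> y = \<zero>\<^bsub>M\<^esub>"
        using * module_hom_eq_iff[OF assms, of x y] M.M.minus_closed by blast
      then show "x = y" using xy by (simp add: M.M.minus_eq_zero_iff)
    qed
  qed
qed

lemma module_hom_injD:
  assumes "left_module R M" "left_module R N" "f \<in> module_hom R M N" "inj_on f (carrier M)"
    "x \<in> carrier M" "f x = \<zero>\<^bsub>N\<^esub>"
  shows "x = \<zero>\<^bsub>M\<^esub>"
  using module_hom_inj_iff[OF assms(1-3)] assms(4-6) by blast

lemma module_hom_id: "(\<lambda>x. x) \<in> module_hom R M M"
  by (auto simp: module_hom_def hom_def)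

lemma module_hom_cong:
  assumes "left_module R M" "f \<in> module_hom R M N" "\<And>x. x \<in> carrier M \<Longrightarrow> g x = f x"
  shows "g \<in> module_hom R M N"
proof -
  interpret M: left_module R M by fact
  show ?thesis using assms(3) by (auto intro!: module_homI simp: module_homD[OF assms(2)])
qed

lemma module_hom_add:
  assumes "left_module R M" "left_module R N" "f \<in> module_hom R M N" "g \<in> module_hom R M N"
  shows "(\<lambda>x. f x \<oplus>\<^bsub>N\<^esub> g x) \<in> module_hom R M N"
proof -
  interpret M: left_module R M by fact
  interpret N: left_module R N by fact
  show ?thesis
    by (rule module_homI)
      (simp_all add: module_homD[OF assms(3)] module_homD[OF assms(4)] N.smult_r_distr N.M.a_ac)
qed

lemma module_hom_diff:
  assumes "left_module R M" "left_module R N" "f \<in> module_hom R M N" "g \<in> module_hom R M N"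
  shows "(\<lambda>x. f x \<ominus>\<^bsub>N\<^esub> g x) \<in> module_hom R M N"
proof -
  interpret M: left_module R M by fact
  interpret N: left_module R N by fact
  \<comment> \<open>Negation is the action of \<open>\<ominus> \<one>\<close>, which commutes with
    every scalar even over a noncommutative ring; this makes negation linear.\<close>
  have neg: "(\<lambda>x. \<ominus>\<^bsub>N\<^esub> x) \<in> module_hom R N N"
  proof (rule module_homI)
    fix r x assume rx: "r \<in> carrier R" "x \<in> carrier N"
    then have "\<ominus>\<^bsub>N\<^esub> (r \<odot>\<^bsub>N\<^esub> x) = ((\<ominus>\<^bsub>R\<^esub> \<one>\<^bsub>R\<^esub>) \<otimes>\<^bsub>R\<^esub> r) \<odot>\<^bsub>N\<^esub> x"
      by (simp add: N.smult_assoc1 N.smult_minus_one)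
    also have "\<dots> = (r \<otimes>\<^bsub>R\<^esub> (\<ominus>\<^bsub>R\<^esub> \<one>\<^bsub>R\<^esub>)) \<odot>\<^bsub>N\<^esub> x" using rx by (simp add: M.R.l_minus M.R.r_minus)
    finally show "\<ominus>\<^bsub>N\<^esub> (r \<odot>\<^bsub>N\<^esub> x) = r \<odot>\<^bsub>N\<^esub> (\<ominus>\<^bsub>N\<^esub> x)"
      using rx by (simp add: N.smult_assoc1 N.smult_minus_one)
  qed (simp_all add: N.M.minus_add)
  show ?thesis
    using module_hom_add[OF assms(1-3) module_hom_comp[OF assms(4) neg]] by (simp add: a_minus_def)
qed

lemma module_hom_zero_map: "left_module R N \<Longrightarrow> (\<lambda>x. \<zero>\<^bsub>N\<^esub>) \<in> module_hom R M N"
  by (rule module_homI) (auto simp: left_module.smult_r_zero left_module_def abelian_group_def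
      abelian_monoid.zero_closed abelian_monoid.l_zero)

text \<open>Two preimages of the same element of C differ by an element of the kernel of g, which h
  kills. So the arbitrary choice made by \<open>inv_into\<close> does not affect the value, and the
  laws for k follow from those for h on preimages.\<close>

lemma factor_surj:
  assumes X: "left_module R X" and C: "left_module R C" and Z: "left_module R Z"
    and g: "g \<in> module_hom R X C" "g ` carrier X = carrier C" and h: "h \<in> module_hom R X Z"
    and ker: "\<And>x. \<lbrakk>x \<in> carrier X; g x = \<zero>\<^bsub>C\<^esub>\<rbrakk> \<Longrightarrow> h x = \<zero>\<^bsub>Z\<^esub>"
  obtains k where "k \<in> module_hom R C Z" "\<And>x. x \<in> carrier X \<Longrightarrow> k (g x) = h x"
proof -
  interpret X: left_module R X by fact
  interpret C: left_module R C by fact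
  define k where "k = (\<lambda>c. h (inv_into (carrier X) g c))"
  have kg: "k (g x) = h x" if "x \<in> carrier X" for x
  proof -
    let ?y = "inv_into (carrier X) g (g x)"
    have y: "?y \<in> carrier X" "g ?y = g x"
      using that by (auto intro: inv_into_into f_inv_into_f)
    then have "h (?y \<ominus>\<^bsub>X\<^esub> x) = \<zero>\<^bsub>Z\<^esub>"
      using that by (intro ker) (simp_all flip: module_hom_eq_iff[OF X C g(1)])
    then show ?thesis using y that by (simp add: k_def module_hom_eq_iff[OF X Z h])
  qed
  have "k \<in> module_hom R C Z"
  proof (rule module_homI)
    fix c assume "c \<in> carrier C"
    then obtain x where "x \<in> carrier X" "c = g x" using g(2) by auto
    then show "k c \<in> carrier Z" by (simp add: kg module_homD[OF h])
  next
    fix c d assume "c \<in> carrier C" "d \<in> carrier C"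
    then obtain x y where "x \<in> carrier X" "c = g x" "y \<in> carrier X" "d = g y" using g(2) by blast
    then show "k (c \<oplus>\<^bsub>C\<^esub> d) = k c \<oplus>\<^bsub>Z\<^esub> k d"
      by (simp add: kg module_homD[OF h] flip: module_homD(2)[OF g(1)])
  next
    fix r c assume "r \<in> carrier R" "c \<in> carrier C"
    moreover then obtain x where "x \<in> carrier X" "c = g x" using g(2) by auto
    ultimately show "k (r \<odot>\<^bsub>C\<^esub> c) = r \<odot>\<^bsub>Z\<^esub> k c"
      by (simp add: kg module_homD[OF h] flip: module_homD(3)[OF g(1)])
  qed
  then show ?thesis using kg by (rule that[of k])
qed

lemma factor_inj:
  assumes K: "left_module R K" and Z: "left_module R Z"
    and f: "f \<in> module_hom R K X" "inj_on f (carrier K)" and h: "h \<in> module_hom R Z X"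
    and im: "\<And>z. z \<in> carrier Z \<Longrightarrow> h z \<in> f ` carrier K"
  obtains k where "k \<in> module_hom R Z K" "\<And>z. z \<in> carrier Z \<Longrightarrow> f (k z) = h z"
proof -
  interpret K: left_module R K by fact
  interpret Z: left_module R Z by fact
  define k where "k = (\<lambda>z. inv_into (carrier K) f (h z))"
  have kc: "k z \<in> carrier K" and fk: "f (k z) = h z" if "z \<in> carrier Z" for z
    using im[OF that] by (auto simp: k_def intro: inv_into_into f_inv_into_f)
  \<comment> \<open>The algebraic laws are checked after applying f, which loses nothing because f
    is injective.\<close>
  have "k \<in> module_hom R Z K"
    by (rule module_homI; (rule inj_onD[OF f(2)])?)
      (simp_all add: kc fk module_homD[OF f(1)] module_homD[OF h])
  then show ?thesis using fk by (rule that[of k])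
qed

section \<open>Short exact sequences, their transport along isomorphisms, and induced sequences of
  cokernels\<close>

definition short_exact ::
  "('r, 'q) ring_scheme \<Rightarrow> ('r, 'k, 'c) module_scheme \<Rightarrow> ('k \<Rightarrow> 'm) \<Rightarrow> ('r, 'm, 'd) module_scheme \<Rightarrow>
    ('m \<Rightarrow> 'n) \<Rightarrow> ('r, 'n, 'e) module_scheme \<Rightarrow> bool"
  where "short_exact R K f X g C \<longleftrightarrow>
    left_module R K \<and> left_module R X \<and> left_module R C \<and>
    f \<in> module_hom R K X \<and> g \<in> module_hom R X C \<and>
    inj_on f (carrier K) \<and> g ` carrier X = carrier C \<and>
    f ` carrier K = {x \<in> carrier X. g x = \<zero>\<^bsub>C\<^esub>}"

lemma short_exactD:
  assumes "short_exact R K f X g C"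
  shows "left_module R K" "left_module R X" "left_module R C"
    and "f \<in> module_hom R K X" "g \<in> module_hom R X C"
    and "inj_on f (carrier K)" "g ` carrier X = carrier C"
    and "\<And>k. k \<in> carrier K \<Longrightarrow> g (f k) = \<zero>\<^bsub>C\<^esub>"
    and "\<And>x. \<lbrakk>x \<in> carrier X; g x = \<zero>\<^bsub>C\<^esub>\<rbrakk> \<Longrightarrow> x \<in> f ` carrier K"
  using assms by (auto simp: short_exact_def)

lemma short_exactI:
  assumes "left_module R K" "left_module R X" "left_module R C"
    and "f \<in> module_hom R K X" "g \<in> module_hom R X C"
    and "\<And>k. \<lbrakk>k \<in> carrier K; f k = \<zero>\<^bsub>X\<^esub>\<rbrakk> \<Longrightarrow> k = \<zero>\<^bsub>K\<^esub>"
    and "\<And>c. c \<in> carrier C \<Longrightarrow> \<exists>x \<in> carrier X. g x = c"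
    and "\<And>k. k \<in> carrier K \<Longrightarrow> g (f k) = \<zero>\<^bsub>C\<^esub>"
    and "\<And>x. \<lbrakk>x \<in> carrier X; g x = \<zero>\<^bsub>C\<^esub>\<rbrakk> \<Longrightarrow> \<exists>k \<in> carrier K. f k = x"
  shows "short_exact R K f X g C"
proof -
  have "inj_on f (carrier K)" using module_hom_inj_iff[OF assms(1,2,4)] assms(6) by blast
  moreover have "g ` carrier X = carrier C" using assms(7) module_homD(1)[OF assms(5)] by blast
  moreover have "f ` carrier K = {x \<in> carrier X. g x = \<zero>\<^bsub>C\<^esub>}"
    using assms(8,9) module_homD(1)[OF assms(4)] by blast
  ultimately show ?thesis using assms by (simp add: short_exact_def)
qed

lemma short_exact_iso_left:
  assumes "short_exact R K f X g C" "left_module R L" "e \<in> module_hom R L K" "bij_betw e (carrier L) (carrier K)"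
  shows "short_exact R L (\<lambda>x. f (e x)) X g C"
proof -
  have "(\<lambda>x. f (e x)) ` carrier L = f ` carrier K"
    using assms(4) by (metis bij_betw_imp_surj_on image_image)
  moreover have "inj_on (\<lambda>x. f (e x)) (carrier L)"
    using assms(1,4) comp_inj_on[of e "carrier L" f] by (auto simp: bij_betw_def short_exact_def comp_def)
  ultimately show ?thesis
    using assms(1,2) module_hom_comp[OF assms(3), of f X] by (simp add: short_exact_def)
qed

lemma short_exact_iso_right:
  assumes "short_exact R K f X g C" "left_module R D" "e \<in> module_hom R C D" "bij_betw e (carrier C) (carrier D)"
  shows "short_exact R K f X (\<lambda>x. e (g x)) D"
proof -
  note S = short_exactD[OF assms(1)]
  have "e (g x) = \<zero>\<^bsub>D\<^esub> \<longleftrightarrow> g x = \<zero>\<^bsub>C\<^esub>" if "x \<in> carrier X" for x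
    using module_hom_inj_iff[OF S(3) assms(2,3)] assms(4) module_homD(1)[OF S(5) that]
      module_hom_zero[OF S(3) assms(2,3)] by (auto simp: bij_betw_def)
  moreover have "(\<lambda>x. e (g x)) ` carrier X = carrier D"
    using assms(4) S(7) by (metis bij_betw_imp_surj_on image_image)
  ultimately show ?thesis
    using assms(1,2) module_hom_comp[OF S(5) assms(3)] by (auto simp: short_exact_def)
qed

lemma short_exact_iso_middle:
  assumes "short_exact R K f X g C" "left_module R Y" "e \<in> module_hom R X Y" "bij_betw e (carrier X) (carrier Y)"
  shows "short_exact R K (\<lambda>x. e (f x)) Y (\<lambda>y. g (inv_into (carrier X) e y)) C"
proof -
  note S = short_exactD[OF assms(1)]
  let ?i = "inv_into (carrier X) e"
  note i = module_hom_inv[OF S(2) assms(3,4)]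
  note ie = bij_betw_inv_into_left[OF assms(4)] and ei = bij_betw_inv_into_right[OF assms(4)]
  show ?thesis
  proof (rule short_exactI[OF S(1) assms(2) S(3) module_hom_comp[OF S(4) assms(3)] module_hom_comp[OF i S(5)]])
    fix k assume k: "k \<in> carrier K" "e (f k) = \<zero>\<^bsub>Y\<^esub>"
    have "f k = \<zero>\<^bsub>X\<^esub>"
      by (rule module_hom_injD[OF S(2) assms(2,3) bij_betw_imp_inj_on[OF assms(4)] module_homD(1)[OF S(4) k(1)] k(2)])
    then show "k = \<zero>\<^bsub>K\<^esub>" by (rule module_hom_injD[OF S(1,2,4,6) k(1)])
  next
    fix c assume "c \<in> carrier C"
    then have "c \<in> g ` carrier X" by (simp only: S(7))
    then obtain x where x: "x \<in> carrier X" "g x = c" by (metis imageE)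
    show "\<exists>y \<in> carrier Y. g (?i y) = c"
      by (rule bexI[OF _ module_homD(1)[OF assms(3) x(1)]]) (simp only: ie[OF x(1)] x(2))
  next
    fix k assume "k \<in> carrier K"
    then show "g (?i (e (f k))) = \<zero>\<^bsub>C\<^esub>" by (simp add: ie S(8) module_homD(1)[OF S(4)])
  next
    fix y assume y: "y \<in> carrier Y" "g (?i y) = \<zero>\<^bsub>C\<^esub>"
    then have "?i y \<in> f ` carrier K" by (intro S(9) module_homD(1)[OF i])
    then show "\<exists>k \<in> carrier K. e (f k) = y" using ei[OF y(1)] by force
  qed
qed

lemma short_exact_surjE:
  assumes "short_exact R K f X g C" "c \<in> carrier C"
  obtains x where "x \<in> carrier X" "c = g x"
proof -
  have "c \<in> g ` carrier X" using assms(2) by (simp only: short_exactD(7)[OF assms(1)])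
  then show ?thesis using that by (metis imageE)
qed

lemma short_exact_kernelE:
  assumes "short_exact R K f X g C" "x \<in> carrier X" "g x = \<zero>\<^bsub>C\<^esub>"
  obtains k where "k \<in> carrier K" "x = f k"
  using short_exactD(9)[OF assms] that by (metis imageE)

lemma module_isomorphicE:
  assumes "module_isomorphic R M N"
  obtains e where "e \<in> module_hom R M N" "bij_betw e (carrier M) (carrier N)"
  using assms by (auto simp: module_isomorphic_def)

lemma module_isomorphicI:
  "\<lbrakk>e \<in> module_hom R M N; bij_betw e (carrier M) (carrier N)\<rbrakk> \<Longrightarrow> module_isomorphic R M N"
  by (auto simp: module_isomorphic_def)

lemma module_isomorphic_sym:
  assumes "left_module R M" "module_isomorphic R M N" shows "module_isomorphic R N M"
  using assms(2) module_hom_inv[OF assms(1)] bij_betw_inv_into by (metis module_isomorphic_def)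

lemma module_isomorphic_trans:
  assumes "module_isomorphic R L M" "module_isomorphic R M N" shows "module_isomorphic R L N"
proof -
  obtain e f where "e \<in> module_hom R L M" "bij_betw e (carrier L) (carrier M)"
    "f \<in> module_hom R M N" "bij_betw f (carrier M) (carrier N)"
    using assms by (auto simp: module_isomorphic_def)
  then show ?thesis
    using bij_betw_trans[of e _ _ f] by (intro module_isomorphicI[OF module_hom_comp]) (auto simp: comp_def)
qed

lemma submodule_image:
  assumes "left_module R M" "left_module R N" "f \<in> module_hom R M N"
  shows "submodule (f ` carrier M) R N"
proof -
  interpret M: left_module R M by fact
  interpret N: left_module R N by fact
  show ?thesis
    by (rule N.left_submoduleI)
      (auto simp: module_homD[OF assms(3)] simp flip: module_homD(2,3)[OF assms(3)]
        module_hom_zero[OF assms])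
qed

text \<open>This is the bridge from the coset construction of \<open>cokernel_module\<close> to
  short exact sequences. Later arguments use a cokernel only through such a sequence, so that any
  isomorphic copy serves equally well.\<close>

lemma short_exact_cokernel:
  assumes "left_module R M" "left_module R N" "f \<in> module_hom R M N" "inj_on f (carrier M)"
  shows "short_exact R M f N (\<lambda>x. f ` carrier M +>\<^bsub>N\<^esub> x) (cokernel_module M N f)"
proof -
  interpret M: left_module R M by fact
  interpret N: left_module R N by fact
  let ?H = "f ` carrier M"
  have H: "submodule ?H R N" by (rule submodule_image[OF assms(1-3)])
  interpret H: submodule ?H R N by fact
  note ops = quotient_module_ops[OF N.M.abelian_group_axioms H.subgroup_axioms]
  have smult: "r \<odot>\<^bsub>quotient_module N ?H\<^esub> (?H +>\<^bsub>N\<^esub> x) = ?H +>\<^bsub>N\<^esub> (r \<odot>\<^bsub>N\<^esub> x)"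
    if "r \<in> carrier R" "x \<in> carrier N" for r x
    by (rule ops(5)) (use that H.smult_closed in \<open>auto simp: N.smult_r_distr\<close>)
  have z: "?H +>\<^bsub>N\<^esub> x = \<zero>\<^bsub>quotient_module N ?H\<^esub> \<longleftrightarrow> x \<in> ?H" if "x \<in> carrier N" for x
  proof -
    have "\<zero>\<^bsub>quotient_module N ?H\<^esub> = ?H +>\<^bsub>N\<^esub> \<zero>\<^bsub>N\<^esub>"
      using N.M.a_coset_add_zero[OF H.subset[simplified]] by (simp add: quotient_module_def)
    then show ?thesis using ops(3)[OF that N.M.zero_closed] N.M.minus_zero_right[OF that] by simp
  qed
  have "(\<lambda>x. ?H +>\<^bsub>N\<^esub> x) \<in> module_hom R N (cokernel_module M N f)"
    by (rule module_homI) (auto simp: cokernel_module_def ops(1,2) smult)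
  moreover have "left_module R (cokernel_module M N f)" by (rule left_module_cokernel) fact+
  moreover have "carrier (cokernel_module M N f) = (\<lambda>x. ?H +>\<^bsub>N\<^esub> x) ` carrier N"
    by (simp add: cokernel_module_def ops(1))
  moreover have "?H = {x \<in> carrier N. ?H +>\<^bsub>N\<^esub> x = \<zero>\<^bsub>cokernel_module M N f\<^esub>}"
    using z module_homD(1)[OF assms(3)] by (auto simp: cokernel_module_def)
  ultimately show ?thesis using assms by (simp add: short_exact_def)
qed

lemma left_module_restrict:
  assumes "left_module R M" "submodule H R M"
  shows "left_module R (M\<lparr>carrier := H\<rparr>)"
proof -
  interpret M: left_module R M by fact
  interpret H: submodule H R M by fact
  have sub: "x \<in> carrier M" if "x \<in> H" for x using H.subset that by auto
  have inv: "\<ominus>\<^bsub>M\<^esub> x \<in> H" if "x \<in> H" for x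
    using H.smult_closed[of "\<ominus>\<^bsub>R\<^esub> \<one>\<^bsub>R\<^esub>" x] that M.smult_minus_one[OF sub] by simp
  show ?thesis
  proof (rule left_moduleI[OF M.R.ring_axioms])
    show "abelian_group (M\<lparr>carrier := H\<rparr>)"
    proof (rule abelian_groupI)
      fix x assume "x \<in> carrier (M\<lparr>carrier := H\<rparr>)"
      then show "\<exists>y \<in> carrier (M\<lparr>carrier := H\<rparr>). y \<oplus>\<^bsub>M\<lparr>carrier := H\<rparr>\<^esub> x = \<zero>\<^bsub>M\<lparr>carrier := H\<rparr>\<^esub>"
        by (intro bexI[of _ "\<ominus>\<^bsub>M\<^esub> x"]) (auto simp: inv sub M.M.l_neg)
    qed (use H.m_closed H.one_closed in \<open>auto simp: sub M.M.a_ac\<close>)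
  qed (auto simp: sub M.smult_l_distr M.smult_r_distr M.smult_assoc1)
qed

lemma short_exact_kernel:
  assumes "left_module R X" "left_module R C" "g \<in> module_hom R X C" "g ` carrier X = carrier C"
  shows "short_exact R (X\<lparr>carrier := {x \<in> carrier X. g x = \<zero>\<^bsub>C\<^esub>}\<rparr>) (\<lambda>x. x) X g C"
proof -
  interpret X: left_module R X by fact
  interpret C: left_module R C by fact
  let ?H = "{x \<in> carrier X. g x = \<zero>\<^bsub>C\<^esub>}"
  have "submodule ?H R X"
    by (rule X.left_submoduleI) (auto simp: module_homD[OF assms(3)] module_hom_zero[OF assms(1-3)])
  then have "left_module R (X\<lparr>carrier := ?H\<rparr>)" by (rule left_module_restrict[OF assms(1)])
  moreover have "(\<lambda>x. x) \<in> module_hom R (X\<lparr>carrier := ?H\<rparr>) X" by (auto simp: module_hom_def hom_def)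
  ultimately show ?thesis using assms by (simp add: short_exact_def)
qed

text \<open>Picture \<open>c1\<close>, \<open>c2\<close>, \<open>c3\<close> as columns and
  \<open>r1\<close>, \<open>r2\<close> as the upper two rows of a commutative diagram. The maps c
  and d are induced by f and g on the quotients, and exactness of the third row is a diagram
  chase.\<close>

lemma three_by_three:
  assumes c1: "short_exact R K \<phi> X p C" and c2: "short_exact R S \<psi> U q D" and c3: "short_exact R K' \<phi>' X' p' C'"
    and r1: "short_exact R K a S b K'" and r2: "short_exact R X f U g X'"
    and ca: "\<And>k. k \<in> carrier K \<Longrightarrow> \<psi> (a k) = f (\<phi> k)"
    and cb: "\<And>s. s \<in> carrier S \<Longrightarrow> \<phi>' (b s) = g (\<psi> s)"
  obtains c d where "short_exact R C c D d C'"
    "\<And>x. x \<in> carrier X \<Longrightarrow> c (p x) = q (f x)" "\<And>u. u \<in> carrier U \<Longrightarrow> d (q u) = p' (g u)"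
proof -
  note X = short_exactD[OF c1] and U = short_exactD[OF c2] and X' = short_exactD[OF c3]
    and T = short_exactD[OF r1] and E = short_exactD[OF r2]
  interpret U: left_module R U by (rule U(2))
  obtain c where c: "c \<in> module_hom R C D" "\<And>x. x \<in> carrier X \<Longrightarrow> c (p x) = q (f x)"
  proof (rule factor_surj[OF X(2,3) U(3) X(5,7) module_hom_comp[OF E(4) U(5)]])
    fix x assume "x \<in> carrier X" "p x = \<zero>\<^bsub>C\<^esub>"
    then obtain k where k: "k \<in> carrier K" "x = \<phi> k" using X(9) by blast
    then show "q (f x) = \<zero>\<^bsub>D\<^esub>" using U(8)[OF module_homD(1)[OF T(4)]] by (simp flip: ca)
  qed auto
  obtain d where d: "d \<in> module_hom R D C'" "\<And>u. u \<in> carrier U \<Longrightarrow> d (q u) = p' (g u)"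
  proof (rule factor_surj[OF U(2,3) X'(3) U(5,7) module_hom_comp[OF E(5) X'(5)]])
    fix u assume "u \<in> carrier U" "q u = \<zero>\<^bsub>D\<^esub>"
    then obtain s where s: "s \<in> carrier S" "u = \<psi> s" using U(9) by blast
    then show "p' (g u) = \<zero>\<^bsub>C'\<^esub>" using X'(8)[OF module_homD(1)[OF T(5)]] by (simp flip: cb)
  qed auto
  have "short_exact R C c D d C'"
  proof (rule short_exactI[OF X(3) U(3) X'(3) c(1) d(1)])
    fix y assume y: "y \<in> carrier C" "c y = \<zero>\<^bsub>D\<^esub>"
    then obtain x where x: "x \<in> carrier X" "y = p x" using X(7) by blast
    then have "f x \<in> carrier U" "q (f x) = \<zero>\<^bsub>D\<^esub>" using y c(2) module_homD(1)[OF E(4)] by auto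
    then obtain s where s: "s \<in> carrier S" "f x = \<psi> s" using U(9) by blast
    then have "\<phi>' (b s) = \<zero>\<^bsub>X'\<^esub>" using E(8)[OF x(1)] by (simp add: cb)
    then have "b s = \<zero>\<^bsub>K'\<^esub>" by (rule module_hom_injD[OF X'(1,2,4,6) module_homD(1)[OF T(5) s(1)]])
    then obtain k where k: "k \<in> carrier K" "s = a k" using T(9) s(1) by blast
    then have "x = \<phi> k" using E(6) x(1) s(2) module_homD(1)[OF X(4) k(1)] by (simp add: ca inj_on_eq_iff)
    then show "y = \<zero>\<^bsub>C\<^esub>" using x X(8) k by simp
  next
    fix y assume "y \<in> carrier C'"
    then obtain x where "x \<in> carrier X'" "y = p' x" using X'(7) by blast
    moreover then obtain u where "u \<in> carrier U" "x = g u" using E(7) by blast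
    ultimately show "\<exists>x \<in> carrier D. d x = y"
      using d(2) module_homD(1)[OF U(5)] by (intro bexI[of _ "q u"]) auto
  next
    fix y assume "y \<in> carrier C"
    then obtain x where x: "x \<in> carrier X" "y = p x" using X(7) by blast
    then show "d (c y) = \<zero>\<^bsub>C'\<^esub>"
      using c(2) d(2) module_homD(1)[OF E(4)] E(8) module_hom_zero[OF X'(2,3,5)] by simp
  next
    fix y assume y: "y \<in> carrier D" "d y = \<zero>\<^bsub>C'\<^esub>"
    then obtain u where u: "u \<in> carrier U" "y = q u" using U(7) by blast
    then have "g u \<in> carrier X'" "p' (g u) = \<zero>\<^bsub>C'\<^esub>" using y d(2) module_homD(1)[OF E(5)] by auto
    then obtain k where k: "k \<in> carrier K'" "g u = \<phi>' k" using X'(9) by blast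
    then obtain s where s: "s \<in> carrier S" "k = b s" using T(7) by blast
    have \<psi>s: "\<psi> s \<in> carrier U" by (rule module_homD(1)[OF U(4) s(1)])
    \<comment> \<open>Subtracting \<open>\<psi> s\<close> does not change the class
      \<open>q u\<close>, and s is chosen to cancel \<open>g u\<close>; the difference then comes
      from X by exactness of the second row.\<close>
    have "g (u \<ominus>\<^bsub>U\<^esub> \<psi> s) = \<zero>\<^bsub>X'\<^esub>"
      using k s u \<psi>s by (simp add: cb flip: module_hom_eq_iff[OF E(2,3,5)])
    then obtain x where x: "x \<in> carrier X" "u \<ominus>\<^bsub>U\<^esub> \<psi> s = f x" using E(9) u(1) \<psi>s by blast
    interpret D: left_module R D by (rule U(3))
    have "c (p x) = q u \<ominus>\<^bsub>D\<^esub> q (\<psi> s)"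
      using c(2)[OF x(1)] x u \<psi>s by (simp add: module_hom_minus[OF U(2,3,5), symmetric])
    then have "c (p x) = y" using u U(8)[OF s(1)] y(1) by (simp add: a_minus_def)
    then show "\<exists>k \<in> carrier C. c k = y" using module_homD(1)[OF X(5) x(1)] by blast
  qed
  from that[OF this c(2) d(2)] show ?thesis .
qed

section \<open>Splicing and unsplicing complete resolutions\<close>

text \<open>Surjectivity of Hom(X, Z) \<rightarrow> Hom(K, Z) induced by f. If K embeds in a
  projective X with quotient C, this is the vanishing of Ext^1(C, Z), so no derived functors have to
  be constructed.\<close>

definition extends_along ::
  "('r, 'q) ring_scheme \<Rightarrow> ('r, 'k, 'c) module_scheme \<Rightarrow> ('k \<Rightarrow> 'm) \<Rightarrow> ('r, 'm, 'd) module_scheme \<Rightarrow>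
    ('r, 'z, 'e) module_scheme \<Rightarrow> bool"
  where "extends_along R K f X Z \<longleftrightarrow>
    (\<forall>h \<in> module_hom R K Z. \<exists>k \<in> module_hom R X Z. \<forall>x \<in> carrier K. k (f x) = h x)"

lemma extends_alongI:
  assumes "\<And>h. h \<in> module_hom R K Z \<Longrightarrow> \<exists>k \<in> module_hom R X Z. \<forall>x \<in> carrier K. k (f x) = h x"
  shows "extends_along R K f X Z"
  using assms by (simp add: extends_along_def)

lemma extends_alongE:
  assumes "extends_along R K f X Z" "h \<in> module_hom R K Z"
  obtains k where "k \<in> module_hom R X Z" "\<And>x. x \<in> carrier K \<Longrightarrow> k (f x) = h x"
  using assms by (auto simp: extends_along_def)

definition proper_step ::
  "('r, 'q) ring_scheme \<Rightarrow> ('r, 'k, 'c) module_scheme \<Rightarrow> ('k \<Rightarrow> 'm) \<Rightarrow> ('r, 'm, 'd) module_scheme \<Rightarrow>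
    ('m \<Rightarrow> 'n) \<Rightarrow> ('r, 'n, 'e) module_scheme \<Rightarrow> bool"
  where "proper_step R N f P g N' \<longleftrightarrow> short_exact R N f P g N' \<and>
    projective_module R P \<and> finitely_generated R P \<and> extends_along R N f P (regular_module R)"

lemma proper_stepD:
  assumes "proper_step R N f P g N'"
  shows "short_exact R N f P g N'" "projective_module R P" "finitely_generated R P"
    "extends_along R N f P (regular_module R)"
  using assms by (auto simp: proper_step_def)

text \<open>Exactness of the dual complex at Hom(P1, S) becomes a factorization property: a map that
  vanishes on the image of d0 factors through d1. One inclusion is automatic from
  \<open>d1 (d0 x) = 0\<close>. The restrictions in the proof only reconcile arbitrary functions
  with the extensional elements of \<open>Hom_group\<close>.\<close>

lemma Hom_complex_exact_iff:
  fixes P0 P1 P2 :: "('r, 'p) module"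
  assumes L: "left_module R P0" "left_module R P1" "left_module R P2" "left_module R S"
    and d: "d0 \<in> module_hom R P0 P1" "d1 \<in> module_hom R P1 P2"
    and dd: "\<And>x. x \<in> carrier P0 \<Longrightarrow> d1 (d0 x) = \<zero>\<^bsub>P2\<^esub>"
  shows "(\<lambda>f. compose (carrier P1) f d1) ` carrier (Hom_group R P2 S) =
      a_kernel (Hom_group R P1 S) (Hom_group R P0 S) (\<lambda>f. compose (carrier P0) f d0) \<longleftrightarrow>
    (\<forall>\<phi> \<in> module_hom R P1 S. (\<forall>x \<in> carrier P0. \<phi> (d0 x) = \<zero>\<^bsub>S\<^esub>) \<longrightarrow>
      (\<exists>\<psi> \<in> module_hom R P2 S. \<forall>x \<in> carrier P1. \<phi> x = \<psi> (d1 x)))"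
    (is "?l = ?k \<longleftrightarrow> ?r")
proof -
  have car: "f \<in> carrier (Hom_group R M S) \<longleftrightarrow> f \<in> module_hom R M S \<and> f \<in> extensional (carrier M)"
    for f and M :: "('r, 'p) module" by (simp add: Hom_group_def)
  have k: "f \<in> ?k \<longleftrightarrow> f \<in> module_hom R P1 S \<and> f \<in> extensional (carrier P1) \<and>
      (\<forall>x \<in> carrier P0. f (d0 x) = \<zero>\<^bsub>S\<^esub>)" for f
    by (auto simp: a_kernel_def' Hom_group_def compose_def restrict_def fun_eq_iff)
  have res: "restrict f (carrier M) \<in> module_hom R M S \<and> restrict f (carrier M) \<in> extensional (carrier M)"
    if "f \<in> module_hom R M S" "left_module R M" for f and M :: "('r, 'p) module"
    using module_hom_cong[OF that(2,1), of "restrict f (carrier M)"] by simp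
  have "?l \<subseteq> ?k"
  proof
    fix f assume "f \<in> ?l"
    then obtain g where "g \<in> carrier (Hom_group R P2 S)" and g2: "f = compose (carrier P1) g d1" by (rule imageE)
    then have g: "g \<in> module_hom R P2 S" "f = compose (carrier P1) g d1" by (simp_all only: car)
    have "f \<in> module_hom R P1 S"
      by (rule module_hom_cong[OF L(2) module_hom_comp[OF d(2) g(1)]]) (simp add: g(2) compose_eq)
    moreover have "f (d0 x) = \<zero>\<^bsub>S\<^esub>" if "x \<in> carrier P0" for x
      using module_homD(1)[OF d(1) that] module_hom_zero[OF L(3,4) g(1)]
      by (simp add: g(2) compose_eq dd that)
    ultimately show "f \<in> ?k" by (simp add: k g(2))
  qed
  moreover have "?k \<subseteq> ?l \<longleftrightarrow> ?r"
  proof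
    assume kl: "?k \<subseteq> ?l"
    show ?r
    proof (intro ballI impI)
      fix \<phi> assume \<phi>: "\<phi> \<in> module_hom R P1 S" "\<forall>x \<in> carrier P0. \<phi> (d0 x) = \<zero>\<^bsub>S\<^esub>"
      then have "restrict \<phi> (carrier P1) \<in> ?k" using res[OF \<phi>(1) L(2)] module_homD(1)[OF d(1)] by (simp add: k)
      then have "restrict \<phi> (carrier P1) \<in> ?l" by (rule subsetD[OF kl])
      then obtain \<psi> where "\<psi> \<in> carrier (Hom_group R P2 S)" and "restrict \<phi> (carrier P1) = compose (carrier P1) \<psi> d1"
        by (rule imageE)
      then have "\<psi> \<in> module_hom R P2 S" "restrict \<phi> (carrier P1) = compose (carrier P1) \<psi> d1"
        by (simp_all only: car)
      then show "\<exists>\<psi> \<in> module_hom R P2 S. \<forall>x \<in> carrier P1. \<phi> x = \<psi> (d1 x)"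
        by (intro bexI[of _ \<psi>]) (auto simp: fun_eq_iff compose_def restrict_def split: if_splits)
    qed
  next
    assume r: ?r
    show "?k \<subseteq> ?l"
    proof
      fix f assume "f \<in> ?k"
      then have f: "f \<in> module_hom R P1 S" "f \<in> extensional (carrier P1)"
        "\<forall>x \<in> carrier P0. f (d0 x) = \<zero>\<^bsub>S\<^esub>" by (auto simp: k)
      then obtain \<psi> where \<psi>: "\<psi> \<in> module_hom R P2 S" "\<forall>x \<in> carrier P1. f x = \<psi> (d1 x)" using r by blast
      have "f = compose (carrier P1) (restrict \<psi> (carrier P2)) d1"
        using f(2) \<psi>(2) module_homD(1)[OF d(2)] by (auto simp: fun_eq_iff compose_def extensional_def)
      moreover have "restrict \<psi> (carrier P2) \<in> carrier (Hom_group R P2 S)"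
        using res[OF \<psi>(1) L(3)] by (simp only: car)
      ultimately show "f \<in> ?l" by (rule image_eqI)
    qed
  qed
  ultimately show ?thesis by blast
qed

text \<open>This removes the reversed indices of the dual complex, so that both exactness conditions
  speak of the same three consecutive terms i, i + 1, i + 2. The first conjunct is needed to make
  sense of the other two, hence the case distinction on it.\<close>

lemma complete_projective_resolution_iff:
  fixes P :: "int \<Rightarrow> ('r, 'p) module"
  shows "complete_projective_resolution R P d \<longleftrightarrow>
    (\<forall>i. projective_module R (P i) \<and> finitely_generated R (P i) \<and> d i \<in> module_hom R (P i) (P (i + 1))) \<and>
    (\<forall>i. d i ` carrier (P i) = {x \<in> carrier (P (i + 1)). d (i + 1) x = \<zero>\<^bsub>P (i + 2)\<^esub>}) \<and>
    (\<forall>i. \<forall>\<phi> \<in> module_hom R (P (i + 1)) (regular_module R).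
      (\<forall>x \<in> carrier (P i). \<phi> (d i x) = \<zero>\<^bsub>regular_module R\<^esub>) \<longrightarrow>
      (\<exists>\<psi> \<in> module_hom R (P (i + 2)) (regular_module R).
        \<forall>x \<in> carrier (P (i + 1)). \<phi> x = \<psi> (d (i + 1) x)))"
    (is "_ \<longleftrightarrow> ?a \<and> ?b \<and> ?c")
proof (cases ?a)
  case a: True
  let ?S = "regular_module R"
  let ?H = "\<lambda>i. Hom_group R (P (- i)) ?S" and ?D = "\<lambda>i f. compose (carrier (P (- (i + 1)))) f (d (- (i + 1)))"
  have L: "left_module R (P i)" and d: "d i \<in> module_hom R (P i) (P (i + 1))" for i
    using a by (auto simp: projective_module_def)
  have d2: "d (i + 1) \<in> module_hom R (P (i + 1)) (P (i + 2))" for i using d[of "i + 1"] by (simp add: add.assoc)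
  have S: "left_module R ?S"
    by (rule left_module_regular) (use L in \<open>auto simp: left_module_def\<close>)
  have b: "exact_complex P d \<longleftrightarrow> ?b"
    using L d by (simp add: exact_complex_def a_kernel_def' left_module_def module_hom_def)
  have "exact_complex ?H ?D \<longleftrightarrow> ?c" if b: ?b
  proof -
    have "d (- (i + 1)) \<in> module_hom R (P (- (i + 1))) (P (- i))" for i using d[of "- (i + 1)"] by simp
    then have "?D i \<in> hom (add_monoid (?H i)) (add_monoid (?H (i + 1)))" for i
      using Hom_group_precompose[OF L] by blast
    then have "exact_complex ?H ?D \<longleftrightarrow>
        (\<forall>i. ?D i ` carrier (?H i) = a_kernel (?H (i + 1)) (?H (i + 2)) (?D (i + 1)))"
      using abelian_group_Hom_group[OF L S] by (simp only: exact_complex_def simp_thms)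
    also have "\<dots> \<longleftrightarrow> (\<forall>i. (\<lambda>f. compose (carrier (P (i + 1))) f (d (i + 1))) ` carrier (Hom_group R (P (i + 2)) ?S) =
        a_kernel (Hom_group R (P (i + 1)) ?S) (Hom_group R (P i) ?S) (\<lambda>f. compose (carrier (P i)) f (d i)))"
      (is "(\<forall>i. ?E i) \<longleftrightarrow> (\<forall>i. ?F i)")
    proof -
      \<comment> \<open>Degrees \<open>- i - 2\<close>, \<open>- i - 1\<close>, \<open>- i\<close>
        of the dual complex come from the terms i + 2, i + 1, i of the resolution; the substitution
        i to \<open>- i - 2\<close> is its own inverse.\<close>
      have "?E (- i - 2) \<longleftrightarrow> ?F i" for i by (simp add: algebra_simps)
      moreover have "?E i \<longleftrightarrow> ?F (- i - 2)" for i by (simp add: algebra_simps)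
      ultimately show ?thesis by (intro iffI allI) (simp only: simp_thms)+
    qed
    also have "\<dots> \<longleftrightarrow> ?c"
      by (intro all_cong1 Hom_complex_exact_iff[OF L L L S d d2]) (use b in blast)
    finally show ?thesis .
  qed
  with a b show ?thesis unfolding complete_projective_resolution_def by blast
next
  case False
  then show ?thesis unfolding complete_projective_resolution_def by blast
qed

text \<open>The differential is \<open>g i\<close> followed by the embedding
  \<open>f (i + 1)\<close>. Its kernel is the image of \<open>f i\<close>, which is also the image
  of the preceding differential because \<open>g (i - 1)\<close> is onto. For the dual complex, a
  functional on P(i + 1) that kills the image of the differential descends to N(i + 2) and then
  extends to P(i + 2) by properness.\<close>

lemma Gorenstein_projective_splice:
  fixes N :: "int \<Rightarrow> ('r, 'n) module" and P :: "int \<Rightarrow> ('r, 'p) module"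
  assumes step: "\<And>k. proper_step R (N k) (f k) (P k) (g k) (N (k + 1))"
  shows "Gorenstein_projective R (N k)"
proof -
  have gen: "Gorenstein_projective R (N 0)"
    if step: "\<And>k. proper_step R (N k) (f k) (P k) (g k) (N (k + 1))"
    for N :: "int \<Rightarrow> ('r, 'n) module" and P :: "int \<Rightarrow> ('r, 'p) module" and f g
  proof -
    note S = short_exactD[OF proper_stepD(1)[OF step]]
    let ?d = "\<lambda>i x. f (i + 1) (g i x)"
    have S2: "f (i + 1) \<in> module_hom R (N (i + 1)) (P (i + 1))" for i by (rule S(4))
    have RS: "left_module R (regular_module R)"
      by (rule left_module_regular) (use S(1) in \<open>auto simp: left_module_def\<close>)
    have fz: "f i x = \<zero>\<^bsub>P i\<^esub> \<longleftrightarrow> x = \<zero>\<^bsub>N i\<^esub>" if "x \<in> carrier (N i)" for i x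
      using module_hom_injD[OF S(1,2,4,6) that] module_hom_zero[OF S(1,2,4)] by auto
    have gN: "g i x \<in> carrier (N (i + 1))" if "x \<in> carrier (P i)" for i x
      using module_homD(1)[OF S(5) that] .
    have im: "?d i ` carrier (P i) = f (i + 1) ` carrier (N (i + 1))" for i
    proof -
      have "?d i ` carrier (P i) = f (i + 1) ` g i ` carrier (P i)" by (simp only: image_image)
      then show ?thesis by (simp only: S(7))
    qed
    have ker: "{x \<in> carrier (P i). ?d i x = \<zero>\<^bsub>P (i + 1)\<^esub>} = f i ` carrier (N i)" for i
      using proper_stepD(1)[OF step, of i] gN fz[of _ "i + 1"] by (auto simp: short_exact_def)
    have cpr: "complete_projective_resolution R P ?d"
      unfolding complete_projective_resolution_iff
    proof (intro conjI allI ballI impI)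
      fix i
      show "projective_module R (P i)" "finitely_generated R (P i)" using proper_stepD(2,3)[OF step] .
      show "?d i \<in> module_hom R (P i) (P (i + 1))" by (rule module_hom_comp[OF S(5) S2])
      show "?d i ` carrier (P i) = {x \<in> carrier (P (i + 1)). ?d (i + 1) x = \<zero>\<^bsub>P (i + 2)\<^esub>}"
        using ker[of "i + 1"] im[of i] by (simp add: add.assoc)
    next
      fix i \<phi> assume \<phi>: "\<phi> \<in> module_hom R (P (i + 1)) (regular_module R)"
        "\<forall>x \<in> carrier (P i). \<phi> (?d i x) = \<zero>\<^bsub>regular_module R\<^esub>"
      obtain \<psi> where \<psi>: "\<psi> \<in> module_hom R (N (i + 1 + 1)) (regular_module R)"
        "\<And>x. x \<in> carrier (P (i + 1)) \<Longrightarrow> \<psi> (g (i + 1) x) = \<phi> x"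
      proof (rule factor_surj[OF S(2,3) RS S(5,7) \<phi>(1)])
        fix x assume "x \<in> carrier (P (i + 1))" "g (i + 1) x = \<zero>\<^bsub>N (i + 1 + 1)\<^esub>"
        then obtain y where y: "y \<in> carrier (N (i + 1))" "x = f (i + 1) y"
          by (rule short_exact_kernelE[OF proper_stepD(1)[OF step]])
        obtain z where "z \<in> carrier (P i)" "y = g i z"
          by (rule short_exact_surjE[OF proper_stepD(1)[OF step] y(1)])
        then show "\<phi> x = \<zero>\<^bsub>regular_module R\<^esub>" using \<phi>(2) y by blast
      qed blast
      obtain \<chi> where \<chi>: "\<chi> \<in> module_hom R (P (i + 1 + 1)) (regular_module R)"
        "\<And>x. x \<in> carrier (N (i + 1 + 1)) \<Longrightarrow> \<chi> (f (i + 1 + 1) x) = \<psi> x"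
        by (rule extends_alongE[OF proper_stepD(4)[OF step] \<psi>(1)]) blast
      have "\<phi> x = \<chi> (?d (i + 1) x)" if "x \<in> carrier (P (i + 1))" for x
        using \<psi>(2)[OF that] \<chi>(2)[OF gN[OF that]] by simp
      with \<chi>(1) show "\<exists>\<psi> \<in> module_hom R (P (i + 2)) (regular_module R).
          \<forall>x \<in> carrier (P (i + 1)). \<phi> x = \<psi> (?d (i + 1) x)" by (auto simp: add.assoc)
    qed
    \<comment> \<open>N 0 is a quotient of the finitely generated module in degree -1.\<close>
    have fg: "finitely_generated R (N 0)"
      by (rule finitely_generated_image[OF S(2) proper_stepD(3)[OF step] S(1), of "g (- 1)" "- 1"])
        (use S(5)[of "- 1"] S(7)[of "- 1"] in auto)
    have "a_kernel (P 0) (P 1) (?d 0) = f 0 ` carrier (N 0)"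
      using ker[of 0] by (simp add: a_kernel_def')
    then have "module_isomorphic R (N 0) (kernel_module (P 0) (P 1) (?d 0))"
      using S(6)[of 0] by (intro module_isomorphicI[of "f 0"] module_homI)
        (auto simp: kernel_module_def bij_betw_def module_homD[OF S(4)])
    then show ?thesis by (rule Gorenstein_projectiveI[OF S(1) fg cpr])
  qed
  \<comment> \<open>The definition reads off the kernel in degree 0; the other members of the family
    are reached by shifting indices.\<close>
  have "proper_step R (N (i + k)) (f (i + k)) (P (i + k)) (g (i + k)) (N (i + 1 + k))" for i
    using step[of "i + k"] by (simp add: add_ac)
  then have "Gorenstein_projective R ((\<lambda>i. N (i + k)) 0)"
    by (rule gen[of "\<lambda>i. N (i + k)" "\<lambda>i. f (i + k)" "\<lambda>i. P (i + k)" "\<lambda>i. g (i + k)"])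
  then show ?thesis by simp
qed

text \<open>By choice, each member of the class has a preferred right step and a preferred left step
  that stay in the class. Iterating both from N gives a family indexed by all integers, ready to be
  spliced. All members share the type \<open>'n\<close> and all projectives the type
  \<open>'p\<close>, which need not be related.\<close>

theorem Gorenstein_projective_coinduct:
  fixes N :: "('r, 'n) module"
  assumes "\<C> N"
    and right: "\<And>N. \<C> N \<Longrightarrow> \<exists>f (P :: ('r, 'p) module) g N'. proper_step R N f P g N' \<and> \<C> N'"
    and left: "\<And>N. \<C> N \<Longrightarrow> \<exists>N' f (P :: ('r, 'p) module) g. proper_step R N' f P g N \<and> \<C> N'"
  shows "Gorenstein_projective R N"
proof -
  obtain rf rP rg rN where r: "\<And>N. \<C> N \<Longrightarrow> proper_step R N (rf N) (rP N :: ('r, 'p) module) (rg N) (rN N) \<and> \<C> (rN N)"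
    using right by metis
  obtain lf lP lg lN where l: "\<And>N. \<C> N \<Longrightarrow> proper_step R (lN N) (lf N) (lP N :: ('r, 'p) module) (lg N) N \<and> \<C> (lN N)"
    using left by metis
  define K where "K k = (if k \<ge> 0 then (rN ^^ nat k) N else (lN ^^ nat (- k)) N)" for k :: int
  have CK: "\<C> (K k)" for k
  proof -
    have "\<C> ((rN ^^ n) N)" "\<C> ((lN ^^ n) N)" for n
      by (induction n) (use \<open>\<C> N\<close> r l in auto)
    then show ?thesis by (simp add: K_def)
  qed
  have pos: "K (k + 1) = rN (K k)" if "k \<ge> 0" for k
    using that by (simp add: K_def nat_add_distrib)
  have neg: "K k = lN (K (k + 1))" if "k < 0" for k
  proof -
    have "nat (- k) = Suc (nat (- (k + 1)))" using that by simp
    then show ?thesis using that by (auto simp: K_def)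
  qed
  \<comment> \<open>Step k leads from \<open>K k\<close> to \<open>K (k + 1)\<close>. For negative k
    it was chosen as the left step of its right end, which explains the index
    \<open>k + 1\<close>.\<close>
  define f where "f k = (if k \<ge> 0 then rf (K k) else lf (K (k + 1)))" for k
  define P where "P k = (if k \<ge> 0 then rP (K k) else lP (K (k + 1)))" for k
  define g where "g k = (if k \<ge> 0 then rg (K k) else lg (K (k + 1)))" for k
  have "proper_step R (K k) (f k) (P k) (g k) (K (k + 1))" for k
  proof (cases "k \<ge> 0")
    case True
    with r[OF CK, of k] show ?thesis by (simp add: f_def P_def g_def pos)
  next
    case False
    with l[OF CK, of "k + 1"] neg[of k] show ?thesis by (simp add: f_def P_def g_def)
  qed
  from Gorenstein_projective_splice[of R K f P g 0, OF this] show ?thesis by (simp add: K_def)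
qed

text \<open>The inverse of splicing. Let h be a functional on \<open>K i\<close>, which is the image
  of \<open>d (i - 1)\<close>. Its composite with \<open>d (i - 1)\<close> vanishes on the image of
  \<open>d (i - 2)\<close>, so exactness of the dual complex writes it as a functional on
  \<open>P i\<close> composed with \<open>d (i - 1)\<close>; this functional extends h.\<close>

lemma kernel_proper_step:
  fixes P :: "int \<Rightarrow> ('r, 'p) module"
  assumes "complete_projective_resolution R P d"
  defines "K \<equiv> \<lambda>i. kernel_module (P i) (P (i + 1)) (d i)"
  shows "proper_step R (K i) (\<lambda>x. x) (P i) (d i) (K (i + 1))"
proof -
  note C = assms(1)[unfolded complete_projective_resolution_iff]
  have pj: "projective_module R (P i)" and fg: "finitely_generated R (P i)"
    and d: "d i \<in> module_hom R (P i) (P (i + 1))" for i using C by blast+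
  have L: "left_module R (P i)" for i using pj by (simp add: projective_module_def)
  interpret Pi: left_module R "P k" for k by (rule L)
  have factor: "\<exists>\<psi> \<in> module_hom R (P (i + 2)) (regular_module R). \<forall>x \<in> carrier (P (i + 1)). \<phi> x = \<psi> (d (i + 1) x)"
    if "\<phi> \<in> module_hom R (P (i + 1)) (regular_module R)"
      "\<forall>x \<in> carrier (P i). \<phi> (d i x) = \<zero>\<^bsub>regular_module R\<^esub>" for i \<phi>
    using C that by blast
  have ex: "d i ` carrier (P i) = {x \<in> carrier (P (i + 1)). d (i + 1) x = \<zero>\<^bsub>P (i + 2)\<^esub>}" for i
    using C by blast
  have Kc: "carrier (K i) = {x \<in> carrier (P i). d i x = \<zero>\<^bsub>P (i + 1)\<^esub>}" for i
    by (simp add: K_def kernel_module_def a_kernel_def')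
  have Kc': "carrier (K (i + 1)) = d i ` carrier (P i)" for i
    using ex by (simp add: Kc add.assoc)
  have sub: "submodule (carrier (K i)) R (P i)" for i
    by (rule Pi.left_submoduleI) (auto simp: Kc module_homD[OF d] module_hom_zero[OF L L d])
  have K_eq: "K i = (P i)\<lparr>carrier := carrier (K i)\<rparr>" for i by (simp add: K_def kernel_module_def)
  have LK: "left_module R (K i)" for i using left_module_restrict[OF L sub, of i] K_eq[of i] by simp
  have ops: "\<zero>\<^bsub>K i\<^esub> = \<zero>\<^bsub>P i\<^esub>" "ring.add (K i) = ring.add (P i)" "smult (K i) = smult (P i)" for i
    by (simp_all add: K_def kernel_module_def)
  have id: "(\<lambda>x. x) \<in> module_hom R (K i) (P i)" for i
    by (rule module_homI) (auto simp: Kc ops)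
  have d': "d i \<in> module_hom R (P i) (K (i + 1))" for i
    by (rule module_homI) (auto simp: Kc' ops module_homD[OF d])
  have "short_exact R (K i) (\<lambda>x. x) (P i) (d i) (K (i + 1))"
    using L LK id d' by (simp add: short_exact_def Kc' ops) (simp add: Kc)
  moreover have "extends_along R (K i) (\<lambda>x. x) (P i) (regular_module R)"
  proof (rule extends_alongI)
    fix h assume h: "h \<in> module_hom R (K i) (regular_module R)"
    have RS: "left_module R (regular_module R)" by (rule left_module_regular[OF Pi.R.ring_axioms])
    \<comment> \<open>The factorization property is stated for terms j, j + 1, j + 2 and produces a
      functional on the last one, so j + 2 has to be i.\<close>
    define j where "j = i - 2"
    have i: "i = j + 1 + 1" "j + 2 = i" by (auto simp: j_def)
    have hd: "(\<lambda>x. h (d (j + 1) x)) \<in> module_hom R (P (j + 1)) (regular_module R)"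
      by (rule module_hom_comp[OF d' h[unfolded i(1)]])
    have "\<forall>x \<in> carrier (P j). h (d (j + 1) (d j x)) = \<zero>\<^bsub>regular_module R\<^esub>"
    proof
      fix x assume "x \<in> carrier (P j)"
      then have "d (j + 1) (d j x) = \<zero>\<^bsub>P (j + 2)\<^esub>" using ex[of j] by blast
      then show "h (d (j + 1) (d j x)) = \<zero>\<^bsub>regular_module R\<^esub>"
        using module_hom_zero[OF LK RS h] by (simp add: i(2) ops)
    qed
    then obtain \<psi> where \<psi>: "\<psi> \<in> module_hom R (P (j + 2)) (regular_module R)"
      "\<forall>x \<in> carrier (P (j + 1)). h (d (j + 1) x) = \<psi> (d (j + 1) x)"
      by (rule bexE[OF factor[OF hd]])
    have "\<psi> x = h x" if "x \<in> carrier (K i)" for x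
      using that \<psi>(2) Kc'[of "j + 1"] i(1) by auto
    then show "\<exists>k \<in> module_hom R (P i) (regular_module R). \<forall>x \<in> carrier (K i). k x = h x"
      using \<psi>(1) unfolding i(2) by blast
  qed
  ultimately show ?thesis unfolding proper_step_def by (intro conjI pj fg)
qed

section \<open>Transport of proper steps, and the local criterion for being
  Gorenstein-projective\<close>

lemma Gorenstein_projective_iso:
  assumes "Gorenstein_projective R N" "left_module R N'" "module_isomorphic R N N'"
  shows "Gorenstein_projective R N'"
proof -
  note N = assms(1)[unfolded Gorenstein_projective_def]
  obtain e where e: "e \<in> module_hom R N N'" "bij_betw e (carrier N) (carrier N')"
    using assms(3) by (rule module_isomorphicE)
  have "finitely_generated R N'"
    by (rule finitely_generated_image[of R N]) (use N assms(2) e in \<open>auto simp: bij_betw_def\<close>)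
  with N assms(2,3) show ?thesis
    unfolding Gorenstein_projective_def
    by (meson module_isomorphic_sym module_isomorphic_trans)
qed

text \<open>The kernels in degrees -1, 0, 1 of a complete resolution give the left and the right
  step of N, and each kernel is Gorenstein-projective by a shift of the same resolution. N may live
  on any type; its new neighbours always live on \<open>nat \<Rightarrow> 'r\<close>.\<close>

lemma Gorenstein_projective_steps:
  fixes N :: "('r, 'm, 'c) module_scheme"
  assumes "Gorenstein_projective R N"
  shows "\<exists>f (P :: ('r, nat \<Rightarrow> 'r) module) g (N' :: ('r, nat \<Rightarrow> 'r) module).
      proper_step R N f P g N' \<and> Gorenstein_projective R N'" (is ?right)
    and "\<exists>(N' :: ('r, nat \<Rightarrow> 'r) module) f (P :: ('r, nat \<Rightarrow> 'r) module) g.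
      proper_step R N' f P g N \<and> Gorenstein_projective R N'" (is ?left)
proof -
  obtain P :: "int \<Rightarrow> ('r, nat \<Rightarrow> 'r) module" and d where N: "left_module R N"
    and P: "complete_projective_resolution R P d"
    and iso: "module_isomorphic R N (kernel_module (P 0) (P 1) (d 0))"
    using assms by (auto simp: Gorenstein_projective_def)
  define K where "K i = kernel_module (P i) (P (i + 1)) (d i)" for i
  have step: "proper_step R (K i) (\<lambda>x. x) (P i) (d i) (K (i + 1))" for i
    using kernel_proper_step[OF P] by (simp add: K_def)
  have GP: "Gorenstein_projective R (K i)" for i
    by (rule Gorenstein_projective_splice[of R K _ P d, OF step])
  obtain e where e: "e \<in> module_hom R N (K 0)" "bij_betw e (carrier N) (carrier (K 0))"
    using iso by (auto simp: K_def module_isomorphic_def)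
  let ?i = "inv_into (carrier N) e"
  have i: "?i \<in> module_hom R (K 0) N" "bij_betw ?i (carrier (K 0)) (carrier N)"
    by (rule module_hom_inv[OF N e], rule bij_betw_inv_into[OF e(2)])
  note S = proper_stepD[OF step]
  have "proper_step R N e (P 0) (d 0) (K 1)"
    unfolding proper_step_def
  proof (intro conjI S(2,3))
    show "short_exact R N e (P 0) (d 0) (K 1)"
      using short_exact_iso_left[OF S(1)[of 0] N e] by simp
    show "extends_along R N e (P 0) (regular_module R)"
    proof (rule extends_alongI)
      fix h assume "h \<in> module_hom R N (regular_module R)"
      then obtain k where k: "k \<in> module_hom R (P 0) (regular_module R)" "\<And>x. x \<in> carrier (K 0) \<Longrightarrow> k x = h (?i x)"
        using extends_alongE[OF S(4)[of 0] module_hom_comp[OF i(1)]] by metis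
      then show "\<exists>k \<in> module_hom R (P 0) (regular_module R). \<forall>x \<in> carrier N. k (e x) = h x"
        by (intro bexI[OF _ k(1)] ballI)
          (simp add: k(2) module_homD(1)[OF e(1)] bij_betw_inv_into_left[OF e(2)])
    qed
  qed
  then show ?right using GP by blast
  have "proper_step R (K (- 1)) (\<lambda>x. x) (P (- 1)) (\<lambda>x. ?i (d (- 1) x)) N"
    unfolding proper_step_def
    using S(2-4)[of "- 1"] short_exact_iso_right[OF S(1)[of "- 1", simplified] N i] by simp
  then show ?left using GP by blast
qed

lemma finitely_generated_nat_model:
  fixes N :: "('r, 'm, 'c) module_scheme"
  assumes "left_module R N" "finitely_generated R N"
  obtains N' :: "('r, nat \<Rightarrow> 'r) module" and e where "left_module R N'"
    "e \<in> module_hom R N N'" "bij_betw e (carrier N) (carrier N')"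
proof -
  obtain e :: "'m \<Rightarrow> nat \<Rightarrow> 'r" where "inj_on e (carrier N)" using finitely_generated_nat_fun[OF assms] by blast
  from transported_module[OF assms(1) this] show ?thesis by (rule that)
qed

lemma proper_step_iso_right:
  assumes "proper_step R N f P g N'" "left_module R D" "e \<in> module_hom R N' D" "bij_betw e (carrier N') (carrier D)"
  shows "proper_step R N f P (\<lambda>x. e (g x)) D"
  unfolding proper_step_def
  by (intro conjI proper_stepD[OF assms(1)] short_exact_iso_right[OF proper_stepD(1)[OF assms(1)] assms(2-4)])

lemma proper_step_iso_left:
  assumes "proper_step R N f P g N'" "left_module R L" "e \<in> module_hom R L N" "bij_betw e (carrier L) (carrier N)"
  shows "proper_step R L (\<lambda>x. f (e x)) P g N'"
  unfolding proper_step_def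
proof (intro conjI proper_stepD[OF assms(1)] short_exact_iso_left[OF proper_stepD(1)[OF assms(1)] assms(2-4)] extends_alongI)
  note N = short_exactD(1)[OF proper_stepD(1)[OF assms(1)]]
  fix h assume "h \<in> module_hom R L (regular_module R)"
  then obtain k where k: "k \<in> module_hom R P (regular_module R)"
      "\<And>x. x \<in> carrier N \<Longrightarrow> k (f x) = h (inv_into (carrier L) e x)"
    using extends_alongE[OF proper_stepD(4)[OF assms(1)] module_hom_comp[OF module_hom_inv[OF assms(2-4)]]] by metis
  then show "\<exists>k \<in> module_hom R P (regular_module R). \<forall>x \<in> carrier L. k (f (e x)) = h x"
    by (intro bexI[OF _ k(1)] ballI)
      (simp add: module_homD(1)[OF assms(3)] bij_betw_inv_into_left[OF assms(4)])
qed

lemma proper_step_iso_middle: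
  assumes "proper_step R N f P g N'" "left_module R Q" "e \<in> module_hom R P Q" "bij_betw e (carrier P) (carrier Q)"
  shows "proper_step R N (\<lambda>x. e (f x)) Q (\<lambda>y. g (inv_into (carrier P) e y)) N'"
proof -
  note P = proper_stepD[OF assms(1)]
  note S = short_exactD[OF P(1)]
  let ?i = "inv_into (carrier P) e"
  have "finitely_generated R Q"
    by (rule finitely_generated_image[OF S(2) P(3) assms(2,3)]) (use assms(4) in \<open>simp add: bij_betw_def\<close>)
  moreover have "extends_along R N (\<lambda>x. e (f x)) Q (regular_module R)"
  proof (rule extends_alongI)
    fix h assume "h \<in> module_hom R N (regular_module R)"
    then obtain k where k: "k \<in> module_hom R P (regular_module R)" "\<And>x. x \<in> carrier N \<Longrightarrow> k (f x) = h x"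
      using extends_alongE[OF P(4)] by metis
    show "\<exists>k \<in> module_hom R Q (regular_module R). \<forall>x \<in> carrier N. k (e (f x)) = h x"
      by (rule bexI[OF _ module_hom_comp[OF module_hom_inv[OF S(2) assms(3,4)] k(1)]])
        (simp add: k(2) bij_betw_inv_into_left[OF assms(4)] module_homD(1)[OF S(4)])
  qed
  ultimately show ?thesis
    unfolding proper_step_def
    by (intro conjI short_exact_iso_middle[OF P(1) assms(2-4)] projective_module_iso[OF P(2) assms(2-4)])
qed

lemma proper_step_transport:
  assumes step: "proper_step R N f P g N'"
    and N1: "left_module R N1" "module_isomorphic R N1 N"
    and N1': "left_module R N1'" "module_isomorphic R N' N1'"
  obtains f' and P' :: "('r, nat \<Rightarrow> 'r) module" and g' where "proper_step R N1 f' P' g' N1'"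
proof -
  obtain a where a: "a \<in> module_hom R N1 N" "bij_betw a (carrier N1) (carrier N)"
    using N1(2) by (rule module_isomorphicE)
  obtain b where b: "b \<in> module_hom R N' N1'" "bij_betw b (carrier N') (carrier N1')"
    using N1'(2) by (rule module_isomorphicE)
  obtain P' :: "('r, nat \<Rightarrow> 'r) module" and e where P': "left_module R P'"
    "e \<in> module_hom R P P'" "bij_betw e (carrier P) (carrier P')"
    by (rule finitely_generated_nat_model[OF short_exactD(2)[OF proper_stepD(1)[OF step]] proper_stepD(3)[OF step]])
  show ?thesis
    by (rule that[OF proper_step_iso_middle[OF proper_step_iso_right[OF proper_step_iso_left[OF step N1(1) a] N1'(1) b] P']])
qed

text \<open>Adjoining N to the class of Gorenstein-projective modules keeps it closed under steps in
  both directions, so coinduction applies. The rest of the proof copies N, its neighbours and the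
  two projectives to \<open>nat \<Rightarrow> 'r\<close>, where the class is formed.\<close>

lemma Gorenstein_projective_stepI:
  fixes N :: "('r, 'm, 'c) module_scheme"
  assumes right: "proper_step R N f P g N'" "Gorenstein_projective R N'"
    and left: "proper_step R N'' f' P' g' N" "Gorenstein_projective R N''"
  shows "Gorenstein_projective R N"
proof -
  note S = short_exactD[OF proper_stepD(1)[OF left(1)]]
  note gp = right(2)[unfolded Gorenstein_projective_def] left(2)[unfolded Gorenstein_projective_def]
  have "finitely_generated R N"
    by (rule finitely_generated_image[OF S(2) proper_stepD(3)[OF left(1)] S(3,5,7)])
  then obtain N0 :: "('r, nat \<Rightarrow> 'r) module" and e where N0: "left_module R N0"
    and e: "e \<in> module_hom R N N0" "bij_betw e (carrier N) (carrier N0)"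
    by (rule finitely_generated_nat_model[OF S(3)])
  have iso: "module_isomorphic R N N0" by (rule module_isomorphicI[OF e])
  have iso': "module_isomorphic R N0 N" by (rule module_isomorphic_sym[OF S(3) iso])
  obtain N1 :: "('r, nat \<Rightarrow> 'r) module" and a where N1: "left_module R N1"
    and a: "a \<in> module_hom R N' N1" "bij_betw a (carrier N') (carrier N1)"
    using finitely_generated_nat_model[of R N'] gp by blast
  have isoa: "module_isomorphic R N' N1" by (rule module_isomorphicI[OF a])
  obtain N2 :: "('r, nat \<Rightarrow> 'r) module" and b where N2: "left_module R N2"
    and b: "b \<in> module_hom R N'' N2" "bij_betw b (carrier N'') (carrier N2)"
    using finitely_generated_nat_model[of R N''] gp by blast
  have isob: "module_isomorphic R N'' N2" by (rule module_isomorphicI[OF b])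
  have isob': "module_isomorphic R N2 N''" by (rule module_isomorphic_sym[OF S(1) isob])
  have r: "\<exists>f (P :: ('r, nat \<Rightarrow> 'r) module) g. proper_step R N0 f P g N1"
    using proper_step_transport[OF right(1) N0 iso' N1 isoa] by metis
  have l: "\<exists>f (P :: ('r, nat \<Rightarrow> 'r) module) g. proper_step R N2 f P g N0"
    using proper_step_transport[OF left(1) N2 isob' N0 iso] by metis
  have GP1: "Gorenstein_projective R N1" by (rule Gorenstein_projective_iso[OF right(2) N1 isoa])
  have GP2: "Gorenstein_projective R N2" by (rule Gorenstein_projective_iso[OF left(2) N2 isob])
  have "Gorenstein_projective R N0"
  proof (rule Gorenstein_projective_coinduct[where \<C> = "\<lambda>K. Gorenstein_projective R K \<or> K = N0"])
    fix K :: "('r, nat \<Rightarrow> 'r) module" assume "Gorenstein_projective R K \<or> K = N0"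
    then show "\<exists>f (P :: ('r, nat \<Rightarrow> 'r) module) g N'. proper_step R K f P g N' \<and> (Gorenstein_projective R N' \<or> N' = N0)"
      using r GP1 Gorenstein_projective_steps(1)[of R K] by metis
  next
    fix K :: "('r, nat \<Rightarrow> 'r) module" assume "Gorenstein_projective R K \<or> K = N0"
    then show "\<exists>N' f (P :: ('r, nat \<Rightarrow> 'r) module) g. proper_step R N' f P g K \<and> (Gorenstein_projective R N' \<or> N' = N0)"
      using l GP2 Gorenstein_projective_steps(2)[of R K] by metis
  qed simp
  then show ?thesis by (rule Gorenstein_projective_iso[OF _ S(3) iso'])
qed

section \<open>Finitely generated projective modules\<close>

lemma regular_module_simps [simp]:
  "carrier (regular_module R) = carrier R" "\<zero>\<^bsub>regular_module R\<^esub> = \<zero>\<^bsub>R\<^esub>"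
  "x \<oplus>\<^bsub>regular_module R\<^esub> y = x \<oplus>\<^bsub>R\<^esub> y" "r \<odot>\<^bsub>regular_module R\<^esub> x = r \<otimes>\<^bsub>R\<^esub> x"
  by (simp_all add: regular_module_def)

lemma finitely_generated_free_lift:
  assumes "left_module R M" "finitely_generated R M"
  obtains n :: nat and s where "s \<in> {..<n} \<rightarrow> carrier M"
    "free_lift R M s ` carrier (free_module R {..<n}) = carrier M"
proof -
  interpret M: left_module R M by fact
  obtain S where S: "finite S" "S \<subseteq> carrier M"
    "\<And>H. submodule H R M \<Longrightarrow> S \<subseteq> H \<Longrightarrow> H = carrier M"
    using assms(2) by (auto simp: finitely_generated_def)
  obtain n and s :: "nat \<Rightarrow> _" where s: "S = s ` {i. i < n}"
    using S(1) by (metis finite_imp_nat_seg_image_inj_on)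
  let ?F = "free_module R {..<n}"
  have sM: "s \<in> {..<n} \<rightarrow> carrier M" using S(2) s by auto
  have "free_lift R M s ` carrier ?F = carrier M"
  proof (rule S(3))
    show "submodule (free_lift R M s ` carrier ?F) R M"
      by (rule submodule_image[OF left_module_free_module[OF M.R.ring_axioms] assms(1) free_lift_hom[OF assms(1) sM]])
    show "S \<subseteq> free_lift R M s ` carrier ?F"
    proof
      fix x assume "x \<in> S"
      then obtain j where j: "j < n" "x = s j" using s by auto
      let ?d = "\<lambda>i. if i = j then \<one>\<^bsub>R\<^esub> else \<zero>\<^bsub>R\<^esub>"
      have d: "?d \<in> carrier ?F" using j by (auto simp: free_module_def)
      have "free_lift R M s ?d = (\<Oplus>\<^bsub>M\<^esub>i \<in> {j}. ?d i \<odot>\<^bsub>M\<^esub> s i)"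
        by (rule free_lift_superset[OF assms(1) sM d]) (use j in auto)
      also have "\<dots> = x" using j funcset_mem[OF sM, of j] by simp
      finally show "x \<in> free_lift R M s ` carrier ?F" using d by (metis image_eqI)
    qed
  qed
  with sM show ?thesis by (rule that)
qed

text \<open>The coordinates \<xi> and the elements p exhibit P as a direct summand of a free module
  of rank n. For \<open>op_ring B\<close> and \<open>right_part M\<close> these are the coordinates
  of M as a right B-module.\<close>

definition dual_basis ::
  "('r, 'q) ring_scheme \<Rightarrow> ('r, 'm, 'c) module_scheme \<Rightarrow> nat \<Rightarrow> (nat \<Rightarrow> 'm) \<Rightarrow> (nat \<Rightarrow> 'm \<Rightarrow> 'r) \<Rightarrow> bool"
  where "dual_basis R P n p \<xi> \<longleftrightarrow>
    (\<forall>i < n. p i \<in> carrier P \<and> \<xi> i \<in> module_hom R P (regular_module R)) \<and>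
    (\<forall>x \<in> carrier P. (\<Oplus>\<^bsub>P\<^esub>i \<in> {..<n}. \<xi> i x \<odot>\<^bsub>P\<^esub> p i) = x)"

lemma dual_basisD:
  assumes "dual_basis R P n p \<xi>"
  shows "\<And>i. i < n \<Longrightarrow> p i \<in> carrier P" "\<And>i. i < n \<Longrightarrow> \<xi> i \<in> module_hom R P (regular_module R)"
    "\<And>x. x \<in> carrier P \<Longrightarrow> (\<Oplus>\<^bsub>P\<^esub>i \<in> {..<n}. \<xi> i x \<odot>\<^bsub>P\<^esub> p i) = x"
  using assms by (auto simp: dual_basis_def)

text \<open>Projectivity splits the surjection from a free module of finite rank given by generators
  of P; the components of the splitting are the coordinates.\<close>

lemma projective_dual_basis:
  assumes "projective_module R P" "finitely_generated R P"
  obtains n p \<xi> where "dual_basis R P n p \<xi>"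
proof -
  have L: "left_module R P" using assms(1) by (simp add: projective_module_def)
  interpret P: left_module R P by fact
  obtain n and s where s: "s \<in> {..<n::nat} \<rightarrow> carrier P"
    and onto: "free_lift R P s ` carrier (free_module R {..<n}) = carrier P"
    by (rule finitely_generated_free_lift[OF L assms(2)])
  let ?F = "free_module R {..<n}"
  have F: "left_module R ?F" by (rule left_module_free_module[OF P.R.ring_axioms])
  obtain h where h: "h \<in> module_hom R P ?F" "\<And>x. x \<in> carrier P \<Longrightarrow> free_lift R P s (h x) = x"
    using projective_module_lift[OF assms(1) F L free_lift_hom[OF L s] onto module_hom_id] by blast
  have hc: "h x i \<in> carrier R" if "x \<in> carrier P" for x i
    using module_homD(1)[OF h(1) that] by (simp add: free_module_def)
  have "dual_basis R P n s (\<lambda>i x. h x i)"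
    unfolding dual_basis_def
  proof (intro conjI allI impI ballI)
    fix i assume "i < n"
    then show "s i \<in> carrier P" using s by auto
    show "(\<lambda>x. h x i) \<in> module_hom R P (regular_module R)"
      by (rule module_homI) (simp_all add: hc module_homD[OF h(1)], simp_all add: free_module_def)
  next
    fix x assume x: "x \<in> carrier P"
    have hx: "h x \<in> carrier ?F" by (rule module_homD(1)[OF h(1) x])
    then have "free_lift R P s (h x) = (\<Oplus>\<^bsub>P\<^esub>i \<in> {..<n}. h x i \<odot>\<^bsub>P\<^esub> s i)"
      by (intro free_lift_superset[OF L s]) (auto simp: free_module_def)
    with h(2)[OF x] show "(\<Oplus>\<^bsub>P\<^esub>i \<in> {..<n}. h x i \<odot>\<^bsub>P\<^esub> s i) = x" by simp
  qed
  then show ?thesis by (rule that)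
qed

lemma module_hom_finsum_map:
  assumes L: "left_module R M" "left_module R N" and f: "\<And>i. i \<in> I \<Longrightarrow> f i \<in> module_hom R M N"
  shows "(\<lambda>x. \<Oplus>\<^bsub>N\<^esub>i \<in> I. f i x) \<in> module_hom R M N"
proof -
  interpret M: left_module R M by fact
  interpret N: left_module R N by fact
  show ?thesis
  proof (rule module_homI)
    fix x assume x: "x \<in> carrier M"
    show "(\<Oplus>\<^bsub>N\<^esub>i \<in> I. f i x) \<in> carrier N"
      by (rule N.M.finsum_closed) (use module_homD(1)[OF f] x in auto)
    fix r assume r: "r \<in> carrier R"
    have "(\<Oplus>\<^bsub>N\<^esub>i \<in> I. f i (r \<odot>\<^bsub>M\<^esub> x)) = (\<Oplus>\<^bsub>N\<^esub>i \<in> I. r \<odot>\<^bsub>N\<^esub> f i x)"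
      by (rule N.M.finsum_cong') (use module_homD[OF f] x r in auto)
    then show "(\<Oplus>\<^bsub>N\<^esub>i \<in> I. f i (r \<odot>\<^bsub>M\<^esub> x)) = r \<odot>\<^bsub>N\<^esub> (\<Oplus>\<^bsub>N\<^esub>i \<in> I. f i x)"
      using N.smult_finsum[OF r, of "\<lambda>i. f i x" I] module_homD(1)[OF f] x by auto
  next
    fix x y assume xy: "x \<in> carrier M" "y \<in> carrier M"
    have "(\<Oplus>\<^bsub>N\<^esub>i \<in> I. f i (x \<oplus>\<^bsub>M\<^esub> y)) = (\<Oplus>\<^bsub>N\<^esub>i \<in> I. f i x \<oplus>\<^bsub>N\<^esub> f i y)"
      by (rule N.M.finsum_cong') (use module_homD[OF f] xy in auto)
    also have "\<dots> = (\<Oplus>\<^bsub>N\<^esub>i \<in> I. f i x) \<oplus>\<^bsub>N\<^esub> (\<Oplus>\<^bsub>N\<^esub>i \<in> I. f i y)"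
      by (rule N.M.finsum_addf) (use module_homD(1)[OF f] xy in auto)
    finally show "(\<Oplus>\<^bsub>N\<^esub>i \<in> I. f i (x \<oplus>\<^bsub>M\<^esub> y)) = (\<Oplus>\<^bsub>N\<^esub>i \<in> I. f i x) \<oplus>\<^bsub>N\<^esub> (\<Oplus>\<^bsub>N\<^esub>i \<in> I. f i y)" .
  qed
qed

lemma module_hom_smult_right:
  assumes "left_module R N" "\<xi> \<in> module_hom R M (regular_module R)" "y \<in> carrier N"
  shows "(\<lambda>x. \<xi> x \<odot>\<^bsub>N\<^esub> y) \<in> module_hom R M N"
proof -
  interpret N: left_module R N by fact
  show ?thesis
    using module_homD[OF assms(2)] assms(3)
    by (intro module_homI) (auto simp: N.smult_l_distr N.smult_assoc1)
qed

text \<open>Each coordinate of a Z-valued map is a functional and can be extended separately; the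
  extensions are reassembled with the dual basis of Z. Thus the single condition on the regular
  module covers all finitely generated projective targets.\<close>

lemma extends_along_dual_basis:
  assumes ext: "extends_along R K f X (regular_module R)"
    and L: "left_module R K" "left_module R X" "left_module R Z" and f: "f \<in> module_hom R K X"
    and db: "dual_basis R Z n p \<xi>"
  shows "extends_along R K f X Z"
proof (rule extends_alongI)
  note D = dual_basisD[OF db]
  interpret X: left_module R X by fact
  interpret Z: left_module R Z by fact
  fix h assume h: "h \<in> module_hom R K Z"
  have "\<exists>k \<in> module_hom R X (regular_module R). \<forall>x \<in> carrier K. k (f x) = \<xi> i (h x)" if "i < n" for i
    using ext module_hom_comp[OF h D(2)[OF that]] by (auto simp: extends_along_def)
  then obtain k where k: "\<And>i. i < n \<Longrightarrow> k i \<in> module_hom R X (regular_module R)"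
    "\<And>i x. \<lbrakk>i < n; x \<in> carrier K\<rbrakk> \<Longrightarrow> k i (f x) = \<xi> i (h x)"
    by metis
  have hom: "(\<lambda>x. \<Oplus>\<^bsub>Z\<^esub>i \<in> {..<n}. k i x \<odot>\<^bsub>Z\<^esub> p i) \<in> module_hom R X Z"
    by (rule module_hom_finsum_map[OF L(2,3) module_hom_smult_right[OF L(3)]]) (use k(1) D(1) in auto)
  have "(\<Oplus>\<^bsub>Z\<^esub>i \<in> {..<n}. k i (f x) \<odot>\<^bsub>Z\<^esub> p i) = h x" if "x \<in> carrier K" for x
  proof -
    have "(\<Oplus>\<^bsub>Z\<^esub>i \<in> {..<n}. k i (f x) \<odot>\<^bsub>Z\<^esub> p i) = (\<Oplus>\<^bsub>Z\<^esub>i \<in> {..<n}. \<xi> i (h x) \<odot>\<^bsub>Z\<^esub> p i)"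
      by (rule Z.M.finsum_cong')
        (use k(2) that D(1) module_homD(1)[OF D(2) module_homD(1)[OF h that]] in auto)
    then show ?thesis using D(3)[OF module_homD(1)[OF h that]] by simp
  qed
  then show "\<exists>k \<in> module_hom R X Z. \<forall>x \<in> carrier K. k (f x) = h x"
    by (intro bexI[OF _ hom] ballI)
qed

section \<open>Direct sums, direct summands and finite generation of extensions\<close>

definition module_sum ::
  "('r, 'm, 'c) module_scheme \<Rightarrow> ('r, 'n, 'd) module_scheme \<Rightarrow> ('r, 'm \<times> 'n) module"
  where "module_sum M N =
    \<lparr>carrier = carrier M \<times> carrier N, mult = undefined, one = undefined,
     ring.zero = (\<zero>\<^bsub>M\<^esub>, \<zero>\<^bsub>N\<^esub>), ring.add = (\<lambda>(x, y) (x', y'). (x \<oplus>\<^bsub>M\<^esub> x', y \<oplus>\<^bsub>N\<^esub> y')),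
     smult = (\<lambda>r (x, y). (r \<odot>\<^bsub>M\<^esub> x, r \<odot>\<^bsub>N\<^esub> y))\<rparr>"

lemma module_sum_simps [simp]:
  "carrier (module_sum M N) = carrier M \<times> carrier N" "\<zero>\<^bsub>module_sum M N\<^esub> = (\<zero>\<^bsub>M\<^esub>, \<zero>\<^bsub>N\<^esub>)"
  "z \<oplus>\<^bsub>module_sum M N\<^esub> w = (fst z \<oplus>\<^bsub>M\<^esub> fst w, snd z \<oplus>\<^bsub>N\<^esub> snd w)"
  "r \<odot>\<^bsub>module_sum M N\<^esub> z = (r \<odot>\<^bsub>M\<^esub> fst z, r \<odot>\<^bsub>N\<^esub> snd z)"
  by (auto simp: module_sum_def split: prod.splits)

lemma left_module_module_sum:
  assumes "left_module R M" "left_module R N"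
  shows "left_module R (module_sum M N)"
proof -
  interpret M: left_module R M by fact
  interpret N: left_module R N by fact
  show ?thesis
  proof (rule left_moduleI[OF M.R.ring_axioms])
    show "abelian_group (module_sum M N)"
    proof (rule abelian_groupI)
      fix z assume "z \<in> carrier (module_sum M N)"
      then show "\<exists>w \<in> carrier (module_sum M N). w \<oplus>\<^bsub>module_sum M N\<^esub> z = \<zero>\<^bsub>module_sum M N\<^esub>"
        by (intro bexI[of _ "(\<ominus>\<^bsub>M\<^esub> fst z, \<ominus>\<^bsub>N\<^esub> snd z)"]) (auto simp: M.M.l_neg N.M.l_neg)
    qed (auto simp: M.M.a_ac N.M.a_ac)
  qed (auto simp: M.smult_l_distr M.smult_r_distr M.smult_assoc1 N.smult_l_distr N.smult_r_distr N.smult_assoc1)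
qed

lemma module_hom_fst: "fst \<in> module_hom R (module_sum M N) M"
  and module_hom_snd: "snd \<in> module_hom R (module_sum M N) N"
  by (auto intro!: module_homI)

lemma module_hom_pair:
  "\<lbrakk>f \<in> module_hom R L M; g \<in> module_hom R L N\<rbrakk> \<Longrightarrow> (\<lambda>x. (f x, g x)) \<in> module_hom R L (module_sum M N)"
  by (rule module_homI) (simp_all add: module_homD)

lemma module_hom_inl: "left_module R N \<Longrightarrow> (\<lambda>x. (x, \<zero>\<^bsub>N\<^esub>)) \<in> module_hom R M (module_sum M N)"
  by (intro module_hom_pair module_hom_id module_hom_zero_map)

lemma module_hom_inr: "left_module R M \<Longrightarrow> (\<lambda>x. (\<zero>\<^bsub>M\<^esub>, x)) \<in> module_hom R N (module_sum M N)"
  by (intro module_hom_pair module_hom_id module_hom_zero_map)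

lemma module_hom_copair:
  assumes "left_module R M" "left_module R N" "left_module R L" "f \<in> module_hom R M L" "g \<in> module_hom R N L"
  shows "(\<lambda>z. f (fst z) \<oplus>\<^bsub>L\<^esub> g (snd z)) \<in> module_hom R (module_sum M N) L"
  by (rule module_hom_add[OF left_module_module_sum[OF assms(1,2)] assms(3)
        module_hom_comp[OF module_hom_fst assms(4)] module_hom_comp[OF module_hom_snd assms(5)]])

lemma short_exact_module_sum:
  assumes "left_module R M" "left_module R N"
  shows "short_exact R M (\<lambda>x. (x, \<zero>\<^bsub>N\<^esub>)) (module_sum M N) snd N"
proof -
  interpret M: left_module R M by fact
  show ?thesis
    by (rule short_exactI[OF assms(1) left_module_module_sum[OF assms] assms(2) module_hom_inl[OF assms(2)] module_hom_snd])
      (auto intro!: bexI[of _ "(\<zero>\<^bsub>M\<^esub>, c)" for c])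
qed

text \<open>The definition tests the sum against modules on types built from
  \<open>'m \<times> 'n\<close>, on which the definitions for P and Q say nothing directly;
  \<open>projective_module_lift\<close> bridges this. The lifts on the two summands are then
  added.\<close>

lemma projective_module_sum:
  fixes P :: "('r, 'm, 'c) module_scheme" and Q :: "('r, 'n, 'd) module_scheme"
  assumes "projective_module R P" "projective_module R Q"
  shows "projective_module R (module_sum P Q)"
proof -
  have L: "left_module R P" "left_module R Q" using assms by (simp_all add: projective_module_def)
  interpret P: left_module R P by (rule L)
  interpret Q: left_module R Q by (rule L)
  show ?thesis
    unfolding projective_module_def
  proof (intro conjI allI impI left_module_module_sum[OF L]; elim conjE)
    fix N :: "('r, 'm \<times> 'n \<Rightarrow> 'r) module" and N' :: "('r, 'm \<times> 'n) module" and g f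
    assume *: "left_module R N" "left_module R N'" "g \<in> module_hom R N N'"
      "g ` carrier N = carrier N'" "f \<in> module_hom R (module_sum P Q) N'"
    obtain a where a: "a \<in> module_hom R P N" "\<And>x. x \<in> carrier P \<Longrightarrow> g (a x) = f (x, \<zero>\<^bsub>Q\<^esub>)"
      using projective_module_lift[OF assms(1) *(1-4) module_hom_comp[OF module_hom_inl[OF L(2)] *(5)]] by blast
    obtain b where b: "b \<in> module_hom R Q N" "\<And>x. x \<in> carrier Q \<Longrightarrow> g (b x) = f (\<zero>\<^bsub>P\<^esub>, x)"
      using projective_module_lift[OF assms(2) *(1-4) module_hom_comp[OF module_hom_inr[OF L(1)] *(5)]] by blast
    have "g (a (fst z) \<oplus>\<^bsub>N\<^esub> b (snd z)) = f z" if "z \<in> carrier (module_sum P Q)" for z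
    proof -
      have z: "fst z \<in> carrier P" "snd z \<in> carrier Q" using that by auto
      have "g (a (fst z) \<oplus>\<^bsub>N\<^esub> b (snd z)) = f (fst z, \<zero>\<^bsub>Q\<^esub>) \<oplus>\<^bsub>N'\<^esub> f (\<zero>\<^bsub>P\<^esub>, snd z)"
        using z by (simp add: module_homD(2)[OF *(3)] module_homD(1)[OF a(1)] module_homD(1)[OF b(1)] a(2) b(2))
      also have "\<dots> = f ((fst z, \<zero>\<^bsub>Q\<^esub>) \<oplus>\<^bsub>module_sum P Q\<^esub> (\<zero>\<^bsub>P\<^esub>, snd z))"
        using z by (intro module_homD(2)[OF *(5), symmetric]) auto
      finally show ?thesis using z by simp
    qed
    then show "\<exists>h \<in> module_hom R (module_sum P Q) N. \<forall>x \<in> carrier (module_sum P Q). g (h x) = f x"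
      by (intro bexI[OF _ module_hom_copair[OF L *(1) a(1) b(1)]] ballI)
  qed
qed

lemma projective_retract:
  fixes Q :: "('r, 'n, 'd) module_scheme"
  assumes P: "projective_module R P" and Q: "left_module R Q"
    and i: "i \<in> module_hom R Q P" and r: "r \<in> module_hom R P Q"
    and ri: "\<And>x. x \<in> carrier Q \<Longrightarrow> r (i x) = x"
  shows "projective_module R Q"
  unfolding projective_module_def
proof (intro conjI allI impI Q; elim conjE)
  fix N :: "('r, 'n \<Rightarrow> 'r) module" and N' :: "('r, 'n) module" and g f
  assume *: "left_module R N" "left_module R N'" "g \<in> module_hom R N N'"
    "g ` carrier N = carrier N'" "f \<in> module_hom R Q N'"
  obtain h where h: "h \<in> module_hom R P N" "\<And>x. x \<in> carrier P \<Longrightarrow> g (h x) = f (r x)"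
    using projective_module_lift[OF P *(1-4) module_hom_comp[OF r *(5)]] by blast
  have "g (h (i x)) = f x" if "x \<in> carrier Q" for x
    using h(2)[OF module_homD(1)[OF i that]] ri[OF that] by simp
  with module_hom_comp[OF i h(1)] show "\<exists>h \<in> module_hom R Q N. \<forall>x \<in> carrier Q. g (h x) = f x"
    by (intro bexI[of _ "\<lambda>x. h (i x)"]) auto
qed

text \<open>Generators of K together with lifts of generators of C suffice: a submodule H containing
  them contains the image of K and maps onto C, so each x differs from an element of H by an element
  of that image.\<close>

lemma finitely_generated_extension:
  assumes S: "short_exact R K f X g C" and K: "finitely_generated R K" and C: "finitely_generated R C"
  shows "finitely_generated R X"
proof -
  note L = short_exactD[OF S]
  interpret X: left_module R X by (rule L(2))
  obtain U where U: "finite U" "U \<subseteq> carrier K" "\<And>H. submodule H R K \<Longrightarrow> U \<subseteq> H \<Longrightarrow> H = carrier K"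
    using K by (auto simp: finitely_generated_def)
  obtain V where V: "finite V" "V \<subseteq> carrier C" "\<And>H. submodule H R C \<Longrightarrow> V \<subseteq> H \<Longrightarrow> H = carrier C"
    using C by (auto simp: finitely_generated_def)
  have "\<exists>x. x \<in> carrier X \<and> g x = c" if "c \<in> V" for c
    using short_exact_surjE[OF S, of c] V(2) that by (metis subsetD)
  then obtain l where l: "\<And>c. c \<in> V \<Longrightarrow> l c \<in> carrier X" "\<And>c. c \<in> V \<Longrightarrow> g (l c) = c"
    by metis
  have "H = carrier X" if H: "submodule H R X" "f ` U \<union> l ` V \<subseteq> H" for H
  proof -
    interpret H: submodule H R X by (rule H)
    have HX: "H \<subseteq> carrier X" using H.subset by simp
    have "{x \<in> carrier K. f x \<in> H} = carrier K"
      by (rule U(3)[OF left_module.submodule_vimage[OF L(1,2,4) H(1)]]) (use U(2) H(2) in auto)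
    then have fK: "f x \<in> H" if "x \<in> carrier K" for x using that by blast
    have "g ` H = carrier C"
    proof (rule V(3))
      have "left_module R (X\<lparr>carrier := H\<rparr>)" by (rule left_module_restrict[OF L(2) H(1)])
      moreover have "g \<in> module_hom R (X\<lparr>carrier := H\<rparr>) C"
        using HX by (intro module_homI) (auto simp: module_homD[OF L(5)] subset_iff)
      ultimately show "submodule (g ` H) R C"
        using submodule_image[of R "X\<lparr>carrier := H\<rparr>" C g] L(3) by simp
      show "V \<subseteq> g ` H" using l H(2) by force
    qed
    have "x \<in> H" if x: "x \<in> carrier X" for x
    proof -
      have "g x \<in> g ` H" using module_homD(1)[OF L(5) x] \<open>g ` H = carrier C\<close> by simp
      then obtain h where h: "h \<in> H" "g x = g h" by (rule imageE)
      have hX: "h \<in> carrier X" using h HX by auto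
      have "g (x \<ominus>\<^bsub>X\<^esub> h) = \<zero>\<^bsub>C\<^esub>" using h x hX by (simp flip: module_hom_eq_iff[OF L(2,3,5)])
      then obtain k where k: "k \<in> carrier K" "x \<ominus>\<^bsub>X\<^esub> h = f k"
        by (rule short_exact_kernelE[OF S X.M.minus_closed[OF x hX]])
      have "x = (x \<ominus>\<^bsub>X\<^esub> h) \<oplus>\<^bsub>X\<^esub> h" using x hX by (simp add: a_minus_def X.M.a_assoc X.M.l_neg)
      then show ?thesis using H.m_closed[OF fK[OF k(1)] h(1)] by (simp add: k(2))
    qed
    with HX show ?thesis by auto
  qed
  moreover have "finite (f ` U \<union> l ` V)" using U(1) V(1) by simp
  moreover have "f ` U \<union> l ` V \<subseteq> carrier X"
    using U(2) l(1) module_homD(1)[OF L(4)] by blast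
  ultimately show ?thesis
    unfolding finitely_generated_def by (intro exI[of _ "f ` U \<union> l ` V"]) simp
qed

lemma finitely_generated_module_sum:
  assumes "left_module R M" "left_module R N" "finitely_generated R M" "finitely_generated R N"
  shows "finitely_generated R (module_sum M N)"
  by (rule finitely_generated_extension[OF short_exact_module_sum[OF assms(1,2)] assms(3,4)])

section \<open>Extensions of Gorenstein-projective modules\<close>

lemma projective_section:
  assumes "projective_module R P" "left_module R X" "left_module R C"
    and "g \<in> module_hom R X C" "g ` carrier X = carrier C" "f \<in> module_hom R P C"
  obtains s where "s \<in> module_hom R P X" "\<And>x. x \<in> carrier P \<Longrightarrow> g (s x) = f x"
  using projective_module_lift[OF assms] by (auto simp: Bex_def)

text \<open>\<open>Ext\<^sup>1\<close> of \<open>C\<close> may be computed from any projective presentation.\<close>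

lemma extends_along_presentation:
  assumes X: "short_exact R K f X g C" and P: "short_exact R C' \<iota> P \<pi> C" "projective_module R P"
    and Z: "left_module R Z" and ext: "extends_along R C' \<iota> P Z"
  shows "extends_along R K f X Z"
proof (rule extends_alongI)
  fix h assume h: "h \<in> module_hom R K Z"
  note x = short_exactD[OF X] and p = short_exactD[OF P(1)]
  interpret X: left_module R X by (rule x)
  interpret K: left_module R K by (rule x)
  interpret Z: left_module R Z by (rule Z)
  interpret P: left_module R P by (rule p)
  obtain s where s: "s \<in> module_hom R P X" "\<And>y. y \<in> carrier P \<Longrightarrow> g (s y) = \<pi> y"
    using projective_section[OF P(2) x(2,3,5,7) p(5)] by metis
  have "s (\<iota> c) \<in> f ` carrier K" if c: "c \<in> carrier C'" for c
    using module_homD(1)[OF p(4) c] by (intro x(9) module_homD(1)[OF s(1)]) (simp_all add: s(2) p(8) c)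
  then obtain t where t: "t \<in> module_hom R C' K" "\<And>c. c \<in> carrier C' \<Longrightarrow> f (t c) = s (\<iota> c)"
    using factor_inj[OF x(1) p(1) x(4,6) module_hom_comp[OF p(4) s(1)]] by metis
  obtain k where k: "k \<in> module_hom R P Z" "\<And>c. c \<in> carrier C' \<Longrightarrow> k (\<iota> c) = h (t c)"
    using extends_alongE[OF ext module_hom_comp[OF t(1) h]] by metis
  \<comment> \<open>X is the pushout of K and P along C': the map \<open>?a\<close> is onto with
    kernel the pairs (u, \<iota> d) with u + t d = 0, and \<open>?b\<close> kills these because k
    \<iota> = h t. So \<open>?b\<close> descends to the extension of h.\<close>
  let ?a = "\<lambda>z. f (fst z) \<oplus>\<^bsub>X\<^esub> s (snd z)" and ?b = "\<lambda>z. h (fst z) \<oplus>\<^bsub>Z\<^esub> k (snd z)"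
  have a: "?a \<in> module_hom R (module_sum K P) X" by (rule module_hom_copair[OF x(1) p(2) x(2) x(4) s(1)])
  have b: "?b \<in> module_hom R (module_sum K P) Z" by (rule module_hom_copair[OF x(1) p(2) Z h k(1)])
  have onto: "?a ` carrier (module_sum K P) = carrier X"
  proof (rule subset_antisym)
    show "?a ` carrier (module_sum K P) \<subseteq> carrier X" using module_homD(1)[OF a] by blast
    show "carrier X \<subseteq> ?a ` carrier (module_sum K P)"
    proof
      fix y assume y: "y \<in> carrier X"
      obtain q where q: "q \<in> carrier P" "g y = \<pi> q"
        by (rule short_exact_surjE[OF P(1) module_homD(1)[OF x(5) y]])
      have sq: "s q \<in> carrier X" by (rule module_homD(1)[OF s(1) q(1)])
      have "g (y \<ominus>\<^bsub>X\<^esub> s q) = \<zero>\<^bsub>C\<^esub>" using y sq q s(2) by (simp flip: module_hom_eq_iff[OF x(2,3,5)])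
      then obtain u where u: "u \<in> carrier K" "y \<ominus>\<^bsub>X\<^esub> s q = f u"
        by (rule short_exact_kernelE[OF X X.M.minus_closed[OF y sq]])
      have "y = (y \<ominus>\<^bsub>X\<^esub> s q) \<oplus>\<^bsub>X\<^esub> s q" using y sq by (simp add: a_minus_def X.M.a_assoc X.M.l_neg)
      then have "y = ?a (u, q)" by (simp add: u(2))
      then show "y \<in> ?a ` carrier (module_sum K P)" using u(1) q(1) by (intro image_eqI) auto
    qed
  qed
  obtain e where e: "e \<in> module_hom R X Z" "\<And>z. z \<in> carrier (module_sum K P) \<Longrightarrow> e (?a z) = ?b z"
  proof (rule factor_surj[OF left_module_module_sum[OF x(1) p(2)] x(2) Z a onto b])
    fix z assume z: "z \<in> carrier (module_sum K P)" "?a z = \<zero>\<^bsub>X\<^esub>"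
    obtain u q where uq: "z = (u, q)" "u \<in> carrier K" "q \<in> carrier P" using z(1) by auto
    have c: "f u \<in> carrier X" "s q \<in> carrier X"
      by (rule module_homD(1)[OF x(4) uq(2)], rule module_homD(1)[OF s(1) uq(3)])
    have "g (f u \<oplus>\<^bsub>X\<^esub> s q) = \<zero>\<^bsub>C\<^esub>" using z(2) uq(1) module_hom_zero[OF x(2,3,5)] by simp
    then have "\<pi> q = \<zero>\<^bsub>C\<^esub>"
      using c uq module_homD(1)[OF p(5) uq(3)] left_module.axioms(2)[OF x(3)] x(8)[OF uq(2)] s(2)[OF uq(3)]
      by (simp add: module_homD(2)[OF x(5)] abelian_group_def abelian_monoid.l_zero)
    then obtain d where d: "d \<in> carrier C'" "q = \<iota> d" by (rule short_exact_kernelE[OF P(1) uq(3)])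
    have td: "t d \<in> carrier K" by (rule module_homD(1)[OF t(1) d(1)])
    have "f (u \<oplus>\<^bsub>K\<^esub> t d) = \<zero>\<^bsub>X\<^esub>"
      using z(2) uq td d t(2) by (simp add: module_homD(2)[OF x(4)])
    then have "u \<oplus>\<^bsub>K\<^esub> t d = \<zero>\<^bsub>K\<^esub>" by (intro module_hom_injD[OF x(1,2,4,6)] K.M.a_closed uq td)
    then have "h u \<oplus>\<^bsub>Z\<^esub> h (t d) = \<zero>\<^bsub>Z\<^esub>"
      using uq td module_hom_zero[OF x(1) Z h] by (simp flip: module_homD(2)[OF h])
    then show "?b z = \<zero>\<^bsub>Z\<^esub>" using uq d k(2) by simp
  qed blast
  have "e (f y) = h y" if y: "y \<in> carrier K" for y
    using e(2)[of "(y, \<zero>\<^bsub>P\<^esub>)"] y module_homD(1)[OF x(4) y] module_homD(1)[OF h y]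
    by (simp add: module_hom_zero[OF p(2) x(2) s(1)] module_hom_zero[OF p(2) Z k(1)])
  then show "\<exists>k \<in> module_hom R X Z. \<forall>x \<in> carrier K. k (f x) = h x"
    by (intro bexI[OF _ e(1)] ballI)
qed

text \<open>A left step of C is a projective presentation along which all functionals extend, and
  \<open>extends_along_presentation\<close> carries this over to every short exact sequence ending
  in C.\<close>

lemma Gorenstein_projective_extends:
  fixes R :: "('r, 'q) ring_scheme"
  assumes "short_exact R K f X g C" "Gorenstein_projective R C"
  shows "extends_along R K f X (regular_module R)"
proof -
  obtain C' :: "('r, nat \<Rightarrow> 'r) module" and \<iota> and P :: "('r, nat \<Rightarrow> 'r) module" and \<pi>
    where step: "proper_step R C' \<iota> P \<pi> C" using Gorenstein_projective_steps(2)[OF assms(2)] by blast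
  show ?thesis
    by (rule extends_along_presentation[OF assms(1) proper_stepD(1,2)[OF step] _ proper_stepD(4)[OF step]])
      (rule left_module_regular, use short_exactD(1)[OF assms(1)] in \<open>simp add: left_module_def\<close>)
qed

lemma Gorenstein_projective_extends_dual_basis:
  assumes "short_exact R K f X g C" "Gorenstein_projective R C" "left_module R Z" "dual_basis R Z n p \<xi>"
  shows "extends_along R K f X Z"
  using short_exactD[OF assms(1)] assms(3,4) Gorenstein_projective_extends[OF assms(1,2)]
  by (intro extends_along_dual_basis[OF _ _ _ _ _ assms(4)])

text \<open>The horseshoe lemma for embeddings, in which an extension \<alpha> of \<iota> to X
  stands in for injectivity of S. The pair of \<alpha> and j p embeds X into the sum; its cokernel
  has K' as submodule and C' as quotient. The last conclusion, an explicit formula for \<phi>', is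
  what later identifies structure maps of triples.\<close>

lemma horseshoe_right:
  assumes X: "short_exact R K \<phi> X p C" and S: "short_exact R K \<iota> S \<kappa> K'" and P: "short_exact R C j P q C'"
    and a: "\<alpha> \<in> module_hom R X S" "\<And>k. k \<in> carrier K \<Longrightarrow> \<alpha> (\<phi> k) = \<iota> k"
  defines "u \<equiv> \<lambda>x. (\<alpha> x, j (p x))"
  defines "X' \<equiv> cokernel_module X (module_sum S P) u"
  obtains v \<phi>' p' where "short_exact R X u (module_sum S P) v X'" "short_exact R K' \<phi>' X' p' C'"
    "\<And>s. s \<in> carrier S \<Longrightarrow> \<phi>' (\<kappa> s) = v (s, \<zero>\<^bsub>P\<^esub>)"
proof -
  note x = short_exactD[OF X] and s = short_exactD[OF S] and c = short_exactD[OF P]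
  interpret S: left_module R S by (rule s)
  interpret P: left_module R P by (rule c)
  let ?E = "module_sum S P"
  have E: "left_module R ?E" by (rule left_module_module_sum[OF s(2) c(2)])
  have pc: "p y \<in> carrier C" if "y \<in> carrier X" for y by (rule module_homD(1)[OF x(5) that])
  have ac: "\<alpha> y \<in> carrier S" if "y \<in> carrier X" for y by (rule module_homD(1)[OF a(1) that])
  have u: "u \<in> module_hom R X ?E"
    unfolding u_def by (rule module_hom_pair[OF a(1) module_hom_comp[OF x(5) c(4)]])
  have u_ker: "\<exists>k \<in> carrier K. y = \<phi> k" if y: "y \<in> carrier X" "j (p y) = \<zero>\<^bsub>P\<^esub>" for y
  proof -
    have "p y = \<zero>\<^bsub>C\<^esub>" by (rule module_hom_injD[OF c(1,2,4,6) pc[OF y(1)] y(2)])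
    then show ?thesis using short_exact_kernelE[OF X y(1)] by metis
  qed
  have "inj_on u (carrier X)"
    unfolding module_hom_inj_iff[OF x(2) E u]
  proof (intro ballI impI)
    fix y assume y: "y \<in> carrier X" "u y = \<zero>\<^bsub>?E\<^esub>"
    then obtain k where k: "k \<in> carrier K" "y = \<phi> k" using u_ker[OF y(1)] by (auto simp: u_def)
    then have "\<iota> k = \<zero>\<^bsub>S\<^esub>" using y(2) by (simp add: u_def a(2))
    then have "k = \<zero>\<^bsub>K\<^esub>" by (rule module_hom_injD[OF s(1,2,4,6) k(1)])
    then show "y = \<zero>\<^bsub>X\<^esub>" using k(2) module_hom_zero[OF x(1,2,4)] by simp
  qed
  from short_exact_cokernel[OF x(2) E u this]
  obtain v where V: "short_exact R X u ?E v X'" unfolding X'_def by blast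
  note v = short_exactD[OF V]
  have vS: "(\<lambda>y. v (y, \<zero>\<^bsub>P\<^esub>)) \<in> module_hom R S X'"
    by (rule module_hom_comp[OF module_hom_inl[OF c(2)] v(5)])
  have u\<phi>: "u (\<phi> k) = (\<iota> k, \<zero>\<^bsub>P\<^esub>)" if "k \<in> carrier K" for k
    using that by (simp add: u_def a(2) x(8) module_hom_zero[OF c(1,2,4)])
  obtain \<phi>' where \<phi>': "\<phi>' \<in> module_hom R K' X'" "\<And>y. y \<in> carrier S \<Longrightarrow> \<phi>' (\<kappa> y) = v (y, \<zero>\<^bsub>P\<^esub>)"
  proof (rule factor_surj[OF s(2,3) v(3) s(5,7) vS])
    fix y assume "y \<in> carrier S" "\<kappa> y = \<zero>\<^bsub>K'\<^esub>"
    then obtain k where k: "k \<in> carrier K" "y = \<iota> k" by (rule short_exact_kernelE[OF S])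
    then show "v (y, \<zero>\<^bsub>P\<^esub>) = \<zero>\<^bsub>X'\<^esub>" using v(8)[OF module_homD(1)[OF x(4) k(1)]] by (simp add: u\<phi>)
  qed blast
  obtain p' where p': "p' \<in> module_hom R X' C'" "\<And>z. z \<in> carrier ?E \<Longrightarrow> p' (v z) = q (snd z)"
  proof (rule factor_surj[OF E v(3) c(3) v(5,7) module_hom_comp[OF module_hom_snd c(5)]])
    fix z assume "z \<in> carrier ?E" "v z = \<zero>\<^bsub>X'\<^esub>"
    then obtain y where y: "y \<in> carrier X" "z = u y" by (rule short_exact_kernelE[OF V])
    then show "q (snd z) = \<zero>\<^bsub>C'\<^esub>" using c(8)[OF pc] by (simp add: u_def)
  qed blast
  have "short_exact R K' \<phi>' X' p' C'"
  proof (rule short_exactI[OF s(3) v(3) c(3) \<phi>'(1) p'(1)])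
    fix k' assume k': "k' \<in> carrier K'" "\<phi>' k' = \<zero>\<^bsub>X'\<^esub>"
    obtain y where y: "y \<in> carrier S" "k' = \<kappa> y" by (rule short_exact_surjE[OF S k'(1)])
    have "v (y, \<zero>\<^bsub>P\<^esub>) = \<zero>\<^bsub>X'\<^esub>" using k'(2) y \<phi>'(2) by simp
    then obtain w where w: "w \<in> carrier X" "(y, \<zero>\<^bsub>P\<^esub>) = u w"
      by (rule short_exact_kernelE[OF V, rotated]) (use y in auto)
    then obtain k where k: "k \<in> carrier K" "w = \<phi> k" using u_ker[OF w(1)] by (auto simp: u_def)
    then show "k' = \<zero>\<^bsub>K'\<^esub>" using w(2) y(2) s(8) by (simp add: u\<phi>)
  next
    fix d assume d: "d \<in> carrier C'"
    obtain b where "b \<in> carrier P" "d = q b" by (rule short_exact_surjE[OF P d])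
    then show "\<exists>w \<in> carrier X'. p' w = d"
      by (intro bexI[OF _ module_homD(1)[OF v(5), of "(\<zero>\<^bsub>S\<^esub>, b)"]]) (simp_all add: p'(2))
  next
    fix k' assume k': "k' \<in> carrier K'"
    obtain y where y: "y \<in> carrier S" "k' = \<kappa> y" by (rule short_exact_surjE[OF S k'])
    then show "p' (\<phi>' k') = \<zero>\<^bsub>C'\<^esub>" by (simp add: \<phi>'(2) p'(2) module_hom_zero[OF c(2,3,5)])
  next
    fix w assume w: "w \<in> carrier X'" "p' w = \<zero>\<^bsub>C'\<^esub>"
    obtain z where z: "z \<in> carrier ?E" "w = v z" by (rule short_exact_surjE[OF V w(1)])
    then have zc: "fst z \<in> carrier S" "snd z \<in> carrier P" by auto
    have "q (snd z) = \<zero>\<^bsub>C'\<^esub>" using w(2) z by (simp add: p'(2))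
    then obtain d where d: "d \<in> carrier C" "snd z = j d" by (rule short_exact_kernelE[OF P zc(2)])
    obtain y where y: "y \<in> carrier X" "d = p y" by (rule short_exact_surjE[OF X d(1)])
    \<comment> \<open>Since \<open>snd z = j (p y)\<close>, subtracting \<open>u y\<close> from z
      leaves a pair with second component zero. The class of z is unchanged and is seen to come from
      S, hence from K'.\<close>
    let ?t = "fst z \<ominus>\<^bsub>S\<^esub> \<alpha> y"
    have t: "?t \<in> carrier S" using zc ac[OF y(1)] by simp
    interpret X': left_module R X' by (rule v(3))
    have z_eq: "z = (?t, \<zero>\<^bsub>P\<^esub>) \<oplus>\<^bsub>?E\<^esub> u y"
      using zc ac[OF y(1)] d(2) y(2)
      by (cases z) (simp add: u_def a_minus_def S.M.a_assoc S.M.l_neg)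
    have "v z = v (?t, \<zero>\<^bsub>P\<^esub>) \<oplus>\<^bsub>X'\<^esub> v (u y)"
      unfolding z_eq[symmetric] by (subst z_eq, rule module_homD(2)[OF v(5)])
        (use t module_homD(1)[OF u y(1)] in auto)
    then have "v z = \<phi>' (\<kappa> ?t)" using v(8)[OF y(1)] module_homD(1)[OF vS t] by (simp add: \<phi>'(2)[OF t])
    then show "\<exists>k \<in> carrier K'. \<phi>' k = w" using module_homD(1)[OF s(5) t] z(2) by auto
  qed
  with V \<phi>'(2) show ?thesis by (intro that)
qed

text \<open>The classical horseshoe: projectivity of P lifts q to a map \<beta> into X, and S
  \<oplus> P maps onto X. The kernel X'' is taken as a restricted carrier, so that its embedding is
  the identity and the components of \<phi>'' and p'' can be stated explicitly.\<close>

lemma horseshoe_left: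
  fixes S :: "('r, 's, 'c) module_scheme" and P :: "('r, 'p, 'd) module_scheme"
  assumes X: "short_exact R K \<phi> X p C" and S: "short_exact R K'' \<iota> S \<kappa> K" and P: "short_exact R C'' j P q C"
    and pr: "projective_module R P"
  obtains \<beta> \<phi>'' p'' and X'' :: "('r, 's \<times> 'p) module" where "\<beta> \<in> module_hom R P X" "\<And>b. b \<in> carrier P \<Longrightarrow> p (\<beta> b) = q b"
    "short_exact R X'' (\<lambda>z. z) (module_sum S P) (\<lambda>z. \<phi> (\<kappa> (fst z)) \<oplus>\<^bsub>X\<^esub> \<beta> (snd z)) X"
    "short_exact R K'' \<phi>'' X'' p'' C''"
    "\<And>k. k \<in> carrier K'' \<Longrightarrow> \<phi>'' k = (\<iota> k, \<zero>\<^bsub>P\<^esub>)" "\<And>x. x \<in> carrier X'' \<Longrightarrow> j (p'' x) = snd x"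
proof -
  note x = short_exactD[OF X] and s = short_exactD[OF S] and c = short_exactD[OF P]
  interpret S: left_module R S by (rule s)
  interpret P: left_module R P by (rule c)
  interpret X: left_module R X by (rule x)
  interpret C: left_module R C by (rule x)
  interpret K: left_module R K by (rule s)
  let ?E = "module_sum S P"
  have E: "left_module R ?E" by (rule left_module_module_sum[OF s(2) c(2)])
  obtain \<beta> where b: "\<beta> \<in> module_hom R P X" "\<And>b. b \<in> carrier P \<Longrightarrow> p (\<beta> b) = q b"
    using projective_section[OF pr x(2,3,5,7) c(5)] by metis
  let ?v = "\<lambda>z. \<phi> (\<kappa> (fst z)) \<oplus>\<^bsub>X\<^esub> \<beta> (snd z)"
  have \<phi>\<kappa>: "(\<lambda>y. \<phi> (\<kappa> y)) \<in> module_hom R S X" by (rule module_hom_comp[OF s(5) x(4)])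
  have v: "?v \<in> module_hom R ?E X" by (rule module_hom_copair[OF s(2) c(2) x(2) \<phi>\<kappa> b(1)])
  have pv: "p (?v z) = q (snd z)" if "z \<in> carrier ?E" for z
  proof -
    have z: "fst z \<in> carrier S" "snd z \<in> carrier P" using that by auto
    show ?thesis
      using module_homD(1)[OF \<phi>\<kappa> z(1)] module_homD(1)[OF b(1) z(2)] x(8)[OF module_homD(1)[OF s(5) z(1)]]
        module_homD(1)[OF c(5) z(2)]
      by (simp add: module_homD(2)[OF x(5)] b(2)[OF z(2)])
  qed
  have onto: "\<exists>a \<in> carrier S. y = ?v (a, d)" if y: "y \<in> carrier X" and d: "d \<in> carrier P" "p y = q d" for y d
  proof -
    have bd: "\<beta> d \<in> carrier X" by (rule module_homD(1)[OF b(1) d(1)])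
    have "p (y \<ominus>\<^bsub>X\<^esub> \<beta> d) = \<zero>\<^bsub>C\<^esub>" using y bd b(2) d by (simp flip: module_hom_eq_iff[OF x(2,3,5)])
    then obtain k where k: "k \<in> carrier K" "y \<ominus>\<^bsub>X\<^esub> \<beta> d = \<phi> k"
      by (rule short_exact_kernelE[OF X X.M.minus_closed[OF y bd]])
    obtain a where a: "a \<in> carrier S" "k = \<kappa> a" by (rule short_exact_surjE[OF S k(1)])
    have "y = (y \<ominus>\<^bsub>X\<^esub> \<beta> d) \<oplus>\<^bsub>X\<^esub> \<beta> d" using y bd by (simp add: a_minus_def X.M.a_assoc X.M.l_neg)
    then show ?thesis using k(2) a by (intro bexI[of _ a]) simp_all
  qed
  have vX: "?v ` carrier ?E = carrier X"
  proof (rule subset_antisym)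
    show "?v ` carrier ?E \<subseteq> carrier X" using module_homD(1)[OF v] by blast
    show "carrier X \<subseteq> ?v ` carrier ?E"
    proof
      fix y assume y: "y \<in> carrier X"
      obtain d where d: "d \<in> carrier P" "p y = q d" by (rule short_exact_surjE[OF P module_homD(1)[OF x(5) y]])
      then obtain a where "a \<in> carrier S" "y = ?v (a, d)" using onto[OF y] by blast
      then show "y \<in> ?v ` carrier ?E" using d by (intro image_eqI[of _ _ "(a, d)"]) auto
    qed
  qed
  define X'' where "X'' = ?E\<lparr>carrier := {z \<in> carrier ?E. ?v z = \<zero>\<^bsub>X\<^esub>}\<rparr>"
  have V: "short_exact R X'' (\<lambda>z. z) ?E ?v X"
    unfolding X''_def by (rule short_exact_kernel[OF E x(2) v vX])
  note w = short_exactD[OF V]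
  have X'': "z \<in> carrier X'' \<longleftrightarrow> fst z \<in> carrier S \<and> snd z \<in> carrier P \<and> ?v z = \<zero>\<^bsub>X\<^esub>"
    "\<zero>\<^bsub>X''\<^esub> = (\<zero>\<^bsub>S\<^esub>, \<zero>\<^bsub>P\<^esub>)" for z
    by (auto simp: X''_def mem_Times_iff)
  have \<iota>0: "(\<iota> k, \<zero>\<^bsub>P\<^esub>) \<in> carrier X''" if k: "k \<in> carrier K''" for k
    using module_homD(1)[OF s(4) k]
    by (simp add: X'' s(8)[OF k] module_hom_zero[OF x(1,2,4)] module_hom_zero[OF c(2) x(2) b(1)])
  obtain \<phi>'' where \<phi>'': "\<phi>'' \<in> module_hom R K'' X''" "\<And>k. k \<in> carrier K'' \<Longrightarrow> \<phi>'' k = (\<iota> k, \<zero>\<^bsub>P\<^esub>)"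
    using factor_inj[OF w(1) s(1) w(4,6) module_hom_pair[OF s(4) module_hom_zero_map[OF c(2)]]] \<iota>0
    by (metis image_eqI)
  have "snd z \<in> j ` carrier C''" if z: "z \<in> carrier X''" for z
    using z pv[of z] module_hom_zero[OF x(2,3,5)] by (intro c(9)) (auto simp: X'' mem_Times_iff)
  then obtain p'' where p'': "p'' \<in> module_hom R X'' C''" "\<And>z. z \<in> carrier X'' \<Longrightarrow> j (p'' z) = snd z"
    using factor_inj[OF c(1) w(1) c(4,6) module_hom_comp[OF w(4) module_hom_snd]] by metis
  have "short_exact R K'' \<phi>'' X'' p'' C''"
  proof (rule short_exactI[OF s(1) w(1) c(1) \<phi>''(1) p''(1)])
    fix k assume k: "k \<in> carrier K''" "\<phi>'' k = \<zero>\<^bsub>X''\<^esub>"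
    show "k = \<zero>\<^bsub>K''\<^esub>"
      by (rule module_hom_injD[OF s(1,2,4,6) k(1)]) (use k \<phi>''(2) in \<open>simp add: X''(2)\<close>)
  next
    fix d assume d: "d \<in> carrier C''"
    have jd: "j d \<in> carrier P" by (rule module_homD(1)[OF c(4) d])
    have "p \<zero>\<^bsub>X\<^esub> = q (j d)" using c(8)[OF d] module_hom_zero[OF x(2,3,5)] by simp
    then obtain a where a: "a \<in> carrier S" "\<zero>\<^bsub>X\<^esub> = ?v (a, j d)" using onto[OF X.M.zero_closed jd] by blast
    then have z: "(a, j d) \<in> carrier X''" using jd unfolding X'' by simp
    have "p'' (a, j d) = d"
      by (rule inj_onD[OF c(6) _ module_homD(1)[OF p''(1) z] d]) (simp add: p''(2)[OF z])
    then show "\<exists>x \<in> carrier X''. p'' x = d" using z by blast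
  next
    fix k assume k: "k \<in> carrier K''"
    show "p'' (\<phi>'' k) = \<zero>\<^bsub>C''\<^esub>"
      by (rule module_hom_injD[OF c(1,2,4,6)])
        (use \<iota>0[OF k] module_homD(1)[OF p''(1) \<iota>0[OF k]] in \<open>simp_all add: \<phi>''(2) k p''(2)\<close>)
  next
    fix z assume z: "z \<in> carrier X''" "p'' z = \<zero>\<^bsub>C''\<^esub>"
    have sz: "snd z = \<zero>\<^bsub>P\<^esub>" using p''(2)[OF z(1)] z(2) module_hom_zero[OF c(1,2,4)] by simp
    have fz: "fst z \<in> carrier S" "?v z = \<zero>\<^bsub>X\<^esub>" using z(1) by (simp_all add: X'')
    have "\<phi> (\<kappa> (fst z)) = \<zero>\<^bsub>X\<^esub>"
      using fz sz module_homD(1)[OF \<phi>\<kappa> fz(1)] by (simp add: module_hom_zero[OF c(2) x(2) b(1)])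
    then have "\<kappa> (fst z) = \<zero>\<^bsub>K\<^esub>" by (rule module_hom_injD[OF x(1,2,4,6) module_homD(1)[OF s(5) fz(1)]])
    then obtain k where k: "k \<in> carrier K''" "fst z = \<iota> k" by (rule short_exact_kernelE[OF S fz(1)])
    then have "\<phi>'' k = z" using sz by (cases z) (simp add: \<phi>''(2))
    then show "\<exists>k \<in> carrier K''. \<phi>'' k = z" using k(1) by blast
  qed
  from that[OF b V this \<phi>''(2) p''(2)] show ?thesis .
qed

text \<open>Extend first the restriction of h to K. The difference between h and this extension
  vanishes on K, hence is a map on C, and extending that one as well corrects the error.\<close>

lemma extends_along_horseshoe:
  assumes X: "short_exact R K \<phi> X p C" and E: "left_module R E" and u: "u \<in> module_hom R X E" and Z: "left_module R Z"
    and K: "extends_along R K (\<lambda>k. u (\<phi> k)) E Z"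
    and C: "\<And>h. h \<in> module_hom R C Z \<Longrightarrow> \<exists>k \<in> module_hom R E Z. \<forall>x \<in> carrier X. k (u x) = h (p x)"
  shows "extends_along R X u E Z"
proof (rule extends_alongI)
  fix h assume h: "h \<in> module_hom R X Z"
  note x = short_exactD[OF X]
  interpret Z: left_module R Z by (rule Z)
  obtain k1 where k1: "k1 \<in> module_hom R E Z" "\<And>k. k \<in> carrier K \<Longrightarrow> k1 (u (\<phi> k)) = h (\<phi> k)"
    using extends_alongE[OF K module_hom_comp[OF x(4) h]] by metis
  have k1u: "(\<lambda>y. k1 (u y)) \<in> module_hom R X Z" by (rule module_hom_comp[OF u k1(1)])
  obtain d where d: "d \<in> module_hom R C Z" "\<And>y. y \<in> carrier X \<Longrightarrow> d (p y) = h y \<ominus>\<^bsub>Z\<^esub> k1 (u y)"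
  proof (rule factor_surj[OF x(2,3) Z x(5,7) module_hom_diff[OF x(2) Z h k1u]])
    fix y assume "y \<in> carrier X" "p y = \<zero>\<^bsub>C\<^esub>"
    then obtain k where k: "k \<in> carrier K" "y = \<phi> k" by (rule short_exact_kernelE[OF X])
    then show "h y \<ominus>\<^bsub>Z\<^esub> k1 (u y) = \<zero>\<^bsub>Z\<^esub>"
      using module_homD(1)[OF h module_homD(1)[OF x(4) k(1)]] by (simp add: k1(2) Z.M.minus_eq_zero_iff)
  qed blast
  obtain k2 where k2: "k2 \<in> module_hom R E Z" "\<And>y. y \<in> carrier X \<Longrightarrow> k2 (u y) = d (p y)"
    using C[OF d(1)] by metis
  have "k1 (u y) \<oplus>\<^bsub>Z\<^esub> k2 (u y) = h y" if y: "y \<in> carrier X" for y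
    using module_homD(1)[OF h y] module_homD(1)[OF k1u y]
    by (simp add: k2(2)[OF y] d(2)[OF y] a_minus_def Z.M.a_lcomm Z.M.r_neg)
  then show "\<exists>k \<in> module_hom R E Z. \<forall>x \<in> carrier X. k (u x) = h x"
    by (intro bexI[OF _ module_hom_add[OF E Z k1(1) k2(1)]] ballI)
qed

lemma extends_along_module_sum:
  assumes X: "short_exact R K \<phi> X p C" and L: "left_module R S" "left_module R P" "left_module R Z"
    and u: "u \<in> module_hom R X (module_sum S P)"
    and ext: "extends_along R K \<iota> S Z" "extends_along R C j P Z"
    and fst: "\<And>k. k \<in> carrier K \<Longrightarrow> fst (u (\<phi> k)) = \<iota> k"
    and snd: "\<And>x. x \<in> carrier X \<Longrightarrow> snd (u x) = j (p x)"
  shows "extends_along R X u (module_sum S P) Z"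
proof (rule extends_along_horseshoe[OF X left_module_module_sum[OF L(1,2)] u L(3)])
  note x = short_exactD[OF X]
  show "extends_along R K (\<lambda>k. u (\<phi> k)) (module_sum S P) Z"
  proof (rule extends_alongI)
    fix h assume "h \<in> module_hom R K Z"
    then obtain k where k: "k \<in> module_hom R S Z" "\<And>y. y \<in> carrier K \<Longrightarrow> k (\<iota> y) = h y"
      using extends_alongE[OF ext(1)] by metis
    then show "\<exists>k \<in> module_hom R (module_sum S P) Z. \<forall>x \<in> carrier K. k (u (\<phi> x)) = h x"
      by (intro bexI[OF _ module_hom_comp[OF module_hom_fst k(1)]] ballI) (simp add: fst)
  qed
  fix h assume "h \<in> module_hom R C Z"
  then obtain k where k: "k \<in> module_hom R P Z" "\<And>y. y \<in> carrier C \<Longrightarrow> k (j y) = h y"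
    using extends_alongE[OF ext(2)] by metis
  then show "\<exists>k \<in> module_hom R (module_sum S P) Z. \<forall>x \<in> carrier X. k (u x) = h (p x)"
    by (intro bexI[OF _ module_hom_comp[OF module_hom_snd k(1)]] ballI) (simp add: snd module_homD(1)[OF x(5)])
qed

lemma proper_horseshoe_right:
  fixes S :: "('r, 's, 'c) module_scheme" and P :: "('r, 'p, 'd) module_scheme"
  assumes X: "short_exact R K \<phi> X p C" and K: "proper_step R K \<iota> S \<kappa> K'" and C: "proper_step R C j P q C'"
    and GP: "Gorenstein_projective R C"
  obtains u v \<phi>' p' and X' :: "('r, ('s \<times> 'p) set) module" where "proper_step R X u (module_sum S P) v X'"
    "short_exact R K' \<phi>' X' p' C'"
proof -
  note k = proper_stepD[OF K] and c = proper_stepD[OF C]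
  note x = short_exactD[OF X] and sk = short_exactD[OF k(1)] and sc = short_exactD[OF c(1)]
  have RS: "left_module R (regular_module R)"
    by (rule left_module_regular) (use x(1) in \<open>simp add: left_module_def\<close>)
  obtain n s \<xi> where db: "dual_basis R S n s \<xi>" by (rule projective_dual_basis[OF k(2,3)])
  \<comment> \<open>S has a finite dual basis and functionals extend from K to X because C is
    Gorenstein-projective; so the S-valued map \<iota> extends too.\<close>
  obtain \<alpha> where a: "\<alpha> \<in> module_hom R X S" "\<And>y. y \<in> carrier K \<Longrightarrow> \<alpha> (\<phi> y) = \<iota> y"
    using extends_alongE[OF Gorenstein_projective_extends_dual_basis[OF X GP sk(2) db] sk(4)] by metis
  obtain v \<phi>' p' where h: "short_exact R X (\<lambda>x. (\<alpha> x, j (p x))) (module_sum S P) v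
      (cokernel_module X (module_sum S P) (\<lambda>x. (\<alpha> x, j (p x))))"
    "short_exact R K' \<phi>' (cokernel_module X (module_sum S P) (\<lambda>x. (\<alpha> x, j (p x)))) p' C'"
    "\<And>s. s \<in> carrier S \<Longrightarrow> \<phi>' (\<kappa> s) = v (s, \<zero>\<^bsub>P\<^esub>)"
    by (rule horseshoe_right[OF X k(1) c(1) a]) blast+
  have "extends_along R X (\<lambda>x. (\<alpha> x, j (p x))) (module_sum S P) (regular_module R)"
    by (rule extends_along_module_sum[OF X sk(2) sc(2) RS short_exactD(4)[OF h(1)] k(4) c(4)]) (simp_all add: a(2))
  then have "proper_step R X (\<lambda>x. (\<alpha> x, j (p x))) (module_sum S P) v
      (cokernel_module X (module_sum S P) (\<lambda>x. (\<alpha> x, j (p x))))"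
    unfolding proper_step_def
    by (intro conjI h(1) projective_module_sum k(2) c(2) finitely_generated_module_sum sk(2) sc(2) k(3) c(3))
  from that[OF this h(2)] show ?thesis .
qed

lemma proper_horseshoe_left:
  fixes S :: "('r, 's, 'c) module_scheme" and P :: "('r, 'p, 'd) module_scheme"
  assumes X: "short_exact R K \<phi> X p C" and K: "proper_step R K'' \<iota> S \<kappa> K" and C: "proper_step R C'' j P q C"
  obtains v \<phi>'' p'' and X'' :: "('r, 's \<times> 'p) module" where "proper_step R X'' (\<lambda>z. z) (module_sum S P) v X"
    "short_exact R K'' \<phi>'' X'' p'' C''"
proof -
  note k = proper_stepD[OF K] and c = proper_stepD[OF C]
  note x = short_exactD[OF X] and sk = short_exactD[OF k(1)] and sc = short_exactD[OF c(1)]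
  have RS: "left_module R (regular_module R)"
    by (rule left_module_regular) (use x(1) in \<open>simp add: left_module_def\<close>)
  obtain \<beta> \<phi>'' p'' and X'' :: "('r, 's \<times> 'p) module" where
    "\<beta> \<in> module_hom R P X" "\<And>b. b \<in> carrier P \<Longrightarrow> p (\<beta> b) = q b" and
    v: "short_exact R X'' (\<lambda>z. z) (module_sum S P) (\<lambda>z. \<phi> (\<kappa> (fst z)) \<oplus>\<^bsub>X\<^esub> \<beta> (snd z)) X" and
    h: "short_exact R K'' \<phi>'' X'' p'' C''" and
    e: "\<And>k. k \<in> carrier K'' \<Longrightarrow> \<phi>'' k = (\<iota> k, \<zero>\<^bsub>P\<^esub>)" "\<And>x. x \<in> carrier X'' \<Longrightarrow> j (p'' x) = snd x"
    by (rule horseshoe_left[OF X k(1) c(1,2)]) blast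
  have "extends_along R X'' (\<lambda>z. z) (module_sum S P) (regular_module R)"
    by (rule extends_along_module_sum[OF h sk(2) sc(2) RS short_exactD(4)[OF v] k(4) c(4)]) (simp_all add: e)
  then have "proper_step R X'' (\<lambda>z. z) (module_sum S P) (\<lambda>z. \<phi> (\<kappa> (fst z)) \<oplus>\<^bsub>X\<^esub> \<beta> (snd z)) X"
    unfolding proper_step_def
    by (intro conjI v projective_module_sum k(2) c(2) finitely_generated_module_sum sk(2) sc(2) k(3) c(3))
  from that[OF this h] show ?thesis .
qed

lemma finitely_generated_step_target:
  assumes "proper_step R N f P g N'"
  shows "finitely_generated R N'"
  using short_exactD[OF proper_stepD(1)[OF assms]] proper_stepD(3)[OF assms]
  by (intro finitely_generated_image[of R P N' g])

text \<open>The horseshoes deliver their new middle term on a product type or on a type of sets;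
  this returns it to the type on which the coinductive class is formed, together with matching
  copies of the two ends.\<close>

lemma Gorenstein_extension_nat_model:
  fixes R :: "('r, 'q) ring_scheme"
  assumes m: "short_exact R K \<phi> X p C" "Gorenstein_projective R K" "Gorenstein_projective R C"
  obtains K' :: "('r, nat \<Rightarrow> 'r) module" and \<phi>' and X' :: "('r, nat \<Rightarrow> 'r) module" and p' and C' :: "('r, nat \<Rightarrow> 'r) module" and e
  where "left_module R X'" "e \<in> module_hom R X X'" "bij_betw e (carrier X) (carrier X')"
    "short_exact R K' \<phi>' X' p' C'" "Gorenstein_projective R K'" "Gorenstein_projective R C'"
proof -
  note S = short_exactD[OF m(1)]
  have fK: "finitely_generated R K" and fC: "finitely_generated R C"
    using m by (simp_all add: Gorenstein_projective_def)
  obtain X' :: "('r, nat \<Rightarrow> 'r) module" and e where X': "left_module R X'" "e \<in> module_hom R X X'" "bij_betw e (carrier X) (carrier X')"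
    by (rule finitely_generated_nat_model[OF S(2) finitely_generated_extension[OF m(1) fK fC]])
  obtain K' :: "('r, nat \<Rightarrow> 'r) module" and a where K': "left_module R K'" "a \<in> module_hom R K K'" "bij_betw a (carrier K) (carrier K')"
    by (rule finitely_generated_nat_model[OF S(1) fK])
  obtain C' :: "('r, nat \<Rightarrow> 'r) module" and b where C': "left_module R C'" "b \<in> module_hom R C C'" "bij_betw b (carrier C) (carrier C')"
    by (rule finitely_generated_nat_model[OF S(3) fC])
  note se = short_exact_iso_middle[OF short_exact_iso_right[OF short_exact_iso_left[OF m(1) K'(1)
      module_hom_inv[OF S(1) K'(2,3)] bij_betw_inv_into[OF K'(3)]] C'] X']
  show ?thesis
    by (rule that[OF X' se Gorenstein_projective_iso[OF m(2) K'(1) module_isomorphicI[OF K'(2,3)]]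
      Gorenstein_projective_iso[OF m(3) C'(1) module_isomorphicI[OF C'(2,3)]]])
qed

text \<open>The middle terms of sequences with Gorenstein-projective ends form a class closed under
  steps: the two horseshoes combine steps of the ends into a step of the middle term whose other end
  is again such an extension.\<close>

theorem Gorenstein_projective_extension:
  fixes R :: "('r, 'q) ring_scheme"
  assumes X: "short_exact R K \<phi> X p C" and K: "Gorenstein_projective R K" and C: "Gorenstein_projective R C"
  shows "Gorenstein_projective R X"
proof -
  define \<C> where "\<C> X \<longleftrightarrow> (\<exists>(K :: ('r, nat \<Rightarrow> 'r) module) \<phi> p (C :: ('r, nat \<Rightarrow> 'r) module).
    short_exact R K \<phi> X p C \<and> Gorenstein_projective R K \<and> Gorenstein_projective R C)"
    for X :: "('r, nat \<Rightarrow> 'r) module"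
  have GP: "Gorenstein_projective R X" if "\<C> X" for X
  proof (rule Gorenstein_projective_coinduct[where \<C> = \<C>, OF that])
    fix X assume "\<C> X"
    then obtain K :: "('r, nat \<Rightarrow> 'r) module" and \<phi> p and C :: "('r, nat \<Rightarrow> 'r) module"
      where X: "short_exact R K \<phi> X p C" and K: "Gorenstein_projective R K" and C: "Gorenstein_projective R C"
      unfolding \<C>_def by blast
    obtain f and S :: "('r, nat \<Rightarrow> 'r) module" and g and K' :: "('r, nat \<Rightarrow> 'r) module"
      where K': "proper_step R K f S g K'" "Gorenstein_projective R K'"
      using Gorenstein_projective_steps(1)[OF K] by blast
    obtain f' and P :: "('r, nat \<Rightarrow> 'r) module" and g' and C' :: "('r, nat \<Rightarrow> 'r) module"
      where C': "proper_step R C f' P g' C'" "Gorenstein_projective R C'"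
      using Gorenstein_projective_steps(1)[OF C] by blast
    obtain u v \<phi>' p' and X' :: "('r, ((nat \<Rightarrow> 'r) \<times> (nat \<Rightarrow> 'r)) set) module"
      where X': "proper_step R X u (module_sum S P) v X'" "short_exact R K' \<phi>' X' p' C'"
      by (rule proper_horseshoe_right[OF X K'(1) C'(1) C])
    obtain X1 e where X1: "left_module R X1" "e \<in> module_hom R X' X1" "bij_betw e (carrier X') (carrier X1)" "\<C> X1"
      using Gorenstein_extension_nat_model[OF X'(2) K'(2) C'(2)] unfolding \<C>_def by metis
    then show "\<exists>f (P :: ('r, (nat \<Rightarrow> 'r) \<times> (nat \<Rightarrow> 'r)) module) g N'. proper_step R X f P g N' \<and> \<C> N'"
      using proper_step_iso_right[OF X'(1) X1(1-3)] by blast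
  next
    fix X assume "\<C> X"
    then obtain K :: "('r, nat \<Rightarrow> 'r) module" and \<phi> p and C :: "('r, nat \<Rightarrow> 'r) module"
      where X: "short_exact R K \<phi> X p C" and K: "Gorenstein_projective R K" and C: "Gorenstein_projective R C"
      unfolding \<C>_def by blast
    obtain K' :: "('r, nat \<Rightarrow> 'r) module" and f and S :: "('r, nat \<Rightarrow> 'r) module" and g
      where K': "proper_step R K' f S g K" "Gorenstein_projective R K'"
      using Gorenstein_projective_steps(2)[OF K] by blast
    obtain C' :: "('r, nat \<Rightarrow> 'r) module" and f' and P :: "('r, nat \<Rightarrow> 'r) module" and g'
      where C': "proper_step R C' f' P g' C" "Gorenstein_projective R C'"
      using Gorenstein_projective_steps(2)[OF C] by blast
    obtain v \<phi>' p' and X' :: "('r, (nat \<Rightarrow> 'r) \<times> (nat \<Rightarrow> 'r)) module"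
      where X': "proper_step R X' (\<lambda>z. z) (module_sum S P) v X" "short_exact R K' \<phi>' X' p' C'"
      by (rule proper_horseshoe_left[OF X K'(1) C'(1)])
    obtain X1 e where X1: "left_module R X1" "e \<in> module_hom R X' X1" "bij_betw e (carrier X') (carrier X1)" "\<C> X1"
      using Gorenstein_extension_nat_model[OF X'(2) K'(2) C'(2)] unfolding \<C>_def by metis
    note L = short_exactD(1)[OF proper_stepD(1)[OF X'(1)]]
    show "\<exists>N' f (P :: ('r, (nat \<Rightarrow> 'r) \<times> (nat \<Rightarrow> 'r)) module) g. proper_step R N' f P g X \<and> \<C> N'"
      using proper_step_iso_left[OF X'(1) X1(1) module_hom_inv[OF L X1(2,3)] bij_betw_inv_into[OF X1(3)]] X1(4) by blast
  qed
  obtain X' e where X': "left_module R X'" "e \<in> module_hom R X X'" "bij_betw e (carrier X) (carrier X')" "\<C> X'"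
    using Gorenstein_extension_nat_model[OF X K C] unfolding \<C>_def by metis
  show ?thesis
    by (rule Gorenstein_projective_iso[OF GP[OF X'(4)] short_exactD(2)[OF X]
        module_isomorphic_sym[OF short_exactD(2)[OF X] module_isomorphicI[OF X'(2,3)]]])
qed

section \<open>Kernels of epimorphisms between Gorenstein-projective modules\<close>

lemma extends_along_trans:
  assumes "extends_along R K f X Z" "extends_along R X g Y Z" "f \<in> module_hom R K X"
  shows "extends_along R K (\<lambda>x. g (f x)) Y Z"
proof (rule extends_alongI)
  fix h assume "h \<in> module_hom R K Z"
  then obtain k where k: "k \<in> module_hom R X Z" "\<And>x. x \<in> carrier K \<Longrightarrow> k (f x) = h x"
    using extends_alongE[OF assms(1)] by metis
  obtain l where l: "l \<in> module_hom R Y Z" "\<And>x. x \<in> carrier X \<Longrightarrow> l (g x) = k x"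
    using extends_alongE[OF assms(2) k(1)] by metis
  then show "\<exists>k \<in> module_hom R Y Z. \<forall>x \<in> carrier K. k (g (f x)) = h x"
    by (intro bexI[OF _ l(1)] ballI) (simp add: k(2) module_homD(1)[OF assms(3)])
qed

text \<open>E is the fibre product of p and \<rho>, that is, the kernel of the difference map from X
  \<oplus> P to C. Each projection is onto, with the kernel of the opposite map as its
  kernel.\<close>

lemma pullback_short_exact:
  fixes X :: "('r, 'x, 'c) module_scheme" and P :: "('r, 'p, 'd) module_scheme"
  assumes X: "short_exact R K \<phi> X p C" and P: "short_exact R C' \<iota> P \<rho> C"
  obtains E :: "('r, 'x \<times> 'p) module"
  where "short_exact R C' (\<lambda>c. (\<zero>\<^bsub>X\<^esub>, \<iota> c)) E fst X" "short_exact R K (\<lambda>k. (\<phi> k, \<zero>\<^bsub>P\<^esub>)) E snd P"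
proof -
  note x = short_exactD[OF X] and c = short_exactD[OF P]
  interpret X: left_module R X by (rule x)
  interpret P: left_module R P by (rule c)
  interpret C: left_module R C by (rule c)
  let ?S = "module_sum X P"
  let ?d = "\<lambda>z. p (fst z) \<ominus>\<^bsub>C\<^esub> \<rho> (snd z)"
  have S: "left_module R ?S" by (rule left_module_module_sum[OF x(2) c(2)])
  have d: "?d \<in> module_hom R ?S C"
    by (rule module_hom_diff[OF S x(3) module_hom_comp[OF module_hom_fst x(5)] module_hom_comp[OF module_hom_snd c(5)]])
  have onto: "?d ` carrier ?S = carrier C"
  proof (rule subset_antisym)
    show "?d ` carrier ?S \<subseteq> carrier C" using module_homD(1)[OF d] by blast
    show "carrier C \<subseteq> ?d ` carrier ?S"
    proof
      fix y assume y: "y \<in> carrier C"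
      obtain a where a: "a \<in> carrier X" "y = p a" by (rule short_exact_surjE[OF X y])
      then have "y = ?d (a, \<zero>\<^bsub>P\<^esub>)" using y by (simp add: module_hom_zero[OF c(2,3,5)] C.M.minus_zero_right)
      then show "y \<in> ?d ` carrier ?S" using a(1) by (intro image_eqI[of _ _ "(a, \<zero>\<^bsub>P\<^esub>)"]) auto
    qed
  qed
  define E where "E = ?S\<lparr>carrier := {z \<in> carrier ?S. ?d z = \<zero>\<^bsub>C\<^esub>}\<rparr>"
  note e = short_exactD[OF short_exact_kernel[OF S x(3) d onto, folded E_def]]
  have E: "z \<in> carrier E \<longleftrightarrow> fst z \<in> carrier X \<and> snd z \<in> carrier P \<and> p (fst z) = \<rho> (snd z)" for z
    using module_homD(1)[OF x(5)] module_homD(1)[OF c(5)]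
    by (auto simp: E_def mem_Times_iff C.M.minus_eq_zero_iff)
  have E0: "\<zero>\<^bsub>E\<^esub> = (\<zero>\<^bsub>X\<^esub>, \<zero>\<^bsub>P\<^esub>)" by (simp add: E_def)
  have fst_hom: "fst \<in> module_hom R E X" and snd_hom: "snd \<in> module_hom R E P"
    by (rule module_hom_comp[OF e(4) module_hom_fst], rule module_hom_comp[OF e(4) module_hom_snd])
  have z: "p \<zero>\<^bsub>X\<^esub> = \<zero>\<^bsub>C\<^esub>" "\<rho> \<zero>\<^bsub>P\<^esub> = \<zero>\<^bsub>C\<^esub>" by (rule module_hom_zero; rule x c)+
  have inE: "(\<zero>\<^bsub>X\<^esub>, \<iota> y) \<in> carrier E" if "y \<in> carrier C'" for y
    using that by (simp add: E z c(8) module_homD(1)[OF c(4)])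
  have inE': "(\<phi> k, \<zero>\<^bsub>P\<^esub>) \<in> carrier E" if "k \<in> carrier K" for k
    using that by (simp add: E z x(8) module_homD(1)[OF x(4)])
  have h: "(\<lambda>y. (\<zero>\<^bsub>X\<^esub>, \<iota> y)) \<in> module_hom R C' E"
    by (rule module_homI) (simp_all add: inE, simp_all add: E_def module_homD[OF c(4)])
  have h': "(\<lambda>k. (\<phi> k, \<zero>\<^bsub>P\<^esub>)) \<in> module_hom R K E"
    by (rule module_homI) (simp_all add: inE', simp_all add: E_def module_homD[OF x(4)])
  have "short_exact R C' (\<lambda>c. (\<zero>\<^bsub>X\<^esub>, \<iota> c)) E fst X"
  proof (rule short_exactI[OF c(1) e(1) x(2) h fst_hom])
    fix k assume k: "k \<in> carrier C'" "(\<zero>\<^bsub>X\<^esub>, \<iota> k) = \<zero>\<^bsub>E\<^esub>"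
    show "k = \<zero>\<^bsub>C'\<^esub>" by (rule module_hom_injD[OF c(1,2,4,6) k(1)]) (use k(2) in \<open>simp add: E0\<close>)
  next
    fix y assume y: "y \<in> carrier X"
    obtain b where b: "b \<in> carrier P" "p y = \<rho> b" by (rule short_exact_surjE[OF P module_homD(1)[OF x(5) y]])
    then show "\<exists>x \<in> carrier E. fst x = y" using y by (intro bexI[of _ "(y, b)"]) (simp_all add: E)
  next
    fix w assume w: "w \<in> carrier E" "fst w = \<zero>\<^bsub>X\<^esub>"
    then have "snd w \<in> carrier P" "\<rho> (snd w) = \<zero>\<^bsub>C\<^esub>" by (simp_all add: E z)
    then obtain k where "k \<in> carrier C'" "snd w = \<iota> k" by (rule short_exact_kernelE[OF P])
    with w(2) show "\<exists>k \<in> carrier C'. (\<zero>\<^bsub>X\<^esub>, \<iota> k) = w" by (intro bexI[of _ k] prod_eqI) simp_all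
  qed simp
  moreover have "short_exact R K (\<lambda>k. (\<phi> k, \<zero>\<^bsub>P\<^esub>)) E snd P"
  proof (rule short_exactI[OF x(1) e(1) c(2) h' snd_hom])
    fix k assume k: "k \<in> carrier K" "(\<phi> k, \<zero>\<^bsub>P\<^esub>) = \<zero>\<^bsub>E\<^esub>"
    show "k = \<zero>\<^bsub>K\<^esub>" by (rule module_hom_injD[OF x(1,2,4,6) k(1)]) (use k(2) in \<open>simp add: E0\<close>)
  next
    fix b assume b: "b \<in> carrier P"
    obtain y where y: "y \<in> carrier X" "\<rho> b = p y" by (rule short_exact_surjE[OF X module_homD(1)[OF c(5) b]])
    then show "\<exists>x \<in> carrier E. snd x = b" using b by (intro bexI[of _ "(y, b)"]) (simp_all add: E)
  next
    fix w assume w: "w \<in> carrier E" "snd w = \<zero>\<^bsub>P\<^esub>"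
    then have "fst w \<in> carrier X" "p (fst w) = \<zero>\<^bsub>C\<^esub>" by (simp_all add: E z)
    then obtain k where "k \<in> carrier K" "fst w = \<phi> k" by (rule short_exact_kernelE[OF X])
    with w(2) show "\<exists>k \<in> carrier K. (\<phi> k, \<zero>\<^bsub>P\<^esub>) = w" by (intro bexI[of _ k] prod_eqI) simp_all
  qed simp
  ultimately show ?thesis by (rule that)
qed

text \<open>Removing a projective direct summand from a left step of \<open>E \<cong> K \<oplus> P\<close>.\<close>

lemma proper_step_complement:
  fixes Q :: "('r, 'm, 'c) module_scheme"
  assumes Q: "proper_step R Z f Q \<sigma> E" and E: "short_exact R K \<phi> E \<psi> P" and P: "projective_module R P"
  obtains f' \<kappa> and Q' :: "('r, 'm, 'c) module_scheme" where "proper_step R Z f' Q' \<kappa> K"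
proof -
  note q = proper_stepD[OF Q] and e = short_exactD[OF E]
  note s = short_exactD[OF q(1)]
  interpret Q: left_module R Q by (rule s)
  let ?\<tau> = "\<lambda>x. \<psi> (\<sigma> x)"
  have \<tau>: "?\<tau> \<in> module_hom R Q P" by (rule module_hom_comp[OF s(5) e(5)])
  have onto: "?\<tau> ` carrier Q = carrier P"
  proof -
    have "?\<tau> ` carrier Q = \<psi> ` \<sigma> ` carrier Q" by (simp only: image_image)
    then show ?thesis by (simp only: s(7) e(7))
  qed
  define Q' where "Q' = Q\<lparr>carrier := {x \<in> carrier Q. ?\<tau> x = \<zero>\<^bsub>P\<^esub>}\<rparr>"
  have Q'S: "short_exact R Q' (\<lambda>x. x) Q ?\<tau> P"
    unfolding Q'_def by (rule short_exact_kernel[OF s(2) e(3) \<tau> onto])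
  note t = short_exactD[OF Q'S]
  have Q': "x \<in> carrier Q' \<longleftrightarrow> x \<in> carrier Q \<and> ?\<tau> x = \<zero>\<^bsub>P\<^esub>" for x by (simp add: Q'_def)
  obtain r where r: "r \<in> module_hom R P Q" "\<And>y. y \<in> carrier P \<Longrightarrow> ?\<tau> (r y) = y"
    using projective_section[OF P s(2) e(3) \<tau> onto module_hom_id] by metis
  have rc: "r (?\<tau> x) \<in> carrier Q" "?\<tau> (r (?\<tau> x)) = ?\<tau> x" if "x \<in> carrier Q" for x
    by (rule module_homD(1)[OF r(1) module_homD(1)[OF \<tau> that]], rule r(2)[OF module_homD(1)[OF \<tau> that]])
  \<comment> \<open>As r is a section of \<open>?\<tau>\<close>, the map x - r(\<tau> x) lands in Q'
    and fixes Q' pointwise. So Q' is a direct summand of Q, hence projective and finitely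
    generated.\<close>
  have d: "(\<lambda>x. x \<ominus>\<^bsub>Q\<^esub> r (?\<tau> x)) \<in> module_hom R Q Q"
    by (rule module_hom_diff[OF s(2) s(2) module_hom_id module_hom_comp[OF \<tau> r(1)]])
  have "x \<ominus>\<^bsub>Q\<^esub> r (?\<tau> x) \<in> (\<lambda>x. x) ` carrier Q'" if x: "x \<in> carrier Q" for x
    using rc[OF x] x by (simp add: Q' flip: module_hom_eq_iff[OF s(2) e(3) \<tau>])
  then obtain \<rho> where \<rho>: "\<rho> \<in> module_hom R Q Q'" "\<And>x. x \<in> carrier Q \<Longrightarrow> \<rho> x = x \<ominus>\<^bsub>Q\<^esub> r (?\<tau> x)"
    using factor_inj[OF t(1,2,4,6) d] by metis
  have \<rho>_id: "\<rho> x = x" if "x \<in> carrier Q'" for x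
    using that by (simp add: Q' \<rho>(2) module_hom_zero[OF e(3) s(2) r(1)] Q.M.minus_zero_right)
  have pQ': "projective_module R Q'" by (rule projective_retract[OF q(2) t(1) t(4) \<rho>(1) \<rho>_id])
  have "\<rho> ` carrier Q = carrier Q'"
  proof (rule subset_antisym)
    show "\<rho> ` carrier Q \<subseteq> carrier Q'" using module_homD(1)[OF \<rho>(1)] by blast
    show "carrier Q' \<subseteq> \<rho> ` carrier Q" using \<rho>_id Q' by (metis image_eqI subsetI)
  qed
  then have fQ': "finitely_generated R Q'" by (rule finitely_generated_image[OF s(2) q(3) t(1) \<rho>(1)])
  have "\<sigma> x \<in> \<phi> ` carrier K" if "x \<in> carrier Q'" for x
    using that by (intro e(9) module_homD(1)[OF s(5)]) (simp_all add: Q')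
  then obtain \<kappa> where \<kappa>: "\<kappa> \<in> module_hom R Q' K" "\<And>x. x \<in> carrier Q' \<Longrightarrow> \<phi> (\<kappa> x) = \<sigma> x"
    using factor_inj[OF e(1) t(1) e(4,6) module_hom_comp[OF t(4) s(5)]] by metis
  have "f z \<in> (\<lambda>x. x) ` carrier Q'" if "z \<in> carrier Z" for z
    using that by (simp add: Q' module_homD(1)[OF s(4)] s(8) module_hom_zero[OF e(2,3,5)])
  then obtain f' where f': "f' \<in> module_hom R Z Q'" "\<And>z. z \<in> carrier Z \<Longrightarrow> f' z = f z"
    using factor_inj[OF t(1) s(1) t(4,6) s(4)] by metis
  have "short_exact R Z f' Q' \<kappa> K"
  proof (rule short_exactI[OF s(1) t(1) e(1) f'(1) \<kappa>(1)])
    fix z assume z: "z \<in> carrier Z" "f' z = \<zero>\<^bsub>Q'\<^esub>"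
    show "z = \<zero>\<^bsub>Z\<^esub>" by (rule module_hom_injD[OF s(1,2,4,6) z(1)]) (use z f'(2) in \<open>simp add: Q'_def\<close>)
  next
    fix k assume k: "k \<in> carrier K"
    obtain x where x: "x \<in> carrier Q" "\<phi> k = \<sigma> x" by (rule short_exact_surjE[OF q(1) module_homD(1)[OF e(4) k]])
    have xQ': "x \<in> carrier Q'" using x e(8)[OF k] by (simp add: Q')
    have "\<kappa> x = k"
      by (rule inj_onD[OF e(6) _ module_homD(1)[OF \<kappa>(1) xQ'] k]) (simp add: \<kappa>(2)[OF xQ'] x(2))
    then show "\<exists>x \<in> carrier Q'. \<kappa> x = k" using xQ' by blast
  next
    fix z assume z: "z \<in> carrier Z"
    have fz: "f' z \<in> carrier Q'" by (rule module_homD(1)[OF f'(1) z])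
    show "\<kappa> (f' z) = \<zero>\<^bsub>K\<^esub>"
      by (rule module_hom_injD[OF e(1,2,4,6) module_homD(1)[OF \<kappa>(1) fz]])
        (simp only: \<kappa>(2)[OF fz], simp only: f'(2)[OF z] s(8)[OF z])
  next
    fix x assume x: "x \<in> carrier Q'" "\<kappa> x = \<zero>\<^bsub>K\<^esub>"
    have xQ: "x \<in> carrier Q" using x(1) by (simp add: Q')
    have "\<sigma> x = \<zero>\<^bsub>E\<^esub>" using \<kappa>(2)[OF x(1)] x(2) module_hom_zero[OF e(1,2,4)] by simp
    then obtain z where z: "z \<in> carrier Z" "x = f z" by (rule short_exact_kernelE[OF q(1) xQ])
    then show "\<exists>k \<in> carrier Z. f' k = x" using f'(2) by auto
  qed
  moreover have "extends_along R Z f' Q' (regular_module R)"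
  proof (rule extends_alongI)
    fix h assume "h \<in> module_hom R Z (regular_module R)"
    then obtain k where k: "k \<in> module_hom R Q (regular_module R)" "\<And>z. z \<in> carrier Z \<Longrightarrow> k (f z) = h z"
      using extends_alongE[OF q(4)] by metis
    then show "\<exists>k \<in> module_hom R Q' (regular_module R). \<forall>x \<in> carrier Z. k (f' x) = h x"
      by (intro bexI[OF _ module_hom_comp[OF t(4) k(1)]] ballI) (simp add: f'(2))
  qed
  ultimately have "proper_step R Z f' Q' \<kappa> K" using pQ' fQ' by (simp add: proper_step_def)
  then show ?thesis by (rule that)
qed

text \<open>For a left step of K, pull X back along a projective P mapping onto C: the pullback E is
  an extension of X by C'', hence Gorenstein-projective, and K is the kernel of E \<rightarrow> P,
  so a left step of E yields one of K. For a right step, embed K through X into the projective P' of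
  a right step of X.\<close>

theorem Gorenstein_projective_kernel:
  fixes R :: "('r, 'q) ring_scheme" and X :: "('r, 'x, 'c) module_scheme"
  assumes X: "short_exact R K \<phi> X p C" and GX: "Gorenstein_projective R X" and GC: "Gorenstein_projective R C"
  shows "Gorenstein_projective R K"
proof -
  note x = short_exactD[OF X]
  obtain C'' :: "('r, nat \<Rightarrow> 'r) module" and \<iota> and P :: "('r, nat \<Rightarrow> 'r) module" and \<rho>
    where C'': "proper_step R C'' \<iota> P \<rho> C" "Gorenstein_projective R C''"
    using Gorenstein_projective_steps(2)[OF GC] by blast
  obtain E :: "('r, 'x \<times> (nat \<Rightarrow> 'r)) module" where E: "short_exact R C'' (\<lambda>c. (\<zero>\<^bsub>X\<^esub>, \<iota> c)) E fst X" "short_exact R K (\<lambda>k. (\<phi> k, \<zero>\<^bsub>P\<^esub>)) E snd P"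
    by (rule pullback_short_exact[OF X proper_stepD(1)[OF C''(1)]]) blast
  have "Gorenstein_projective R E" by (rule Gorenstein_projective_extension[OF E(1) C''(2) GX])
  then obtain Z :: "('r, nat \<Rightarrow> 'r) module" and f and Q :: "('r, nat \<Rightarrow> 'r) module" and \<sigma>
    where Z: "proper_step R Z f Q \<sigma> E" "Gorenstein_projective R Z"
    using Gorenstein_projective_steps(2)[of R E] by blast
  obtain f' \<kappa> and Q' :: "('r, nat \<Rightarrow> 'r) module" where left: "proper_step R Z f' Q' \<kappa> K"
    by (rule proper_step_complement[OF Z(1) E(2) proper_stepD(2)[OF C''(1)]])
  obtain i and P' :: "('r, nat \<Rightarrow> 'r) module" and \<pi> and X' :: "('r, nat \<Rightarrow> 'r) module"
    where X': "proper_step R X i P' \<pi> X'" "Gorenstein_projective R X'"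
    using Gorenstein_projective_steps(1)[OF GX] by blast
  note px = proper_stepD[OF X'(1)]
  note s = short_exactD[OF px(1)]
  have i\<phi>: "(\<lambda>k. i (\<phi> k)) \<in> module_hom R K P'" by (rule module_hom_comp[OF x(4) s(4)])
  have "inj_on (\<lambda>k. i (\<phi> k)) (carrier K)"
    using s(6) x(6) module_homD(1)[OF x(4)] by (auto simp: inj_on_def)
  \<comment> \<open>K' is P'/K. It is an extension of P'/X, which is X', by X/K, which is C; both
    are Gorenstein-projective.\<close>
  from short_exact_cokernel[OF x(1) s(2) i\<phi> this]
  obtain v and K' :: "('r, (nat \<Rightarrow> 'r) set) module" where V: "short_exact R K (\<lambda>k. i (\<phi> k)) P' v K'" by blast
  note v = short_exactD[OF V]
  obtain a where a: "a \<in> module_hom R C K'" "\<And>y. y \<in> carrier X \<Longrightarrow> a (p y) = v (i y)"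
  proof (rule factor_surj[OF x(2,3) v(3) x(5,7) module_hom_comp[OF s(4) v(5)]])
    fix y assume "y \<in> carrier X" "p y = \<zero>\<^bsub>C\<^esub>"
    then obtain k where "k \<in> carrier K" "y = \<phi> k" by (rule short_exact_kernelE[OF X])
    then show "v (i y) = \<zero>\<^bsub>K'\<^esub>" using v(8) by simp
  qed blast
  obtain b where b: "b \<in> module_hom R K' X'" "\<And>y. y \<in> carrier P' \<Longrightarrow> b (v y) = \<pi> y"
  proof (rule factor_surj[OF s(2) v(3) s(3) v(5,7) s(5)])
    fix y assume "y \<in> carrier P'" "v y = \<zero>\<^bsub>K'\<^esub>"
    then obtain k where "k \<in> carrier K" "y = i (\<phi> k)" by (rule short_exact_kernelE[OF V])
    then show "\<pi> y = \<zero>\<^bsub>X'\<^esub>" using s(8) module_homD(1)[OF x(4)] by simp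
  qed blast
  have "short_exact R C a K' b X'"
  proof (rule short_exactI[OF x(3) v(3) s(3) a(1) b(1)])
    fix c assume c: "c \<in> carrier C" "a c = \<zero>\<^bsub>K'\<^esub>"
    obtain y where y: "y \<in> carrier X" "c = p y" by (rule short_exact_surjE[OF X c(1)])
    have "v (i y) = \<zero>\<^bsub>K'\<^esub>" using c(2) y a(2) by simp
    then obtain k where k: "k \<in> carrier K" "i y = i (\<phi> k)"
      by (rule short_exact_kernelE[OF V module_homD(1)[OF s(4) y(1)]])
    then have "y = \<phi> k" using inj_onD[OF s(6) k(2) y(1)] module_homD(1)[OF x(4)] by blast
    then show "c = \<zero>\<^bsub>C\<^esub>" using y(2) k(1) x(8) by simp
  next
    fix d assume d: "d \<in> carrier X'"
    obtain y where y: "y \<in> carrier P'" "d = \<pi> y" by (rule short_exact_surjE[OF px(1) d])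
    then show "\<exists>k \<in> carrier K'. b k = d"
      by (intro bexI[OF _ module_homD(1)[OF v(5) y(1)]]) (simp add: b(2))
  next
    fix c assume c: "c \<in> carrier C"
    obtain y where y: "y \<in> carrier X" "c = p y" by (rule short_exact_surjE[OF X c])
    then show "b (a c) = \<zero>\<^bsub>X'\<^esub>" by (simp add: a(2) b(2) s(8) module_homD(1)[OF s(4)])
  next
    fix w assume w: "w \<in> carrier K'" "b w = \<zero>\<^bsub>X'\<^esub>"
    obtain y where y: "y \<in> carrier P'" "w = v y" by (rule short_exact_surjE[OF V w(1)])
    have "\<pi> y = \<zero>\<^bsub>X'\<^esub>" using w(2) y b(2) by simp
    then obtain z where z: "z \<in> carrier X" "y = i z" by (rule short_exact_kernelE[OF px(1) y(1)])
    then show "\<exists>c \<in> carrier C. a c = w"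
      by (intro bexI[OF _ module_homD(1)[OF x(5) z(1)]]) (simp add: a(2) y(2))
  qed
  then have GK': "Gorenstein_projective R K'" by (rule Gorenstein_projective_extension[OF _ GC X'(2)])
  have "proper_step R K (\<lambda>k. i (\<phi> k)) P' v K'"
    unfolding proper_step_def
    by (intro conjI V px(2,3) extends_along_trans[OF Gorenstein_projective_extends[OF X GC] px(4) x(4)])
  then show ?thesis by (rule Gorenstein_projective_stepI[OF _ GK' left Z(2)])
qed

section \<open>The tensor product\<close>

text \<open>The coordinate maps on a tensor product go from an A-module to a B-module and are merely
  additive, so the version for module homomorphisms does not apply to them.\<close>

lemma additive_finsum:
  assumes G: "abelian_group G" and H: "abelian_group H" and f: "f \<in> hom (add_monoid G) (add_monoid H)"
    and g: "g \<in> I \<rightarrow> carrier G"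
  shows "f (finsum G g I) = finsum H (\<lambda>i. f (g i)) I"
proof -
  interpret G: abelian_group G by fact
  interpret H: abelian_group H by fact
  have fc: "f x \<in> carrier H" if "x \<in> carrier G" for x using f that by (auto simp: hom_def)
  have fa: "f (x \<oplus>\<^bsub>G\<^esub> y) = f x \<oplus>\<^bsub>H\<^esub> f y" if "x \<in> carrier G" "y \<in> carrier G" for x y
    using f that by (auto simp: hom_def)
  show ?thesis using g
  proof (induction I rule: infinite_finite_induct)
    case (insert i I)
    then have "g i \<in> carrier G" "g \<in> I \<rightarrow> carrier G" by auto
    moreover from this have "(\<lambda>i. f (g i)) \<in> I \<rightarrow> carrier H" using fc by auto
    ultimately show ?case using insert fc by (simp add: fa)
  qed (simp_all add: additive_zero[OF G H f])
qed

section \<open>Induction on tensors and the universal property\<close>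

context tensor
begin

abbreviation "T \<equiv> tensor_module B M Y"
abbreviation "te \<equiv> tensor_elem B M Y"

lemma tensor_elem_zero_left: "y \<in> carrier Y \<Longrightarrow> te \<zero>\<^bsub>M\<^esub> y = \<zero>\<^bsub>T\<^esub>"
  and tensor_elem_zero_right: "x \<in> carrier M \<Longrightarrow> te x \<zero>\<^bsub>Y\<^esub> = \<zero>\<^bsub>T\<^esub>"
proof -
  interpret T: left_module A T by (rule left_module_tensor)
  have *: "u = \<zero>\<^bsub>T\<^esub>" if "u \<in> carrier T" "u = u \<oplus>\<^bsub>T\<^esub> u" for u
    using that T.M.add.r_cancel_one'[of u u] by simp
  show "te \<zero>\<^bsub>M\<^esub> y = \<zero>\<^bsub>T\<^esub>" if "y \<in> carrier Y"
    using that tensor_elem_add_left[of "\<zero>\<^bsub>M\<^esub>" "\<zero>\<^bsub>M\<^esub>" y] by (intro *) (auto intro: tensor_elem_closed)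
  show "te x \<zero>\<^bsub>Y\<^esub> = \<zero>\<^bsub>T\<^esub>" if "x \<in> carrier M"
    using that tensor_elem_add_right[of x "\<zero>\<^bsub>Y\<^esub>" "\<zero>\<^bsub>Y\<^esub>"] by (intro *) (auto intro: tensor_elem_closed)
qed

text \<open>Every tensor is a sum of elementary ones: a negative is again elementary, because -(x
  \<otimes> y) = (-x) \<otimes> y, so it needs no case of its own.\<close>

lemma tensor_induct [consumes 1, case_names zero elem add]:
  assumes u: "u \<in> carrier T" and zero: "P \<zero>\<^bsub>T\<^esub>"
    and elem: "\<And>x y. \<lbrakk>x \<in> carrier M; y \<in> carrier Y\<rbrakk> \<Longrightarrow> P (te x y)"
    and add: "\<And>u v. \<lbrakk>u \<in> carrier T; v \<in> carrier T; P u; P v\<rbrakk> \<Longrightarrow> P (u \<oplus>\<^bsub>T\<^esub> v)"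
  shows "P u"
proof -
  interpret T: left_module A T by (rule left_module_tensor)
  interpret F: abelian_group "pretensor M Y" by (rule abelian_group_pretensor)
  obtain c where c: "u = cl c" "c \<in> carrier (pretensor M Y)" using u by (auto simp: tensor_ops(1))
  have neg: "- c \<in> carrier (pretensor M Y)" if "c \<in> carrier (pretensor M Y)" for c
    using that by (simp add: pretensor_simps keys_minus)
  have clT: "cl c \<in> carrier T" if "c \<in> carrier (pretensor M Y)" for c
    using that by (simp add: tensor_ops(1))
  have cl_add: "cl (c + d) = cl c \<oplus>\<^bsub>T\<^esub> cl d"
    if "c \<in> carrier (pretensor M Y)" "d \<in> carrier (pretensor M Y)" for c d
    using tensor_ops(2)[OF that] by (simp add: pretensor_simps)
  have cl0: "cl 0 = \<zero>\<^bsub>T\<^esub>"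
    using cl_add[of 0 0] clT[of 0] T.M.add.r_cancel_one'[of "cl 0" "cl 0"] by (simp add: pretensor_simps)
  have cl_of: "cl (frag_of (x, y)) = te x y" for x y by (simp add: tensor_elem_def)
  have cl_neg: "cl (- frag_of (x, y)) = te (\<ominus>\<^bsub>M\<^esub> x) y" if xy: "x \<in> carrier M" "y \<in> carrier Y" for x y
  proof -
    have "te (\<ominus>\<^bsub>M\<^esub> x) y \<oplus>\<^bsub>T\<^esub> te x y = \<zero>\<^bsub>T\<^esub>"
      using xy tensor_elem_add_left[of "\<ominus>\<^bsub>M\<^esub> x" x y] by (simp add: left.M.l_neg tensor_elem_zero_left)
    moreover have "cl (- frag_of (x, y)) \<oplus>\<^bsub>T\<^esub> te x y = \<zero>\<^bsub>T\<^esub>"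
      using cl_add[OF neg[OF frag_of_pretensor[OF xy]] frag_of_pretensor[OF xy]] by (simp add: cl0 cl_of)
    ultimately show ?thesis
      using xy clT[OF neg[OF frag_of_pretensor[OF xy]]] by (metis T.M.add.inv_equality tensor_elem_closed
          left.M.a_inv_closed T.M.minus_equality)
  qed
  \<comment> \<open>\<open>frag_induction\<close> builds elements by differences; carrying the
    property for c and - c together turns these into sums.\<close>
  have "c \<in> carrier (pretensor M Y) \<and> P (cl c) \<and> P (cl (- c))"
  proof (rule frag_induction[of c "carrier M \<times> carrier Y"])
    show "Poly_Mapping.keys c \<subseteq> carrier M \<times> carrier Y" using c(2) by (simp add: pretensor_simps)
    show "0 \<in> carrier (pretensor M Y) \<and> P (cl 0) \<and> P (cl (- 0))" using zero by (simp add: cl0 pretensor_simps)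
    fix p assume "p \<in> carrier M \<times> carrier Y"
    then obtain x y where xy: "p = (x, y)" "x \<in> carrier M" "y \<in> carrier Y" by auto
    then show "frag_of p \<in> carrier (pretensor M Y) \<and> P (cl (frag_of p)) \<and> P (cl (- frag_of p))"
      by (simp add: frag_of_pretensor cl_neg elem) (simp add: cl_of elem)
  next
    fix a b assume a: "a \<in> carrier (pretensor M Y) \<and> P (cl a) \<and> P (cl (- a))"
      and b: "b \<in> carrier (pretensor M Y) \<and> P (cl b) \<and> P (cl (- b))"
    have ab: "a - b = a + - b" "- (a - b) = - a + b" by simp_all
    have "P (cl a \<oplus>\<^bsub>T\<^esub> cl (- b))" "P (cl (- a) \<oplus>\<^bsub>T\<^esub> cl b)" using a b by (auto intro!: add clT neg)
    then have "P (cl (a + - b))" "P (cl (- a + b))" using a b neg by (simp_all only: cl_add)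
    moreover have "a + - b \<in> carrier (pretensor M Y)"
      using F.a_closed[of a "- b"] a b neg by (simp add: pretensor_simps(2))
    ultimately show "a - b \<in> carrier (pretensor M Y) \<and> P (cl (a - b)) \<and> P (cl (- (a - b)))"
      by (simp only: ab(2), simp only: ab(1) simp_thms)
  qed
  then show ?thesis by (simp add: c(1))
qed

lemma tensor_hom_eqI:
  assumes "abelian_group G" "f \<in> hom (add_monoid T) (add_monoid G)" "g \<in> hom (add_monoid T) (add_monoid G)"
    and eq: "\<And>x y. \<lbrakk>x \<in> carrier M; y \<in> carrier Y\<rbrakk> \<Longrightarrow> f (te x y) = g (te x y)" and "u \<in> carrier T"
  shows "f u = g u"
proof -
  have "abelian_group T" by (rule tensor_ops(4))
  note 0 = additive_zero[OF this assms(1,2)] additive_zero[OF this assms(1,3)]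
  from assms(5) show ?thesis
  proof (induction rule: tensor_induct)
    case (add u v)
    then show ?case using assms(2,3) by (simp add: hom_def)
  qed (simp_all add: eq 0)
qed

text \<open>The target is only an abelian group, as needed for coordinate maps into Y. The balanced
  map extends to the free abelian group, where its kernel contains the defining relations and
  therefore the subgroup they generate.\<close>

lemma tensor_lift_additive:
  assumes G: "abelian_group G"
    and closed: "\<And>x y. \<lbrakk>x \<in> carrier M; y \<in> carrier Y\<rbrakk> \<Longrightarrow> \<beta> x y \<in> carrier G"
    and left: "\<And>x x' y. \<lbrakk>x \<in> carrier M; x' \<in> carrier M; y \<in> carrier Y\<rbrakk> \<Longrightarrow> \<beta> (x \<oplus>\<^bsub>M\<^esub> x') y = \<beta> x y \<oplus>\<^bsub>G\<^esub> \<beta> x' y"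
    and right: "\<And>x y y'. \<lbrakk>x \<in> carrier M; y \<in> carrier Y; y' \<in> carrier Y\<rbrakk> \<Longrightarrow> \<beta> x (y \<oplus>\<^bsub>Y\<^esub> y') = \<beta> x y \<oplus>\<^bsub>G\<^esub> \<beta> x y'"
    and balanced: "\<And>x b y. \<lbrakk>x \<in> carrier M; b \<in> carrier B; y \<in> carrier Y\<rbrakk> \<Longrightarrow> \<beta> (rsmult M x b) y = \<beta> x (b \<odot>\<^bsub>Y\<^esub> y)"
  obtains h where "h \<in> hom (add_monoid T) (add_monoid G)"
    "\<And>x y. \<lbrakk>x \<in> carrier M; y \<in> carrier Y\<rbrakk> \<Longrightarrow> h (te x y) = \<beta> x y"
proof -
  interpret G: abelian_group G by (rule G)
  interpret F: abelian_group "pretensor M Y" by (rule abelian_group_pretensor)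
  have "case_prod \<beta> ` (carrier M \<times> carrier Y) \<subseteq> carrier (add_monoid G)" using closed by auto
  then obtain h0 where h0: "h0 \<in> hom F (add_monoid G)"
    "\<And>p. p \<in> carrier M \<times> carrier Y \<Longrightarrow> h0 (frag_of p) = case_prod \<beta> p"
    by (rule comm_group.free_Abelian_group_universal[OF G.a_comm_group]) blast
  have h0_of: "h0 (frag_of (x, y)) = \<beta> x y" if "x \<in> carrier M" "y \<in> carrier Y" for x y
    using h0(2)[of "(x, y)"] that by simp
  interpret h: group_hom F "add_monoid G" h0
    by (simp add: group_hom_def group_hom_axioms_def h0(1) G.a_group)
  have h0_closed: "h0 c \<in> carrier G" if "c \<in> carrier (pretensor M Y)" for c
    using h.hom_closed[of c] that by (simp add: pretensor_simps)
  have h0_add: "h0 (c + d) = h0 c \<oplus>\<^bsub>G\<^esub> h0 d" if "c \<in> carrier (pretensor M Y)" "d \<in> carrier (pretensor M Y)" for c d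
    using h.hom_mult[of c d] that by (simp add: pretensor_simps)
  have neg: "- c \<in> carrier (pretensor M Y)" if "c \<in> carrier (pretensor M Y)" for c
    using that by (simp add: pretensor_simps keys_minus)
  have h0_neg: "h0 (- c) = \<ominus>\<^bsub>G\<^esub> h0 c" if "c \<in> carrier (pretensor M Y)" for c
    using h.hom_inv[of c] that by (simp add: pretensor_simps a_inv_def)
  have h0_diff: "h0 (c - d) = h0 c \<ominus>\<^bsub>G\<^esub> h0 d" if "c \<in> carrier (pretensor M Y)" "d \<in> carrier (pretensor M Y)" for c d
    using h0_add[OF that(1) neg[OF that(2)]] h0_neg[OF that(2)] by (simp add: a_minus_def)
  have diff: "c - d \<in> carrier (pretensor M Y)" if "c \<in> carrier (pretensor M Y)" "d \<in> carrier (pretensor M Y)" for c d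
    using F.a_closed[OF that(1) neg[OF that(2)]] by (simp add: pretensor_simps)
  have "tensor_relations B M Y \<subseteq> kernel F (add_monoid G) h0"
  proof
    fix c assume c: "c \<in> tensor_relations B M Y"
    then consider x x' y where "c = frag_of (x \<oplus>\<^bsub>M\<^esub> x', y) - frag_of (x, y) - frag_of (x', y)"
        "x \<in> carrier M" "x' \<in> carrier M" "y \<in> carrier Y"
      | x y y' where "c = frag_of (x, y \<oplus>\<^bsub>Y\<^esub> y') - frag_of (x, y) - frag_of (x, y')"
        "x \<in> carrier M" "y \<in> carrier Y" "y' \<in> carrier Y"
      | x b y where "c = frag_of (rsmult M x b, y) - frag_of (x, b \<odot>\<^bsub>Y\<^esub> y)"
        "x \<in> carrier M" "b \<in> carrier B" "y \<in> carrier Y"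
      unfolding tensor_relations_def by blast
    then have "h0 c = \<zero>\<^bsub>G\<^esub>"
    proof cases
      case (1 x x' y)
      then show ?thesis
        by (simp add: h0_diff diff frag_of_pretensor h0_of left closed a_minus_def G.a_ac)
          (metis G.r_neg G.a_lcomm G.a_inv_closed G.r_zero closed)
    next
      case (2 x y y')
      then show ?thesis
        by (simp add: h0_diff diff frag_of_pretensor h0_of right closed a_minus_def G.a_ac)
          (metis G.r_neg G.a_lcomm G.a_inv_closed G.r_zero closed)
    next
      case (3 x b y)
      then show ?thesis
        by (simp add: h0_diff diff frag_of_pretensor h0_of balanced closed G.minus_eq_zero_iff)
    qed
    then show "c \<in> kernel F (add_monoid G) h0"
      using c subsetD[OF tensor_relations_subset] by (simp add: kernel_def)
  qed
  then have null: "h0 c = \<zero>\<^bsub>G\<^esub>" if "c \<in> tensor_null B M Y" for c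
    using group.generate_subgroup_incl[OF group_free_Abelian_group _ h.subgroup_kernel] that
    by (auto simp: tensor_null_def kernel_def)
  define h where "h u = h0 (SOME c. c \<in> carrier (pretensor M Y) \<and> cl c = u)" for u
  have h_cl: "h (cl c) = h0 c" if c: "c \<in> carrier (pretensor M Y)" for c
  proof -
    let ?d = "SOME d. d \<in> carrier (pretensor M Y) \<and> cl d = cl c"
    have d: "?d \<in> carrier (pretensor M Y) \<and> cl ?d = cl c" by (rule someI[of _ c]) (use c in simp)
    then have "?d - c \<in> tensor_null B M Y" using tensor_ops(3)[of ?d c] c by (simp add: pretensor_minus)
    then have "h0 ?d \<ominus>\<^bsub>G\<^esub> h0 c = \<zero>\<^bsub>G\<^esub>" using null d c by (simp flip: h0_diff)
    then show ?thesis using h0_closed c d by (simp add: h_def G.minus_eq_zero_iff)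
  qed
  have "h \<in> hom (add_monoid T) (add_monoid G)"
  proof (rule homI)
    fix u assume "u \<in> carrier (add_monoid T)"
    then show "h u \<in> carrier (add_monoid G)" by (auto simp: tensor_ops(1) h_cl h0_closed)
  next
    fix u v assume "u \<in> carrier (add_monoid T)" "v \<in> carrier (add_monoid T)"
    then obtain c d where cd: "u = cl c" "v = cl d" "c \<in> carrier (pretensor M Y)" "d \<in> carrier (pretensor M Y)"
      by (auto simp: tensor_ops(1))
    have "c + d \<in> carrier (pretensor M Y)" using F.a_closed[OF cd(3,4)] by (simp add: pretensor_simps)
    then show "h (u \<otimes>\<^bsub>add_monoid T\<^esub> v) = h u \<otimes>\<^bsub>add_monoid G\<^esub> h v"
      using cd by (simp add: tensor_ops(2) pretensor_simps(2) h_cl h0_add)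
  qed
  moreover have "h (te x y) = \<beta> x y" if "x \<in> carrier M" "y \<in> carrier Y" for x y
    using that by (simp add: tensor_elem_def h_cl frag_of_pretensor h0_of)
  ultimately show ?thesis by (rule that)
qed

lemma tensor_lift:
  assumes X: "left_module A X"
    and closed: "\<And>x y. \<lbrakk>x \<in> carrier M; y \<in> carrier Y\<rbrakk> \<Longrightarrow> \<beta> x y \<in> carrier X"
    and left: "\<And>x x' y. \<lbrakk>x \<in> carrier M; x' \<in> carrier M; y \<in> carrier Y\<rbrakk> \<Longrightarrow> \<beta> (x \<oplus>\<^bsub>M\<^esub> x') y = \<beta> x y \<oplus>\<^bsub>X\<^esub> \<beta> x' y"
    and right: "\<And>x y y'. \<lbrakk>x \<in> carrier M; y \<in> carrier Y; y' \<in> carrier Y\<rbrakk> \<Longrightarrow> \<beta> x (y \<oplus>\<^bsub>Y\<^esub> y') = \<beta> x y \<oplus>\<^bsub>X\<^esub> \<beta> x y'"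
    and balanced: "\<And>x b y. \<lbrakk>x \<in> carrier M; b \<in> carrier B; y \<in> carrier Y\<rbrakk> \<Longrightarrow> \<beta> (rsmult M x b) y = \<beta> x (b \<odot>\<^bsub>Y\<^esub> y)"
    and smult: "\<And>a x y. \<lbrakk>a \<in> carrier A; x \<in> carrier M; y \<in> carrier Y\<rbrakk> \<Longrightarrow> \<beta> (a \<odot>\<^bsub>M\<^esub> x) y = a \<odot>\<^bsub>X\<^esub> \<beta> x y"
  obtains h where "h \<in> module_hom A T X"
    "\<And>x y. \<lbrakk>x \<in> carrier M; y \<in> carrier Y\<rbrakk> \<Longrightarrow> h (te x y) = \<beta> x y"
proof -
  interpret X: left_module A X by (rule X)
  interpret T: left_module A T by (rule left_module_tensor)
  obtain h where h: "h \<in> hom (add_monoid T) (add_monoid X)"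
    "\<And>x y. \<lbrakk>x \<in> carrier M; y \<in> carrier Y\<rbrakk> \<Longrightarrow> h (te x y) = \<beta> x y"
  proof (rule tensor_lift_additive[OF X.M.abelian_group_axioms, of \<beta>])
  qed (auto simp: closed left right balanced)
  have hc: "h u \<in> carrier X" if "u \<in> carrier T" for u using h(1) that by (auto simp: hom_def)
  have ha: "h (u \<oplus>\<^bsub>T\<^esub> v) = h u \<oplus>\<^bsub>X\<^esub> h v" if "u \<in> carrier T" "v \<in> carrier T" for u v
    using h(1) that by (auto simp: hom_def)
  have h0: "h \<zero>\<^bsub>T\<^esub> = \<zero>\<^bsub>X\<^esub>" by (rule additive_zero[OF T.M.abelian_group_axioms X.M.abelian_group_axioms h(1)])
  have "h (a \<odot>\<^bsub>T\<^esub> u) = a \<odot>\<^bsub>X\<^esub> h u" if a: "a \<in> carrier A" and u: "u \<in> carrier T" for a u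
    using u
  proof (induction rule: tensor_induct)
    case zero
    then show ?case using a by (simp add: h0)
  next
    case (elem x y)
    then show ?case using a by (simp add: smult_tensor_elem h(2) smult)
  next
    case (add u v)
    then show ?case using a by (simp add: T.smult_r_distr X.smult_r_distr ha hc)
  qed
  then have "h \<in> module_hom A T X" by (intro module_homI hc ha)
  then show ?thesis using h(2) by (rule that)
qed

end

text \<open>The map id \<otimes> g. Only additivity is demanded of the chosen h, so the ring A is
  not a parameter; linearity over A follows afterwards because values on elementary tensors
  determine the map.\<close>

definition tensor_map ::
  "('b, 'q) ring_scheme \<Rightarrow> ('a, 'b, 'm, 'c) bimodule_scheme \<Rightarrow> ('b, 'y, 'd) module_scheme \<Rightarrow>
    ('b, 'z, 'e) module_scheme \<Rightarrow> ('y \<Rightarrow> 'z) \<Rightarrow> (('m \<times> 'y) \<Rightarrow>\<^sub>0 int) set \<Rightarrow> (('m \<times> 'z) \<Rightarrow>\<^sub>0 int) set"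
  where "tensor_map B M Y Z g =
    (SOME h. h \<in> hom (add_monoid (tensor_module B M Y)) (add_monoid (tensor_module B M Z)) \<and>
      (\<forall>x \<in> carrier M. \<forall>y \<in> carrier Y. h (tensor_elem B M Y x y) = tensor_elem B M Z x (g y)))"

section \<open>Functoriality, coordinates and exactness of the tensor product\<close>

context bimodule
begin

lemma left_module_tensor_module: "left_module B Y \<Longrightarrow> left_module A (tensor_module B M Y)"
  by (intro tensor.left_module_tensor tensor.intro bimodule_axioms)

lemma tensor_hom_cong:
  assumes Y: "left_module B Y" and X: "left_module A X"
    and f: "f \<in> module_hom A (tensor_module B M Y) X" and g: "g \<in> module_hom A (tensor_module B M Y) X"
    and eq: "\<And>x y. \<lbrakk>x \<in> carrier M; y \<in> carrier Y\<rbrakk> \<Longrightarrow> f (tensor_elem B M Y x y) = g (tensor_elem B M Y x y)"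
    and u: "u \<in> carrier (tensor_module B M Y)"
  shows "f u = g u"
proof -
  interpret tensor A B M Y by (intro tensor.intro bimodule_axioms Y)
  show ?thesis
    by (rule tensor_hom_eqI[of X]) (use X f g eq u in \<open>auto simp: left_module_def module_hom_def\<close>)
qed

lemma tensor_map:
  assumes Y: "left_module B Y" and Z: "left_module B Z" and g: "g \<in> module_hom B Y Z"
  shows "tensor_map B M Y Z g \<in> module_hom A (tensor_module B M Y) (tensor_module B M Z)"
    and "\<And>x y. \<lbrakk>x \<in> carrier M; y \<in> carrier Y\<rbrakk> \<Longrightarrow>
      tensor_map B M Y Z g (tensor_elem B M Y x y) = tensor_elem B M Z x (g y)"
proof -
  interpret Y: tensor A B M Y by (intro tensor.intro bimodule_axioms Y)
  interpret Z: tensor A B M Z by (intro tensor.intro bimodule_axioms Z)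
  note TZ = Z.left_module_tensor
  obtain h where h: "h \<in> module_hom A Y.T Z.T"
    "\<And>x y. \<lbrakk>x \<in> carrier M; y \<in> carrier Y\<rbrakk> \<Longrightarrow> h (Y.te x y) = Z.te x (g y)"
  proof (rule Y.tensor_lift[OF TZ, of "\<lambda>x y. Z.te x (g y)"])
  qed (auto simp: module_homD[OF g] Z.tensor_elem_closed Z.tensor_elem_add_left Z.tensor_elem_add_right
      Z.tensor_elem_balanced Z.smult_tensor_elem)
  let ?P = "\<lambda>h. h \<in> hom (add_monoid Y.T) (add_monoid Z.T) \<and>
      (\<forall>x \<in> carrier M. \<forall>y \<in> carrier Y. h (Y.te x y) = Z.te x (g y))"
  have hh: "h \<in> hom (add_monoid Y.T) (add_monoid Z.T)" using h(1) by (simp add: module_hom_def)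
  have "?P (tensor_map B M Y Z g)"
    unfolding tensor_map_def by (rule someI[of ?P h]) (use hh h(2) in blast)
  then have t: "tensor_map B M Y Z g \<in> hom (add_monoid Y.T) (add_monoid Z.T)"
    "\<And>x y. \<lbrakk>x \<in> carrier M; y \<in> carrier Y\<rbrakk> \<Longrightarrow> tensor_map B M Y Z g (Y.te x y) = Z.te x (g y)" by blast+
  have "tensor_map B M Y Z g u = h u" if "u \<in> carrier Y.T" for u
    by (rule Y.tensor_hom_eqI[OF Z.tensor_ops(4) t(1) hh _ that]) (simp add: t(2) h(2))
  then show "tensor_map B M Y Z g \<in> module_hom A Y.T Z.T"
    by (rule module_hom_cong[OF Y.left_module_tensor h(1)])
  show "tensor_map B M Y Z g (Y.te x y) = Z.te x (g y)" if "x \<in> carrier M" "y \<in> carrier Y" for x y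
    by (rule t(2)[OF that])
qed

lemma right_coordinate:
  assumes "\<xi> \<in> module_hom (op_ring B) (right_part M) (regular_module (op_ring B))"
  shows "\<And>x. x \<in> carrier M \<Longrightarrow> \<xi> x \<in> carrier B"
    and "\<And>x y. \<lbrakk>x \<in> carrier M; y \<in> carrier M\<rbrakk> \<Longrightarrow> \<xi> (x \<oplus>\<^bsub>M\<^esub> y) = \<xi> x \<oplus>\<^bsub>B\<^esub> \<xi> y"
    and "\<And>x b. \<lbrakk>x \<in> carrier M; b \<in> carrier B\<rbrakk> \<Longrightarrow> \<xi> (rsmult M x b) = \<xi> x \<otimes>\<^bsub>B\<^esub> b"
  using module_homD[OF assms] by (simp_all add: right_part_def op_ring_def)

text \<open>A right-linear functional \<xi> from M to B induces \<xi> \<otimes> id from M \<otimes>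
  Y to B \<otimes> Y, and the latter is identified with Y.\<close>

lemma tensor_coordinate:
  assumes Y: "left_module B Y" and \<xi>: "\<xi> \<in> module_hom (op_ring B) (right_part M) (regular_module (op_ring B))"
  obtains \<Xi> where "\<Xi> \<in> hom (add_monoid (tensor_module B M Y)) (add_monoid Y)"
    "\<And>x y. \<lbrakk>x \<in> carrier M; y \<in> carrier Y\<rbrakk> \<Longrightarrow> \<Xi> (tensor_elem B M Y x y) = \<xi> x \<odot>\<^bsub>Y\<^esub> y"
proof -
  interpret tensor A B M Y by (intro tensor.intro bimodule_axioms Y)
  show ?thesis
  proof (rule tensor_lift_additive[of Y "\<lambda>x y. \<xi> x \<odot>\<^bsub>Y\<^esub> y"])
  qed (auto simp: right_coordinate[OF \<xi>] Y.smult_l_distr Y.smult_r_distr Y.smult_assoc1 Y.M.abelian_group_axioms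
      intro: that)
qed

lemma tensor_coordinates:
  assumes Y: "left_module B Y" and db: "dual_basis (op_ring B) (right_part M) n m \<xi>"
  obtains \<Xi> where "\<And>i. i < n \<Longrightarrow> \<Xi> i \<in> hom (add_monoid (tensor_module B M Y)) (add_monoid Y)"
    "\<And>i x y. \<lbrakk>i < n; x \<in> carrier M; y \<in> carrier Y\<rbrakk> \<Longrightarrow> \<Xi> i (tensor_elem B M Y x y) = \<xi> i x \<odot>\<^bsub>Y\<^esub> y"
proof -
  have "\<exists>\<Xi>. \<Xi> \<in> hom (add_monoid (tensor_module B M Y)) (add_monoid Y) \<and>
      (\<forall>x \<in> carrier M. \<forall>y \<in> carrier Y. \<Xi> (tensor_elem B M Y x y) = \<xi> i x \<odot>\<^bsub>Y\<^esub> y)"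
    if "i < n" for i
    by (rule tensor_coordinate[OF Y dual_basisD(2)[OF db that]]) blast
  then show ?thesis using that by metis
qed

lemma tensor_elem_finsum_left:
  assumes Y: "left_module B Y" and "f \<in> I \<rightarrow> carrier M" "y \<in> carrier Y"
  shows "tensor_elem B M Y (finsum (right_part M) f I) y =
    (\<Oplus>\<^bsub>tensor_module B M Y\<^esub>i \<in> I. tensor_elem B M Y (f i) y)"
proof -
  interpret tensor A B M Y by (intro tensor.intro bimodule_axioms Y)
  show ?thesis
    by (rule additive_finsum[OF right.M.abelian_group_axioms tensor_ops(4), of "\<lambda>x. te x y"])
      (use assms in \<open>auto simp: hom_def right_part_def tensor_elem_closed tensor_elem_add_left\<close>)
qed

lemma tensor_elem_finsum_right:
  assumes Y: "left_module B Y" and "f \<in> I \<rightarrow> carrier Y" "x \<in> carrier M"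
  shows "tensor_elem B M Y x (finsum Y f I) = (\<Oplus>\<^bsub>tensor_module B M Y\<^esub>i \<in> I. tensor_elem B M Y x (f i))"
proof -
  interpret tensor A B M Y by (intro tensor.intro bimodule_axioms Y)
  show ?thesis
    by (rule additive_finsum[OF Y.M.abelian_group_axioms tensor_ops(4), of "\<lambda>y. te x y"])
      (use assms in \<open>auto simp: hom_def tensor_elem_closed tensor_elem_add_right\<close>)
qed

text \<open>Write x as the sum of m_i \<xi>_i(x) and move each scalar \<xi>_i(x) across the tensor
  sign: x \<otimes> y is the sum of m_i \<otimes> \<xi>_i(x) y. Thus a tensor is recovered from its
  n coordinates in Y.\<close>

lemma tensor_decomposition:
  assumes Y: "left_module B Y" and db: "dual_basis (op_ring B) (right_part M) n m \<xi>"
    and \<Xi>: "\<And>i. i < n \<Longrightarrow> \<Xi> i \<in> hom (add_monoid (tensor_module B M Y)) (add_monoid Y)"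
    and el: "\<And>i x y. \<lbrakk>i < n; x \<in> carrier M; y \<in> carrier Y\<rbrakk> \<Longrightarrow> \<Xi> i (tensor_elem B M Y x y) = \<xi> i x \<odot>\<^bsub>Y\<^esub> y"
    and u: "u \<in> carrier (tensor_module B M Y)"
  shows "(\<Oplus>\<^bsub>tensor_module B M Y\<^esub>i \<in> {..<n}. tensor_elem B M Y (m i) (\<Xi> i u)) = u"
proof -
  interpret tensor A B M Y by (intro tensor.intro bimodule_axioms Y)
  interpret T: left_module A T by (rule left_module_tensor)
  have m: "m i \<in> carrier M" if "i < n" for i using dual_basisD(1)[OF db that] by (simp add: right_part_def)
  note \<xi> = right_coordinate[OF dual_basisD(2)[OF db]]
  have \<Xi>c: "\<Xi> i u \<in> carrier Y" if "i < n" "u \<in> carrier T" for i u using \<Xi>[OF that(1)] that(2) by (auto simp: hom_def)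
  show ?thesis using u
  proof (induction rule: tensor_induct)
    case zero
    have "\<Xi> i \<zero>\<^bsub>T\<^esub> = \<zero>\<^bsub>Y\<^esub>" if "i < n" for i
      by (rule additive_zero[OF T.M.abelian_group_axioms Y.M.abelian_group_axioms \<Xi>[OF that]])
    then show ?case by (intro T.M.add.finprod_one_eqI[simplified]) (simp add: m tensor_elem_zero_right)
  next
    case (elem x y)
    have sm: "smult (right_part M) = (\<lambda>b x. rsmult M x b)" by (simp add: right_part_def)
    have "(\<Oplus>\<^bsub>T\<^esub>i \<in> {..<n}. te (m i) (\<Xi> i (te x y))) = (\<Oplus>\<^bsub>T\<^esub>i \<in> {..<n}. te (rsmult M (m i) (\<xi> i x)) y)"
      by (rule T.M.finsum_cong') (auto simp: el elem m \<xi> tensor_elem_balanced tensor_elem_closed)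
    also have "\<dots> = te (\<Oplus>\<^bsub>right_part M\<^esub>i \<in> {..<n}. rsmult M (m i) (\<xi> i x)) y"
      by (rule tensor_elem_finsum_left[OF Y _ elem(2), symmetric]) (auto simp: m \<xi> elem)
    also have "\<dots> = te x y"
      using dual_basisD(3)[OF db, of x] elem by (simp add: sm) (simp add: right_part_def)
    finally show ?case .
  next
    case (add u v)
    have "(\<Oplus>\<^bsub>T\<^esub>i \<in> {..<n}. te (m i) (\<Xi> i (u \<oplus>\<^bsub>T\<^esub> v))) =
        (\<Oplus>\<^bsub>T\<^esub>i \<in> {..<n}. te (m i) (\<Xi> i u) \<oplus>\<^bsub>T\<^esub> te (m i) (\<Xi> i v))"
    proof (rule T.M.finsum_cong')
      fix i assume "i \<in> {..<n}"
      then have i: "i < n" by simp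
      have "\<Xi> i (u \<oplus>\<^bsub>T\<^esub> v) = \<Xi> i u \<oplus>\<^bsub>Y\<^esub> \<Xi> i v" using \<Xi>[OF i] add(1,2) by (auto simp: hom_def)
      then show "te (m i) (\<Xi> i (u \<oplus>\<^bsub>T\<^esub> v)) = te (m i) (\<Xi> i u) \<oplus>\<^bsub>T\<^esub> te (m i) (\<Xi> i v)"
        by (simp add: tensor_elem_add_right m[OF i] \<Xi>c[OF i] add(1,2))
    qed (auto simp: m \<Xi>c add tensor_elem_closed)
    also have "\<dots> = (\<Oplus>\<^bsub>T\<^esub>i \<in> {..<n}. te (m i) (\<Xi> i u)) \<oplus>\<^bsub>T\<^esub> (\<Oplus>\<^bsub>T\<^esub>i \<in> {..<n}. te (m i) (\<Xi> i v))"
      by (rule T.M.finsum_addf) (auto simp: m \<Xi>c add tensor_elem_closed)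
    finally show ?case using add by simp
  qed
qed

text \<open>Coordinates are natural in the second factor. Hence a tensor killed by id \<otimes> f
  has coordinates killed by f and vanishes, and a tensor killed by id \<otimes> g has coordinates
  f(y_i) and is the image of the sum of m_i \<otimes> y_i. Surjectivity and the vanishing of the
  composite are seen on elementary tensors.\<close>

lemma tensor_short_exact:
  assumes S: "short_exact B Y f V g Z" and db: "dual_basis (op_ring B) (right_part M) n m \<xi>"
  shows "short_exact A (tensor_module B M Y) (tensor_map B M Y V f) (tensor_module B M V)
    (tensor_map B M V Z g) (tensor_module B M Z)"
proof -
  note s = short_exactD[OF S]
  interpret Y: tensor A B M Y by (intro tensor.intro bimodule_axioms s)
  interpret V: tensor A B M V by (intro tensor.intro bimodule_axioms s)
  interpret Z: tensor A B M Z by (intro tensor.intro bimodule_axioms s)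
  interpret TY: left_module A Y.T by (rule Y.left_module_tensor)
  interpret TV: left_module A V.T by (rule V.left_module_tensor)
  interpret TZ: left_module A Z.T by (rule Z.left_module_tensor)
  note f = tensor_map[OF s(1,2,4)] and g = tensor_map[OF s(2,3,5)]
  let ?f = "tensor_map B M Y V f" and ?g = "tensor_map B M V Z g"
  have m: "m i \<in> carrier M" if "i < n" for i using dual_basisD(1)[OF db that] by (simp add: right_part_def)
  note \<xi> = dual_basisD(2)[OF db]
  obtain \<Xi>Y where \<Xi>Y: "\<And>i. i < n \<Longrightarrow> \<Xi>Y i \<in> hom (add_monoid Y.T) (add_monoid Y)"
    "\<And>i x y. \<lbrakk>i < n; x \<in> carrier M; y \<in> carrier Y\<rbrakk> \<Longrightarrow> \<Xi>Y i (Y.te x y) = \<xi> i x \<odot>\<^bsub>Y\<^esub> y"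
    by (rule tensor_coordinates[OF s(1) db]) blast
  obtain \<Xi>V where \<Xi>V: "\<And>i. i < n \<Longrightarrow> \<Xi>V i \<in> hom (add_monoid V.T) (add_monoid V)"
    "\<And>i x y. \<lbrakk>i < n; x \<in> carrier M; y \<in> carrier V\<rbrakk> \<Longrightarrow> \<Xi>V i (V.te x y) = \<xi> i x \<odot>\<^bsub>V\<^esub> y"
    by (rule tensor_coordinates[OF s(2) db]) blast
  obtain \<Xi>Z where \<Xi>Z: "\<And>i. i < n \<Longrightarrow> \<Xi>Z i \<in> hom (add_monoid Z.T) (add_monoid Z)"
    "\<And>i x y. \<lbrakk>i < n; x \<in> carrier M; y \<in> carrier Z\<rbrakk> \<Longrightarrow> \<Xi>Z i (Z.te x y) = \<xi> i x \<odot>\<^bsub>Z\<^esub> y"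
    by (rule tensor_coordinates[OF s(3) db]) blast
  have hom: "h \<in> hom (add_monoid K) (add_monoid L)" if "h \<in> module_hom S K L" for h S K L
    using that by (simp add: module_hom_def)
  have nat: "f (\<Xi>Y i u) = \<Xi>V i (?f u)" if i: "i < n" and u: "u \<in> carrier Y.T" for i u
  proof (rule Y.tensor_hom_eqI[OF V.Y.M.abelian_group_axioms _ _ _ u, of "\<lambda>u. f (\<Xi>Y i u)" "\<lambda>u. \<Xi>V i (?f u)"])
    show "(\<lambda>u. f (\<Xi>Y i u)) \<in> hom (add_monoid Y.T) (add_monoid V)"
      using \<Xi>Y(1)[OF i] module_homD[OF s(4)] by (auto simp: hom_def Pi_def)
    show "(\<lambda>u. \<Xi>V i (?f u)) \<in> hom (add_monoid Y.T) (add_monoid V)"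
      using \<Xi>V(1)[OF i] module_homD[OF f(1)] by (auto simp: hom_def Pi_def)
  qed (use i right_coordinate(1)[OF \<xi>[OF i]] in \<open>simp add: \<Xi>Y(2) \<Xi>V(2) f(2) module_homD[OF s(4)]\<close>)
  have nat': "g (\<Xi>V i u) = \<Xi>Z i (?g u)" if i: "i < n" and u: "u \<in> carrier V.T" for i u
  proof (rule V.tensor_hom_eqI[OF Z.Y.M.abelian_group_axioms _ _ _ u, of "\<lambda>u. g (\<Xi>V i u)" "\<lambda>u. \<Xi>Z i (?g u)"])
    show "(\<lambda>u. g (\<Xi>V i u)) \<in> hom (add_monoid V.T) (add_monoid Z)"
      using \<Xi>V(1)[OF i] module_homD[OF s(5)] by (auto simp: hom_def Pi_def)
    show "(\<lambda>u. \<Xi>Z i (?g u)) \<in> hom (add_monoid V.T) (add_monoid Z)"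
      using \<Xi>Z(1)[OF i] module_homD[OF g(1)] by (auto simp: hom_def Pi_def)
  qed (use i right_coordinate(1)[OF \<xi>[OF i]] in \<open>simp add: \<Xi>V(2) \<Xi>Z(2) g(2) module_homD[OF s(5)]\<close>)
  have z: "\<Xi>V i \<zero>\<^bsub>V.T\<^esub> = \<zero>\<^bsub>V\<^esub>" "\<Xi>Z i \<zero>\<^bsub>Z.T\<^esub> = \<zero>\<^bsub>Z\<^esub>" if "i < n" for i
    by (rule additive_zero[OF TV.M.abelian_group_axioms V.Y.M.abelian_group_axioms \<Xi>V(1)[OF that]],
        rule additive_zero[OF TZ.M.abelian_group_axioms Z.Y.M.abelian_group_axioms \<Xi>Z(1)[OF that]])
  have \<Xi>Yc: "\<Xi>Y i u \<in> carrier Y" if "i < n" "u \<in> carrier Y.T" for i u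
    using \<Xi>Y(1)[OF that(1)] that(2) by (auto simp: hom_def)
  have \<Xi>Vc: "\<Xi>V i u \<in> carrier V" if "i < n" "u \<in> carrier V.T" for i u
    using \<Xi>V(1)[OF that(1)] that(2) by (auto simp: hom_def)
  have decY: "(\<Oplus>\<^bsub>Y.T\<^esub>i \<in> {..<n}. Y.te (m i) (\<Xi>Y i u)) = u" if "u \<in> carrier Y.T" for u
    by (rule tensor_decomposition[OF s(1) db \<Xi>Y(1) \<Xi>Y(2) that])
  have decV: "(\<Oplus>\<^bsub>V.T\<^esub>i \<in> {..<n}. V.te (m i) (\<Xi>V i u)) = u" if "u \<in> carrier V.T" for u
    by (rule tensor_decomposition[OF s(2) db \<Xi>V(1) \<Xi>V(2) that])
  show ?thesis
  proof (rule short_exactI[OF Y.left_module_tensor V.left_module_tensor Z.left_module_tensor f(1) g(1)])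
    fix u assume u: "u \<in> carrier Y.T" "?f u = \<zero>\<^bsub>V.T\<^esub>"
    have "\<Xi>Y i u = \<zero>\<^bsub>Y\<^esub>" if i: "i < n" for i
      by (rule module_hom_injD[OF s(1,2,4,6) \<Xi>Yc[OF i u(1)]]) (simp add: nat i u z)
    then have "(\<Oplus>\<^bsub>Y.T\<^esub>i \<in> {..<n}. Y.te (m i) (\<Xi>Y i u)) = \<zero>\<^bsub>Y.T\<^esub>"
      by (intro TY.M.add.finprod_one_eqI[simplified]) (simp add: m Y.tensor_elem_zero_right)
    then show "u = \<zero>\<^bsub>Y.T\<^esub>" by (simp only: decY[OF u(1)])
  next
    fix w assume "w \<in> carrier Z.T"
    then show "\<exists>v \<in> carrier V.T. ?g v = w"
    proof (induction rule: Z.tensor_induct)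
      case zero
      then show ?case
        using module_hom_zero[OF V.left_module_tensor Z.left_module_tensor g(1)] by (intro bexI[OF _ TV.M.zero_closed])
    next
      case (elem x y)
      obtain v where v: "v \<in> carrier V" "y = g v" by (rule short_exact_surjE[OF S elem(2)])
      then show ?case using elem(1) by (intro bexI[OF _ V.tensor_elem_closed[OF elem(1) v(1)]]) (simp add: g(2))
    next
      case (add u v)
      then obtain u' v' where "u' \<in> carrier V.T" "?g u' = u" "v' \<in> carrier V.T" "?g v' = v" by blast
      then show ?case by (intro bexI[of _ "u' \<oplus>\<^bsub>V.T\<^esub> v'"]) (simp_all add: module_homD(2)[OF g(1)])
    qed
  next
    fix u assume "u \<in> carrier Y.T"
    then show "?g (?f u) = \<zero>\<^bsub>Z.T\<^esub>"
    proof (induction rule: Y.tensor_induct)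
      case zero
      then show ?case
        by (simp add: module_hom_zero[OF Y.left_module_tensor V.left_module_tensor f(1)]
            module_hom_zero[OF V.left_module_tensor Z.left_module_tensor g(1)])
    next
      case (elem x y)
      then show ?case using module_homD(1)[OF s(4) elem(2)]
        by (simp add: f(2) g(2) s(8) Z.tensor_elem_zero_right)
    next
      case (add u v)
      then show ?case
        using module_homD(1)[OF f(1)] by (simp add: module_homD(2)[OF f(1)] module_homD(2)[OF g(1)])
    qed
  next
    fix v assume v: "v \<in> carrier V.T" "?g v = \<zero>\<^bsub>Z.T\<^esub>"
    have "\<exists>y. y \<in> carrier Y \<and> \<Xi>V i v = f y" if i: "i < n" for i
    proof -
      have "g (\<Xi>V i v) = \<zero>\<^bsub>Z\<^esub>" by (simp add: nat' i v z)
      then show ?thesis by (rule short_exact_kernelE[OF S \<Xi>Vc[OF i v(1)]]) blast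
    qed
    then obtain y where y: "\<And>i. i < n \<Longrightarrow> y i \<in> carrier Y" "\<And>i. i < n \<Longrightarrow> \<Xi>V i v = f (y i)" by metis
    have "?f (\<Oplus>\<^bsub>Y.T\<^esub>i \<in> {..<n}. Y.te (m i) (y i)) = (\<Oplus>\<^bsub>V.T\<^esub>i \<in> {..<n}. ?f (Y.te (m i) (y i)))"
      by (rule module_hom_finsum[OF Y.left_module_tensor V.left_module_tensor f(1)]) (auto simp: m y Y.tensor_elem_closed)
    also have "\<dots> = (\<Oplus>\<^bsub>V.T\<^esub>i \<in> {..<n}. V.te (m i) (\<Xi>V i v))"
      by (rule TV.M.finsum_cong') (auto simp: m y f(2) V.tensor_elem_closed module_homD(1)[OF s(4)])
    also have "\<dots> = v" by (rule decV[OF v(1)])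
    finally show "\<exists>k \<in> carrier Y.T. ?f k = v"
      by (rule bexI) (auto intro!: TY.M.finsum_closed simp: m y Y.tensor_elem_closed)
  qed
qed

lemma finitely_generated_tensor:
  assumes Y: "left_module B Y" "finitely_generated B Y" and M: "finitely_generated A M"
  shows "finitely_generated A (tensor_module B M Y)"
proof -
  interpret tensor A B M Y by (intro tensor.intro bimodule_axioms Y)
  interpret T: left_module A T by (rule left_module_tensor)
  obtain U where U: "finite U" "U \<subseteq> carrier M" "\<And>H. submodule H A M \<Longrightarrow> U \<subseteq> H \<Longrightarrow> H = carrier M"
    using M by (auto simp: finitely_generated_def)
  obtain W where W: "finite W" "W \<subseteq> carrier Y" "\<And>H. submodule H B Y \<Longrightarrow> W \<subseteq> H \<Longrightarrow> H = carrier Y"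
    using Y(2) by (auto simp: finitely_generated_def)
  let ?G = "(\<lambda>(x, y). te x y) ` (U \<times> W)"
  have "H = carrier T" if H: "submodule H A T" "?G \<subseteq> H" for H
  proof -
    interpret H: submodule H A T by (rule H)
    have HT: "H \<subseteq> carrier T" and H0: "\<zero>\<^bsub>T\<^esub> \<in> H" and Hadd: "\<And>u v. u \<in> H \<Longrightarrow> v \<in> H \<Longrightarrow> u \<oplus>\<^bsub>T\<^esub> v \<in> H"
      using H.subset H.one_closed H.m_closed by auto
    have 1: "te x w \<in> H" if x: "x \<in> carrier M" and w: "w \<in> W" for x w
    proof -
      have wY: "w \<in> carrier Y" using w W(2) by auto
      have "{x \<in> carrier M. te x w \<in> H} = carrier M"
      proof (rule U(3))
        show "submodule {x \<in> carrier M. te x w \<in> H} A M"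
          by (rule left.left_submoduleI)
            (use wY H.smult_closed in \<open>auto simp: tensor_elem_zero_left H0 tensor_elem_add_left Hadd simp flip: smult_tensor_elem\<close>)
        show "U \<subseteq> {x \<in> carrier M. te x w \<in> H}" using H(2) U(2) w by auto
      qed
      then show ?thesis using x by blast
    qed
    have 2: "te x y \<in> H" if x: "x \<in> carrier M" and y: "y \<in> carrier Y" for x y
    proof -
      \<comment> \<open>Quantifying over all x makes this set a B-submodule: scalars on y are moved
        to the left factor, where they change x.\<close>
      have "{y \<in> carrier Y. \<forall>x \<in> carrier M. te x y \<in> H} = carrier Y"
      proof (rule W(3))
        show "submodule {y \<in> carrier Y. \<forall>x \<in> carrier M. te x y \<in> H} B Y"
          by (rule Y.left_submoduleI)
            (auto simp: tensor_elem_zero_right H0 tensor_elem_add_right Hadd simp flip: tensor_elem_balanced)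
        show "W \<subseteq> {y \<in> carrier Y. \<forall>x \<in> carrier M. te x y \<in> H}" using 1 W(2) by auto
      qed
      then show ?thesis using x y by blast
    qed
    have "u \<in> H" if "u \<in> carrier T" for u
      using that by (induction rule: tensor_induct) (auto intro: H0 Hadd 2)
    then show ?thesis using HT by blast
  qed
  moreover have "finite ?G" "?G \<subseteq> carrier T" using U(1,2) W(1,2) by (auto intro: tensor_elem_closed)
  ultimately show ?thesis unfolding finitely_generated_def by (intro exI[of _ ?G]) simp
qed

text \<open>
  Homomorphisms into \<open>M \<otimes> Q\<close> extend as soon as those into \<open>M\<close> do, since the coordinates of
  a dual basis of \<open>Q\<close> turn the former into finitely many of the latter.
\<close>

lemma extends_along_tensor:
  assumes ext: "extends_along A K f X M" and K: "left_module A K" and X: "left_module A X"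
    and f: "f \<in> module_hom A K X" and Q: "left_module B Q" and db: "dual_basis B Q n q \<eta>"
  shows "extends_along A K f X (tensor_module B M Q)"
proof (rule extends_alongI)
  interpret tensor A B M Q by (intro tensor.intro bimodule_axioms Q)
  interpret T: left_module A T by (rule left_module_tensor)
  interpret X: left_module A X by (rule X)
  note q = dual_basisD(1)[OF db] and \<eta> = module_homD[OF dual_basisD(2)[OF db], simplified]
  \<comment> \<open>The map is id \<otimes> \<eta>_i from M \<otimes> Q to M \<otimes> B, followed
    by the right action M \<otimes> B \<rightarrow> M.\<close>
  have "\<exists>h. h \<in> module_hom A T M \<and> (\<forall>x \<in> carrier M. \<forall>y \<in> carrier Q. h (te x y) = rsmult M x (\<eta> i y))"
    if i: "i < n" for i
  proof -
    obtain h where "h \<in> module_hom A T M"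
      "\<And>x y. \<lbrakk>x \<in> carrier M; y \<in> carrier Q\<rbrakk> \<Longrightarrow> h (te x y) = rsmult M x (\<eta> i y)"
    proof (rule tensor_lift[OF left.left_module_axioms, of "\<lambda>x y. rsmult M x (\<eta> i y)"])
    qed (use \<eta>[OF i] in \<open>auto simp: rsmult_distr rsmult_distr_ring rsmult_assoc smult_rsmult\<close>)
    then show ?thesis by blast
  qed
  then obtain c where c: "\<And>i. i < n \<Longrightarrow> c i \<in> module_hom A T M"
    "\<And>i x y. \<lbrakk>i < n; x \<in> carrier M; y \<in> carrier Q\<rbrakk> \<Longrightarrow> c i (te x y) = rsmult M x (\<eta> i y)" by metis
  have te: "(\<lambda>x. te x (q i)) \<in> module_hom A M T" if "i < n" for i
    using q[OF that] by (intro module_homI) (simp_all add: tensor_elem_closed tensor_elem_add_left smult_tensor_elem)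
  have id: "(\<Oplus>\<^bsub>T\<^esub>i \<in> {..<n}. te (c i u) (q i)) = u" if u: "u \<in> carrier T" for u
  proof (rule tensor_hom_cong[OF Q left_module_tensor _ module_hom_id _ u])
    show "(\<lambda>u. \<Oplus>\<^bsub>T\<^esub>i \<in> {..<n}. te (c i u) (q i)) \<in> module_hom A T T"
      by (rule module_hom_finsum_map[OF left_module_tensor left_module_tensor])
        (rule module_hom_comp[OF c(1) te]; simp)
    fix x y assume xy: "x \<in> carrier M" "y \<in> carrier Q"
    have "(\<Oplus>\<^bsub>T\<^esub>i \<in> {..<n}. te (c i (te x y)) (q i)) = (\<Oplus>\<^bsub>T\<^esub>i \<in> {..<n}. te x (\<eta> i y \<odot>\<^bsub>Q\<^esub> q i))"
      by (rule T.M.finsum_cong') (auto simp: c(2) xy q \<eta> tensor_elem_balanced tensor_elem_closed)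
    also have "\<dots> = te x (\<Oplus>\<^bsub>Q\<^esub>i \<in> {..<n}. \<eta> i y \<odot>\<^bsub>Q\<^esub> q i)"
      by (rule tensor_elem_finsum_right[OF Q _ xy(1), symmetric]) (auto simp: \<eta> q xy)
    also have "\<dots> = te x y" by (simp only: dual_basisD(3)[OF db xy(2)])
    finally show "(\<Oplus>\<^bsub>T\<^esub>i \<in> {..<n}. te (c i (te x y)) (q i)) = te x y" .
  qed
  fix h assume h: "h \<in> module_hom A K T"
  have "\<exists>k \<in> module_hom A X M. \<forall>x \<in> carrier K. k (f x) = c i (h x)" if "i < n" for i
    using ext module_hom_comp[OF h c(1)[OF that]] by (auto simp: extends_along_def)
  then obtain k where k: "\<And>i. i < n \<Longrightarrow> k i \<in> module_hom A X M"
    "\<And>i x. \<lbrakk>i < n; x \<in> carrier K\<rbrakk> \<Longrightarrow> k i (f x) = c i (h x)" by metis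
  have hom: "(\<lambda>x. \<Oplus>\<^bsub>T\<^esub>i \<in> {..<n}. te (k i x) (q i)) \<in> module_hom A X T"
    by (rule module_hom_finsum_map[OF X left_module_tensor]) (rule module_hom_comp[OF k(1) te]; simp)
  have "(\<Oplus>\<^bsub>T\<^esub>i \<in> {..<n}. te (k i (f x)) (q i)) = h x" if x: "x \<in> carrier K" for x
  proof -
    have hx: "h x \<in> carrier T" by (rule module_homD(1)[OF h x])
    have "(\<Oplus>\<^bsub>T\<^esub>i \<in> {..<n}. te (k i (f x)) (q i)) = (\<Oplus>\<^bsub>T\<^esub>i \<in> {..<n}. te (c i (h x)) (q i))"
      by (rule T.M.finsum_cong') (auto simp: k(2) x q tensor_elem_closed module_homD(1)[OF c(1) hx])
    then show ?thesis by (simp only: id[OF hx])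
  qed
  then show "\<exists>k \<in> module_hom A X T. \<forall>x \<in> carrier K. k (f x) = h x"
    by (intro bexI[OF _ hom] ballI)
qed

end

section \<open>Modules over triangular matrix rings\<close>

locale triangular = bimodule A B M + B: ring B
  for A :: "('a, 'p) ring_scheme" and B :: "('b, 'q) ring_scheme"
    and M :: "('a, 'b, 'm, 'c) bimodule_scheme"
begin

abbreviation "\<Lambda> \<equiv> triangular_ring A B M"
abbreviation "T \<equiv> tensor_module B M"
abbreviation "te \<equiv> tensor_elem B M"
abbreviation "tri \<equiv> triangular_module B M"

definition triple ::
  "('a, 'x, 'd) module_scheme \<Rightarrow> ('b, 'y, 'e) module_scheme \<Rightarrow> ((('m \<times> 'y) \<Rightarrow>\<^sub>0 int) set \<Rightarrow> 'x) \<Rightarrow> bool"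
  where "triple X Y \<phi> \<longleftrightarrow> left_module A X \<and> left_module B Y \<and> \<phi> \<in> module_hom A (T Y) X"

lemma tripleD:
  assumes "triple X Y \<phi>"
  shows "left_module A X" "left_module B Y" "\<phi> \<in> module_hom A (T Y) X"
  using assms by (auto simp: triple_def)

lemma ring_triangular: "ring \<Lambda>"
  by (rule ring_triangular_ring[OF B.ring_axioms bimodule_axioms])

lemma triangular_ring_simps [simp]:
  "carrier \<Lambda> = carrier A \<times> carrier M \<times> carrier B"
  "\<one>\<^bsub>\<Lambda>\<^esub> = (\<one>\<^bsub>A\<^esub>, \<zero>\<^bsub>M\<^esub>, \<one>\<^bsub>B\<^esub>)" "\<zero>\<^bsub>\<Lambda>\<^esub> = (\<zero>\<^bsub>A\<^esub>, \<zero>\<^bsub>M\<^esub>, \<zero>\<^bsub>B\<^esub>)"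
  "(a, x, b) \<oplus>\<^bsub>\<Lambda>\<^esub> (a', x', b') = (a \<oplus>\<^bsub>A\<^esub> a', x \<oplus>\<^bsub>M\<^esub> x', b \<oplus>\<^bsub>B\<^esub> b')"
  "(a, x, b) \<otimes>\<^bsub>\<Lambda>\<^esub> (a', x', b') = (a \<otimes>\<^bsub>A\<^esub> a', a \<odot>\<^bsub>M\<^esub> x' \<oplus>\<^bsub>M\<^esub> rsmult M x b', b \<otimes>\<^bsub>B\<^esub> b')"
  by (simp_all add: triangular_ring_def)

lemma triangular_module_simps [simp]:
  "carrier (tri X Y \<phi>) = carrier X \<times> carrier Y" "\<zero>\<^bsub>tri X Y \<phi>\<^esub> = (\<zero>\<^bsub>X\<^esub>, \<zero>\<^bsub>Y\<^esub>)"
  "(x, y) \<oplus>\<^bsub>tri X Y \<phi>\<^esub> (x', y') = (x \<oplus>\<^bsub>X\<^esub> x', y \<oplus>\<^bsub>Y\<^esub> y')"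
  "(a, m, b) \<odot>\<^bsub>tri X Y \<phi>\<^esub> (x, y) = (a \<odot>\<^bsub>X\<^esub> x \<oplus>\<^bsub>X\<^esub> \<phi> (te Y m y), b \<odot>\<^bsub>Y\<^esub> y)"
  by (simp_all add: triangular_module_def)

lemma left_module_tri: "triple X Y \<phi> \<Longrightarrow> left_module \<Lambda> (tri X Y \<phi>)"
  by (intro left_module_triangular_module B.ring_axioms bimodule_axioms) (auto simp: triple_def)

lemma te_closed: "\<lbrakk>left_module B Y; m \<in> carrier M; y \<in> carrier Y\<rbrakk> \<Longrightarrow> te Y m y \<in> carrier (T Y)"
  by (intro tensor.tensor_elem_closed[of A] tensor.intro bimodule_axioms)

lemma triple_simps:
  assumes "triple X Y \<phi>"
  shows "\<And>m y. \<lbrakk>m \<in> carrier M; y \<in> carrier Y\<rbrakk> \<Longrightarrow> \<phi> (te Y m y) \<in> carrier X"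
    and "\<And>y. y \<in> carrier Y \<Longrightarrow> \<phi> (te Y \<zero>\<^bsub>M\<^esub> y) = \<zero>\<^bsub>X\<^esub>"
    and "\<And>m. m \<in> carrier M \<Longrightarrow> \<phi> (te Y m \<zero>\<^bsub>Y\<^esub>) = \<zero>\<^bsub>X\<^esub>"
proof -
  note t = tripleD[OF assms]
  interpret Y: tensor A B M Y by (intro tensor.intro bimodule_axioms t)
  note z = module_hom_zero[OF left_module_tensor_module[OF t(2)] t(1,3)]
  show "\<phi> (te Y m y) \<in> carrier X" if "m \<in> carrier M" "y \<in> carrier Y" for m y
    by (rule module_homD(1)[OF t(3) Y.tensor_elem_closed[OF that]])
  show "\<phi> (te Y \<zero>\<^bsub>M\<^esub> y) = \<zero>\<^bsub>X\<^esub>" if "y \<in> carrier Y" for y by (simp add: Y.tensor_elem_zero_left that z)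
  show "\<phi> (te Y m \<zero>\<^bsub>Y\<^esub>) = \<zero>\<^bsub>X\<^esub>" if "m \<in> carrier M" for m by (simp add: Y.tensor_elem_zero_right that z)
qed

lemma tri_homI:
  assumes X: "triple X Y \<phi>" and X': "triple X' Y' \<phi>'"
    and f: "f \<in> module_hom A X X'" and g: "g \<in> module_hom B Y Y'"
    and c: "\<And>m y. \<lbrakk>m \<in> carrier M; y \<in> carrier Y\<rbrakk> \<Longrightarrow> f (\<phi> (te Y m y)) = \<phi>' (te Y' m (g y))"
  shows "map_prod f g \<in> module_hom \<Lambda> (tri X Y \<phi>) (tri X' Y' \<phi>')"
proof -
  interpret X: left_module A X by (rule tripleD[OF X])
  show ?thesis
    by (rule module_homI)
      (auto simp: module_homD[OF f] module_homD[OF g] triple_simps[OF X] c)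
qed

lemma tri_homE:
  assumes X: "triple X Y \<phi>" and X': "triple X' Y' \<phi>'"
    and F: "F \<in> module_hom \<Lambda> (tri X Y \<phi>) (tri X' Y' \<phi>')"
  obtains f g where "f \<in> module_hom A X X'" "g \<in> module_hom B Y Y'"
    "\<And>m y. \<lbrakk>m \<in> carrier M; y \<in> carrier Y\<rbrakk> \<Longrightarrow> f (\<phi> (te Y m y)) = \<phi>' (te Y' m (g y))"
    "\<And>x y. \<lbrakk>x \<in> carrier X; y \<in> carrier Y\<rbrakk> \<Longrightarrow> F (x, y) = (f x, g y)"
proof -
  interpret X: left_module A X by (rule tripleD[OF X])
  interpret Y: left_module B Y by (rule tripleD[OF X])
  interpret X': left_module A X' by (rule tripleD[OF X'])
  interpret Y': left_module B Y' by (rule tripleD[OF X'])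
  let ?f = "\<lambda>x. fst (F (x, \<zero>\<^bsub>Y\<^esub>))" and ?g = "\<lambda>y. snd (F (\<zero>\<^bsub>X\<^esub>, y))"
  note s = triple_simps[OF X] and s' = triple_simps[OF X']
  have Fc: "fst (F (x, y)) \<in> carrier X'" "snd (F (x, y)) \<in> carrier Y'" if "x \<in> carrier X" "y \<in> carrier Y" for x y
    using module_homD(1)[OF F, of "(x, y)"] that by (auto simp: mem_Times_iff)
  have Fs: "F ((a, m, b) \<odot>\<^bsub>tri X Y \<phi>\<^esub> (x, y)) = (a, m, b) \<odot>\<^bsub>tri X' Y' \<phi>'\<^esub> (fst (F (x, y)), snd (F (x, y)))"
    if "a \<in> carrier A" "m \<in> carrier M" "b \<in> carrier B" "x \<in> carrier X" "y \<in> carrier Y" for a m b x y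
    using module_homD(3)[OF F, of "(a, m, b)" "(x, y)"] that by simp
  have Fl: "F (x, \<zero>\<^bsub>Y\<^esub>) = (?f x, \<zero>\<^bsub>Y'\<^esub>)" if "x \<in> carrier X" for x
    using Fs[of "\<one>\<^bsub>A\<^esub>" "\<zero>\<^bsub>M\<^esub>" "\<zero>\<^bsub>B\<^esub>" x "\<zero>\<^bsub>Y\<^esub>"] Fc[of x "\<zero>\<^bsub>Y\<^esub>"] that
    by (cases "F (x, \<zero>\<^bsub>Y\<^esub>)") (simp add: s s')
  have Fr: "F (\<zero>\<^bsub>X\<^esub>, y) = (\<zero>\<^bsub>X'\<^esub>, ?g y)" if "y \<in> carrier Y" for y
    using Fs[of "\<zero>\<^bsub>A\<^esub>" "\<zero>\<^bsub>M\<^esub>" "\<one>\<^bsub>B\<^esub>" "\<zero>\<^bsub>X\<^esub>" y] Fc[of "\<zero>\<^bsub>X\<^esub>" y] that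
    by (cases "F (\<zero>\<^bsub>X\<^esub>, y)") (simp add: s s')
  have f: "?f \<in> module_hom A X X'"
  proof (rule module_homI)
    fix x y assume "x \<in> carrier X" "y \<in> carrier X"
    then show "?f (x \<oplus>\<^bsub>X\<^esub> y) = ?f x \<oplus>\<^bsub>X'\<^esub> ?f y"
      using module_homD(2)[OF F, of "(x, \<zero>\<^bsub>Y\<^esub>)" "(y, \<zero>\<^bsub>Y\<^esub>)"] Fl[of x] Fl[of y]
      by (metis (no_types, lifting) Y.M.l_zero Y.M.zero_closed fst_conv mem_Sigma_iff triangular_module_simps(1,3))
  next
    fix a x assume "a \<in> carrier A" "x \<in> carrier X"
    then show "?f (a \<odot>\<^bsub>X\<^esub> x) = a \<odot>\<^bsub>X'\<^esub> ?f x"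
      using Fs[of a "\<zero>\<^bsub>M\<^esub>" "\<zero>\<^bsub>B\<^esub>" x "\<zero>\<^bsub>Y\<^esub>"] Fc[of x "\<zero>\<^bsub>Y\<^esub>"]
      by (cases "F (x, \<zero>\<^bsub>Y\<^esub>)") (simp add: s s')
  qed (simp add: Fc)
  have g: "?g \<in> module_hom B Y Y'"
  proof (rule module_homI)
    fix x y assume "x \<in> carrier Y" "y \<in> carrier Y"
    then show "?g (x \<oplus>\<^bsub>Y\<^esub> y) = ?g x \<oplus>\<^bsub>Y'\<^esub> ?g y"
      using module_homD(2)[OF F, of "(\<zero>\<^bsub>X\<^esub>, x)" "(\<zero>\<^bsub>X\<^esub>, y)"] Fr[of x] Fr[of y]
      by (metis (no_types, lifting) X.M.l_zero X.M.zero_closed snd_conv mem_Sigma_iff triangular_module_simps(1,3))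
  next
    fix b y assume "b \<in> carrier B" "y \<in> carrier Y"
    then show "?g (b \<odot>\<^bsub>Y\<^esub> y) = b \<odot>\<^bsub>Y'\<^esub> ?g y"
      using Fs[of "\<zero>\<^bsub>A\<^esub>" "\<zero>\<^bsub>M\<^esub>" b "\<zero>\<^bsub>X\<^esub>" y] Fc[of "\<zero>\<^bsub>X\<^esub>" y]
      by (cases "F (\<zero>\<^bsub>X\<^esub>, y)") (simp add: s s')
  qed (simp add: Fc)
  have c: "?f (\<phi> (te Y m y)) = \<phi>' (te Y' m (?g y))" if my: "m \<in> carrier M" "y \<in> carrier Y" for m y
    using Fs[of "\<zero>\<^bsub>A\<^esub>" m "\<zero>\<^bsub>B\<^esub>" "\<zero>\<^bsub>X\<^esub>" y] Fr[of y] my Fc[of "\<zero>\<^bsub>X\<^esub>" y]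
    by (cases "F (\<zero>\<^bsub>X\<^esub>, y)") (simp add: s s')
  have e: "F (x, y) = (?f x, ?g y)" if xy: "x \<in> carrier X" "y \<in> carrier Y" for x y
  proof -
    have "F (x, y) = F ((x, \<zero>\<^bsub>Y\<^esub>) \<oplus>\<^bsub>tri X Y \<phi>\<^esub> (\<zero>\<^bsub>X\<^esub>, y))" using xy by simp
    also have "\<dots> = F (x, \<zero>\<^bsub>Y\<^esub>) \<oplus>\<^bsub>tri X' Y' \<phi>'\<^esub> F (\<zero>\<^bsub>X\<^esub>, y)"
      using xy by (intro module_homD(2)[OF F]) auto
    also have "\<dots> = (?f x, \<zero>\<^bsub>Y'\<^esub>) \<oplus>\<^bsub>tri X' Y' \<phi>'\<^esub> (\<zero>\<^bsub>X'\<^esub>, ?g y)"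
      by (rule arg_cong2[of _ _ _ _ "ring.add (tri X' Y' \<phi>')", OF Fl[OF xy(1)] Fr[OF xy(2)]])
    also have "\<dots> = (?f x, ?g y)" using Fc[of x "\<zero>\<^bsub>Y\<^esub>"] Fc[of "\<zero>\<^bsub>X\<^esub>" y] xy by simp
    finally show ?thesis .
  qed
  show ?thesis using f g c e by (rule that)
qed

lemma tri_short_exactI:
  assumes X: "triple X Y \<phi>" and U: "triple U V \<psi>" and X': "triple X' Y' \<phi>'"
    and 1: "short_exact A X f U g X'" and 2: "short_exact B Y f' V g' Y'"
    and cf: "\<And>m y. \<lbrakk>m \<in> carrier M; y \<in> carrier Y\<rbrakk> \<Longrightarrow> f (\<phi> (te Y m y)) = \<psi> (te V m (f' y))"
    and cg: "\<And>m v. \<lbrakk>m \<in> carrier M; v \<in> carrier V\<rbrakk> \<Longrightarrow> g (\<psi> (te V m v)) = \<phi>' (te Y' m (g' v))"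
  shows "short_exact \<Lambda> (tri X Y \<phi>) (map_prod f f') (tri U V \<psi>) (map_prod g g') (tri X' Y' \<phi>')"
proof -
  note s = short_exactD[OF 1] and t = short_exactD[OF 2]
  note F = tri_homI[OF X U s(4) t(4) cf] and G = tri_homI[OF U X' s(5) t(5) cg]
  show ?thesis
  proof (rule short_exactI[OF left_module_tri[OF X] left_module_tri[OF U] left_module_tri[OF X'] F G])
    fix z assume "z \<in> carrier (tri X Y \<phi>)" "map_prod f f' z = \<zero>\<^bsub>tri U V \<psi>\<^esub>"
    then show "z = \<zero>\<^bsub>tri X Y \<phi>\<^esub>"
      using module_hom_injD[OF s(1,2,4,6)] module_hom_injD[OF t(1,2,4,6)] by (cases z) simp
  next
    fix z assume "z \<in> carrier (tri X' Y' \<phi>')"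
    then obtain x y where z: "z = (x, y)" "x \<in> carrier X'" "y \<in> carrier Y'" by auto
    obtain u where u: "u \<in> carrier U" "x = g u" by (rule short_exact_surjE[OF 1 z(2)])
    obtain v where v: "v \<in> carrier V" "y = g' v" by (rule short_exact_surjE[OF 2 z(3)])
    show "\<exists>w \<in> carrier (tri U V \<psi>). map_prod g g' w = z" using z u v by (intro bexI[of _ "(u, v)"]) simp_all
  next
    fix z assume "z \<in> carrier (tri X Y \<phi>)"
    then show "map_prod g g' (map_prod f f' z) = \<zero>\<^bsub>tri X' Y' \<phi>'\<^esub>" by (auto simp: s(8) t(8))
  next
    fix z assume z: "z \<in> carrier (tri U V \<psi>)" "map_prod g g' z = \<zero>\<^bsub>tri X' Y' \<phi>'\<^esub>"
    then obtain u v where uv: "z = (u, v)" "u \<in> carrier U" "v \<in> carrier V" "g u = \<zero>\<^bsub>X'\<^esub>" "g' v = \<zero>\<^bsub>Y'\<^esub>" by auto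
    obtain x where x: "x \<in> carrier X" "u = f x" by (rule short_exact_kernelE[OF 1 uv(2,4)])
    obtain y where y: "y \<in> carrier Y" "v = f' y" by (rule short_exact_kernelE[OF 2 uv(3,5)])
    show "\<exists>k \<in> carrier (tri X Y \<phi>). map_prod f f' k = z" using uv x y by (intro bexI[of _ "(x, y)"]) simp_all
  qed
qed

lemma tri_short_exactE:
  assumes X: "triple X Y \<phi>" and U: "triple U V \<psi>" and X': "triple X' Y' \<phi>'"
    and S: "short_exact \<Lambda> (tri X Y \<phi>) F (tri U V \<psi>) G (tri X' Y' \<phi>')"
  obtains f f' g g' where "short_exact A X f U g X'" "short_exact B Y f' V g' Y'"
    "\<And>m y. \<lbrakk>m \<in> carrier M; y \<in> carrier Y\<rbrakk> \<Longrightarrow> f (\<phi> (te Y m y)) = \<psi> (te V m (f' y))"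
    "\<And>m v. \<lbrakk>m \<in> carrier M; v \<in> carrier V\<rbrakk> \<Longrightarrow> g (\<psi> (te V m v)) = \<phi>' (te Y' m (g' v))"
    "\<And>x y. \<lbrakk>x \<in> carrier X; y \<in> carrier Y\<rbrakk> \<Longrightarrow> F (x, y) = (f x, f' y)"
proof -
  note s = short_exactD[OF S]
  obtain f f' where f: "f \<in> module_hom A X U" "f' \<in> module_hom B Y V"
    "\<And>m y. \<lbrakk>m \<in> carrier M; y \<in> carrier Y\<rbrakk> \<Longrightarrow> f (\<phi> (te Y m y)) = \<psi> (te V m (f' y))"
    "\<And>x y. \<lbrakk>x \<in> carrier X; y \<in> carrier Y\<rbrakk> \<Longrightarrow> F (x, y) = (f x, f' y)"
    by (rule tri_homE[OF X U s(4)]) blast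
  obtain g g' where g: "g \<in> module_hom A U X'" "g' \<in> module_hom B V Y'"
    "\<And>m v. \<lbrakk>m \<in> carrier M; v \<in> carrier V\<rbrakk> \<Longrightarrow> g (\<psi> (te V m v)) = \<phi>' (te Y' m (g' v))"
    "\<And>x y. \<lbrakk>x \<in> carrier U; y \<in> carrier V\<rbrakk> \<Longrightarrow> G (x, y) = (g x, g' y)"
    by (rule tri_homE[OF U X' s(5)]) blast
  interpret X: left_module A X by (rule tripleD[OF X])
  interpret Y: left_module B Y by (rule tripleD[OF X])
  interpret U: left_module A U by (rule tripleD[OF U])
  interpret V: left_module B V by (rule tripleD[OF U])
  interpret X': left_module A X' by (rule tripleD[OF X'])
  interpret Y': left_module B Y' by (rule tripleD[OF X'])
  have z: "f \<zero>\<^bsub>X\<^esub> = \<zero>\<^bsub>U\<^esub>" "f' \<zero>\<^bsub>Y\<^esub> = \<zero>\<^bsub>V\<^esub>" "g \<zero>\<^bsub>U\<^esub> = \<zero>\<^bsub>X'\<^esub>" "g' \<zero>\<^bsub>V\<^esub> = \<zero>\<^bsub>Y'\<^esub>"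
    by (rule module_hom_zero; rule tripleD[OF X] tripleD[OF U] tripleD[OF X'] f g)+
  have inj: "x = \<zero>\<^bsub>X\<^esub> \<and> y = \<zero>\<^bsub>Y\<^esub>" if "x \<in> carrier X" "y \<in> carrier Y" "f x = \<zero>\<^bsub>U\<^esub>" "f' y = \<zero>\<^bsub>V\<^esub>" for x y
    using module_hom_injD[OF s(1,2,4,6), of "(x, y)"] that by (simp add: f(4))
  have surj: "\<exists>u \<in> carrier U. \<exists>v \<in> carrier V. g u = x \<and> g' v = y" if xy: "x \<in> carrier X'" "y \<in> carrier Y'" for x y
  proof -
    have "(x, y) \<in> carrier (tri X' Y' \<phi>')" using xy by simp
    then obtain w where "w \<in> carrier (tri U V \<psi>)" "(x, y) = G w" by (rule short_exact_surjE[OF S])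
    then show ?thesis using g(4) by auto
  qed
  have ker: "\<exists>x \<in> carrier X. \<exists>y \<in> carrier Y. f x = u \<and> f' y = v"
    if uv: "u \<in> carrier U" "v \<in> carrier V" "g u = \<zero>\<^bsub>X'\<^esub>" "g' v = \<zero>\<^bsub>Y'\<^esub>" for u v
  proof -
    have "(u, v) \<in> carrier (tri U V \<psi>)" "G (u, v) = \<zero>\<^bsub>tri X' Y' \<phi>'\<^esub>" using uv by (simp_all add: g(4))
    then obtain w where "w \<in> carrier (tri X Y \<phi>)" "(u, v) = F w" by (rule short_exact_kernelE[OF S])
    then show ?thesis using f(4) by auto
  qed
  have zero: "g (f x) = \<zero>\<^bsub>X'\<^esub> \<and> g' (f' y) = \<zero>\<^bsub>Y'\<^esub>" if "x \<in> carrier X" "y \<in> carrier Y" for x y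
    using s(8)[of "(x, y)"] that module_homD(1)[OF f(1)] module_homD(1)[OF f(2)] by (simp add: f(4) g(4))
  have 1: "short_exact A X f U g X'"
  proof (rule short_exactI[OF tripleD(1)[OF X] tripleD(1)[OF U] tripleD(1)[OF X'] f(1) g(1)])
    show "k = \<zero>\<^bsub>X\<^esub>" if "k \<in> carrier X" "f k = \<zero>\<^bsub>U\<^esub>" for k using inj[OF that(1) Y.M.zero_closed that(2) z(2)] by simp
    show "\<exists>u \<in> carrier U. g u = c" if "c \<in> carrier X'" for c using surj[OF that Y'.M.zero_closed] by blast
    show "g (f k) = \<zero>\<^bsub>X'\<^esub>" if "k \<in> carrier X" for k using zero[OF that Y.M.zero_closed] by simp
    show "\<exists>k \<in> carrier X. f k = u" if "u \<in> carrier U" "g u = \<zero>\<^bsub>X'\<^esub>" for u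
      using ker[OF that(1) V.M.zero_closed that(2) z(4)] by blast
  qed
  have 2: "short_exact B Y f' V g' Y'"
  proof (rule short_exactI[OF tripleD(2)[OF X] tripleD(2)[OF U] tripleD(2)[OF X'] f(2) g(2)])
    show "k = \<zero>\<^bsub>Y\<^esub>" if "k \<in> carrier Y" "f' k = \<zero>\<^bsub>V\<^esub>" for k using inj[OF X.M.zero_closed that(1) z(1) that(2)] by simp
    show "\<exists>u \<in> carrier V. g' u = c" if "c \<in> carrier Y'" for c using surj[OF X'.M.zero_closed that] by blast
    show "g' (f' k) = \<zero>\<^bsub>Y'\<^esub>" if "k \<in> carrier Y" for k using zero[OF X.M.zero_closed that] by simp
    show "\<exists>k \<in> carrier Y. f' k = u" if "u \<in> carrier V" "g' u = \<zero>\<^bsub>Y'\<^esub>" for u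
      using ker[OF U.M.zero_closed that(1) z(3) that(2)] by blast
  qed
  show ?thesis using 1 2 f(3) g(3) f(4) by (rule that)
qed

text \<open>The Peirce decomposition: X and Y are the images of the two diagonal idempotents,
  described as their fixed points, and (0, m, 0) carries Y into X. Both parts stay on the type of N,
  so a step can be rewritten in triples without leaving a fixed type.\<close>

lemma decompose:
  fixes N :: "('a \<times> 'm \<times> 'b, 'n, 'd) module_scheme"
  assumes N: "left_module \<Lambda> N"
  obtains X :: "('a, 'n) module" and Y :: "('b, 'n) module" and \<phi> e
  where "triple X Y \<phi>" "e \<in> module_hom \<Lambda> N (tri X Y \<phi>)" "bij_betw e (carrier N) (carrier (tri X Y \<phi>))"
proof -
  interpret N: left_module \<Lambda> N by (rule N)
  let ?e1 = "(\<one>\<^bsub>A\<^esub>, \<zero>\<^bsub>M\<^esub>, \<zero>\<^bsub>B\<^esub>)" and ?e2 = "(\<zero>\<^bsub>A\<^esub>, \<zero>\<^bsub>M\<^esub>, \<one>\<^bsub>B\<^esub>)"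
  have e: "?e1 \<in> carrier \<Lambda>" "?e2 \<in> carrier \<Lambda>" by auto
  let ?X = "{x \<in> carrier N. ?e1 \<odot>\<^bsub>N\<^esub> x = x}" and ?Y = "{x \<in> carrier N. ?e2 \<odot>\<^bsub>N\<^esub> x = x}"
  define X :: "('a, 'n) module" where "X = \<lparr>carrier = ?X, mult = undefined, one = undefined,
    ring.zero = \<zero>\<^bsub>N\<^esub>, ring.add = ring.add N, smult = (\<lambda>a x. (a, \<zero>\<^bsub>M\<^esub>, \<zero>\<^bsub>B\<^esub>) \<odot>\<^bsub>N\<^esub> x)\<rparr>"
  define Y :: "('b, 'n) module" where "Y = \<lparr>carrier = ?Y, mult = undefined, one = undefined,
    ring.zero = \<zero>\<^bsub>N\<^esub>, ring.add = ring.add N, smult = (\<lambda>b x. (\<zero>\<^bsub>A\<^esub>, \<zero>\<^bsub>M\<^esub>, b) \<odot>\<^bsub>N\<^esub> x)\<rparr>"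
  have XY: "carrier X = ?X" "\<zero>\<^bsub>X\<^esub> = \<zero>\<^bsub>N\<^esub>" "ring.add X = ring.add N" "\<And>a x. a \<odot>\<^bsub>X\<^esub> x = (a, \<zero>\<^bsub>M\<^esub>, \<zero>\<^bsub>B\<^esub>) \<odot>\<^bsub>N\<^esub> x"
    "carrier Y = ?Y" "\<zero>\<^bsub>Y\<^esub> = \<zero>\<^bsub>N\<^esub>" "ring.add Y = ring.add N" "\<And>b x. b \<odot>\<^bsub>Y\<^esub> x = (\<zero>\<^bsub>A\<^esub>, \<zero>\<^bsub>M\<^esub>, b) \<odot>\<^bsub>N\<^esub> x"
    by (simp_all add: X_def Y_def)
  have cl: "(a, m, b) \<odot>\<^bsub>N\<^esub> x \<in> carrier N" if "a \<in> carrier A" "m \<in> carrier M" "b \<in> carrier B" "x \<in> carrier N" for a m b x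
    using N.smult_closed[of "(a, m, b)" x] that by simp
  have mul: "(a, m, b) \<odot>\<^bsub>N\<^esub> ((a', m', b') \<odot>\<^bsub>N\<^esub> x) = (a \<otimes>\<^bsub>A\<^esub> a', a \<odot>\<^bsub>M\<^esub> m' \<oplus>\<^bsub>M\<^esub> rsmult M m b', b \<otimes>\<^bsub>B\<^esub> b') \<odot>\<^bsub>N\<^esub> x"
    if "a \<in> carrier A" "m \<in> carrier M" "b \<in> carrier B" "a' \<in> carrier A" "m' \<in> carrier M" "b' \<in> carrier B" "x \<in> carrier N"
    for a m b a' m' b' x
    using N.smult_assoc1[of "(a, m, b)" "(a', m', b')" x] that by simp
  have sum: "(a, m, b) \<odot>\<^bsub>N\<^esub> x \<oplus>\<^bsub>N\<^esub> (a', m', b') \<odot>\<^bsub>N\<^esub> x = (a \<oplus>\<^bsub>A\<^esub> a', m \<oplus>\<^bsub>M\<^esub> m', b \<oplus>\<^bsub>B\<^esub> b') \<odot>\<^bsub>N\<^esub> x"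
    if "a \<in> carrier A" "m \<in> carrier M" "b \<in> carrier B" "a' \<in> carrier A" "m' \<in> carrier M" "b' \<in> carrier B" "x \<in> carrier N"
    for a m b a' m' b' x
    using N.smult_l_distr[of "(a, m, b)" "(a', m', b')" x] that by simp
  have dis: "(a, m, b) \<odot>\<^bsub>N\<^esub> (x \<oplus>\<^bsub>N\<^esub> y) = (a, m, b) \<odot>\<^bsub>N\<^esub> x \<oplus>\<^bsub>N\<^esub> (a, m, b) \<odot>\<^bsub>N\<^esub> y"
    if "a \<in> carrier A" "m \<in> carrier M" "b \<in> carrier B" "x \<in> carrier N" "y \<in> carrier N" for a m b x y
    using N.smult_r_distr[of "(a, m, b)" x y] that by simp
  have z: "(a, m, b) \<odot>\<^bsub>N\<^esub> \<zero>\<^bsub>N\<^esub> = \<zero>\<^bsub>N\<^esub>" if "a \<in> carrier A" "m \<in> carrier M" "b \<in> carrier B" for a m b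
    using N.smult_r_zero[of "(a, m, b)"] that by simp
  have z': "(\<zero>\<^bsub>A\<^esub>, \<zero>\<^bsub>M\<^esub>, \<zero>\<^bsub>B\<^esub>) \<odot>\<^bsub>N\<^esub> x = \<zero>\<^bsub>N\<^esub>" if "x \<in> carrier N" for x
    using N.smult_l_zero[OF that] by simp
  have o: "(\<one>\<^bsub>A\<^esub>, \<zero>\<^bsub>M\<^esub>, \<one>\<^bsub>B\<^esub>) \<odot>\<^bsub>N\<^esub> x = x" if "x \<in> carrier N" for x
    using N.smult_one[OF that] by simp
  have neg: "(a, m, b) \<odot>\<^bsub>N\<^esub> (\<ominus>\<^bsub>N\<^esub> x) = \<ominus>\<^bsub>N\<^esub> ((a, m, b) \<odot>\<^bsub>N\<^esub> x)"
    if "a \<in> carrier A" "m \<in> carrier M" "b \<in> carrier B" "x \<in> carrier N" for a m b x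
  proof (rule N.M.minus_equality[symmetric])
    show "(a, m, b) \<odot>\<^bsub>N\<^esub> (\<ominus>\<^bsub>N\<^esub> x) \<oplus>\<^bsub>N\<^esub> (a, m, b) \<odot>\<^bsub>N\<^esub> x = \<zero>\<^bsub>N\<^esub>"
      using that by (simp add: dis[symmetric] N.M.l_neg z)
  qed (use that in \<open>auto intro: cl\<close>)
  have abX: "abelian_group X"
  proof (rule abelian_groupI)
    fix x assume "x \<in> carrier X"
    then show "\<exists>y \<in> carrier X. y \<oplus>\<^bsub>X\<^esub> x = \<zero>\<^bsub>X\<^esub>"
      by (intro bexI[of _ "\<ominus>\<^bsub>N\<^esub> x"]) (auto simp: XY neg N.M.l_neg)
  qed (auto simp: XY dis z N.M.a_ac)
  have abY: "abelian_group Y"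
  proof (rule abelian_groupI)
    fix x assume "x \<in> carrier Y"
    then show "\<exists>y \<in> carrier Y. y \<oplus>\<^bsub>Y\<^esub> x = \<zero>\<^bsub>Y\<^esub>"
      by (intro bexI[of _ "\<ominus>\<^bsub>N\<^esub> x"]) (auto simp: XY neg N.M.l_neg)
  qed (auto simp: XY dis z N.M.a_ac)
  have LX: "left_module A X"
    by (rule left_moduleI[OF left.R.ring_axioms abX]) (auto simp: XY cl mul sum dis)
  have LY: "left_module B Y"
    by (rule left_moduleI[OF B.ring_axioms abY]) (auto simp: XY cl mul sum dis)
  interpret Y: tensor A B M Y by (intro tensor.intro bimodule_axioms LY)
  obtain \<phi> where \<phi>: "\<phi> \<in> module_hom A (T Y) X"
    "\<And>m y. \<lbrakk>m \<in> carrier M; y \<in> carrier Y\<rbrakk> \<Longrightarrow> \<phi> (te Y m y) = (\<zero>\<^bsub>A\<^esub>, m, \<zero>\<^bsub>B\<^esub>) \<odot>\<^bsub>N\<^esub> y"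
  proof (rule Y.tensor_lift[OF LX, of "\<lambda>m y. (\<zero>\<^bsub>A\<^esub>, m, \<zero>\<^bsub>B\<^esub>) \<odot>\<^bsub>N\<^esub> y"])
  qed (auto simp: XY cl mul sum dis)
  have tr: "triple X Y \<phi>" using LX LY \<phi>(1) by (simp add: triple_def)
  interpret X: left_module A X by (rule LX)
  let ?e = "\<lambda>x. (?e1 \<odot>\<^bsub>N\<^esub> x, ?e2 \<odot>\<^bsub>N\<^esub> x)"
  have inX: "?e1 \<odot>\<^bsub>N\<^esub> x \<in> carrier X" and inY: "?e2 \<odot>\<^bsub>N\<^esub> x \<in> carrier Y" if "x \<in> carrier N" for x
    using that by (simp_all add: XY cl mul)
  have hom: "?e \<in> module_hom \<Lambda> N (tri X Y \<phi>)"
  proof (rule module_homI)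
    fix r x assume r: "r \<in> carrier \<Lambda>" and x: "x \<in> carrier N"
    obtain a m b where abm: "r = (a, m, b)" "a \<in> carrier A" "m \<in> carrier M" "b \<in> carrier B" using r by auto
    \<comment> \<open>In \<Lambda> the product of (0, m, 0) with the idempotent (0, 0, 1) is (0, m,
      0) itself.\<close>
    have "\<phi> (te Y m (?e2 \<odot>\<^bsub>N\<^esub> x)) = (\<zero>\<^bsub>A\<^esub>, m, \<zero>\<^bsub>B\<^esub>) \<odot>\<^bsub>N\<^esub> x"
      using abm x by (simp add: \<phi>(2) inY mul)
    then show "?e (r \<odot>\<^bsub>N\<^esub> x) = r \<odot>\<^bsub>tri X Y \<phi>\<^esub> ?e x"
      using abm x by (simp add: mul XY sum cl)
  qed (use inX inY in \<open>simp_all add: dis XY mul\<close>)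
  have "bij_betw ?e (carrier N) (carrier (tri X Y \<phi>))"
  proof (rule bij_betw_byWitness[where f' = "\<lambda>(x, y). x \<oplus>\<^bsub>N\<^esub> y"])
    show "\<forall>x \<in> carrier N. (\<lambda>(x, y). x \<oplus>\<^bsub>N\<^esub> y) (?e x) = x" by (simp add: sum o)
    have "?e1 \<odot>\<^bsub>N\<^esub> y = \<zero>\<^bsub>N\<^esub>" if "y \<in> carrier Y" for y
    proof -
      have y: "y \<in> carrier N" "?e2 \<odot>\<^bsub>N\<^esub> y = y" using that by (simp_all add: XY)
      have "?e1 \<odot>\<^bsub>N\<^esub> (?e2 \<odot>\<^bsub>N\<^esub> y) = \<zero>\<^bsub>N\<^esub>" using y(1) by (simp add: mul z')
      then show ?thesis by (simp only: y(2))
    qed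
    moreover have "?e2 \<odot>\<^bsub>N\<^esub> x = \<zero>\<^bsub>N\<^esub>" if "x \<in> carrier X" for x
    proof -
      have x: "x \<in> carrier N" "?e1 \<odot>\<^bsub>N\<^esub> x = x" using that by (simp_all add: XY)
      have "?e2 \<odot>\<^bsub>N\<^esub> (?e1 \<odot>\<^bsub>N\<^esub> x) = \<zero>\<^bsub>N\<^esub>" using x(1) by (simp add: mul z')
      then show ?thesis by (simp only: x(2))
    qed
    ultimately show "\<forall>w \<in> carrier (tri X Y \<phi>). ?e ((\<lambda>(x, y). x \<oplus>\<^bsub>N\<^esub> y) w) = w"
      by (auto simp: XY dis)
    show "?e ` carrier N \<subseteq> carrier (tri X Y \<phi>)" using inX inY by auto
    show "(\<lambda>(x, y). x \<oplus>\<^bsub>N\<^esub> y) ` carrier (tri X Y \<phi>) \<subseteq> carrier N" by (auto simp: XY)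
  qed
  with tr hom show ?thesis by (rule that)
qed

text \<open>The upper row of a matrix has entries in A \<oplus> M, the lower one in B; the structure
  map is the right action M \<otimes> B \<rightarrow> M. This turns a functional with values in
  \<Lambda> into a pair of component maps.\<close>

lemma regular_decomposition:
  obtains \<mu> e where "triple (module_sum (regular_module A) M) (regular_module B) \<mu>"
    "\<And>m b. \<lbrakk>m \<in> carrier M; b \<in> carrier B\<rbrakk> \<Longrightarrow> \<mu> (te (regular_module B) m b) = (\<zero>\<^bsub>A\<^esub>, rsmult M m b)"
    "e \<in> module_hom \<Lambda> (regular_module \<Lambda>) (tri (module_sum (regular_module A) M) (regular_module B) \<mu>)"
    "bij_betw e (carrier (regular_module \<Lambda>)) (carrier (tri (module_sum (regular_module A) M) (regular_module B) \<mu>))"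
proof -
  let ?X = "module_sum (regular_module A) M" and ?Y = "regular_module B"
  have Y: "left_module B ?Y" by (rule left_module_regular[OF B.ring_axioms])
  have X: "left_module A ?X"
    by (rule left_module_module_sum[OF left_module_regular[OF left.R.ring_axioms] left.left_module_axioms])
  interpret Y: tensor A B M ?Y by (intro tensor.intro bimodule_axioms Y)
  obtain \<mu> where \<mu>: "\<mu> \<in> module_hom A (T ?Y) ?X"
    "\<And>m b. \<lbrakk>m \<in> carrier M; b \<in> carrier ?Y\<rbrakk> \<Longrightarrow> \<mu> (te ?Y m b) = (\<zero>\<^bsub>A\<^esub>, rsmult M m b)"
  proof (rule Y.tensor_lift[OF X, of "\<lambda>m b. (\<zero>\<^bsub>A\<^esub>, rsmult M m b)"])
  qed (auto simp: rsmult_distr rsmult_distr_ring rsmult_assoc smult_rsmult)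
  have tr: "triple ?X ?Y \<mu>" using X Y \<mu>(1) by (simp add: triple_def)
  let ?e = "\<lambda>(a, m, b). ((a, m), b)"
  have "?e \<in> module_hom \<Lambda> (regular_module \<Lambda>) (tri ?X ?Y \<mu>)"
    by (rule module_homI) (auto simp: \<mu>(2))
  moreover have "bij_betw ?e (carrier (regular_module \<Lambda>)) (carrier (tri ?X ?Y \<mu>))"
    by (rule bij_betw_byWitness[where f' = "\<lambda>((a, m), b). (a, m, b)"]) auto
  ultimately show ?thesis using tr \<mu>(2) by (intro that) auto
qed

end

definition zero_module :: "('r, unit) module"
  where "zero_module = \<lparr>carrier = {()}, mult = undefined, one = undefined, ring.zero = (),
    ring.add = (\<lambda>_ _. ()), smult = (\<lambda>_ _. ())\<rparr>"

lemma left_module_zero_module: "ring R \<Longrightarrow> left_module R (zero_module :: ('r, unit) module)"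
  by (rule left_moduleI) (auto intro!: abelian_groupI simp: zero_module_def)

lemma module_hom_to_zero_module: "(\<lambda>_. ()) \<in> module_hom R X (zero_module :: ('r, unit) module)"
  by (rule module_homI) (auto simp: zero_module_def)

section \<open>Projective and finitely generated triples\<close>

context triangular
begin

lemma triple_zero_left: "left_module B Y \<Longrightarrow> triple zero_module Y (\<lambda>_. ())"
  by (simp add: triple_def left_module_zero_module left.R.ring_axioms module_hom_to_zero_module)

lemma triple_zero_right: "left_module A X \<Longrightarrow> triple X zero_module (\<lambda>_. \<zero>\<^bsub>X\<^esub>)"
  by (simp add: triple_def left_module_zero_module B.ring_axioms module_hom_zero_map)

text \<open>The left adjoint of the functor sending (X, Y, \<phi>) to the pair (X, Y), evaluated at
  (P, Q).\<close>

lemma triple_free: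
  assumes "left_module A P" "left_module B Q"
  shows "triple (module_sum (T Q) P) Q (\<lambda>t. (t, \<zero>\<^bsub>P\<^esub>))"
  using assms by (simp add: triple_def left_module_module_sum left_module_tensor_module module_hom_inl)

lemma tri_lift:
  assumes pr: "projective_module \<Lambda> (tri U V \<psi>)" and U: "triple U V \<psi>" and X: "triple X Y \<phi>" and X': "triple X' Y' \<phi>'"
    and g: "g \<in> module_hom A X X'" "g ` carrier X = carrier X'"
    and g': "g' \<in> module_hom B Y Y'" "g' ` carrier Y = carrier Y'"
    and f: "f \<in> module_hom A U X'" and f': "f' \<in> module_hom B V Y'"
    and cg: "\<And>m y. \<lbrakk>m \<in> carrier M; y \<in> carrier Y\<rbrakk> \<Longrightarrow> g (\<phi> (te Y m y)) = \<phi>' (te Y' m (g' y))"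
    and cf: "\<And>m y. \<lbrakk>m \<in> carrier M; y \<in> carrier V\<rbrakk> \<Longrightarrow> f (\<psi> (te V m y)) = \<phi>' (te Y' m (f' y))"
  obtains h h' where "h \<in> module_hom A U X" "h' \<in> module_hom B V Y"
    "\<And>u. u \<in> carrier U \<Longrightarrow> g (h u) = f u" "\<And>v. v \<in> carrier V \<Longrightarrow> g' (h' v) = f' v"
    "\<And>m v. \<lbrakk>m \<in> carrier M; v \<in> carrier V\<rbrakk> \<Longrightarrow> h (\<psi> (te V m v)) = \<phi> (te Y m (h' v))"
proof -
  interpret U: left_module A U by (rule tripleD[OF U])
  interpret V: left_module B V by (rule tripleD[OF U])
  have "map_prod g g' ` carrier (tri X Y \<phi>) = g ` carrier X \<times> g' ` carrier Y"
    by (simp add: map_prod_surj_on[OF refl refl])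
  then have "map_prod g g' ` carrier (tri X Y \<phi>) = carrier (tri X' Y' \<phi>')"
    unfolding g(2) g'(2) by simp
  then obtain H where H: "H \<in> module_hom \<Lambda> (tri U V \<psi>) (tri X Y \<phi>)"
    "\<And>w. w \<in> carrier (tri U V \<psi>) \<Longrightarrow> map_prod g g' (H w) = map_prod f f' w"
    using projective_module_lift[OF pr left_module_tri[OF X] left_module_tri[OF X']
        tri_homI[OF X X' g(1) g'(1) cg] _ tri_homI[OF U X' f f' cf]] by metis
  obtain h h' where h: "h \<in> module_hom A U X" "h' \<in> module_hom B V Y"
    "\<And>m y. \<lbrakk>m \<in> carrier M; y \<in> carrier V\<rbrakk> \<Longrightarrow> h (\<psi> (te V m y)) = \<phi> (te Y m (h' y))"
    "\<And>x y. \<lbrakk>x \<in> carrier U; y \<in> carrier V\<rbrakk> \<Longrightarrow> H (x, y) = (h x, h' y)"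
    by (rule tri_homE[OF U X H(1)]) blast
  have "g (h u) = f u" if "u \<in> carrier U" for u
    using H(2)[of "(u, \<zero>\<^bsub>V\<^esub>)"] that by (simp add: h(4))
  moreover have "g' (h' v) = f' v" if "v \<in> carrier V" for v
    using H(2)[of "(\<zero>\<^bsub>U\<^esub>, v)"] that by (simp add: h(4))
  ultimately show ?thesis by (rule that[OF h(1,2) _ _ h(3)])
qed

text \<open>A surjection N \<rightarrow> N' of B-modules is tested as the surjection of triples (0,
  N) \<rightarrow> (0, N').\<close>

lemma projective_tri_base:
  fixes U :: "('a, 'u, 'd) module_scheme" and V :: "('b, 'v, 'e) module_scheme"
  assumes pr: "projective_module \<Lambda> (tri U V \<psi>)" and U: "triple U V \<psi>"
  shows "projective_module B V"
  unfolding projective_module_def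
proof (intro conjI allI impI tripleD[OF U]; elim conjE)
  fix N :: "('b, 'v \<Rightarrow> 'b) module" and N' :: "('b, 'v) module" and g f
  assume *: "left_module B N" "left_module B N'" "g \<in> module_hom B N N'"
    "g ` carrier N = carrier N'" "f \<in> module_hom B V N'"
  show "\<exists>h \<in> module_hom B V N. \<forall>x \<in> carrier V. g (h x) = f x"
  proof (rule tri_lift[OF pr U triple_zero_left[OF *(1)] triple_zero_left[OF *(2)]
        module_hom_to_zero_module _ *(3,4) module_hom_to_zero_module *(5)])
  qed (auto simp: zero_module_def)
qed

text \<open>A map from (U, V, \<psi>) to (N, 0) is a map U \<rightarrow> N that kills the image of
  \<psi>, that is, a map from the cokernel D. So lifting problems for D are lifting problems for the
  triple against modules of the form (N, 0).\<close>

lemma projective_tri_cokernel: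
  fixes U :: "('a, 'u, 'd) module_scheme" and V :: "('b, 'v, 'e) module_scheme"
    and D :: "('a, 'w, 'f) module_scheme"
  assumes pr: "projective_module \<Lambda> (tri U V \<psi>)" and U: "triple U V \<psi>"
    and S: "short_exact A (T V) \<psi> U q D"
  shows "projective_module A D"
  unfolding projective_module_def
proof (intro conjI allI impI short_exactD(3)[OF S]; elim conjE)
  fix N :: "('a, 'w \<Rightarrow> 'a) module" and N' :: "('a, 'w) module" and g f
  assume *: "left_module A N" "left_module A N'" "g \<in> module_hom A N N'"
    "g ` carrier N = carrier N'" "f \<in> module_hom A D N'"
  note s = short_exactD[OF S] and t = tripleD[OF U]
  have zz: "(\<lambda>_. ()) ` carrier (zero_module :: ('b, unit) module) = carrier (zero_module :: ('b, unit) module)"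
    by (simp add: zero_module_def)
  have g0: "g \<zero>\<^bsub>N\<^esub> = \<zero>\<^bsub>N'\<^esub>" by (rule module_hom_zero[OF *(1-3)])
  have f0: "f \<zero>\<^bsub>D\<^esub> = \<zero>\<^bsub>N'\<^esub>" by (rule module_hom_zero[OF s(3) *(2,5)])
  obtain h and h' :: "'v \<Rightarrow> unit" where h: "h \<in> module_hom A U N" "\<And>u. u \<in> carrier U \<Longrightarrow> g (h u) = f (q u)"
    "\<And>m v. \<lbrakk>m \<in> carrier M; v \<in> carrier V\<rbrakk> \<Longrightarrow> h (\<psi> (te V m v)) = \<zero>\<^bsub>N\<^esub>"
    by (rule tri_lift[OF pr U triple_zero_right[OF *(1)] triple_zero_right[OF *(2)] *(3,4)
        module_hom_to_zero_module zz module_hom_comp[OF s(5) *(5)] module_hom_to_zero_module])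
      (simp_all add: g0 f0 s(8) te_closed[OF t(2)])
  have hz: "h (\<psi> t) = \<zero>\<^bsub>N\<^esub>" if "t \<in> carrier (T V)" for t
    by (rule tensor_hom_cong[OF t(2) *(1) module_hom_comp[OF t(3) h(1)] module_hom_zero_map[OF *(1)] _ that])
      (rule h(3))
  obtain k where k: "k \<in> module_hom A D N" "\<And>u. u \<in> carrier U \<Longrightarrow> k (q u) = h u"
  proof (rule factor_surj[OF s(2,3) *(1) s(5,7) h(1)])
    fix u assume "u \<in> carrier U" "q u = \<zero>\<^bsub>D\<^esub>"
    then obtain t where "t \<in> carrier (T V)" "u = \<psi> t" by (rule short_exact_kernelE[OF S])
    then show "h u = \<zero>\<^bsub>N\<^esub>" by (simp add: hz)
  qed blast
  have "g (k d) = f d" if d: "d \<in> carrier D" for d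
  proof -
    obtain u where "u \<in> carrier U" "d = q u" by (rule short_exact_surjE[OF S d])
    then show ?thesis by (simp add: k(2) h(2))
  qed
  then show "\<exists>h \<in> module_hom A D N. \<forall>x \<in> carrier D. g (h x) = f x" by (intro bexI[OF _ k(1)] ballI)
qed

text \<open>
  A projective module \<open>(U, V, \<psi>)\<close> is a direct summand of \<open>(M \<otimes> V \<oplus> U, V, inl)\<close>, whose structure map is injective.
\<close>

lemma projective_tri_inj:
  assumes pr: "projective_module \<Lambda> (tri U V \<psi>)" and U: "triple U V \<psi>"
  shows "inj_on \<psi> (carrier (T V))"
proof -
  note t = tripleD[OF U]
  interpret U: left_module A U by (rule t)
  have TV: "left_module A (T V)" by (rule left_module_tensor_module[OF t(2)])
  interpret TV: left_module A "T V" by (rule TV)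
  let ?g = "\<lambda>z. \<psi> (fst z) \<oplus>\<^bsub>U\<^esub> snd z"
  have g: "?g \<in> module_hom A (module_sum (T V) U) U"
    by (rule module_hom_copair[OF TV t(1) t(1) t(3) module_hom_id])
  have onto: "?g ` carrier (module_sum (T V) U) = carrier U"
  proof (rule subset_antisym)
    show "?g ` carrier (module_sum (T V) U) \<subseteq> carrier U" using module_homD(1)[OF g] by blast
    show "carrier U \<subseteq> ?g ` carrier (module_sum (T V) U)"
    proof
      fix u assume "u \<in> carrier U"
      then show "u \<in> ?g ` carrier (module_sum (T V) U)"
        by (intro image_eqI[of _ _ "(\<zero>\<^bsub>T V\<^esub>, u)"]) (simp_all add: module_hom_zero[OF TV t(1,3)])
    qed
  qed
  obtain h h' where h: "h \<in> module_hom A U (module_sum (T V) U)" "\<And>v. v \<in> carrier V \<Longrightarrow> h' v = v"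
    "\<And>m v. \<lbrakk>m \<in> carrier M; v \<in> carrier V\<rbrakk> \<Longrightarrow> h (\<psi> (te V m v)) = (te V m (h' v), \<zero>\<^bsub>U\<^esub>)"
    by (rule tri_lift[OF pr U triple_free[OF t(1,2)] U g onto module_hom_id _ module_hom_id module_hom_id])
      (simp_all add: triple_simps[OF U])
  \<comment> \<open>Compatibility of the splitting with the structure maps makes h \<psi> the
    inclusion of the first summand, whence \<psi> is injective.\<close>
  have "h (\<psi> t) = (t, \<zero>\<^bsub>U\<^esub>)" if "t \<in> carrier (T V)" for t
    by (rule tensor_hom_cong[OF t(2) left_module_module_sum[OF TV t(1)] module_hom_comp[OF t(3) h(1)]
          module_hom_inl[OF t(1)] _ that])
      (simp add: h(2,3))
  then show ?thesis by (metis fst_conv inj_onI)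
qed

text \<open>For a submodule H of V the set U \<times> H is a \<Lambda>-submodule, because \<Lambda>
  sends V into U but not conversely. So second entries of generators generate V.\<close>

lemma finitely_generated_tri_base:
  assumes fg: "finitely_generated \<Lambda> (tri U V \<psi>)" and U: "triple U V \<psi>"
  shows "finitely_generated B V"
proof -
  note t = tripleD[OF U]
  interpret U: left_module A U by (rule t)
  interpret V: left_module B V by (rule t)
  interpret L: left_module \<Lambda> "tri U V \<psi>" by (rule left_module_tri[OF U])
  obtain S where S: "finite S" "S \<subseteq> carrier (tri U V \<psi>)"
    "\<And>H. submodule H \<Lambda> (tri U V \<psi>) \<Longrightarrow> S \<subseteq> H \<Longrightarrow> H = carrier (tri U V \<psi>)"
    using fg by (auto simp: finitely_generated_def)
  have "H = carrier V" if H: "submodule H B V" "snd ` S \<subseteq> H" for H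
  proof -
    interpret H: submodule H B V by (rule H)
    have HV: "H \<subseteq> carrier V" "\<zero>\<^bsub>V\<^esub> \<in> H" "\<And>x y. x \<in> H \<Longrightarrow> y \<in> H \<Longrightarrow> x \<oplus>\<^bsub>V\<^esub> y \<in> H"
      using H.subset H.one_closed H.m_closed by auto
    have "carrier U \<times> H = carrier (tri U V \<psi>)"
    proof (rule S(3))
      show "submodule (carrier U \<times> H) \<Lambda> (tri U V \<psi>)"
      proof (rule L.left_submoduleI)
        show "carrier U \<times> H \<subseteq> carrier (tri U V \<psi>)" using HV(1) by auto
        show "\<zero>\<^bsub>tri U V \<psi>\<^esub> \<in> carrier U \<times> H" using HV(2) by simp
      next
        fix w z assume "w \<in> carrier U \<times> H" "z \<in> carrier U \<times> H"
        then show "w \<oplus>\<^bsub>tri U V \<psi>\<^esub> z \<in> carrier U \<times> H" by (cases w; cases z) (simp add: HV(3))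
      next
        fix r w assume r: "r \<in> carrier \<Lambda>" and w: "w \<in> carrier U \<times> H"
        obtain a m b where "r = (a, m, b)" "a \<in> carrier A" "m \<in> carrier M" "b \<in> carrier B" using r by auto
        moreover obtain u v where "w = (u, v)" "u \<in> carrier U" "v \<in> H" using w by auto
        moreover from this have "v \<in> carrier V" using HV(1) by auto
        ultimately show "r \<odot>\<^bsub>tri U V \<psi>\<^esub> w \<in> carrier U \<times> H" by (simp add: triple_simps[OF U])
      qed
      show "S \<subseteq> carrier U \<times> H" using S(2) H(2) by fastforce
    qed
    then show ?thesis by (auto simp: times_eq_iff)
  qed
  moreover have "finite (snd ` S)" "snd ` S \<subseteq> carrier V" using S(1,2) by auto
  ultimately show ?thesis unfolding finitely_generated_def by (intro exI[of _ "snd ` S"]) simp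
qed

text \<open>For a submodule H of D, the vectors whose first entry is mapped into H by q form a
  \<Lambda>-submodule; the contribution of \<psi> does no harm since q kills it.\<close>

lemma finitely_generated_tri_cokernel:
  assumes fg: "finitely_generated \<Lambda> (tri U V \<psi>)" and U: "triple U V \<psi>"
    and S: "short_exact A (T V) \<psi> U q D"
  shows "finitely_generated A D"
proof -
  note t = tripleD[OF U] and s = short_exactD[OF S]
  interpret U: left_module A U by (rule t)
  interpret V: left_module B V by (rule t)
  interpret D: left_module A D by (rule s)
  interpret L: left_module \<Lambda> "tri U V \<psi>" by (rule left_module_tri[OF U])
  obtain G where G: "finite G" "G \<subseteq> carrier (tri U V \<psi>)"
    "\<And>H. submodule H \<Lambda> (tri U V \<psi>) \<Longrightarrow> G \<subseteq> H \<Longrightarrow> H = carrier (tri U V \<psi>)"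
    using fg by (auto simp: finitely_generated_def)
  let ?G = "(\<lambda>w. q (fst w)) ` G"
  have "H = carrier D" if H: "submodule H A D" "?G \<subseteq> H" for H
  proof -
    interpret H: submodule H A D by (rule H)
    have HD: "H \<subseteq> carrier D" "\<zero>\<^bsub>D\<^esub> \<in> H" "\<And>x y. x \<in> H \<Longrightarrow> y \<in> H \<Longrightarrow> x \<oplus>\<^bsub>D\<^esub> y \<in> H"
      using H.subset H.one_closed H.m_closed by auto
    let ?K = "{u \<in> carrier U. q u \<in> H} \<times> carrier V"
    have "?K = carrier (tri U V \<psi>)"
    proof (rule G(3))
      show "submodule ?K \<Lambda> (tri U V \<psi>)"
      proof (rule L.left_submoduleI)
        show "?K \<subseteq> carrier (tri U V \<psi>)" by auto
        show "\<zero>\<^bsub>tri U V \<psi>\<^esub> \<in> ?K" by (simp add: module_hom_zero[OF s(2,3,5)] HD(2))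
      next
        fix w z assume "w \<in> ?K" "z \<in> ?K"
        then show "w \<oplus>\<^bsub>tri U V \<psi>\<^esub> z \<in> ?K" by (cases w; cases z) (simp add: module_homD(2)[OF s(5)] HD(3))
      next
        fix r w assume r: "r \<in> carrier \<Lambda>" and w: "w \<in> ?K"
        obtain a m b where abm: "r = (a, m, b)" "a \<in> carrier A" "m \<in> carrier M" "b \<in> carrier B" using r by auto
        obtain u v where uv: "w = (u, v)" "u \<in> carrier U" "v \<in> carrier V" "q u \<in> H" using w by auto
        have "q (a \<odot>\<^bsub>U\<^esub> u \<oplus>\<^bsub>U\<^esub> \<psi> (te V m v)) = a \<odot>\<^bsub>D\<^esub> q u"
          using abm uv HD(1) by (simp add: triple_simps[OF U] module_homD[OF s(5)] s(8) te_closed[OF t(2)] subset_iff)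
        then show "r \<odot>\<^bsub>tri U V \<psi>\<^esub> w \<in> ?K" using abm uv by (simp add: triple_simps[OF U])
      qed
      show "G \<subseteq> ?K" using G(2) H(2) by auto
    qed
    then have "q u \<in> H" if "u \<in> carrier U" for u using that V.M.zero_closed by auto
    then have "carrier D \<subseteq> H" using short_exact_surjE[OF S] by (metis subsetI)
    with HD(1) show ?thesis by blast
  qed
  moreover have "finite ?G" using G(1) by simp
  moreover have "?G \<subseteq> carrier D" using G(2) module_homD(1)[OF s(5)] by auto
  ultimately show ?thesis unfolding finitely_generated_def by (intro exI[of _ ?G]) simp
qed

lemma finitely_generated_tri_free:
  assumes P: "left_module A P" "finitely_generated A P" and Q: "left_module B Q" "finitely_generated B Q"
  shows "finitely_generated \<Lambda> (tri (module_sum (T Q) P) Q (\<lambda>t. (t, \<zero>\<^bsub>P\<^esub>)))"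
    (is "finitely_generated \<Lambda> ?W")
proof -
  have tr: "triple (module_sum (T Q) P) Q (\<lambda>t. (t, \<zero>\<^bsub>P\<^esub>))" by (rule triple_free[OF P(1) Q(1)])
  interpret P: left_module A P by (rule P)
  interpret Q: tensor A B M Q by (intro tensor.intro bimodule_axioms Q)
  interpret TQ: left_module A "T Q" by (rule Q.left_module_tensor)
  interpret W: left_module \<Lambda> ?W by (rule left_module_tri[OF tr])
  obtain S where S: "finite S" "S \<subseteq> carrier P" "\<And>H. submodule H A P \<Longrightarrow> S \<subseteq> H \<Longrightarrow> H = carrier P"
    using P(2) by (auto simp: finitely_generated_def)
  obtain R where R: "finite R" "R \<subseteq> carrier Q" "\<And>H. submodule H B Q \<Longrightarrow> R \<subseteq> H \<Longrightarrow> H = carrier Q"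
    using Q(2) by (auto simp: finitely_generated_def)
  let ?p = "\<lambda>p. ((\<zero>\<^bsub>T Q\<^esub>, p), \<zero>\<^bsub>Q\<^esub>)" and ?q = "\<lambda>q. ((\<zero>\<^bsub>T Q\<^esub>, \<zero>\<^bsub>P\<^esub>), q)" and ?t = "\<lambda>t. ((t, \<zero>\<^bsub>P\<^esub>), \<zero>\<^bsub>Q\<^esub>)"
  have "H = carrier ?W" if H: "submodule H \<Lambda> ?W" "?p ` S \<union> ?q ` R \<subseteq> H" for H
  proof -
    interpret H: submodule H \<Lambda> ?W by (rule H)
    have HW: "H \<subseteq> carrier ?W" and H0: "?p \<zero>\<^bsub>P\<^esub> \<in> H" and Hadd: "\<And>x y. x \<in> H \<Longrightarrow> y \<in> H \<Longrightarrow> x \<oplus>\<^bsub>?W\<^esub> y \<in> H"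
      using H.subset H.one_closed H.m_closed by auto
    have Hs: "r \<odot>\<^bsub>?W\<^esub> x \<in> H" if "r \<in> carrier \<Lambda>" "x \<in> H" for r x using H.smult_closed[OF that] .
    have te0: "te Q \<zero>\<^bsub>M\<^esub> \<zero>\<^bsub>Q\<^esub> = \<zero>\<^bsub>T Q\<^esub>" "te Q \<zero>\<^bsub>M\<^esub> q = \<zero>\<^bsub>T Q\<^esub>" if "q \<in> carrier Q" for q
      using that by (simp_all add: Q.tensor_elem_zero_left)
    have "{p \<in> carrier P. ?p p \<in> H} = carrier P"
    proof (rule S(3))
      show "submodule {p \<in> carrier P. ?p p \<in> H} A P"
      proof (rule P.left_submoduleI)
        fix x y assume "x \<in> {p \<in> carrier P. ?p p \<in> H}" "y \<in> {p \<in> carrier P. ?p p \<in> H}"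
        then show "x \<oplus>\<^bsub>P\<^esub> y \<in> {p \<in> carrier P. ?p p \<in> H}" using Hadd[of "?p x" "?p y"] by simp
      next
        fix a x assume "a \<in> carrier A" "x \<in> {p \<in> carrier P. ?p p \<in> H}"
        then show "a \<odot>\<^bsub>P\<^esub> x \<in> {p \<in> carrier P. ?p p \<in> H}"
          using Hs[of "(a, \<zero>\<^bsub>M\<^esub>, \<zero>\<^bsub>B\<^esub>)" "?p x"] by (simp add: te0)
      qed (use H0 in auto)
      show "S \<subseteq> {p \<in> carrier P. ?p p \<in> H}" using S(2) H(2) by auto
    qed
    then have 1: "?p p \<in> H" if "p \<in> carrier P" for p using that by blast
    have "{q \<in> carrier Q. ?q q \<in> H} = carrier Q"
    proof (rule R(3))
      show "submodule {q \<in> carrier Q. ?q q \<in> H} B Q"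
      proof (rule Q.Y.left_submoduleI)
        fix x y assume "x \<in> {q \<in> carrier Q. ?q q \<in> H}" "y \<in> {q \<in> carrier Q. ?q q \<in> H}"
        then show "x \<oplus>\<^bsub>Q\<^esub> y \<in> {q \<in> carrier Q. ?q q \<in> H}" using Hadd[of "?q x" "?q y"] by simp
      next
        fix b x assume "b \<in> carrier B" "x \<in> {q \<in> carrier Q. ?q q \<in> H}"
        then show "b \<odot>\<^bsub>Q\<^esub> x \<in> {q \<in> carrier Q. ?q q \<in> H}"
          using Hs[of "(\<zero>\<^bsub>A\<^esub>, \<zero>\<^bsub>M\<^esub>, b)" "?q x"] by (simp add: te0)
      qed (use H0 in auto)
      show "R \<subseteq> {q \<in> carrier Q. ?q q \<in> H}" using R(2) H(2) by auto
    qed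
    then have 2: "?q q \<in> H" if "q \<in> carrier Q" for q using that by blast
    \<comment> \<open>The tensor part needs no generators of its own: (0, m, 0) sends the vector
      with lower entry q to m \<otimes> q.\<close>
    have 3: "?t t \<in> H" if "t \<in> carrier (T Q)" for t
      using that
    proof (induction rule: Q.tensor_induct)
      case zero
      then show ?case using H0 by simp
    next
      case (elem m q)
      then show ?case using Hs[of "(\<zero>\<^bsub>A\<^esub>, m, \<zero>\<^bsub>B\<^esub>)" "?q q", OF _ 2]
        by (simp add: Q.tensor_elem_closed)
    next
      case (add u v)
      then show ?case using Hadd[of "?t u" "?t v"] by simp
    qed
    have "w \<in> H" if w: "w \<in> carrier ?W" for w
    proof -
      obtain t p q where tpq: "w = ((t, p), q)" "t \<in> carrier (T Q)" "p \<in> carrier P" "q \<in> carrier Q" using w by auto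
      then show ?thesis using Hadd[OF Hadd[OF 3 1] 2, of t p q] by simp
    qed
    then show ?thesis using HW by blast
  qed
  moreover have "finite (?p ` S \<union> ?q ` R)" using S(1) R(1) by simp
  moreover have "?p ` S \<union> ?q ` R \<subseteq> carrier ?W" using S(2) R(2) by auto
  ultimately show ?thesis unfolding finitely_generated_def by (intro exI[of _ "?p ` S \<union> ?q ` R"]) simp
qed

text \<open>Lifts on Q and P are chosen separately; the lift on M \<otimes> Q is then forced by
  compatibility to be \<phi> after id \<otimes> h2. That it is a lift needs checking on elementary
  tensors alone.\<close>

lemma projective_tri_free:
  fixes P :: "('a, 'x, 'd) module_scheme" and Q :: "('b, 'y, 'e) module_scheme"
  assumes P: "projective_module A P" and Q: "projective_module B Q"
  shows "projective_module \<Lambda> (tri (module_sum (T Q) P) Q (\<lambda>t. (t, \<zero>\<^bsub>P\<^esub>)))"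
    (is "projective_module \<Lambda> ?W")
proof -
  have LP: "left_module A P" and LQ: "left_module B Q" using P Q by (simp_all add: projective_module_def)
  have tr: "triple (module_sum (T Q) P) Q (\<lambda>t. (t, \<zero>\<^bsub>P\<^esub>))" by (rule triple_free[OF LP LQ])
  interpret P: left_module A P by (rule LP)
  interpret Q: tensor A B M Q by (intro tensor.intro bimodule_axioms LQ)
  have TQ: "left_module A (T Q)" by (rule Q.left_module_tensor)
  interpret TQ: left_module A "T Q" by (rule TQ)
  show ?thesis
    unfolding projective_module_def
  proof (intro conjI allI impI left_module_tri[OF tr]; elim conjE)
    fix N :: "('a \<times> 'm \<times> 'b, ((('m \<times> 'y) \<Rightarrow>\<^sub>0 int) set \<times> 'x) \<times> 'y \<Rightarrow> 'a \<times> 'm \<times> 'b) module"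
      and N' :: "('a \<times> 'm \<times> 'b, ((('m \<times> 'y) \<Rightarrow>\<^sub>0 int) set \<times> 'x) \<times> 'y) module" and g f
    assume *: "left_module \<Lambda> N" "left_module \<Lambda> N'" "g \<in> module_hom \<Lambda> N N'"
      "g ` carrier N = carrier N'" "f \<in> module_hom \<Lambda> ?W N'"
    obtain X :: "('a, ((('m \<times> 'y) \<Rightarrow>\<^sub>0 int) set \<times> 'x) \<times> 'y \<Rightarrow> 'a \<times> 'm \<times> 'b) module" and Y :: "('b, ((('m \<times> 'y) \<Rightarrow>\<^sub>0 int) set \<times> 'x) \<times> 'y \<Rightarrow> 'a \<times> 'm \<times> 'b) module" and \<phi> e
      where X: "triple X Y \<phi>" and e: "e \<in> module_hom \<Lambda> N (tri X Y \<phi>)" "bij_betw e (carrier N) (carrier (tri X Y \<phi>))"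
      by (rule decompose[OF *(1)])
    obtain X' :: "('a, ((('m \<times> 'y) \<Rightarrow>\<^sub>0 int) set \<times> 'x) \<times> 'y) module" and Y' :: "('b, ((('m \<times> 'y) \<Rightarrow>\<^sub>0 int) set \<times> 'x) \<times> 'y) module" and \<phi>' e' where X': "triple X' Y' \<phi>'"
      and e': "e' \<in> module_hom \<Lambda> N' (tri X' Y' \<phi>')" "bij_betw e' (carrier N') (carrier (tri X' Y' \<phi>'))"
      by (rule decompose[OF *(2)])
    let ?i = "inv_into (carrier N) e"
    note i = module_hom_inv[OF *(1) e]
    note x = tripleD[OF X] and x' = tripleD[OF X']
    interpret X: left_module A X by (rule x)
    interpret Y: left_module B Y by (rule x)
    interpret X': left_module A X' by (rule x')
    interpret Y': left_module B Y' by (rule x')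
    obtain g1 g2 where g: "g1 \<in> module_hom A X X'" "g2 \<in> module_hom B Y Y'"
      "\<And>m y. \<lbrakk>m \<in> carrier M; y \<in> carrier Y\<rbrakk> \<Longrightarrow> g1 (\<phi> (te Y m y)) = \<phi>' (te Y' m (g2 y))"
      "\<And>x y. \<lbrakk>x \<in> carrier X; y \<in> carrier Y\<rbrakk> \<Longrightarrow> e' (g (?i (x, y))) = (g1 x, g2 y)"
      by (rule tri_homE[OF X X' module_hom_comp[OF module_hom_comp[OF i *(3)] e'(1)]]) blast
    obtain f1 f2 where f: "f1 \<in> module_hom A (module_sum (T Q) P) X'" "f2 \<in> module_hom B Q Y'"
      "\<And>m y. \<lbrakk>m \<in> carrier M; y \<in> carrier Q\<rbrakk> \<Longrightarrow> f1 (te Q m y, \<zero>\<^bsub>P\<^esub>) = \<phi>' (te Y' m (f2 y))"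
      "\<And>x y. \<lbrakk>x \<in> carrier (module_sum (T Q) P); y \<in> carrier Q\<rbrakk> \<Longrightarrow> e' (f (x, y)) = (f1 x, f2 y)"
      by (rule tri_homE[OF tr X' module_hom_comp[OF *(5) e'(1)]]) blast
    have onto: "\<exists>x \<in> carrier X. \<exists>y \<in> carrier Y. g1 x = x' \<and> g2 y = y'"
      if xy: "x' \<in> carrier X'" "y' \<in> carrier Y'" for x' y'
    proof -
      have "(x', y') \<in> e' ` carrier N'" using xy bij_betw_imp_surj_on[OF e'(2)] by simp
      then obtain n' where n': "n' \<in> carrier N'" "(x', y') = e' n'" by blast
      then have "n' \<in> g ` carrier N" by (simp only: *(4))
      then obtain n where n: "n \<in> carrier N" "n' = g n" by blast
      obtain x y where w: "e n = (x, y)" "x \<in> carrier X" "y \<in> carrier Y"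
        using module_homD(1)[OF e(1) n(1)] by (cases "e n") auto
      have "?i (x, y) = n" using bij_betw_inv_into_left[OF e(2) n(1)] w(1) by simp
      then show ?thesis using g(4)[OF w(2,3)] n(2) n'(2) w(2,3) by auto
    qed
    have g1: "g1 ` carrier X = carrier X'"
    proof (rule subset_antisym)
      show "g1 ` carrier X \<subseteq> carrier X'" using module_homD(1)[OF g(1)] by blast
      show "carrier X' \<subseteq> g1 ` carrier X" using onto[OF _ Y'.M.zero_closed] by (metis image_eqI subsetI)
    qed
    have g2: "g2 ` carrier Y = carrier Y'"
    proof (rule subset_antisym)
      show "g2 ` carrier Y \<subseteq> carrier Y'" using module_homD(1)[OF g(2)] by blast
      show "carrier Y' \<subseteq> g2 ` carrier Y" using onto[OF X'.M.zero_closed] by (metis image_eqI subsetI)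
    qed
    obtain h2 where h2: "h2 \<in> module_hom B Q Y" "\<And>q. q \<in> carrier Q \<Longrightarrow> g2 (h2 q) = f2 q"
      using projective_module_lift[OF Q x(2) x'(2) g(2) g2 f(2)] by metis
    obtain hP where hP: "hP \<in> module_hom A P X" "\<And>p. p \<in> carrier P \<Longrightarrow> g1 (hP p) = f1 (\<zero>\<^bsub>T Q\<^esub>, p)"
      using projective_module_lift[OF P x(1) x'(1) g(1) g1 module_hom_comp[OF module_hom_inr[OF TQ] f(1)]] by metis
    note Th = tensor_map[OF LQ x(2) h2(1)]
    have hT: "(\<lambda>t. \<phi> (tensor_map B M Q Y h2 t)) \<in> module_hom A (T Q) X" by (rule module_hom_comp[OF Th(1) x(3)])
    let ?h1 = "\<lambda>z. \<phi> (tensor_map B M Q Y h2 (fst z)) \<oplus>\<^bsub>X\<^esub> hP (snd z)"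
    have h1: "?h1 \<in> module_hom A (module_sum (T Q) P) X" by (rule module_hom_copair[OF TQ LP x(1) hT hP(1)])
    have c: "?h1 (te Q m q, \<zero>\<^bsub>P\<^esub>) = \<phi> (te Y m (h2 q))" if "m \<in> carrier M" "q \<in> carrier Q" for m q
      using that module_homD(1)[OF h2(1)] by (simp add: Th(2) module_hom_zero[OF LP x(1) hP(1)] triple_simps[OF X])
    have gt: "g1 (\<phi> (tensor_map B M Q Y h2 t)) = f1 (t, \<zero>\<^bsub>P\<^esub>)" if "t \<in> carrier (T Q)" for t
      by (rule tensor_hom_cong[OF LQ x'(1) module_hom_comp[OF hT g(1)] module_hom_comp[OF module_hom_inl[OF LP] f(1)] _ that])
        (simp add: Th(2) g(3) f(3) h2(2) module_homD(1)[OF h2(1)])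
    have gh: "g1 (?h1 z) = f1 z" if z: "z \<in> carrier (module_sum (T Q) P)" for z
    proof -
      obtain t p where tp: "z = (t, p)" "t \<in> carrier (T Q)" "p \<in> carrier P" using z by auto
      have "f1 z = f1 ((t, \<zero>\<^bsub>P\<^esub>) \<oplus>\<^bsub>module_sum (T Q) P\<^esub> (\<zero>\<^bsub>T Q\<^esub>, p))" using tp by simp
      also have "\<dots> = f1 (t, \<zero>\<^bsub>P\<^esub>) \<oplus>\<^bsub>X'\<^esub> f1 (\<zero>\<^bsub>T Q\<^esub>, p)" using tp by (intro module_homD(2)[OF f(1)]) auto
      finally show ?thesis
        using tp by (simp add: module_homD(2)[OF g(1)] module_homD(1)[OF hT] module_homD(1)[OF hP(1)] gt hP(2))
    qed
    let ?h = "\<lambda>w. ?i (map_prod ?h1 h2 w)"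
    have H: "map_prod ?h1 h2 \<in> module_hom \<Lambda> ?W (tri X Y \<phi>)" by (rule tri_homI[OF tr X h1 h2(1) c])
    have "g (?h w) = f w" if w: "w \<in> carrier ?W" for w
    proof -
      obtain z q where zq: "w = (z, q)" "z \<in> carrier (module_sum (T Q) P)" "q \<in> carrier Q" using w by auto
      \<comment> \<open>Equality in N' is tested after the isomorphism e', where it splits into the
        two component equations.\<close>
      have "e' (g (?h w)) = e' (f w)"
        unfolding zq(1) map_prod_simp
        using g(4)[OF module_homD(1)[OF h1 zq(2)] module_homD(1)[OF h2(1) zq(3)]] f(4)[OF zq(2,3)] gh[OF zq(2)] h2(2)[OF zq(3)]
        by simp
      then show ?thesis
        by (rule inj_onD[OF bij_betw_imp_inj_on[OF e'(2)] _ module_homD(1)[OF *(3) module_homD(1)[OF i module_homD(1)[OF H w]]]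
              module_homD(1)[OF *(5) w]])
    qed
    then show "\<exists>h \<in> module_hom \<Lambda> ?W N. \<forall>x \<in> carrier ?W. g (h x) = f x"
      by (intro bexI[OF _ module_hom_comp[OF H i]] ballI)
  qed
qed

end

text \<open>The finiteness conditions on M are derived from the Artin hypothesis in
  \<open>artin_algebra_bimodule\<close>; they are stated here separately because the arguments use
  them to obtain finite dual bases and finitely generated tensor products.\<close>

locale triangular_projective = triangular A B M
  for A :: "('a, 'p) ring_scheme" and B :: "('b, 'q) ring_scheme"
    and M :: "('a, 'b, 'm, 'c) bimodule_scheme" +
  assumes projective_left: "projective_module A M"
    and finitely_generated_left: "finitely_generated A M"
    and projective_right: "projective_module (op_ring B) (right_part M)"
    and finitely_generated_right: "finitely_generated (op_ring B) (right_part M)"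
begin

lemma tensor_exact:
  assumes "short_exact B Y f V g Z"
  shows "short_exact A (T Y) (tensor_map B M Y V f) (T V) (tensor_map B M V Z g) (T Z)"
  by (rule projective_dual_basis[OF projective_right finitely_generated_right])
    (rule tensor_short_exact[OF assms])

lemma triple_commute:
  assumes X: "triple X Y \<phi>" and U: "triple U V \<psi>" and f: "f \<in> module_hom A X U" and f': "f' \<in> module_hom B Y V"
    and c: "\<And>m y. \<lbrakk>m \<in> carrier M; y \<in> carrier Y\<rbrakk> \<Longrightarrow> f (\<phi> (te Y m y)) = \<psi> (te V m (f' y))"
    and t: "t \<in> carrier (T Y)"
  shows "\<psi> (tensor_map B M Y V f' t) = f (\<phi> t)"
proof -
  note x = tripleD[OF X] and u = tripleD[OF U]
  note m = tensor_map[OF x(2) u(2) f']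
  show ?thesis
    by (rule tensor_hom_cong[OF x(2) u(1) module_hom_comp[OF m(1) u(3)] module_hom_comp[OF x(3) f] _ t])
      (simp add: m(2) c)
qed

section \<open>From a Gorenstein-projective triple to its cokernel and its base\<close>

lemma Gorenstein_tri_steps:
  fixes X :: "('a, 'x, 'd) module_scheme" and Y :: "('b, 'y, 'e) module_scheme"
  assumes X: "triple X Y \<phi>" and GP: "Gorenstein_projective \<Lambda> (tri X Y \<phi>)"
  obtains F G \<psi> \<phi>' and U :: "('a, nat \<Rightarrow> 'a \<times> 'm \<times> 'b) module" and V :: "('b, nat \<Rightarrow> 'a \<times> 'm \<times> 'b) module"
    and X' :: "('a, nat \<Rightarrow> 'a \<times> 'm \<times> 'b) module" and Y' :: "('b, nat \<Rightarrow> 'a \<times> 'm \<times> 'b) module"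
  where "triple U V \<psi>" "triple X' Y' \<phi>'" "Gorenstein_projective \<Lambda> (tri X' Y' \<phi>')"
    "proper_step \<Lambda> (tri X Y \<phi>) F (tri U V \<psi>) G (tri X' Y' \<phi>')"
proof -
  obtain f and P :: "('a \<times> 'm \<times> 'b, nat \<Rightarrow> 'a \<times> 'm \<times> 'b) module" and g
    and N :: "('a \<times> 'm \<times> 'b, nat \<Rightarrow> 'a \<times> 'm \<times> 'b) module"
    where step: "proper_step \<Lambda> (tri X Y \<phi>) f P g N" and N: "Gorenstein_projective \<Lambda> N"
    using Gorenstein_projective_steps(1)[OF GP] by blast
  note s = short_exactD[OF proper_stepD(1)[OF step]]
  obtain U :: "('a, nat \<Rightarrow> 'a \<times> 'm \<times> 'b) module" and V :: "('b, nat \<Rightarrow> 'a \<times> 'm \<times> 'b) module" and \<psi> e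
    where U: "triple U V \<psi>" "e \<in> module_hom \<Lambda> P (tri U V \<psi>)" "bij_betw e (carrier P) (carrier (tri U V \<psi>))"
    by (rule decompose[OF s(2)])
  obtain X' :: "('a, nat \<Rightarrow> 'a \<times> 'm \<times> 'b) module" and Y' :: "('b, nat \<Rightarrow> 'a \<times> 'm \<times> 'b) module" and \<phi>' e'
    where X': "triple X' Y' \<phi>'" "e' \<in> module_hom \<Lambda> N (tri X' Y' \<phi>')" "bij_betw e' (carrier N) (carrier (tri X' Y' \<phi>'))"
    by (rule decompose[OF s(3)])
  show ?thesis
    by (rule that[OF U(1) X'(1) Gorenstein_projective_iso[OF N left_module_tri[OF X'(1)] module_isomorphicI[OF X'(2,3)]]
        proper_step_iso_middle[OF proper_step_iso_right[OF step left_module_tri[OF X'(1)] X'(2,3)] left_module_tri[OF U(1)] U(2,3)]])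
qed

lemma Gorenstein_tri_steps_left:
  fixes X :: "('a, 'x, 'd) module_scheme" and Y :: "('b, 'y, 'e) module_scheme"
  assumes X: "triple X Y \<phi>" and GP: "Gorenstein_projective \<Lambda> (tri X Y \<phi>)"
  obtains F G \<psi> \<phi>' and U :: "('a, nat \<Rightarrow> 'a \<times> 'm \<times> 'b) module" and V :: "('b, nat \<Rightarrow> 'a \<times> 'm \<times> 'b) module"
    and X' :: "('a, nat \<Rightarrow> 'a \<times> 'm \<times> 'b) module" and Y' :: "('b, nat \<Rightarrow> 'a \<times> 'm \<times> 'b) module"
  where "triple U V \<psi>" "triple X' Y' \<phi>'" "Gorenstein_projective \<Lambda> (tri X' Y' \<phi>')"
    "proper_step \<Lambda> (tri X' Y' \<phi>') F (tri U V \<psi>) G (tri X Y \<phi>)"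
proof -
  obtain N :: "('a \<times> 'm \<times> 'b, nat \<Rightarrow> 'a \<times> 'm \<times> 'b) module" and f
    and P :: "('a \<times> 'm \<times> 'b, nat \<Rightarrow> 'a \<times> 'm \<times> 'b) module" and g
    where step: "proper_step \<Lambda> N f P g (tri X Y \<phi>)" and N: "Gorenstein_projective \<Lambda> N"
    using Gorenstein_projective_steps(2)[OF GP] by blast
  note s = short_exactD[OF proper_stepD(1)[OF step]]
  obtain U :: "('a, nat \<Rightarrow> 'a \<times> 'm \<times> 'b) module" and V :: "('b, nat \<Rightarrow> 'a \<times> 'm \<times> 'b) module" and \<psi> e
    where U: "triple U V \<psi>" "e \<in> module_hom \<Lambda> P (tri U V \<psi>)" "bij_betw e (carrier P) (carrier (tri U V \<psi>))"
    by (rule decompose[OF s(2)])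
  obtain X' :: "('a, nat \<Rightarrow> 'a \<times> 'm \<times> 'b) module" and Y' :: "('b, nat \<Rightarrow> 'a \<times> 'm \<times> 'b) module" and \<phi>' e'
    where X': "triple X' Y' \<phi>'" "e' \<in> module_hom \<Lambda> N (tri X' Y' \<phi>')" "bij_betw e' (carrier N) (carrier (tri X' Y' \<phi>'))"
    by (rule decompose[OF s(1)])
  show ?thesis
    by (rule that[OF U(1) X'(1) Gorenstein_projective_iso[OF N left_module_tri[OF X'(1)] module_isomorphicI[OF X'(2,3)]]
        proper_step_iso_middle[OF proper_step_iso_left[OF step left_module_tri[OF X'(1)]
            module_hom_inv[OF s(1) X'(2,3)] bij_betw_inv_into[OF X'(3)]] left_module_tri[OF U(1)] U(2,3)]])
qed

text \<open>In the identity \<psi> (id \<otimes> f') = f \<phi> the left side is injective: \<psi>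
  because (U, V) is projective, id \<otimes> f' because tensoring with M is exact. Hence \<phi> is
  injective.\<close>

lemma proper_step_tri_inj:
  assumes X: "triple X Y \<phi>" and U: "triple U V \<psi>" and X': "triple X' Y' \<phi>'"
    and step: "proper_step \<Lambda> (tri X Y \<phi>) F (tri U V \<psi>) G (tri X' Y' \<phi>')"
  shows "inj_on \<phi> (carrier (T Y))"
proof -
  obtain f f' g g' where f: "short_exact A X f U g X'" "short_exact B Y f' V g' Y'"
    "\<And>m y. \<lbrakk>m \<in> carrier M; y \<in> carrier Y\<rbrakk> \<Longrightarrow> f (\<phi> (te Y m y)) = \<psi> (te V m (f' y))"
    by (rule tri_short_exactE[OF X U X' proper_stepD(1)[OF step]]) blast
  note t = short_exactD[OF tensor_exact[OF f(2)]]
  have i: "inj_on \<psi> (carrier (T V))" by (rule projective_tri_inj[OF proper_stepD(2)[OF step] U])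
  show ?thesis
  proof (rule inj_onI)
    fix s t' assume st: "s \<in> carrier (T Y)" "t' \<in> carrier (T Y)" "\<phi> s = \<phi> t'"
    have "\<psi> (tensor_map B M Y V f' s) = \<psi> (tensor_map B M Y V f' t')"
      using triple_commute[OF X U short_exactD(4)[OF f(1)] short_exactD(4)[OF f(2)] f(3)] st by metis
    then have "tensor_map B M Y V f' s = tensor_map B M Y V f' t'"
      by (rule inj_onD[OF i _ module_homD(1)[OF t(4) st(1)] module_homD(1)[OF t(4) st(2)]])
    then show "s = t'" by (rule inj_onD[OF t(6) _ st(1,2)])
  qed
qed

lemma Gorenstein_tri_inj:
  assumes X: "triple X Y \<phi>" and GP: "Gorenstein_projective \<Lambda> (tri X Y \<phi>)"
  shows "inj_on \<phi> (carrier (T Y))"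
  by (rule Gorenstein_tri_steps[OF X GP]) (rule proper_step_tri_inj[OF X])

text \<open>A functional on C is inflated to a map from (X, Y) to \<Lambda>, extended to (U, V), and
  its A-entry is pushed down to the cokernel D of \<psi>.\<close>

lemma proper_step_tri_cokernel:
  assumes X: "triple X Y \<phi>" and U: "triple U V \<psi>" and X': "triple X' Y' \<phi>'"
    and step: "proper_step \<Lambda> (tri X Y \<phi>) F (tri U V \<psi>) G (tri X' Y' \<phi>')"
    and C: "short_exact A (T Y) \<phi> X p C" and D: "short_exact A (T V) \<psi> U q D" and C': "short_exact A (T Y') \<phi>' X' p' C'"
  obtains c d where "proper_step A C c D d C'"
proof -
  note st = proper_stepD[OF step]
  note x = tripleD[OF X] and u = tripleD[OF U] and x' = tripleD[OF X']
  note sC = short_exactD[OF C] and sD = short_exactD[OF D]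
  obtain f f' g g' where f: "short_exact A X f U g X'" "short_exact B Y f' V g' Y'"
    "\<And>m y. \<lbrakk>m \<in> carrier M; y \<in> carrier Y\<rbrakk> \<Longrightarrow> f (\<phi> (te Y m y)) = \<psi> (te V m (f' y))"
    "\<And>m v. \<lbrakk>m \<in> carrier M; v \<in> carrier V\<rbrakk> \<Longrightarrow> g (\<psi> (te V m v)) = \<phi>' (te Y' m (g' v))"
    "\<And>x y. \<lbrakk>x \<in> carrier X; y \<in> carrier Y\<rbrakk> \<Longrightarrow> F (x, y) = (f x, f' y)"
    by (rule tri_short_exactE[OF X U X' st(1)]) blast
  note s = short_exactD[OF f(1)] and s' = short_exactD[OF f(2)]
  obtain c d where cd: "short_exact A C c D d C'" "\<And>x. x \<in> carrier X \<Longrightarrow> c (p x) = q (f x)"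
  proof (rule three_by_three[OF C D C' tensor_exact[OF f(2)] f(1)])
    show "\<psi> (tensor_map B M Y V f' k) = f (\<phi> k)" if "k \<in> carrier (T Y)" for k
      by (rule triple_commute[OF X U s(4) s'(4) f(3) that])
    show "\<phi>' (tensor_map B M V Y' g' k) = g (\<psi> k)" if "k \<in> carrier (T V)" for k
      by (rule triple_commute[OF U X' s(5) s'(5) f(4) that])
  qed blast
  interpret U: left_module A U by (rule u)
  interpret V: left_module B V by (rule u)
  interpret Y: left_module B Y by (rule x)
  have "extends_along A C c D (regular_module A)"
  proof (rule extends_alongI)
    fix h assume h: "h \<in> module_hom A C (regular_module A)"
    have RA: "left_module A (regular_module A)" by (rule left_module_regular[OF left.R.ring_axioms])
    have h0: "h \<zero>\<^bsub>C\<^esub> = \<zero>\<^bsub>A\<^esub>" using module_hom_zero[OF sC(3) RA h] by simp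
    have hp: "(\<lambda>x. h (p x)) \<in> module_hom A X (regular_module A)" by (rule module_hom_comp[OF sC(5) h])
    note hp' = module_homD[OF hp, simplified]
    have h\<phi>: "h (p (\<phi> (te Y m y))) = \<zero>\<^bsub>A\<^esub>" if "m \<in> carrier M" "y \<in> carrier Y" for m y
      using that by (simp add: sC(8) te_closed[OF x(2)] h0)
    \<comment> \<open>The values lie in the first column of \<Lambda>. Linearity for (0, m, 0) holds
      because h p vanishes on the image of \<phi>.\<close>
    have "(\<lambda>w. (h (p (fst w)), \<zero>\<^bsub>M\<^esub>, \<zero>\<^bsub>B\<^esub>)) \<in> module_hom \<Lambda> (tri X Y \<phi>) (regular_module \<Lambda>)"
    proof (rule module_homI)
      interpret X: left_module A X by (rule x)
      fix r w assume r: "r \<in> carrier \<Lambda>" and w: "w \<in> carrier (tri X Y \<phi>)"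
      obtain a m b where abm: "r = (a, m, b)" "a \<in> carrier A" "m \<in> carrier M" "b \<in> carrier B" using r by auto
      obtain y z where yz: "w = (y, z)" "y \<in> carrier X" "z \<in> carrier Y" using w by auto
      show "(h (p (fst (r \<odot>\<^bsub>tri X Y \<phi>\<^esub> w))), \<zero>\<^bsub>M\<^esub>, \<zero>\<^bsub>B\<^esub>) =
          r \<odot>\<^bsub>regular_module \<Lambda>\<^esub> (h (p (fst w)), \<zero>\<^bsub>M\<^esub>, \<zero>\<^bsub>B\<^esub>)"
        using abm yz by (simp add: hp' h\<phi> triple_simps[OF X])
    qed (auto simp: hp')
    then obtain K where K: "K \<in> module_hom \<Lambda> (tri U V \<psi>) (regular_module \<Lambda>)"
      "\<And>w. w \<in> carrier (tri X Y \<phi>) \<Longrightarrow> K (F w) = (h (p (fst w)), \<zero>\<^bsub>M\<^esub>, \<zero>\<^bsub>B\<^esub>)"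
      by (rule extends_alongE[OF st(4)]) blast
    let ?k = "\<lambda>x. fst (K (x, \<zero>\<^bsub>V\<^esub>))"
    have Kc: "K (y, v) \<in> carrier A \<times> carrier M \<times> carrier B" if "y \<in> carrier U" "v \<in> carrier V" for y v
      using module_homD(1)[OF K(1), of "(y, v)"] that by simp
    have Ks: "K ((a, m, b) \<odot>\<^bsub>tri U V \<psi>\<^esub> (y, v)) = (a, m, b) \<otimes>\<^bsub>\<Lambda>\<^esub> K (y, v)"
      if "a \<in> carrier A" "m \<in> carrier M" "b \<in> carrier B" "y \<in> carrier U" "v \<in> carrier V" for a m b y v
      using module_homD(3)[OF K(1), of "(a, m, b)" "(y, v)"] that by simp
    have k: "?k \<in> module_hom A U (regular_module A)"
    proof (rule module_homI)
      fix y assume "y \<in> carrier U"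
      then show "?k y \<in> carrier (regular_module A)" using Kc[of y "\<zero>\<^bsub>V\<^esub>"] by (cases "K (y, \<zero>\<^bsub>V\<^esub>)") simp
    next
      fix y z assume "y \<in> carrier U" "z \<in> carrier U"
      then show "?k (y \<oplus>\<^bsub>U\<^esub> z) = ?k y \<oplus>\<^bsub>regular_module A\<^esub> ?k z"
        using module_homD(2)[OF K(1), of "(y, \<zero>\<^bsub>V\<^esub>)" "(z, \<zero>\<^bsub>V\<^esub>)"]
        by (cases "K (y, \<zero>\<^bsub>V\<^esub>)"; cases "K (z, \<zero>\<^bsub>V\<^esub>)") simp
    next
      fix a y assume "a \<in> carrier A" "y \<in> carrier U"
      then show "?k (a \<odot>\<^bsub>U\<^esub> y) = a \<odot>\<^bsub>regular_module A\<^esub> ?k y"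
        using Ks[of a "\<zero>\<^bsub>M\<^esub>" "\<zero>\<^bsub>B\<^esub>" y "\<zero>\<^bsub>V\<^esub>"]
        by (cases "K (y, \<zero>\<^bsub>V\<^esub>)") (simp add: triple_simps[OF U])
    qed
    \<comment> \<open>The vector with entries \<psi>(m \<otimes> v) and 0 is (0, m, 0) applied to
      the one with entries 0 and v, and every product with left factor (0, m, 0) has A-entry
      zero.\<close>
    have k\<psi>: "?k (\<psi> t) = \<zero>\<^bsub>A\<^esub>" if t: "t \<in> carrier (T V)" for t
    proof (rule tensor_hom_cong[OF u(2) RA module_hom_comp[OF u(3) k] module_hom_zero_map[OF RA] _ t, simplified])
      fix m v assume "m \<in> carrier M" "v \<in> carrier V"
      then show "?k (\<psi> (te V m v)) = \<zero>\<^bsub>A\<^esub>"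
        using Ks[of "\<zero>\<^bsub>A\<^esub>" m "\<zero>\<^bsub>B\<^esub>" "\<zero>\<^bsub>U\<^esub>" v] Kc[of "\<zero>\<^bsub>U\<^esub>" v]
        by (cases "K (\<zero>\<^bsub>U\<^esub>, v)") (simp add: triple_simps[OF U])
    qed
    obtain l where l: "l \<in> module_hom A D (regular_module A)" "\<And>y. y \<in> carrier U \<Longrightarrow> l (q y) = ?k y"
    proof (rule factor_surj[OF sD(2,3) RA sD(5,7) k])
      fix y assume "y \<in> carrier U" "q y = \<zero>\<^bsub>D\<^esub>"
      then obtain t where "t \<in> carrier (T V)" "y = \<psi> t" by (rule short_exact_kernelE[OF D])
      then show "?k y = \<zero>\<^bsub>regular_module A\<^esub>" using k\<psi> by simp
    qed blast
    have "l (c z) = h z" if z: "z \<in> carrier C" for z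
    proof -
      obtain y where y: "y \<in> carrier X" "z = p y" by (rule short_exact_surjE[OF C z])
      have "l (c z) = ?k (f y)" using y module_homD(1)[OF s(4)] by (simp add: cd(2) l(2))
      also have "\<dots> = fst (K (F (y, \<zero>\<^bsub>Y\<^esub>)))" using y by (simp add: f(5) module_hom_zero[OF s'(1,2,4)])
      also have "\<dots> = h z" using y by (simp add: K(2))
      finally show ?thesis .
    qed
    then show "\<exists>k \<in> module_hom A D (regular_module A). \<forall>x \<in> carrier C. k (c x) = h x"
      by (intro bexI[OF _ l(1)] ballI)
  qed
  then have "proper_step A C c D d C'"
    unfolding proper_step_def
    by (intro conjI cd(1) projective_tri_cokernel[OF st(2) U D] finitely_generated_tri_cokernel[OF st(3) U D])
  then show ?thesis by (rule that)
qed

text \<open>A functional h on Y is to become the lower entry of a map into the second column of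
  \<Lambda>. Its upper entry must be some c from X to M whose composite with \<phi> sends m
  \<otimes> y to m h(y). Such a c exists because C is Gorenstein-projective and M is finitely
  generated projective over A; this is why the cokernel is treated before Y.\<close>

lemma proper_step_tri_base:
  assumes X: "triple X Y \<phi>" and U: "triple U V \<psi>" and X': "triple X' Y' \<phi>'"
    and step: "proper_step \<Lambda> (tri X Y \<phi>) F (tri U V \<psi>) G (tri X' Y' \<phi>')"
    and C: "short_exact A (T Y) \<phi> X p C" and GC: "Gorenstein_projective A C"
  obtains f g where "proper_step B Y f V g Y'"
proof -
  note st = proper_stepD[OF step]
  note x = tripleD[OF X] and u = tripleD[OF U] and x' = tripleD[OF X']
  obtain f f' g g' where f: "short_exact A X f U g X'" "short_exact B Y f' V g' Y'"
    "\<And>x y. \<lbrakk>x \<in> carrier X; y \<in> carrier Y\<rbrakk> \<Longrightarrow> F (x, y) = (f x, f' y)"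
    by (rule tri_short_exactE[OF X U X' st(1)]) blast
  note s = short_exactD[OF f(1)] and s' = short_exactD[OF f(2)]
  interpret X: left_module A X by (rule x)
  interpret U: left_module A U by (rule u)
  interpret V: left_module B V by (rule u)
  interpret Y: tensor A B M Y by (intro tensor.intro bimodule_axioms x)
  obtain n m \<xi> where db: "dual_basis A M n m \<xi>" by (rule projective_dual_basis[OF projective_left finitely_generated_left])
  have ext: "extends_along A (T Y) \<phi> X M"
    by (rule Gorenstein_projective_extends_dual_basis[OF C GC left.left_module_axioms db])
  have "extends_along B Y f' V (regular_module B)"
  proof (rule extends_alongI)
    fix h assume h: "h \<in> module_hom B Y (regular_module B)"
    note h' = module_homD[OF h, simplified]
    obtain c0 where c0: "c0 \<in> module_hom A (T Y) M"
      "\<And>m y. \<lbrakk>m \<in> carrier M; y \<in> carrier Y\<rbrakk> \<Longrightarrow> c0 (te Y m y) = rsmult M m (h y)"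
    proof (rule Y.tensor_lift[OF left.left_module_axioms, of "\<lambda>m y. rsmult M m (h y)"])
    qed (auto simp: h' rsmult_distr rsmult_distr_ring rsmult_assoc smult_rsmult)
    obtain c where c: "c \<in> module_hom A X M" "\<And>t. t \<in> carrier (T Y) \<Longrightarrow> c (\<phi> t) = c0 t"
      using extends_alongE[OF ext c0(1)] by metis
    note c' = module_homD[OF c(1)]
    have "(\<lambda>w. (\<zero>\<^bsub>A\<^esub>, c (fst w), h (snd w))) \<in> module_hom \<Lambda> (tri X Y \<phi>) (regular_module \<Lambda>)"
    proof (rule module_homI)
      fix r w assume r: "r \<in> carrier \<Lambda>" and w: "w \<in> carrier (tri X Y \<phi>)"
      obtain a m b where abm: "r = (a, m, b)" "a \<in> carrier A" "m \<in> carrier M" "b \<in> carrier B" using r by auto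
      obtain y z where yz: "w = (y, z)" "y \<in> carrier X" "z \<in> carrier Y" using w by auto
      show "(\<zero>\<^bsub>A\<^esub>, c (fst (r \<odot>\<^bsub>tri X Y \<phi>\<^esub> w)), h (snd (r \<odot>\<^bsub>tri X Y \<phi>\<^esub> w))) =
          r \<odot>\<^bsub>regular_module \<Lambda>\<^esub> (\<zero>\<^bsub>A\<^esub>, c (fst w), h (snd w))"
        using abm yz by (simp add: h' c' c(2) c0(2) te_closed[OF x(2)] triple_simps[OF X])
    qed (auto simp: h' c')
    then obtain K where K: "K \<in> module_hom \<Lambda> (tri U V \<psi>) (regular_module \<Lambda>)"
      "\<And>w. w \<in> carrier (tri X Y \<phi>) \<Longrightarrow> K (F w) = (\<zero>\<^bsub>A\<^esub>, c (fst w), h (snd w))"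
      by (rule extends_alongE[OF st(4)]) blast
    let ?k = "\<lambda>v. snd (snd (K (\<zero>\<^bsub>U\<^esub>, v)))"
    have Kc: "K (\<zero>\<^bsub>U\<^esub>, v) \<in> carrier A \<times> carrier M \<times> carrier B" if "v \<in> carrier V" for v
      using module_homD(1)[OF K(1), of "(\<zero>\<^bsub>U\<^esub>, v)"] that by simp
    have k: "?k \<in> module_hom B V (regular_module B)"
    proof (rule module_homI)
      fix y assume "y \<in> carrier V"
      then show "?k y \<in> carrier (regular_module B)" using Kc[of y] by (cases "K (\<zero>\<^bsub>U\<^esub>, y)") simp
    next
      fix y z assume "y \<in> carrier V" "z \<in> carrier V"
      then show "?k (y \<oplus>\<^bsub>V\<^esub> z) = ?k y \<oplus>\<^bsub>regular_module B\<^esub> ?k z"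
        using module_homD(2)[OF K(1), of "(\<zero>\<^bsub>U\<^esub>, y)" "(\<zero>\<^bsub>U\<^esub>, z)"]
        by (cases "K (\<zero>\<^bsub>U\<^esub>, y)"; cases "K (\<zero>\<^bsub>U\<^esub>, z)") simp
    next
      fix b y assume "b \<in> carrier B" "y \<in> carrier V"
      then show "?k (b \<odot>\<^bsub>V\<^esub> y) = b \<odot>\<^bsub>regular_module B\<^esub> ?k y"
        using module_homD(3)[OF K(1), of "(\<zero>\<^bsub>A\<^esub>, \<zero>\<^bsub>M\<^esub>, b)" "(\<zero>\<^bsub>U\<^esub>, y)"]
        by (cases "K (\<zero>\<^bsub>U\<^esub>, y)") (simp add: triple_simps[OF U])
    qed
    have "?k (f' y) = h y" if y: "y \<in> carrier Y" for y
      using K(2)[of "(\<zero>\<^bsub>X\<^esub>, y)"] y by (simp add: f(3) module_hom_zero[OF s(1,2,4)])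
    then show "\<exists>k \<in> module_hom B V (regular_module B). \<forall>x \<in> carrier Y. k (f' x) = h x"
      by (intro bexI[OF _ k] ballI)
  qed
  then have "proper_step B Y f' V g' Y'"
    unfolding proper_step_def
    by (intro conjI f(2) projective_tri_base[OF st(2) U] finitely_generated_tri_base[OF st(3) U])
  then show ?thesis by (rule that)
qed

lemma cokernel_short_exact:
  assumes "triple X Y \<phi>" "inj_on \<phi> (carrier (T Y))"
  obtains p where "short_exact A (T Y) \<phi> X p (cokernel_module (T Y) X \<phi>)"
  by (rule that[OF short_exact_cokernel[OF left_module_tensor_module[OF tripleD(2)[OF assms(1)]] tripleD(1,3)[OF assms(1)] assms(2)]])

text \<open>The class for the coinduction over A. The types of X and Y are those on which
  \<open>Gorenstein_tri_steps\<close> delivers neighbours, so that the class is closed under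
  steps.\<close>

definition Gorenstein_cokernel :: "('a, nat \<Rightarrow> 'a) module \<Rightarrow> bool"
  where "Gorenstein_cokernel C \<longleftrightarrow>
    (\<exists>(X :: ('a, nat \<Rightarrow> 'a \<times> 'm \<times> 'b) module) (Y :: ('b, nat \<Rightarrow> 'a \<times> 'm \<times> 'b) module) \<phi> p.
      triple X Y \<phi> \<and> Gorenstein_projective \<Lambda> (tri X Y \<phi>) \<and> short_exact A (T Y) \<phi> X p C)"

lemma Gorenstein_cokernel_exists:
  fixes X :: "('a, nat \<Rightarrow> 'a \<times> 'm \<times> 'b) module" and Y :: "('b, nat \<Rightarrow> 'a \<times> 'm \<times> 'b) module"
  assumes X: "triple X Y \<phi>" and GP: "Gorenstein_projective \<Lambda> (tri X Y \<phi>)"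
  obtains p and C :: "('a, nat \<Rightarrow> 'a) module" where "short_exact A (T Y) \<phi> X p C" "Gorenstein_cokernel C"
proof -
  obtain p where p: "short_exact A (T Y) \<phi> X p (cokernel_module (T Y) X \<phi>)"
    by (rule cokernel_short_exact[OF X Gorenstein_tri_inj[OF X GP]])
  have "finitely_generated \<Lambda> (tri X Y \<phi>)" using GP by (simp add: Gorenstein_projective_def)
  from finitely_generated_tri_cokernel[OF this X p]
  obtain C :: "('a, nat \<Rightarrow> 'a) module" and e where C: "left_module A C"
    "e \<in> module_hom A (cokernel_module (T Y) X \<phi>) C" "bij_betw e (carrier (cokernel_module (T Y) X \<phi>)) (carrier C)"
    by (rule finitely_generated_nat_model[OF short_exactD(3)[OF p]])
  have "short_exact A (T Y) \<phi> X (\<lambda>x. e (p x)) C" by (rule short_exact_iso_right[OF p C])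
  moreover from this have "Gorenstein_cokernel C" unfolding Gorenstein_cokernel_def using X GP by blast
  ultimately show ?thesis by (rule that)
qed

text \<open>The given triple may live on any types while the new one lies in the coinductive class;
  the same statement thus serves the coinduction itself and the final passage to arbitrary
  types.\<close>

lemma cokernel_steps:
  fixes X :: "('a, 'x, 'd) module_scheme" and Y :: "('b, 'y, 'e) module_scheme" and C :: "('a, 'z, 'f) module_scheme"
  assumes X: "triple X Y \<phi>" and GP: "Gorenstein_projective \<Lambda> (tri X Y \<phi>)" and C: "short_exact A (T Y) \<phi> X p C"
  shows "\<exists>c (D :: ('a, (nat \<Rightarrow> 'a \<times> 'm \<times> 'b) set) module) d C'. proper_step A C c D d C' \<and> Gorenstein_cokernel C'" (is ?right)
    and "\<exists>C' c (D :: ('a, (nat \<Rightarrow> 'a \<times> 'm \<times> 'b) set) module) d. proper_step A C' c D d C \<and> Gorenstein_cokernel C'" (is ?left)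
proof -
  obtain F G \<psi> \<phi>' and U :: "('a, nat \<Rightarrow> 'a \<times> 'm \<times> 'b) module" and V :: "('b, nat \<Rightarrow> 'a \<times> 'm \<times> 'b) module"
    and X' :: "('a, nat \<Rightarrow> 'a \<times> 'm \<times> 'b) module" and Y' :: "('b, nat \<Rightarrow> 'a \<times> 'm \<times> 'b) module"
    where U: "triple U V \<psi>" and X': "triple X' Y' \<phi>'" "Gorenstein_projective \<Lambda> (tri X' Y' \<phi>')"
      and step: "proper_step \<Lambda> (tri X Y \<phi>) F (tri U V \<psi>) G (tri X' Y' \<phi>')"
    by (rule Gorenstein_tri_steps[OF X GP])
  obtain q where D: "short_exact A (T V) \<psi> U q (cokernel_module (T V) U \<psi>)"
    by (rule cokernel_short_exact[OF U projective_tri_inj[OF proper_stepD(2)[OF step] U]])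
  obtain p' and C' :: "('a, nat \<Rightarrow> 'a) module" where C': "short_exact A (T Y') \<phi>' X' p' C'" "Gorenstein_cokernel C'"
    by (rule Gorenstein_cokernel_exists[OF X'])
  obtain c d where "proper_step A C c (cokernel_module (T V) U \<psi>) d C'"
    by (rule proper_step_tri_cokernel[OF X U X'(1) step C D C'(1)])
  then show ?right using C'(2) by blast
next
  obtain F G \<psi> \<phi>' and U :: "('a, nat \<Rightarrow> 'a \<times> 'm \<times> 'b) module" and V :: "('b, nat \<Rightarrow> 'a \<times> 'm \<times> 'b) module"
    and X' :: "('a, nat \<Rightarrow> 'a \<times> 'm \<times> 'b) module" and Y' :: "('b, nat \<Rightarrow> 'a \<times> 'm \<times> 'b) module"
    where U: "triple U V \<psi>" and X': "triple X' Y' \<phi>'" "Gorenstein_projective \<Lambda> (tri X' Y' \<phi>')"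
      and step: "proper_step \<Lambda> (tri X' Y' \<phi>') F (tri U V \<psi>) G (tri X Y \<phi>)"
    by (rule Gorenstein_tri_steps_left[OF X GP])
  obtain q where D: "short_exact A (T V) \<psi> U q (cokernel_module (T V) U \<psi>)"
    by (rule cokernel_short_exact[OF U projective_tri_inj[OF proper_stepD(2)[OF step] U]])
  obtain p' and C' :: "('a, nat \<Rightarrow> 'a) module" where C': "short_exact A (T Y') \<phi>' X' p' C'" "Gorenstein_cokernel C'"
    by (rule Gorenstein_cokernel_exists[OF X'])
  obtain c d where "proper_step A C' c (cokernel_module (T V) U \<psi>) d C"
    by (rule proper_step_tri_cokernel[OF X'(1) U X step C'(1) D C])
  then show ?left using C'(2) by blast
qed

lemma Gorenstein_cokernel: "Gorenstein_cokernel C \<Longrightarrow> Gorenstein_projective A C"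
proof (rule Gorenstein_projective_coinduct[where \<C> = Gorenstein_cokernel])
  fix C :: "('a, nat \<Rightarrow> 'a) module" assume "Gorenstein_cokernel C"
  then obtain X :: "('a, nat \<Rightarrow> 'a \<times> 'm \<times> 'b) module" and Y :: "('b, nat \<Rightarrow> 'a \<times> 'm \<times> 'b) module" and \<phi> p
    where *: "triple X Y \<phi>" "Gorenstein_projective \<Lambda> (tri X Y \<phi>)" "short_exact A (T Y) \<phi> X p C"
    unfolding Gorenstein_cokernel_def by blast
  show "\<exists>c (D :: ('a, (nat \<Rightarrow> 'a \<times> 'm \<times> 'b) set) module) d C'. proper_step A C c D d C' \<and> Gorenstein_cokernel C'"
    by (rule cokernel_steps(1)[OF *])
  show "\<exists>C' c (D :: ('a, (nat \<Rightarrow> 'a \<times> 'm \<times> 'b) set) module) d. proper_step A C' c D d C \<and> Gorenstein_cokernel C'"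
    by (rule cokernel_steps(2)[OF *])
qed

theorem Gorenstein_tri_cokernel:
  assumes X: "triple X Y \<phi>" and GP: "Gorenstein_projective \<Lambda> (tri X Y \<phi>)" and C: "short_exact A (T Y) \<phi> X p C"
  shows "Gorenstein_projective A C"
proof -
  obtain c and D :: "('a, (nat \<Rightarrow> 'a \<times> 'm \<times> 'b) set) module" and d C'
    where right: "proper_step A C c D d C'" "Gorenstein_cokernel C'" using cokernel_steps(1)[OF assms] by blast
  obtain C'' c' and D' :: "('a, (nat \<Rightarrow> 'a \<times> 'm \<times> 'b) set) module" and d'
    where left: "proper_step A C'' c' D' d' C" "Gorenstein_cokernel C''" using cokernel_steps(2)[OF assms] by blast
  show ?thesis
    by (rule Gorenstein_projective_stepI[OF right(1) Gorenstein_cokernel[OF right(2)] left(1) Gorenstein_cokernel[OF left(2)]])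
qed

definition Gorenstein_base :: "('b, nat \<Rightarrow> 'a \<times> 'm \<times> 'b) module \<Rightarrow> bool"
  where "Gorenstein_base Y \<longleftrightarrow>
    (\<exists>(X :: ('a, nat \<Rightarrow> 'a \<times> 'm \<times> 'b) module) \<phi>. triple X Y \<phi> \<and> Gorenstein_projective \<Lambda> (tri X Y \<phi>))"

lemma base_steps:
  fixes X :: "('a, 'x, 'd) module_scheme" and Y :: "('b, 'y, 'e) module_scheme"
  assumes X: "triple X Y \<phi>" and GP: "Gorenstein_projective \<Lambda> (tri X Y \<phi>)"
  shows "\<exists>f (V :: ('b, nat \<Rightarrow> 'a \<times> 'm \<times> 'b) module) g Y'. proper_step B Y f V g Y' \<and> Gorenstein_base Y'" (is ?right)
    and "\<exists>Y' f (V :: ('b, nat \<Rightarrow> 'a \<times> 'm \<times> 'b) module) g. proper_step B Y' f V g Y \<and> Gorenstein_base Y'" (is ?left)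
proof -
  obtain F G \<psi> \<phi>' and U :: "('a, nat \<Rightarrow> 'a \<times> 'm \<times> 'b) module" and V :: "('b, nat \<Rightarrow> 'a \<times> 'm \<times> 'b) module"
    and X' :: "('a, nat \<Rightarrow> 'a \<times> 'm \<times> 'b) module" and Y' :: "('b, nat \<Rightarrow> 'a \<times> 'm \<times> 'b) module"
    where U: "triple U V \<psi>" and X': "triple X' Y' \<phi>'" "Gorenstein_projective \<Lambda> (tri X' Y' \<phi>')"
      and step: "proper_step \<Lambda> (tri X Y \<phi>) F (tri U V \<psi>) G (tri X' Y' \<phi>')"
    by (rule Gorenstein_tri_steps[OF X GP])
  obtain p where C: "short_exact A (T Y) \<phi> X p (cokernel_module (T Y) X \<phi>)"
    by (rule cokernel_short_exact[OF X Gorenstein_tri_inj[OF X GP]])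
  obtain f g where "proper_step B Y f V g Y'"
    by (rule proper_step_tri_base[OF X U X'(1) step C Gorenstein_tri_cokernel[OF X GP C]])
  then show ?right using X' unfolding Gorenstein_base_def by blast
next
  obtain F G \<psi> \<phi>' and U :: "('a, nat \<Rightarrow> 'a \<times> 'm \<times> 'b) module" and V :: "('b, nat \<Rightarrow> 'a \<times> 'm \<times> 'b) module"
    and X' :: "('a, nat \<Rightarrow> 'a \<times> 'm \<times> 'b) module" and Y' :: "('b, nat \<Rightarrow> 'a \<times> 'm \<times> 'b) module"
    where U: "triple U V \<psi>" and X': "triple X' Y' \<phi>'" "Gorenstein_projective \<Lambda> (tri X' Y' \<phi>')"
      and step: "proper_step \<Lambda> (tri X' Y' \<phi>') F (tri U V \<psi>) G (tri X Y \<phi>)"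
    by (rule Gorenstein_tri_steps_left[OF X GP])
  obtain p where C: "short_exact A (T Y') \<phi>' X' p (cokernel_module (T Y') X' \<phi>')"
    by (rule cokernel_short_exact[OF X'(1) Gorenstein_tri_inj[OF X']])
  obtain f g where "proper_step B Y' f V g Y"
    by (rule proper_step_tri_base[OF X'(1) U X step C Gorenstein_tri_cokernel[OF X' C]])
  then show ?left using X' unfolding Gorenstein_base_def by blast
qed

lemma Gorenstein_base: "Gorenstein_base Y \<Longrightarrow> Gorenstein_projective B Y"
proof (rule Gorenstein_projective_coinduct[where \<C> = Gorenstein_base])
  fix Y :: "('b, nat \<Rightarrow> 'a \<times> 'm \<times> 'b) module" assume "Gorenstein_base Y"
  then obtain X :: "('a, nat \<Rightarrow> 'a \<times> 'm \<times> 'b) module" and \<phi>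
    where *: "triple X Y \<phi>" "Gorenstein_projective \<Lambda> (tri X Y \<phi>)"
    unfolding Gorenstein_base_def by blast
  show "\<exists>f (V :: ('b, nat \<Rightarrow> 'a \<times> 'm \<times> 'b) module) g Y'. proper_step B Y f V g Y' \<and> Gorenstein_base Y'"
    by (rule base_steps(1)[OF *])
  show "\<exists>Y' f (V :: ('b, nat \<Rightarrow> 'a \<times> 'm \<times> 'b) module) g. proper_step B Y' f V g Y \<and> Gorenstein_base Y'"
    by (rule base_steps(2)[OF *])
qed

theorem Gorenstein_tri_base:
  assumes X: "triple X Y \<phi>" and GP: "Gorenstein_projective \<Lambda> (tri X Y \<phi>)"
  shows "Gorenstein_projective B Y"
proof -
  obtain f and V :: "('b, nat \<Rightarrow> 'a \<times> 'm \<times> 'b) module" and g Y'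
    where right: "proper_step B Y f V g Y'" "Gorenstein_base Y'" using base_steps(1)[OF assms] by blast
  obtain Y'' f' and V' :: "('b, nat \<Rightarrow> 'a \<times> 'm \<times> 'b) module" and g'
    where left: "proper_step B Y'' f' V' g' Y" "Gorenstein_base Y''" using base_steps(2)[OF assms] by blast
  show ?thesis
    by (rule Gorenstein_projective_stepI[OF right(1) Gorenstein_base[OF right(2)] left(1) Gorenstein_base[OF left(2)]])
qed

end

section \<open>From cokernel and base back to the triple\<close>

lemma extends_along_iso_target:
  assumes "extends_along R K f X Z" "left_module R W" "e \<in> module_hom R W Z" "bij_betw e (carrier W) (carrier Z)"
    and f: "f \<in> module_hom R K X"
  shows "extends_along R K f X W"
proof (rule extends_alongI)
  fix h assume h: "h \<in> module_hom R K W"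
  obtain k where k: "k \<in> module_hom R X Z" "\<And>x. x \<in> carrier K \<Longrightarrow> k (f x) = e (h x)"
    using extends_alongE[OF assms(1) module_hom_comp[OF h assms(3)]] by metis
  show "\<exists>k \<in> module_hom R X W. \<forall>x \<in> carrier K. k (f x) = h x"
    by (rule bexI[OF _ module_hom_comp[OF k(1) module_hom_inv[OF assms(2-4)]]])
      (simp add: k(2) bij_betw_inv_into_left[OF assms(4)] module_homD(1)[OF h])
qed

lemma extends_along_sum_target:
  assumes "extends_along R K f X Z" "extends_along R K f X W"
  shows "extends_along R K f X (module_sum Z W)"
proof (rule extends_alongI)
  fix h assume h: "h \<in> module_hom R K (module_sum Z W)"
  obtain k where k: "k \<in> module_hom R X Z" "\<And>x. x \<in> carrier K \<Longrightarrow> k (f x) = fst (h x)"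
    using extends_alongE[OF assms(1) module_hom_comp[OF h module_hom_fst]] by metis
  obtain l where l: "l \<in> module_hom R X W" "\<And>x. x \<in> carrier K \<Longrightarrow> l (f x) = snd (h x)"
    using extends_alongE[OF assms(2) module_hom_comp[OF h module_hom_snd]] by metis
  show "\<exists>k \<in> module_hom R X (module_sum Z W). \<forall>x \<in> carrier K. k (f x) = h x"
    by (rule bexI[OF _ module_hom_pair[OF k(1) l(1)]]) (simp add: k(2) l(2))
qed

context triangular_projective
begin

lemma extends_along_left:
  assumes "extends_along A K f X (regular_module A)" "left_module A K" "left_module A X" "f \<in> module_hom A K X"
  shows "extends_along A K f X M"
  by (rule projective_dual_basis[OF projective_left finitely_generated_left])
    (rule extends_along_dual_basis[OF assms(1-3) left.left_module_axioms assms(4)])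

text \<open>A \<Lambda>-valued map has components h1 into A \<oplus> M and h2 into B. An extension
  k2 of h2 to Q determines the upper component on M \<otimes> Q, namely m \<otimes> q to (0, m
  k2(q)). What is left of h1 descends to C and extends to P, since maps from C into A and into M
  extend along j.\<close>

lemma tri_extends:
  assumes X: "triple X Y \<phi>" and C: "short_exact A (T Y) \<phi> X p C"
    and P: "short_exact A C j P q C'" "extends_along A C j P (regular_module A)"
    and Q: "short_exact B Y f' Q g Y'" "extends_along B Y f' Q (regular_module B)"
    and u: "u \<in> module_hom A X (module_sum (T Q) P)"
    and c: "\<And>m y. \<lbrakk>m \<in> carrier M; y \<in> carrier Y\<rbrakk> \<Longrightarrow> u (\<phi> (te Y m y)) = (te Q m (f' y), \<zero>\<^bsub>P\<^esub>)"
    and snd_u: "\<And>x. x \<in> carrier X \<Longrightarrow> snd (u x) = j (p x)"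
  shows "extends_along \<Lambda> (tri X Y \<phi>) (map_prod u f') (tri (module_sum (T Q) P) Q (\<lambda>t. (t, \<zero>\<^bsub>P\<^esub>))) (regular_module \<Lambda>)"
    (is "extends_along _ _ _ ?W _")
proof -
  let ?R = "module_sum (regular_module A) M"
  let ?E = "module_sum (T Q) P"
  note x = tripleD[OF X] and sC = short_exactD[OF C] and sP = short_exactD[OF P(1)] and sQ = short_exactD[OF Q(1)]
  have W: "triple ?E Q (\<lambda>t. (t, \<zero>\<^bsub>P\<^esub>))" by (rule triple_free[OF sP(2) sQ(2)])
  have TQ: "left_module A (T Q)" by (rule left_module_tensor_module[OF sQ(2)])
  interpret P: left_module A P by (rule sP)
  interpret Q: tensor A B M Q by (intro tensor.intro bimodule_axioms sQ)
  interpret TQ: left_module A "T Q" by (rule TQ)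
  have F: "map_prod u f' \<in> module_hom \<Lambda> (tri X Y \<phi>) ?W" by (rule tri_homI[OF X W u sQ(4) c])
  obtain \<mu> e where \<mu>: "triple ?R (regular_module B) \<mu>"
    "\<And>m b. \<lbrakk>m \<in> carrier M; b \<in> carrier B\<rbrakk> \<Longrightarrow> \<mu> (te (regular_module B) m b) = (\<zero>\<^bsub>A\<^esub>, rsmult M m b)"
    and e: "e \<in> module_hom \<Lambda> (regular_module \<Lambda>) (tri ?R (regular_module B) \<mu>)"
      "bij_betw e (carrier (regular_module \<Lambda>)) (carrier (tri ?R (regular_module B) \<mu>))"
    by (rule regular_decomposition) blast
  have LR: "left_module A ?R" by (rule tripleD[OF \<mu>(1)])
  interpret R: left_module A ?R by (rule LR)
  have "extends_along \<Lambda> (tri X Y \<phi>) (map_prod u f') ?W (tri ?R (regular_module B) \<mu>)"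
  proof (rule extends_alongI)
    fix h assume h: "h \<in> module_hom \<Lambda> (tri X Y \<phi>) (tri ?R (regular_module B) \<mu>)"
    obtain h1 h2 where h12: "h1 \<in> module_hom A X ?R" "h2 \<in> module_hom B Y (regular_module B)"
      "\<And>m y. \<lbrakk>m \<in> carrier M; y \<in> carrier Y\<rbrakk> \<Longrightarrow> h1 (\<phi> (te Y m y)) = \<mu> (te (regular_module B) m (h2 y))"
      "\<And>x y. \<lbrakk>x \<in> carrier X; y \<in> carrier Y\<rbrakk> \<Longrightarrow> h (x, y) = (h1 x, h2 y)"
      by (rule tri_homE[OF X \<mu>(1) h]) blast
    have h2c: "h2 y \<in> carrier B" if "y \<in> carrier Y" for y using module_homD(1)[OF h12(2) that] by simp
    obtain k2 where k2: "k2 \<in> module_hom B Q (regular_module B)" "\<And>y. y \<in> carrier Y \<Longrightarrow> k2 (f' y) = h2 y"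
      using extends_alongE[OF Q(2) h12(2)] by metis
    note k2' = module_homD[OF k2(1), simplified]
    obtain \<kappa> where \<kappa>: "\<kappa> \<in> module_hom A (T Q) ?R"
      "\<And>m y. \<lbrakk>m \<in> carrier M; y \<in> carrier Q\<rbrakk> \<Longrightarrow> \<kappa> (te Q m y) = (\<zero>\<^bsub>A\<^esub>, rsmult M m (k2 y))"
    proof (rule Q.tensor_lift[OF LR, of "\<lambda>m y. (\<zero>\<^bsub>A\<^esub>, rsmult M m (k2 y))"])
    qed (auto simp: k2' rsmult_distr rsmult_distr_ring rsmult_assoc smult_rsmult)
    have \<kappa>u: "(\<lambda>x. \<kappa> (fst (u x))) \<in> module_hom A X ?R"
      by (rule module_hom_comp[OF module_hom_comp[OF u module_hom_fst] \<kappa>(1)])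
    have h\<phi>: "h1 (\<phi> t) = \<kappa> (fst (u (\<phi> t)))" if t: "t \<in> carrier (T Y)" for t
      by (rule tensor_hom_cong[OF x(2) LR module_hom_comp[OF x(3) h12(1)] module_hom_comp[OF x(3) \<kappa>u] _ t])
        (simp add: h12(3) \<mu>(2) h2c c \<kappa>(2) k2(2) module_homD(1)[OF sQ(4)])
    \<comment> \<open>On the image of \<phi> the map h1 already agrees with the part determined by
      k2, so the difference is a map on the cokernel.\<close>
    obtain d where d: "d \<in> module_hom A C ?R" "\<And>y. y \<in> carrier X \<Longrightarrow> d (p y) = h1 y \<ominus>\<^bsub>?R\<^esub> \<kappa> (fst (u y))"
    proof (rule factor_surj[OF x(1) sC(3) LR sC(5,7) module_hom_diff[OF x(1) LR h12(1) \<kappa>u]])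
      fix y assume "y \<in> carrier X" "p y = \<zero>\<^bsub>C\<^esub>"
      then obtain t where t: "t \<in> carrier (T Y)" "y = \<phi> t" by (rule short_exact_kernelE[OF C])
      have "h1 (\<phi> t) \<in> carrier ?R" by (rule module_homD(1)[OF h12(1) module_homD(1)[OF x(3) t(1)]])
      then show "h1 y \<ominus>\<^bsub>?R\<^esub> \<kappa> (fst (u y)) = \<zero>\<^bsub>?R\<^esub>"
        unfolding t(2) h\<phi>[OF t(1), symmetric] by (simp add: R.M.minus_eq_zero_iff del: module_sum_simps)
    qed blast
    have extR: "extends_along A C j P ?R"
      by (rule extends_along_sum_target[OF P(2) extends_along_left[OF P(2) sP(1,2,4)]])
    obtain k where k: "k \<in> module_hom A P ?R" "\<And>y. y \<in> carrier C \<Longrightarrow> k (j y) = d y"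
      using extends_alongE[OF extR d(1)] by metis
    let ?k1 = "\<lambda>z. \<kappa> (fst z) \<oplus>\<^bsub>?R\<^esub> k (snd z)"
    have k1: "?k1 \<in> module_hom A ?E ?R" by (rule module_hom_copair[OF TQ sP(2) LR \<kappa>(1) k(1)])
    have k1u: "?k1 (u y) = h1 y" if y: "y \<in> carrier X" for y
    proof -
      have "k (snd (u y)) = h1 y \<ominus>\<^bsub>?R\<^esub> \<kappa> (fst (u y))"
        by (simp only: snd_u[OF y] k(2)[OF module_homD(1)[OF sC(5) y]] d(2)[OF y])
      then show ?thesis
        using module_homD(1)[OF h12(1) y] module_homD(1)[OF \<kappa>u y]
        by (simp only: a_minus_def R.M.a_lcomm R.M.a_inv_closed R.M.r_neg R.M.r_zero)
    qed
    have "k \<zero>\<^bsub>P\<^esub> = \<zero>\<^bsub>?R\<^esub>" by (rule module_hom_zero[OF sP(2) LR k(1)])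
    then have ck: "?k1 (te Q m y, \<zero>\<^bsub>P\<^esub>) = \<mu> (te (regular_module B) m (k2 y))"
      if "m \<in> carrier M" "y \<in> carrier Q" for m y
      using that by (simp add: \<kappa>(2) \<mu>(2) k2')
    show "\<exists>k \<in> module_hom \<Lambda> ?W (tri ?R (regular_module B) \<mu>). \<forall>x \<in> carrier (tri X Y \<phi>). k (map_prod u f' x) = h x"
    proof (rule bexI[OF _ tri_homI[OF W \<mu>(1) k1 k2(1) ck]], rule ballI)
      fix w assume "w \<in> carrier (tri X Y \<phi>)"
      then obtain y z where w: "w = (y, z)" "y \<in> carrier X" "z \<in> carrier Y" by auto
      show "map_prod ?k1 k2 (map_prod u f' w) = h w"
        by (simp only: w map_prod_simp k1u k2(2) h12(4))
    qed
  qed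
  then show ?thesis
    by (rule extends_along_iso_target[OF _ left_module_regular[OF ring_triangular] e F])
qed

lemma proper_step_tri_right:
  fixes X :: "('a, 'x, 'd) module_scheme" and Y :: "('b, 'y, 'e) module_scheme" and C :: "('a, 'z, 'f) module_scheme"
    and P :: "('a, nat \<Rightarrow> 'a) module" and Q :: "('b, nat \<Rightarrow> 'b) module"
    and C' :: "('a, nat \<Rightarrow> 'a) module" and Y' :: "('b, nat \<Rightarrow> 'b) module"
  assumes X: "triple X Y \<phi>" and C: "short_exact A (T Y) \<phi> X p C" and GC: "Gorenstein_projective A C"
    and P: "proper_step A C j P q C'" and Q: "proper_step B Y f' Q g' Y'"
  obtains F G \<phi>' p' and X' :: "('a, nat \<Rightarrow> 'a) module"
  where "triple X' Y' \<phi>'" "short_exact A (T Y') \<phi>' X' p' C'"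
    "proper_step \<Lambda> (tri X Y \<phi>) F (tri (module_sum (T Q) P) Q (\<lambda>t. (t, \<zero>\<^bsub>P\<^esub>))) G (tri X' Y' \<phi>')"
proof -
  note pP = proper_stepD[OF P] and pQ = proper_stepD[OF Q]
  note x = tripleD[OF X] and sC = short_exactD[OF C] and sP = short_exactD[OF pP(1)] and sQ = short_exactD[OF pQ(1)]
  let ?W = "tri (module_sum (T Q) P) Q (\<lambda>t. (t, \<zero>\<^bsub>P\<^esub>))"
  have W: "triple (module_sum (T Q) P) Q (\<lambda>t. (t, \<zero>\<^bsub>P\<^esub>))" by (rule triple_free[OF sP(2) sQ(2)])
  have TQ: "left_module A (T Q)" by (rule left_module_tensor_module[OF sQ(2)])
  note tf = tensor_map[OF sQ(1,2,4)] and tg = tensor_map[OF sQ(2,3,5)]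
  obtain n b \<eta> where db: "dual_basis B Q n b \<eta>" by (rule projective_dual_basis[OF pQ(2,3)])
  have "extends_along A (T Y) \<phi> X (T Q)"
    by (rule extends_along_tensor[OF extends_along_left[OF Gorenstein_projective_extends[OF C GC] sC(1,2,4)] sC(1,2,4) sQ(2) db])
  then obtain \<alpha> where a: "\<alpha> \<in> module_hom A X (T Q)"
    "\<And>t. t \<in> carrier (T Y) \<Longrightarrow> \<alpha> (\<phi> t) = tensor_map B M Y Q f' t"
    by (rule extends_alongE[OF _ tf(1)]) blast
  let ?u = "\<lambda>x. (\<alpha> x, j (p x))"
  let ?X' = "cokernel_module X (module_sum (T Q) P) ?u"
  obtain v \<phi>0 p0 where h: "short_exact A X ?u (module_sum (T Q) P) v ?X'" "short_exact A (T Y') \<phi>0 ?X' p0 C'"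
    "\<And>t. t \<in> carrier (T Q) \<Longrightarrow> \<phi>0 (tensor_map B M Q Y' g' t) = v (t, \<zero>\<^bsub>P\<^esub>)"
    by (rule horseshoe_right[OF C tensor_exact[OF pQ(1)] pP(1) a]) blast+
  note s = short_exactD[OF h(1)] and s0 = short_exactD[OF h(2)]
  have fgY': "finitely_generated B Y'" and fgC': "finitely_generated A C'"
    by (rule finitely_generated_step_target[OF Q], rule finitely_generated_step_target[OF P])
  \<comment> \<open>Copying the cokernel to \<open>nat \<Rightarrow> 'a\<close> requires finite
    generation. It is an extension of C' by M \<otimes> Y', and the latter is finitely generated
    because M is so over A.\<close>
  have "finitely_generated A ?X'"
    by (rule finitely_generated_extension[OF h(2) finitely_generated_tensor[OF sQ(3) fgY' finitely_generated_left] fgC'])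
  then obtain X' :: "('a, nat \<Rightarrow> 'a) module" and e where X': "left_module A X'" "e \<in> module_hom A ?X' X'"
    "bij_betw e (carrier ?X') (carrier X')"
    by (rule finitely_generated_nat_model[OF s(3)])
  note E1 = short_exact_iso_right[OF h(1) X'] and E2 = short_exact_iso_middle[OF h(2) X']
  have tr': "triple X' Y' (\<lambda>t. e (\<phi>0 t))" using short_exactD(4)[OF E2] X'(1) sQ(3) by (simp add: triple_def)
  have cu: "?u (\<phi> (te Y m y)) = (te Q m (f' y), \<zero>\<^bsub>P\<^esub>)" if "m \<in> carrier M" "y \<in> carrier Y" for m y
    using that te_closed[OF x(2) that] by (simp add: a(2) tf(2) sC(8) module_hom_zero[OF sP(1,2,4)])
  have cv: "e (v (te Q m y, \<zero>\<^bsub>P\<^esub>)) = e (\<phi>0 (te Y' m (g' y)))" if "m \<in> carrier M" "y \<in> carrier Q" for m y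
    using h(3)[OF te_closed[OF sQ(2) that]] that by (simp add: tg(2))
  have "proper_step \<Lambda> (tri X Y \<phi>) (map_prod ?u f') ?W (map_prod (\<lambda>x. e (v x)) g') (tri X' Y' (\<lambda>t. e (\<phi>0 t)))"
    unfolding proper_step_def
    by (intro conjI tri_short_exactI[OF X W tr' E1 pQ(1) cu cv] projective_tri_free[OF pP(2) pQ(2)]
        finitely_generated_tri_free[OF sP(2) pP(3) sQ(2) pQ(3)]
        tri_extends[OF X C pP(1,4) pQ(1,4) s(4) cu]) simp_all
  from that[OF tr' E2 this] show ?thesis .
qed

lemma proper_step_tri_left:
  fixes X :: "('a, 'x, 'd) module_scheme" and Y :: "('b, 'y, 'e) module_scheme" and C :: "('a, 'z, 'f) module_scheme"
    and P :: "('a, nat \<Rightarrow> 'a) module" and Q :: "('b, nat \<Rightarrow> 'b) module"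
    and C' :: "('a, nat \<Rightarrow> 'a) module" and Y' :: "('b, nat \<Rightarrow> 'b) module"
  assumes X: "triple X Y \<phi>" and C: "short_exact A (T Y) \<phi> X p C"
    and P: "proper_step A C' j P q C" and Q: "proper_step B Y' f' Q g' Y"
    and fg: "finitely_generated A C'" "finitely_generated B Y'"
  obtains F G \<phi>' p' and X' :: "('a, nat \<Rightarrow> 'a) module"
  where "triple X' Y' \<phi>'" "short_exact A (T Y') \<phi>' X' p' C'"
    "proper_step \<Lambda> (tri X' Y' \<phi>') F (tri (module_sum (T Q) P) Q (\<lambda>t. (t, \<zero>\<^bsub>P\<^esub>))) G (tri X Y \<phi>)"
proof -
  note pP = proper_stepD[OF P] and pQ = proper_stepD[OF Q]
  note x = tripleD[OF X] and sC = short_exactD[OF C] and sP = short_exactD[OF pP(1)] and sQ = short_exactD[OF pQ(1)]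
  let ?W = "tri (module_sum (T Q) P) Q (\<lambda>t. (t, \<zero>\<^bsub>P\<^esub>))"
  have W: "triple (module_sum (T Q) P) Q (\<lambda>t. (t, \<zero>\<^bsub>P\<^esub>))" by (rule triple_free[OF sP(2) sQ(2)])
  have TQ: "left_module A (T Q)" by (rule left_module_tensor_module[OF sQ(2)])
  interpret X: left_module A X by (rule x)
  note tf = tensor_map[OF sQ(1,2,4)] and tg = tensor_map[OF sQ(2,3,5)]
  obtain \<beta> \<phi>0 p0 and X0 :: "('a, ((('m \<times> (nat \<Rightarrow> 'b)) \<Rightarrow>\<^sub>0 int) set) \<times> (nat \<Rightarrow> 'a)) module"
    where b: "\<beta> \<in> module_hom A P X" "\<And>b. b \<in> carrier P \<Longrightarrow> p (\<beta> b) = q b"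
    and h: "short_exact A X0 (\<lambda>z. z) (module_sum (T Q) P)
        (\<lambda>z. \<phi> (tensor_map B M Q Y g' (fst z)) \<oplus>\<^bsub>X\<^esub> \<beta> (snd z)) X"
      "short_exact A (T Y') \<phi>0 X0 p0 C'"
      "\<And>t. t \<in> carrier (T Y') \<Longrightarrow> \<phi>0 t = (tensor_map B M Y' Q f' t, \<zero>\<^bsub>P\<^esub>)"
      "\<And>z. z \<in> carrier X0 \<Longrightarrow> j (p0 z) = snd z"
    by (rule horseshoe_left[OF C tensor_exact[OF pQ(1)] pP(1,2)]) blast
  note s = short_exactD[OF h(1)] and s0 = short_exactD[OF h(2)]
  have "finitely_generated A X0"
    by (rule finitely_generated_extension[OF h(2) finitely_generated_tensor[OF sQ(1) fg(2) finitely_generated_left] fg(1)])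
  then obtain X' :: "('a, nat \<Rightarrow> 'a) module" and e where X': "left_module A X'" "e \<in> module_hom A X0 X'"
    "bij_betw e (carrier X0) (carrier X')"
    by (rule finitely_generated_nat_model[OF s(1)])
  \<comment> \<open>X0 sits inside M \<otimes> Q \<oplus> P by the identity; for its copy X' the
    embedding is the inverse of the isomorphism e.\<close>
  let ?i = "inv_into (carrier X0) e"
  have ie: "?i (e z) = z" if "z \<in> carrier X0" for z by (rule bij_betw_inv_into_left[OF X'(3) that])
  have i: "?i \<in> module_hom A X' X0" by (rule module_hom_inv[OF s(1) X'(2,3)])
  note E1 = short_exact_iso_left[OF h(1) X'(1) i bij_betw_inv_into[OF X'(3)]] and E2 = short_exact_iso_middle[OF h(2) X']
  have tr': "triple X' Y' (\<lambda>t. e (\<phi>0 t))" using short_exactD(4)[OF E2] X'(1) sQ(1) by (simp add: triple_def)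
  have cu: "?i (e (\<phi>0 (te Y' m y))) = (te Q m (f' y), \<zero>\<^bsub>P\<^esub>)" if "m \<in> carrier M" "y \<in> carrier Y'" for m y
    using te_closed[OF sQ(1) that] that by (simp add: ie module_homD(1)[OF s0(4)]) (simp add: h(3) tf(2))
  have cv: "\<phi> (tensor_map B M Q Y g' (fst (te Q m y, \<zero>\<^bsub>P\<^esub>))) \<oplus>\<^bsub>X\<^esub> \<beta> (snd (te Q m y, \<zero>\<^bsub>P\<^esub>)) = \<phi> (te Y m (g' y))"
    if "m \<in> carrier M" "y \<in> carrier Q" for m y
    using that module_homD(1)[OF sQ(5) that(2)]
    by (simp add: tg(2) module_hom_zero[OF sP(2) x(1) b(1)] triple_simps[OF X])
  have E: "short_exact \<Lambda> (tri X' Y' (\<lambda>t. e (\<phi>0 t))) (map_prod ?i f') ?W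
      (map_prod (\<lambda>z. \<phi> (tensor_map B M Q Y g' (fst z)) \<oplus>\<^bsub>X\<^esub> \<beta> (snd z)) g') (tri X Y \<phi>)"
  proof (rule tri_short_exactI[OF tr' W X E1 pQ(1)])
  qed (fact cu cv)+
  have ext: "extends_along \<Lambda> (tri X' Y' (\<lambda>t. e (\<phi>0 t))) (map_prod ?i f') ?W (regular_module \<Lambda>)"
  proof (rule tri_extends[OF tr' E2 pP(1,4) pQ(1,4) short_exactD(4)[OF E1]])
    show "snd (?i x) = j (p0 (?i x))" if "x \<in> carrier X'" for x
      using h(4)[OF module_homD(1)[OF i that]] by simp
  qed (fact cu)
  have "proper_step \<Lambda> (tri X' Y' (\<lambda>t. e (\<phi>0 t))) (map_prod ?i f') ?W
      (map_prod (\<lambda>z. \<phi> (tensor_map B M Q Y g' (fst z)) \<oplus>\<^bsub>X\<^esub> \<beta> (snd z)) g') (tri X Y \<phi>)"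
    unfolding proper_step_def
    by (intro conjI E projective_tri_free[OF pP(2) pQ(2)]
        finitely_generated_tri_free[OF sP(2) pP(3) sQ(2) pQ(3)] ext)
  from that[OF tr' E2 this] show ?thesis .
qed

definition Gorenstein_triple :: "('a \<times> 'm \<times> 'b, (nat \<Rightarrow> 'a) \<times> (nat \<Rightarrow> 'b)) module \<Rightarrow> bool"
  where "Gorenstein_triple N \<longleftrightarrow>
    (\<exists>(X :: ('a, nat \<Rightarrow> 'a) module) (Y :: ('b, nat \<Rightarrow> 'b) module) \<phi> p (C :: ('a, nat \<Rightarrow> 'a) module).
      N = tri X Y \<phi> \<and> triple X Y \<phi> \<and> short_exact A (T Y) \<phi> X p C \<and>
      Gorenstein_projective A C \<and> Gorenstein_projective B Y)"

lemma triple_steps: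
  fixes X :: "('a, 'x, 'd) module_scheme" and Y :: "('b, 'y, 'e) module_scheme" and C :: "('a, 'z, 'f) module_scheme"
  assumes X: "triple X Y \<phi>" and C: "short_exact A (T Y) \<phi> X p C"
    and GC: "Gorenstein_projective A C" and GY: "Gorenstein_projective B Y"
  shows "\<exists>F (W :: ('a \<times> 'm \<times> 'b, (((('m \<times> (nat \<Rightarrow> 'b)) \<Rightarrow>\<^sub>0 int) set) \<times> (nat \<Rightarrow> 'a)) \<times> (nat \<Rightarrow> 'b)) module) G N.
      proper_step \<Lambda> (tri X Y \<phi>) F W G N \<and> Gorenstein_triple N" (is ?right)
    and "\<exists>N F (W :: ('a \<times> 'm \<times> 'b, (((('m \<times> (nat \<Rightarrow> 'b)) \<Rightarrow>\<^sub>0 int) set) \<times> (nat \<Rightarrow> 'a)) \<times> (nat \<Rightarrow> 'b)) module) G.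
      proper_step \<Lambda> N F W G (tri X Y \<phi>) \<and> Gorenstein_triple N" (is ?left)
proof -
  obtain j and P :: "('a, nat \<Rightarrow> 'a) module" and q and C' :: "('a, nat \<Rightarrow> 'a) module"
    where P: "proper_step A C j P q C'" "Gorenstein_projective A C'"
    using Gorenstein_projective_steps(1)[OF GC] by blast
  obtain f and Q :: "('b, nat \<Rightarrow> 'b) module" and g and Y' :: "('b, nat \<Rightarrow> 'b) module"
    where Q: "proper_step B Y f Q g Y'" "Gorenstein_projective B Y'"
    using Gorenstein_projective_steps(1)[OF GY] by blast
  obtain F G \<phi>' p' and X' :: "('a, nat \<Rightarrow> 'a) module"
    where X': "triple X' Y' \<phi>'" "short_exact A (T Y') \<phi>' X' p' C'"
      "proper_step \<Lambda> (tri X Y \<phi>) F (tri (module_sum (T Q) P) Q (\<lambda>t. (t, \<zero>\<^bsub>P\<^esub>))) G (tri X' Y' \<phi>')"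
    by (rule proper_step_tri_right[OF X C GC P(1) Q(1)])
  have "Gorenstein_triple (tri X' Y' \<phi>')" unfolding Gorenstein_triple_def using X'(1,2) P(2) Q(2) by blast
  then show ?right using X'(3) by blast
next
  obtain C' :: "('a, nat \<Rightarrow> 'a) module" and j and P :: "('a, nat \<Rightarrow> 'a) module" and q
    where P: "proper_step A C' j P q C" "Gorenstein_projective A C'"
    using Gorenstein_projective_steps(2)[OF GC] by blast
  obtain Y' :: "('b, nat \<Rightarrow> 'b) module" and f and Q :: "('b, nat \<Rightarrow> 'b) module" and g
    where Q: "proper_step B Y' f Q g Y" "Gorenstein_projective B Y'"
    using Gorenstein_projective_steps(2)[OF GY] by blast
  have fg: "finitely_generated A C'" "finitely_generated B Y'" using P(2) Q(2) by (simp_all add: Gorenstein_projective_def)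
  obtain F G \<phi>' p' and X' :: "('a, nat \<Rightarrow> 'a) module"
    where X': "triple X' Y' \<phi>'" "short_exact A (T Y') \<phi>' X' p' C'"
      "proper_step \<Lambda> (tri X' Y' \<phi>') F (tri (module_sum (T Q) P) Q (\<lambda>t. (t, \<zero>\<^bsub>P\<^esub>))) G (tri X Y \<phi>)"
    by (rule proper_step_tri_left[OF X C P(1) Q(1) fg])
  have "Gorenstein_triple (tri X' Y' \<phi>')" unfolding Gorenstein_triple_def using X'(1,2) P(2) Q(2) by blast
  then show ?left using X'(3) by blast
qed

lemma Gorenstein_triple: "Gorenstein_triple N \<Longrightarrow> Gorenstein_projective \<Lambda> N"
proof (rule Gorenstein_projective_coinduct[where \<C> = Gorenstein_triple])
  fix N assume "Gorenstein_triple N"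
  then obtain X :: "('a, nat \<Rightarrow> 'a) module" and Y :: "('b, nat \<Rightarrow> 'b) module" and \<phi> p and C :: "('a, nat \<Rightarrow> 'a) module"
    where N: "N = tri X Y \<phi>" and *: "triple X Y \<phi>" "short_exact A (T Y) \<phi> X p C"
      "Gorenstein_projective A C" "Gorenstein_projective B Y"
    unfolding Gorenstein_triple_def by blast
  show "\<exists>F (W :: ('a \<times> 'm \<times> 'b, (((('m \<times> (nat \<Rightarrow> 'b)) \<Rightarrow>\<^sub>0 int) set) \<times> (nat \<Rightarrow> 'a)) \<times> (nat \<Rightarrow> 'b)) module) G N'.
      proper_step \<Lambda> N F W G N' \<and> Gorenstein_triple N'"
    unfolding N by (rule triple_steps(1)[OF *])
  show "\<exists>N' F (W :: ('a \<times> 'm \<times> 'b, (((('m \<times> (nat \<Rightarrow> 'b)) \<Rightarrow>\<^sub>0 int) set) \<times> (nat \<Rightarrow> 'a)) \<times> (nat \<Rightarrow> 'b)) module) G.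
      proper_step \<Lambda> N' F W G N \<and> Gorenstein_triple N'"
    unfolding N by (rule triple_steps(2)[OF *])
qed

theorem Gorenstein_triI:
  assumes X: "triple X Y \<phi>" and C: "short_exact A (T Y) \<phi> X p C"
    and GC: "Gorenstein_projective A C" and GY: "Gorenstein_projective B Y"
  shows "Gorenstein_projective \<Lambda> (tri X Y \<phi>)"
proof -
  obtain F and W :: "('a \<times> 'm \<times> 'b, (((('m \<times> (nat \<Rightarrow> 'b)) \<Rightarrow>\<^sub>0 int) set) \<times> (nat \<Rightarrow> 'a)) \<times> (nat \<Rightarrow> 'b)) module" and G N
    where right: "proper_step \<Lambda> (tri X Y \<phi>) F W G N" "Gorenstein_triple N"
    using triple_steps(1)[OF assms] by blast
  obtain N' F' and W' :: "('a \<times> 'm \<times> 'b, (((('m \<times> (nat \<Rightarrow> 'b)) \<Rightarrow>\<^sub>0 int) set) \<times> (nat \<Rightarrow> 'a)) \<times> (nat \<Rightarrow> 'b)) module" and G'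
    where left: "proper_step \<Lambda> N' F' W' G' (tri X Y \<phi>)" "Gorenstein_triple N'"
    using triple_steps(2)[OF assms] by blast
  show ?thesis
    by (rule Gorenstein_projective_stepI[OF right(1) Gorenstein_triple[OF right(2)] left(1) Gorenstein_triple[OF left(2)]])
qed

end

text \<open>A central element of \<open>\<Lambda>\<close> is diagonal, so that the base ring acts on \<open>M\<close> through \<open>A\<close> as well as through \<open>B\<close>.\<close>

lemma (in triangular) artin_algebra_bimodule:
  assumes "artin_algebra \<Lambda>"
  shows "finitely_generated A M" "finitely_generated (op_ring B) (right_part M)"
proof -
  obtain K :: "('a \<times> 'm \<times> 'b) ring" and \<eta> where K: "artin_algebra_over K \<eta> \<Lambda>"
    using assms by (auto simp: artin_algebra_def)
  let ?L = "\<lparr>carrier = carrier \<Lambda>, mult = mult \<Lambda>, one = one \<Lambda>, ring.zero = ring.zero \<Lambda>, ring.add = ring.add \<Lambda>,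
    smult = (\<lambda>k r. \<eta> k \<otimes>\<^bsub>\<Lambda>\<^esub> r)\<rparr>"
  have rK: "ring K" and eta: "\<eta> \<in> ring_hom K \<Lambda>"
    and central: "\<And>k r. k \<in> carrier K \<Longrightarrow> r \<in> carrier \<Lambda> \<Longrightarrow> \<eta> k \<otimes>\<^bsub>\<Lambda>\<^esub> r = r \<otimes>\<^bsub>\<Lambda>\<^esub> \<eta> k"
    and fg: "finitely_generated K ?L"
    using K by (auto simp: artin_algebra_over_def artinian_cring_def cring_def)
  obtain S where S: "finite S" "S \<subseteq> carrier \<Lambda>" "\<And>H. submodule H K ?L \<Longrightarrow> S \<subseteq> H \<Longrightarrow> H = carrier \<Lambda>"
    using fg by (auto simp: finitely_generated_def)
  interpret L: ring \<Lambda> by (rule ring_triangular)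
  have ab: "abelian_group ?L"
    by (rule abelian_groupI) (auto simp del: triangular_ring_simps simp: L.a_ac intro!: bexI[of _ "\<ominus>\<^bsub>\<Lambda>\<^esub> x" for x] L.l_neg)
  have LK: "left_module K ?L"
    by (rule left_moduleI[OF rK ab])
      (use eta in \<open>auto simp del: triangular_ring_simps simp: ring_hom_def Pi_def L.l_distr L.r_distr L.m_assoc\<close>)
  \<comment> \<open>Commuting with (1, 0, 0) forces the off-diagonal entry to vanish; commuting with
    (0, x, 0) says that the diagonal entries act equally on x from the two sides.\<close>
  have diag: "\<exists>a b. \<eta> k = (a, \<zero>\<^bsub>M\<^esub>, b) \<and> a \<in> carrier A \<and> b \<in> carrier B \<and>
      (\<forall>x \<in> carrier M. a \<odot>\<^bsub>M\<^esub> x = rsmult M x b)" if k: "k \<in> carrier K" for k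
  proof -
    have "\<eta> k \<in> carrier \<Lambda>" using ring_hom_closed[OF eta k] .
    then obtain a m b where abm: "\<eta> k = (a, m, b)" "a \<in> carrier A" "m \<in> carrier M" "b \<in> carrier B" by auto
    have m: "m = \<zero>\<^bsub>M\<^esub>" using central[OF k, of "(\<one>\<^bsub>A\<^esub>, \<zero>\<^bsub>M\<^esub>, \<zero>\<^bsub>B\<^esub>)"] abm by simp
    have "a \<odot>\<^bsub>M\<^esub> x = rsmult M x b" if "x \<in> carrier M" for x
      using central[OF k, of "(\<zero>\<^bsub>A\<^esub>, x, \<zero>\<^bsub>B\<^esub>)"] abm that by simp
    then show ?thesis using abm m by blast
  qed
  let ?S = "(\<lambda>(a, x, b). x) ` S"
  \<comment> \<open>If H is closed under addition and under these diagonal scalars, then A \<times>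
    H \<times> B is a K-submodule of \<Lambda>. So the middle entries of K-generators of \<Lambda>
    generate M, as a left and as a right module alike.\<close>
  have gen: "H = carrier M"
    if H: "H \<subseteq> carrier M" "\<zero>\<^bsub>M\<^esub> \<in> H" "\<And>x y. x \<in> H \<Longrightarrow> y \<in> H \<Longrightarrow> x \<oplus>\<^bsub>M\<^esub> y \<in> H" "?S \<subseteq> H"
      and st: "\<And>a b x. \<lbrakk>a \<in> carrier A; b \<in> carrier B; \<forall>x \<in> carrier M. a \<odot>\<^bsub>M\<^esub> x = rsmult M x b; x \<in> H\<rbrakk> \<Longrightarrow> a \<odot>\<^bsub>M\<^esub> x \<in> H"
    for H
  proof -
    have "carrier A \<times> H \<times> carrier B = carrier \<Lambda>"
    proof (rule S(3))
      show "submodule (carrier A \<times> H \<times> carrier B) K ?L"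
      proof (rule left_module.left_submoduleI[OF LK])
        fix u v assume "u \<in> carrier A \<times> H \<times> carrier B" "v \<in> carrier A \<times> H \<times> carrier B"
        then show "u \<oplus>\<^bsub>?L\<^esub> v \<in> carrier A \<times> H \<times> carrier B" by (auto simp: H(3))
      next
        fix k u assume k: "k \<in> carrier K" and u: "u \<in> carrier A \<times> H \<times> carrier B"
        obtain a b where ab: "\<eta> k = (a, \<zero>\<^bsub>M\<^esub>, b)" "a \<in> carrier A" "b \<in> carrier B"
          "\<forall>x \<in> carrier M. a \<odot>\<^bsub>M\<^esub> x = rsmult M x b" using diag[OF k] by blast
        obtain c x d where cxd: "u = (c, x, d)" "c \<in> carrier A" "x \<in> H" "d \<in> carrier B" using u by auto
        then show "k \<odot>\<^bsub>?L\<^esub> u \<in> carrier A \<times> H \<times> carrier B" using ab st[OF ab(2-4) cxd(3)] H(1) by (auto simp: subset_iff)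
      qed (use H(1,2) in auto)
      show "S \<subseteq> carrier A \<times> H \<times> carrier B" using S(2) H(4) by force
    qed
    then show ?thesis by (auto simp: times_eq_iff)
  qed
  have S': "finite ?S" "?S \<subseteq> carrier M" using S(1,2) by auto
  show "finitely_generated A M"
    unfolding finitely_generated_def
  proof (intro exI[of _ ?S] conjI allI impI S')
    fix H assume H: "submodule H A M \<and> ?S \<subseteq> H"
    then interpret H: submodule H A M by blast
    show "H = carrier M"
      by (rule gen) (use H H.subset H.one_closed H.m_closed H.smult_closed in auto)
  qed
  show "finitely_generated (op_ring B) (right_part M)"
    unfolding finitely_generated_def
  proof (intro exI[of _ ?S] conjI allI impI)
    show "finite ?S" "?S \<subseteq> carrier (right_part M)" using S' by (simp_all add: right_part_def)
    fix H assume H: "submodule H (op_ring B) (right_part M) \<and> ?S \<subseteq> H"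
    then interpret H: submodule H "op_ring B" "right_part M" by blast
    have cl: "rsmult M x b \<in> H" if "x \<in> H" "b \<in> carrier B" for x b
      using H.smult_closed[of b x] that by (simp add: op_ring_def right_part_def)
    have HM: "H \<subseteq> carrier M" "\<zero>\<^bsub>M\<^esub> \<in> H" "\<And>x y. x \<in> H \<Longrightarrow> y \<in> H \<Longrightarrow> x \<oplus>\<^bsub>M\<^esub> y \<in> H"
      using H.subset H.one_closed H.m_closed by (simp_all add: right_part_def)
    have "H = carrier M"
    proof (rule gen)
      fix a b x assume "a \<in> carrier A" "b \<in> carrier B" "\<forall>x \<in> carrier M. a \<odot>\<^bsub>M\<^esub> x = rsmult M x b" "x \<in> H"
      then show "a \<odot>\<^bsub>M\<^esub> x \<in> H" using HM(1) cl by auto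
    qed (use HM H in auto)
    then show "H = carrier (right_part M)" by (simp add: right_part_def)
  qed
qed

theorem theorem3p1:
  fixes A :: "'a ring" and B :: "'b ring" and M :: "('a, 'b, 'm) bimodule"
    and X :: "('a, 'x) module" and Y :: "('b, 'y) module"
    and \<phi> :: "(('m \<times> 'y) \<Rightarrow>\<^sub>0 int) set \<Rightarrow> 'x"
  assumes "ring A" and "ring B" and "bimodule A B M"
    and "artin_algebra (triangular_ring A B M)"
    and "projective_module A M" and "projective_module (op_ring B) (right_part M)"
    and "left_module A X" and "left_module B Y"
    and "\<phi> \<in> module_hom A (tensor_module B M Y) X"
    and "finitely_generated (triangular_ring A B M) (triangular_module B M X Y \<phi>)"
  shows "(Gorenstein_projective (triangular_ring A B M) (triangular_module B M X Y \<phi>) \<longleftrightarrow>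
            inj_on \<phi> (carrier (tensor_module B M Y)) \<and>
            Gorenstein_projective A (cokernel_module (tensor_module B M Y) X \<phi>) \<and>
            Gorenstein_projective B Y) \<and>
         (Gorenstein_projective (triangular_ring A B M) (triangular_module B M X Y \<phi>) \<longrightarrow>
            (Gorenstein_projective A X \<longleftrightarrow> Gorenstein_projective A (tensor_module B M Y)))"
proof -
  interpret triangular A B M using assms(2,3) by (simp add: triangular_def)
  interpret triangular_projective A B M
    by unfold_locales (fact assms(5,6) artin_algebra_bimodule[OF assms(4)])+
  have tr: "triple X Y \<phi>" using assms(7-9) by (simp add: triple_def)
  show ?thesis
  proof (intro conjI iffI impI; (elim conjE)?)
    assume GP: "Gorenstein_projective \<Lambda> (tri X Y \<phi>)"
    show inj: "inj_on \<phi> (carrier (T Y))" by (rule Gorenstein_tri_inj[OF tr GP])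
    obtain p where C: "short_exact A (T Y) \<phi> X p (cokernel_module (T Y) X \<phi>)"
      by (rule cokernel_short_exact[OF tr inj])
    show GC: "Gorenstein_projective A (cokernel_module (T Y) X \<phi>)" by (rule Gorenstein_tri_cokernel[OF tr GP C])
    show "Gorenstein_projective B Y" by (rule Gorenstein_tri_base[OF tr GP])
    show "Gorenstein_projective A (T Y)" if "Gorenstein_projective A X"
      by (rule Gorenstein_projective_kernel[OF C that GC])
    show "Gorenstein_projective A X" if "Gorenstein_projective A (T Y)"
      by (rule Gorenstein_projective_extension[OF C that GC])
  next
    assume *: "inj_on \<phi> (carrier (T Y))" "Gorenstein_projective A (cokernel_module (T Y) X \<phi>)" "Gorenstein_projective B Y"
    obtain p where C: "short_exact A (T Y) \<phi> X p (cokernel_module (T Y) X \<phi>)"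
      by (rule cokernel_short_exact[OF tr *(1)])
    show "Gorenstein_projective \<Lambda> (tri X Y \<phi>)" by (rule Gorenstein_triI[OF tr C *(2,3)])
  qed
qed

end
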